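(* Let $\frac{3}{4}<s<1$, $0<t<1$ and $2_s^*:=\frac{6}{3-2s}$. Assume: (a) $V\in C^0(\mathbb{R}^3)\cap L^\infty(\mathbb{R}^3)$ and $0$ lies in a spectral gap of the self-adjoint operator $(-\Delta)^s+V$ on $L^2(\mathbb{R}^3)$ (with domain $H^s(\mathbb{R}^3)$); (b) $K\in L^{\frac{3}{4s-3}}(\mathbb{R}^3)\cap L^\infty(\mathbb{R}^3)$ and $K(x)>0$ for a.e. $x\in\mathbb{R}^3$; (c) $1<q<\frac{4}{3}$ and $g\in L^{q_0}(\mathbb{R}^3)$ with $q_0=\frac{6}{6-q(3-2s)}$. Then the system $$(-\Delta)^s u+V(x)u=K(x)\phi u+g(x)|u|^{q-2}u,\qquad (I-\Delta)^t\phi=K(x)u^2,\qquad x\in\mathbb{R}^3,$$ possesses infinitely many (weak) solutions $\{(u_n,\phi_{u_n})\}\subset H^s(\mathbb{R}^3)\times L^{t,2}(\mathbb{R}^3)$ satisfying $\lim_{n\to\infty}\|u_n\|_{H^s(\mathbb{R}^3)}=+\infty$.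
   Context: $(-\Delta)^s$ is the fractional Laplacian, $\widehat{(-\Delta)^s u}(\xi)=|\xi|^{2s}\hat u(\xi)$, and $H^s(\mathbb{R}^3)$ the usual fractional Sobolev space. The Bessel space $L^{t,2}(\mathbb{R}^3)$ is the set of $f\in L^2(\mathbb{R}^3)$ with $f=G_t*h$ for some $h\in L^2(\mathbb{R}^3)$, where $G_t=\mathcal{F}^{-1}\big((1+|\xi|^2)^{-t/2}\big)$ is the Bessel kernel; its norm is $\|f\|_{L^{t,2}}=\|h\|_{L^2}=\|(I-\Delta)^{t/2}f\|_{L^2}$, i.e. $\|f\|^2_{L^{t,2}}=\int(1+|\xi|^2)^t|\hat f(\xi)|^2d\xi$, with the associated inner product $(\cdot,\cdot)_{L^{t,2}}$. For $u\in H^s(\mathbb{R}^3)$, $\phi_u\in L^{t,2}(\mathbb{R}^3)$ denotes the unique element with $(\phi_u,v)_{L^{t,2}}=\int_{\mathbb{R}^3}K u^2 v\,dx$ for all $v\in L^{t,2}(\mathbb{R}^3)$; equivalently $\phi_u=G_{2t}*(Ku^2)$, the weak solution of $(I-\Delta)^t\phi=Ku^2$. A pair $(u,\phi)\in H^s\times L^{t,2}$ is a weak solution of the system if $\phi=\phi_u$ and $u$ satisfies $\int_{\mathbb{R}^3}\big[(-\Delta)^{s/2}u(-\Delta)^{s/2}v+V uv-K\phi_u uv-g|u|^{q-2}uv\big]dx=0$ for all $v\in H^s(\mathbb{R}^3)$. *)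

theory Defs
  imports "HOL-Analysis.Analysis"
begin

type_synonym r3 = "real^3"

definition lp :: "real \<Rightarrow> (r3 \<Rightarrow> real) \<Rightarrow> bool" where
  "lp p f \<longleftrightarrow> f \<in> borel_measurable lebesgue \<and>
     (\<integral>\<^sup>+ x. ennreal (\<bar>f x\<bar> powr p) \<partial>lebesgue) < \<infinity>"

definition linf :: "(r3 \<Rightarrow> real) \<Rightarrow> bool" where
  "linf f \<longleftrightarrow> f \<in> borel_measurable lebesgue \<and> (\<exists>C. AE x in lebesgue. \<bar>f x\<bar> \<le> C)"

definition l2norm :: "(r3 \<Rightarrow> real) \<Rightarrow> real" where
  "l2norm f = sqrt (\<integral>x. (f x)\<^sup>2 \<partial>lebesgue)"

definition fourier_l1 :: "(r3 \<Rightarrow> real) \<Rightarrow> r3 \<Rightarrow> complex" where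
  "fourier_l1 f \<xi> = complex_of_real ((2 * pi) powr (-3/2)) *
     (\<integral>x. complex_of_real (f x) * cis (- (\<xi> \<bullet> x)) \<partial>lebesgue)"

text \<open>Plancherel transform of an L^2 function: L^2-limit of transforms of truncations.\<close>
definition is_fourier :: "(r3 \<Rightarrow> real) \<Rightarrow> (r3 \<Rightarrow> complex) \<Rightarrow> bool" where
  "is_fourier u w \<longleftrightarrow> w \<in> borel_measurable lebesgue \<and>
     ((\<lambda>R::real. \<integral>\<^sup>+ \<xi>. ennreal ((cmod (fourier_l1 (\<lambda>x. indicator (ball 0 R) x * u x) \<xi> - w \<xi>))\<^sup>2)
        \<partial>lebesgue) \<longlongrightarrow> 0) at_top"

definition fourier :: "(r3 \<Rightarrow> real) \<Rightarrow> r3 \<Rightarrow> complex" where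
  "fourier u = (SOME w. is_fourier u w)"

definition hs :: "real \<Rightarrow> (r3 \<Rightarrow> real) \<Rightarrow> bool" where
  "hs s u \<longleftrightarrow> lp 2 u \<and> (\<exists>w. is_fourier u w) \<and>
     (\<integral>\<^sup>+ \<xi>. ennreal ((1 + (norm \<xi>)\<^sup>2) powr s * (cmod (fourier u \<xi>))\<^sup>2) \<partial>lebesgue) < \<infinity>"

definition hs_norm :: "real \<Rightarrow> (r3 \<Rightarrow> real) \<Rightarrow> real" where
  "hs_norm s u = sqrt (\<integral>\<xi>. (1 + (norm \<xi>)\<^sup>2) powr s * (cmod (fourier u \<xi>))\<^sup>2 \<partial>lebesgue)"

definition frac_half :: "real \<Rightarrow> (r3 \<Rightarrow> real) \<Rightarrow> r3 \<Rightarrow> real" where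
  "frac_half s u = (SOME f. lp 2 f \<and> is_fourier f (\<lambda>\<xi>. complex_of_real (norm \<xi> powr s) * fourier u \<xi>))"

definition bessel_space :: "real \<Rightarrow> (r3 \<Rightarrow> real) \<Rightarrow> bool" where
  "bessel_space t f \<longleftrightarrow> lp 2 f \<and> (\<exists>w. is_fourier f w) \<and>
     (\<integral>\<^sup>+ \<xi>. ennreal ((1 + (norm \<xi>)\<^sup>2) powr t * (cmod (fourier f \<xi>))\<^sup>2) \<partial>lebesgue) < \<infinity>"

definition bessel_inner :: "real \<Rightarrow> (r3 \<Rightarrow> real) \<Rightarrow> (r3 \<Rightarrow> real) \<Rightarrow> real" where
  "bessel_inner t f h = Re (\<integral>\<xi>. complex_of_real ((1 + (norm \<xi>)\<^sup>2) powr t) * fourier f \<xi> * cnj (fourier h \<xi>) \<partial>lebesgue)"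

definition phi_of :: "real \<Rightarrow> (r3 \<Rightarrow> real) \<Rightarrow> (r3 \<Rightarrow> real) \<Rightarrow> r3 \<Rightarrow> real" where
  "phi_of t K u = (SOME \<phi>. bessel_space t \<phi> \<and>
     (\<forall>v. bessel_space t v \<longrightarrow> bessel_inner t \<phi> v = (\<integral>x. K x * (u x)\<^sup>2 * v x \<partial>lebesgue)))"

text \<open>The self-adjoint operator (-Delta)^s + V (associated with its closed form on H^s):
  form_op s V u f means u is in the operator domain and ((-Delta)^s + V) u = f.\<close>
definition form_op :: "real \<Rightarrow> (r3 \<Rightarrow> real) \<Rightarrow> (r3 \<Rightarrow> real) \<Rightarrow> (r3 \<Rightarrow> real) \<Rightarrow> bool" where
  "form_op s V u f \<longleftrightarrow> hs s u \<and> lp 2 f \<and>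
     (\<forall>v. hs s v \<longrightarrow>
        (\<integral>x. frac_half s u x * frac_half s v x + V x * u x * v x \<partial>lebesgue) = (\<integral>x. f x * v x \<partial>lebesgue))"

text \<open>lambda is in the resolvent set: A - lambda maps the domain onto L^2 with bounded inverse.\<close>
definition in_resolvent :: "real \<Rightarrow> (r3 \<Rightarrow> real) \<Rightarrow> real \<Rightarrow> bool" where
  "in_resolvent s V lam \<longleftrightarrow>
     (\<forall>f. lp 2 f \<longrightarrow> (\<exists>u. form_op s V u (\<lambda>x. f x + lam * u x))) \<and>
     (\<exists>C. \<forall>u f. form_op s V u f \<longrightarrow> l2norm u \<le> C * l2norm (\<lambda>x. f x - lam * u x))"

definition zero_in_spectral_gap :: "real \<Rightarrow> (r3 \<Rightarrow> real) \<Rightarrow> bool" where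
  "zero_in_spectral_gap s V \<longleftrightarrow> in_resolvent s V 0 \<and>
     (\<exists>a<0. \<not> in_resolvent s V a) \<and> (\<exists>b>0. \<not> in_resolvent s V b)"

definition weak_solution ::
  "real \<Rightarrow> real \<Rightarrow> (r3 \<Rightarrow> real) \<Rightarrow> (r3 \<Rightarrow> real) \<Rightarrow> (r3 \<Rightarrow> real) \<Rightarrow> real
     \<Rightarrow> (r3 \<Rightarrow> real) \<Rightarrow> (r3 \<Rightarrow> real) \<Rightarrow> bool" where
  "weak_solution s t V K g q u \<phi> \<longleftrightarrow> hs s u \<and> bessel_space t \<phi> \<and> \<phi> = phi_of t K u \<and>
     (\<forall>v. hs s v \<longrightarrow>
        (\<integral>x. frac_half s u x * frac_half s v x + V x * u x * v x
              - K x * phi_of t K u x * u x * v x - g x * \<bar>u x\<bar> powr (q - 2) * u x * v x \<partial>lebesgue) = 0)"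

end

(* With S diagonalising the invertible form of (-Delta)^s + V into a self-adjoint involution J, solutions are
the critical points of I(z) = <J z, z>/2 - Psi(S z), where Psi is even with a compact, uniformly continuous
gradient. If I had no critical level above b, Euler steps for the gradient would deform a sphere in the
positive space, oddly, above the supremum of I on the negative space plus a finite dimensional one; by
Borsuk-Ulam the deformed sphere meets that set. The supremum is finite because the nonlocal quartic term
is positive definite, and q < 4/3 makes almost critical sequences bounded. The real Hartley transform
replaces the Fourier transform, so that all function spaces are real Hilbert spaces. *)
theory Submission
 imports Defs "HOL-Probability.Probability" "HOL-Homology.Homology"
begin

text \<open>Three exponents shape the argument. First, 3/(4s-3) is conjugate to a quarter of the
  critical Sobolev exponent, and \<open>K^2\<close> belongs to that class because \<open>K\<close>
  is bounded; so \<open>K u^2\<close> lies in L^2, and the nonlocal term is the squared L^2 norm of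
  a Bessel potential. Secondly, since q < 2 the gradient is controlled only in a Hoelder sense and
  need not generate a flow; Euler steps get by with uniform continuity on balls. Thirdly, testing
  with z bounds the square of the nonlocal norm by |z|^q, and testing with J z then gives |z|^2 <= C
  |z|^(3q/4+1) for large z; that exponent is below 2 exactly when q < 4/3. The negative space of J
  may be infinite dimensional, out of reach of Borsuk-Ulam. The deformation is therefore carried out
  in finite dimensional J-invariant spaces, and compactness of the gradient makes an almost critical
  point of the restricted functional almost critical for I itself. Finally I is bounded above on
  bounded sets, so critical points at arbitrarily high levels have arbitrarily large norm.\<close>

lemmas bint_add = Bochner_Integration.integrable_add and bint_diff = Bochner_Integration.integrable_diff
 and bint_bound = Bochner_Integration.integrable_bound and bintegral_add = Bochner_Integration.integral_add
 and bintegral_diff = Bochner_Integration.integral_diff and bintegral_cong = Bochner_Integration.integral_cong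

abbreviation nn_lborel :: "('a::euclidean_space => ennreal) => ennreal" (binder "NB " 10) where
 "nn_lborel f \<equiv> integral\<^sup>N lborel f"
abbreviation int_lborel :: "('a::euclidean_space => 'b::{banach,second_countable_topology}) => 'b" (binder "LB " 10) where
 "int_lborel f \<equiv> integral\<^sup>L lborel f"

section \<open>Odd maps of spheres\<close>

definition nsph :: "nat => (nat => real) set" where
 "nsph n = {x. (\<Sum>i\<le>n. (x i)^2) = 1 & (ALL i>n. x i = 0)}"

lemma topspace_nsphere_nsph: "topspace (nsphere n) = nsph n"
 by (auto simp: nsphere nsph_def)

lemma nsphere_top_of_set: "nsphere n = top_of_set (nsph n)"
proof -
 have "{x::nat=>real. (\<Sum>i\<le>n. (x i)^2) = 1 & (ALL i>n. x i = 0)} = nsph n" by (simp add: nsph_def)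
 then show ?thesis by (simp add: nsphere euclidean_product_topology)
qed

lemma cmap_nsphere:
 "continuous_map (nsphere n) (nsphere n) f \<longleftrightarrow> continuous_on (nsph n) f & f ` nsph n \<subseteq> nsph n"
 unfolding nsphere_top_of_set by (auto simp: continuous_map_subtopology_eu image_subset_iff_funcset)

lemma nsph_abs_le: assumes "x : nsph n" shows "\<bar>x i\<bar> <= 1"
proof (cases "i <= n")
 case True
 have "(x i)^2 <= (\<Sum>i\<le>n. (x i)^2)" using True by (intro member_le_sum) auto
 also have "... = 1" using assms by (simp add: nsph_def)
 finally show ?thesis by (simp add: abs_square_le_1)
next
 case False then show ?thesis using assms by (auto simp: nsph_def)
qed

lemma nsph_uminus: "x : nsph n ==> (%i. - x i) : nsph n"
 by (simp add: nsph_def)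

lemma compact_nsph: "compact (nsph n)"
proof -
 let ?B = "\<Pi>\<^sub>E i\<in>UNIV. if i <= n then {-1..1} else {0::real}"
 have "compactin (product_topology (%i. euclideanreal) UNIV) ?B"
  by (subst compactin_PiE) auto
 then have "compact ?B" by (simp add: euclidean_product_topology compactin_euclidean_iff)
 moreover have "closed (nsph n)"
 proof -
  have "nsph n = {x. (\<Sum>i\<le>n. (x i)^2) = 1} \<inter> (\<Inter>i\<in>{n<..}. {x. x i = 0})"
   by (auto simp: nsph_def)
  moreover have "closed {x::nat=>real. (\<Sum>i\<le>n. (x i)^2) = 1}"
   by (intro closed_Collect_eq continuous_intros continuous_on_product_coordinates)
  moreover have "closed {x::nat=>real. x i = 0}" for i
   by (intro closed_Collect_eq continuous_intros continuous_on_product_coordinates)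
  ultimately show ?thesis by (simp add: closed_Int closed_INT)
 qed
 ultimately have "compact (?B \<inter> nsph n)" by (rule compact_Int_closed)
 moreover have "?B \<inter> nsph n = nsph n"
  using nsph_abs_le by (fastforce simp: PiE_iff abs_le_iff nsph_def)
 ultimately show ?thesis by simp
qed

text \<open>Radial projection onto the sphere after the coordinates above \<open>n\<close> are
  dropped. At a common zero of the others, division by zero gives 0.\<close>

definition nrml :: "nat => (nat => real) => nat => real" where
 "nrml n y = (%i. if i <= n then y i / sqrt (\<Sum>j\<le>n. (y j)^2) else 0)"

lemma nrml_in: assumes "EX i<=n. y i ~= 0" shows "nrml n y : nsph n"
proof -
 have pos: "(\<Sum>j\<le>n. (y j)^2) > 0"
 proof -
  obtain i where "i <= n" "y i ~= 0" using assms by auto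
  then show ?thesis by (intro sum_pos2[where i=i]) auto
 qed
 have "(\<Sum>i\<le>n. (nrml n y i)^2) = (\<Sum>i\<le>n. (y i)^2 / (\<Sum>j\<le>n. (y j)^2))"
  using pos by (intro sum.cong) (auto simp: nrml_def power_divide)
 also have "... = 1" using pos by (simp add: sum_divide_distrib[symmetric])
 finally show ?thesis by (simp add: nsph_def nrml_def)
qed

lemma nrml_id: "x : nsph n ==> nrml n x = x"
 by (auto simp: nrml_def nsph_def fun_eq_iff)

lemma nrml_uminus: "nrml n (%i. - y i) = (%i. - nrml n y i)"
 by (auto simp: nrml_def)

lemma continuous_on_nrml:
 assumes "!!i. i <= n ==> continuous_on A (%x. f x i)" "!!x. x : A ==> EX i<=n. f x i ~= 0"
 shows "continuous_on A (%x. nrml n (f x))"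
proof (rule continuous_on_coordinatewise_then_product)
 fix i
 have "(\<Sum>j\<le>n. (f x j)^2) ~= 0" if "x : A" for x
  using assms(2)[OF that] by (subst sum_nonneg_eq_0_iff) auto
 then show "continuous_on A (%x. nrml n (f x) i)"
  using assms(1) by (cases "i <= n") (auto simp: nrml_def intro!: continuous_intros)
qed

text \<open>Lets degrees be compared along homotopies through nowhere vanishing maps, which need not
  stay on the sphere.\<close>

lemma degree_nrml_homotopic:
 fixes h :: "real => (nat => real) => nat => real"
 assumes h: "!!i. i <= n ==> continuous_on ({0..1} \<times> nsph n) (%(t,x). h t x i)"
  and nz: "!!t x. t : {0..1} ==> x : nsph n ==> EX i<=n. h t x i ~= 0"
 shows "Brouwer_degree2 n (%x. nrml n (h 0 x)) = Brouwer_degree2 n (%x. nrml n (h 1 x))"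
proof (rule Brouwer_degree2_homotopic)
 have "continuous_on ({0..1} \<times> nsph n) (%p. nrml n (h (fst p) (snd p)))"
  by (rule continuous_on_nrml) (use h nz in "auto simp: case_prod_unfold")
 then have "continuous_map (prod_topology (top_of_set {0..1}) (top_of_set (nsph n))) (top_of_set (nsph n))
   (%p. nrml n (h (fst p) (snd p)))"
  using nrml_in nz by (auto simp: prod_topology_subtopology_eu continuous_map_subtopology_eu)
 then show "homotopic_with (%x. True) (nsphere n) (nsphere n) (%x. nrml n (h 0 x)) (%x. nrml n (h 1 x))"
  unfolding nsphere_top_of_set homotopic_with_def
  apply -
  apply (rule exI[of _ "%p. nrml n (h (fst p) (snd p))"])
  by simp
qed

lemma continuous_on_coord: "continuous_on A (%x::nat=>real. x i)"
 by (rule continuous_on_subset[OF continuous_on_product_coordinates subset_UNIV])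

definition d1 :: "nat => (nat => real) => (nat => real) => real" where
 "d1 n x y = (\<Sum>j\<le>n. \<bar>x j - y j\<bar>)"

definition lips :: "nat => ((nat => real) => real) set" where
 "lips n = {f. continuous_on (nsph n) f & (EX L>=0. ALL x:nsph n. ALL y:nsph n. \<bar>f x - f y\<bar> <= L * d1 n x y)}"

lemma d1_nonneg: "0 <= d1 n x y" by (simp add: d1_def sum_nonneg)

lemma lips_mult: assumes "f : lips n" "g : lips n" shows "(%x. f x * g x) : lips n"
proof -
 obtain L M where L: "L >= 0" "!!x y. x : nsph n ==> y : nsph n ==> \<bar>f x - f y\<bar> <= L * d1 n x y"
  and M: "M >= 0" "!!x y. x : nsph n ==> y : nsph n ==> \<bar>g x - g y\<bar> <= M * d1 n x y"
  using assms by (auto simp: lips_def)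
 have cf: "continuous_on (nsph n) f" "continuous_on (nsph n) g" using assms by (auto simp: lips_def)
 have "bounded (f ` nsph n)" "bounded (g ` nsph n)"
  using cf compact_nsph by (auto intro!: compact_imp_bounded compact_continuous_image)
 then obtain A B where A: "!!x. x : nsph n ==> \<bar>f x\<bar> <= A" "0 < A" and B: "!!x. x : nsph n ==> \<bar>g x\<bar> <= B" "0 < B"
  by (auto simp: bounded_pos)
 have "\<bar>f x * g x - f y * g y\<bar> <= (A * M + B * L) * d1 n x y" if xy: "x : nsph n" "y : nsph n" for x y
 proof -
  have "f x * g x - f y * g y = f x * (g x - g y) + g y * (f x - f y)" by (simp add: algebra_simps)
  then have "\<bar>f x * g x - f y * g y\<bar> <= \<bar>f x\<bar> * \<bar>g x - g y\<bar> + \<bar>g y\<bar> * \<bar>f x - f y\<bar>"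
   by (metis abs_mult abs_triangle_ineq)
  also have "... <= A * (M * d1 n x y) + B * (L * d1 n x y)"
   using xy A B L(2)[OF xy] M(2)[OF xy] by (intro add_mono mult_mono) auto
  finally show ?thesis by (simp add: algebra_simps)
 qed
 moreover have "0 <= A * M + B * L" using A B L M by simp
 ultimately show ?thesis using cf by (auto simp: lips_def intro!: continuous_intros)
qed

lemma lips_add: assumes "f : lips n" "g : lips n" shows "(%x. f x + g x) : lips n"
proof -
 obtain L M where L: "L >= 0" "!!x y. x : nsph n ==> y : nsph n ==> \<bar>f x - f y\<bar> <= L * d1 n x y"
  and M: "M >= 0" "!!x y. x : nsph n ==> y : nsph n ==> \<bar>g x - g y\<bar> <= M * d1 n x y"
  using assms by (auto simp: lips_def)
 have "\<bar>(f x + g x) - (f y + g y)\<bar> <= (L + M) * d1 n x y" if xy: "x : nsph n" "y : nsph n" for x y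
  using L(2)[OF xy] M(2)[OF xy] by (simp add: algebra_simps)
 moreover have "0 <= L + M" using L M by simp
 moreover have "continuous_on (nsph n) (%x. f x + g x)" using assms by (auto simp: lips_def intro!: continuous_intros)
 ultimately show ?thesis unfolding lips_def by blast
qed

lemma lips_const: "(%_. c) : lips n"
 by (auto simp: lips_def intro!: exI[of _ 0])

lemma lips_coord: assumes "i <= n" shows "(%x. x i) : lips n"
proof -
 have "\<bar>x i - y i\<bar> <= 1 * d1 n x y" for x y :: "nat => real"
  unfolding d1_def using assms member_le_sum[of i "{..n}" "%j. \<bar>x j - y j\<bar>"] by auto
 then show ?thesis by (auto simp: lips_def intro!: exI[of _ 1] continuous_on_coord)
qed

text \<open>Lipschitz functions form an algebra that separates points, so Stone-Weierstrass applies.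
  Density is needed because a merely continuous image of a sphere may fill an open set, while the
  counting argument below rests on a Lipschitz bound.\<close>

lemma lips_dense:
 assumes "continuous_on (nsph n) f" "0 < e"
 obtains g where "g : lips n" "!!x. x : nsph n ==> \<bar>f x - g x\<bar> < e"
proof -
 interpret function_ring_on "lips n" "nsph n"
 proof
  show "compact (nsph n)" by (rule compact_nsph)
  show "!!f. f : lips n ==> continuous_on (nsph n) f" by (simp add: lips_def)
  fix x y assume xy: "x : nsph n" "y : nsph n" "x ~= y"
  then obtain i where i: "x i ~= y i" by auto
  then have "i <= n" using xy by (force simp: nsph_def not_le)
  then show "EX f:lips n. f x ~= f y" using i by (intro bexI[of _ "%x. x i"] lips_coord)
 next
  show "!!f g. f : lips n ==> g : lips n ==> (%x. f x + g x) : lips n" by (rule lips_add)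
  show "!!f g. f : lips n ==> g : lips n ==> (%x. f x * g x) : lips n" by (rule lips_mult)
  show "!!c. (%_. c) : lips n" by (rule lips_const)
 qed
 obtain g where "g : lips n" "ALL x:nsph n. \<bar>f x - g x\<bar> < e" using Stone_Weierstrass_basic[OF assms] ..
 then show ?thesis using that by blast
qed

lemma lips_neg: assumes "g : lips n" shows "(%x. g (%i. - x i)) : lips n"
proof -
 obtain L where L: "L >= 0" "!!x y. x : nsph n ==> y : nsph n ==> \<bar>g x - g y\<bar> <= L * d1 n x y"
  using assms by (auto simp: lips_def)
 have "d1 n (%i. - x i) (%i. - y i) = d1 n x y" for x y
  by (simp add: d1_def abs_minus_commute)
 then have "\<bar>g (%i. - x i) - g (%i. - y i)\<bar> <= L * d1 n x y" if "x : nsph n" "y : nsph n" for x y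
  using L(2)[OF nsph_uminus nsph_uminus] that by metis
 moreover have "continuous_on (nsph n) (%x. g (%i. - x i))"
 proof (rule continuous_on_compose2[where g=g and t="nsph n"])
  show "continuous_on (nsph n) g" using assms by (simp add: lips_def)
  show "continuous_on (nsph n) (%x i. - x i)"
   by (intro continuous_on_coordinatewise_then_product continuous_intros continuous_on_coord)
 qed (use nsph_uminus in auto)
 ultimately show ?thesis using L(1) by (auto simp: lips_def)
qed

text \<open>A cell records which coordinate is large, its sign, and the grid positions of the
  others. The large coordinate is stored as 0 because the equation of the sphere recovers it. Hence
  the exponent is m and not m + 1, which is what the pigeonhole needs.\<close>

lemma card_cells:
 "card (SIGMA i:{..m::nat}. (UNIV::bool set) \<times> (PiE {..m} (%j. if j = i then {0} else {- int D..int D})))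
   = (m+1) * (2 * (2*D+1)^m)"
proof -
 have "card (PiE {..m} (%j. if j = i then {0} else {- int D..int D})) = (2*D+1)^m" if "i <= m" for i
 proof -
  have "card (PiE {..m} (%j. if j = i then {0} else {- int D..int D}))
    = (\<Prod>j\<le>m. card (if j = i then {0} else {- int D..int D}))"
   by (simp add: card_PiE)
  also have "... = (\<Prod>j\<in>{..m}-{i}. card (if j = i then {0} else {- int D..int D}))"
   using that by (subst prod.remove[of _ i]) auto
  also have "... = (\<Prod>j\<in>{..m}-{i}. 2*D+1)" by (intro prod.cong) auto
  also have "... = (2*D+1)^m" using that by simp
  finally show ?thesis .
 qed
 then show ?thesis by (subst card_SigmaI) (auto simp: card_cartesian_product intro!: finite_PiE)
qed

lemma exists_large_coord: assumes "x : nsph m" shows "EX i<=m. \<bar>x i\<bar> >= 1 / (real m + 1)"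
proof (rule ccontr)
 assume "~ ?thesis"
 then have lt: "!!i. i <= m ==> \<bar>x i\<bar> < 1 / (real m + 1)" by auto
 have "(\<Sum>i\<le>m. (x i)^2) < (\<Sum>i\<le>m. 1 / (real m + 1))"
 proof (rule sum_strict_mono)
  fix i assume "i : {..m}"
  then have l: "\<bar>x i\<bar> < 1 / (real m + 1)" using lt by auto
  have "(x i)^2 = \<bar>x i\<bar> * \<bar>x i\<bar>" by (simp add: power2_eq_square)
  also have "... <= \<bar>x i\<bar> * 1" using nsph_abs_le[OF assms] by (intro mult_left_mono) auto
  finally show "(x i)^2 < 1 / (real m + 1)" using l by simp
 qed auto
 then show False using assms by (simp add: nsph_def)
qed

text \<open>Pigeonhole: a Lipschitz image of the m-sphere in (m+2)-space has too few grid cells to hit every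
 direction near the last axis.\<close>
lemma avoid_direction:
 assumes lip: "!!i. i <= Suc m ==> p i : lips m" and c: "0 < c" "!!x. x : nsph m ==> EX i<=Suc m. \<bar>p i x\<bar> >= c"
  and eta: "0 < \<eta>" "\<eta> <= 1"
 shows "EX v. (ALL i<=m. \<bar>v i\<bar> <= \<eta>) & (ALL x:nsph m. EX i<=m. p i x ~= p (Suc m) x * v i)"
proof (rule ccontr)
 assume neg: "~ ?thesis"
 have "ALL i. EX L>=0. i <= Suc m --> (ALL x:nsph m. ALL y:nsph m. \<bar>p i x - p i y\<bar> <= L * d1 m x y)"
 proof
  fix i
  show "EX L>=0. i <= Suc m --> (ALL x:nsph m. ALL y:nsph m. \<bar>p i x - p i y\<bar> <= L * d1 m x y)"
   using lip[of i] by (cases "i <= Suc m") (auto simp: lips_def)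
 qed
 then obtain Lf where Lf: "!!i. Lf i >= 0" "!!i x y. i <= Suc m ==> x : nsph m ==> y : nsph m ==> \<bar>p i x - p i y\<bar> <= Lf i * d1 m x y"
  by metis
 define L where "L = (\<Sum>i\<le>Suc m. Lf i)"
 have L0: "0 <= L" unfolding L_def by (rule sum_nonneg) (rule Lf)
 have L: "\<bar>p i x - p i y\<bar> <= L * d1 m x y" if "i <= Suc m" "x : nsph m" "y : nsph m" for i x y
 proof -
  have "Lf i <= L" unfolding L_def using that Lf by (intro member_le_sum) auto
  then show ?thesis using Lf(2)[OF that] d1_nonneg[of m x y] mult_right_mono by fastforce
 qed
 \<comment> \<open>\<open>Bc / D\<close> will bound the \<open>d1\<close> diameter of a cell: m/D
   from the stored coordinates and m(m+1)/D from the recovered one.\<close>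
 define Bc where "Bc = (real m + 2)^2"
 \<comment> \<open>With D = \<kappa> M, the Lipschitz image of one cell becomes too small to meet
   two distinct grid directions.\<close>
 obtain \<kappa> :: nat where kap: "real \<kappa> > 2 * L * Bc / (c * \<eta>)" using reals_Archimedean2 by blast
 have kap0: "\<kappa> > 0"
 proof -
  have "0 <= 2 * L * Bc / (c * \<eta>)" using L0 c eta by (simp add: Bc_def)
  then show ?thesis using kap by (metis gr0I less_le_not_le of_nat_0)
 qed
 \<comment> \<open>There are M^(m+1) grid directions, but the number of cells is at most (M-1) M^m,
   so two directions would have to share a cell.\<close>
 define M where "M = (m+1) * (2 * (3*\<kappa>)^m) + 1"
 define D where "D = \<kappa> * M"
 have M0: "M > 0" and D0: "D > 0" using kap0 by (auto simp: M_def D_def)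
 define vv where "vv k i = \<eta> * real (k i) / real M" for k :: "nat => nat" and i
 define G where "G = PiE {..m} (%_. {1..M})"
 have "EX x:nsph m. ALL i<=m. p i x = p (Suc m) x * vv k i" if "k : G" for k
 proof -
  have "\<bar>vv k i\<bar> <= \<eta>" if "i <= m" for i
  proof -
   have "k i <= M" using \<open>k : G\<close> that by (auto simp: G_def PiE_iff)
   then have "real (k i) / real M <= 1" using M0 by simp
   then have "\<eta> * (real (k i) / real M) <= \<eta> * 1" using eta by (intro mult_left_mono) auto
   then show ?thesis using eta by (simp add: vv_def)
  qed
  then show ?thesis using neg by blast
 qed
 then obtain X where X: "!!k. k : G ==> X k : nsph m" "!!k i. k : G ==> i <= m ==> p i (X k) = p (Suc m) (X k) * vv k i"
  by metis
 have vle: "\<bar>vv k i\<bar> <= 1" if "k : G" "i <= m" for k i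
 proof -
  have "k i <= M" using that by (auto simp: G_def PiE_iff)
  then have "real (k i) / real M <= 1" using M0 by simp
  then have "\<eta> * (real (k i) / real M) <= 1 * 1" using eta by (intro mult_mono) auto
  then show ?thesis using eta by (simp add: vv_def)
 qed
 \<comment> \<open>On a ray through (v, 1) with all |v_i| <= 1 the last coordinate is the largest,
   so it inherits the lower bound \<open>c\<close>.\<close>
 have P: "\<bar>p (Suc m) (X k)\<bar> >= c" if kG: "k : G" for k
 proof -
  obtain i where i: "i <= Suc m" "\<bar>p i (X k)\<bar> >= c" using c(2)[OF X(1)[OF kG]] by auto
  show ?thesis
  proof (cases "i = Suc m")
   case False
   then have "i <= m" using i by simp
   then have "\<bar>p i (X k)\<bar> = \<bar>p (Suc m) (X k)\<bar> * \<bar>vv k i\<bar>" using X(2)[OF kG] by (simp add: abs_mult)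
   also have "... <= \<bar>p (Suc m) (X k)\<bar> * 1" using vle[OF kG \<open>i <= m\<close>] by (intro mult_left_mono) auto
   finally show ?thesis using i by simp
  qed (use i in simp)
 qed
 define i0 where "i0 x = (SOME i. i <= m & \<bar>x i\<bar> >= 1 / (real m + 1))" for x :: "nat => real"
 have i0: "i0 x <= m" "\<bar>x (i0 x)\<bar> >= 1 / (real m + 1)" if "x : nsph m" for x
  using someI_ex[OF exists_large_coord[OF that]] unfolding i0_def by auto
 define cell where "cell x = (i0 x, x (i0 x) > 0, \<lambda>j\<in>{..m}. if j = i0 x then 0 else \<lfloor>x j * real D\<rfloor>)" for x
 \<comment> \<open>Points of one cell have close stored coordinates, hence close squares of the
   large coordinate. Equal signs and a size of at least 1/(m+1) turn this into closeness of the
   large coordinate itself.\<close>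
 have close: "d1 m x y <= Bc / real D" if xy: "x : nsph m" "y : nsph m" and eq: "cell x = cell y" for x y
 proof -
  define i where "i = i0 x"
  have i: "i0 y = i" "i <= m" "\<bar>x i\<bar> >= 1 / (real m + 1)" "\<bar>y i\<bar> >= 1 / (real m + 1)" "(x i > 0) = (y i > 0)"
   using eq i0[OF xy(1)] i0[OF xy(2)] by (auto simp: cell_def i_def)
  have dj: "\<bar>x j - y j\<bar> <= 1 / real D" if "j <= m" "j ~= i" for j
  proof -
   have "(\<lambda>j\<in>{..m}. if j = i0 x then 0 else \<lfloor>x j * real D\<rfloor>) = (\<lambda>j\<in>{..m}. if j = i0 y then 0 else \<lfloor>y j * real D\<rfloor>)"
    using eq unfolding cell_def prod.inject by (elim conjE)
   then have "(\<lambda>j\<in>{..m}. if j = i0 x then 0 else \<lfloor>x j * real D\<rfloor>) j = (\<lambda>j\<in>{..m}. if j = i0 y then 0 else \<lfloor>y j * real D\<rfloor>) j"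
    by (rule fun_cong)
   moreover have "j ~= i0 x" "j ~= i0 y" using that i(1) by (auto simp: i_def)
   ultimately have "\<lfloor>x j * real D\<rfloor> = \<lfloor>y j * real D\<rfloor>" using that(1) by (simp only: restrict_apply' atMost_iff if_False)
   then have "\<bar>x j * real D - y j * real D\<bar> <= 1" by linarith
   then have "\<bar>x j - y j\<bar> * real D <= 1" by (simp add: abs_mult flip: left_diff_distrib)
   then show ?thesis using D0 by (simp add: field_simps)
  qed
  have sx: "(x i)^2 + (\<Sum>j\<in>{..m}-{i}. (x j)^2) = 1" "(y i)^2 + (\<Sum>j\<in>{..m}-{i}. (y j)^2) = 1"
   using xy i(2) sum.remove[of "{..m}" i "%j. (x j)^2"] sum.remove[of "{..m}" i "%j. (y j)^2"]
   by (auto simp: nsph_def)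
  have "\<bar>(x i)^2 - (y i)^2\<bar> = \<bar>\<Sum>j\<in>{..m}-{i}. (y j)^2 - (x j)^2\<bar>"
   using sx by (simp add: sum_subtractf)
  also have "... <= (\<Sum>j\<in>{..m}-{i}. \<bar>(y j)^2 - (x j)^2\<bar>)" by (rule sum_abs)
  also have "... <= (\<Sum>j\<in>{..m}-{i}. 2 / real D)"
  proof (rule sum_mono)
   fix j assume j: "j : {..m}-{i}"
   have "(y j)^2 - (x j)^2 = (y j - x j) * (y j + x j)" by (simp add: power2_eq_square algebra_simps)
   then have "\<bar>(y j)^2 - (x j)^2\<bar> = \<bar>x j - y j\<bar> * \<bar>y j + x j\<bar>" by (simp add: abs_mult abs_minus_commute)
   also have "... <= 1 / real D * 2"
    using dj[of j] j nsph_abs_le[OF xy(1), of j] nsph_abs_le[OF xy(2), of j] by (intro mult_mono) auto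
   finally show "\<bar>(y j)^2 - (x j)^2\<bar> <= 2 / real D" by simp
  qed
  also have "... = real m * (2 / real D)" using i(2) by simp
  finally have s1: "\<bar>(x i)^2 - (y i)^2\<bar> <= real m * (2 / real D)" .
  have s2: "\<bar>(x i)^2 - (y i)^2\<bar> = \<bar>x i - y i\<bar> * \<bar>x i + y i\<bar>"
   by (simp add: power2_eq_square abs_mult[symmetric] algebra_simps)
  have s3: "\<bar>x i + y i\<bar> >= 2 / (real m + 1)"
  proof -
   have "\<bar>x i + y i\<bar> = \<bar>x i\<bar> + \<bar>y i\<bar>"
    using i(3,4,5) by (cases "x i > 0") (auto simp: abs_if)
   then show ?thesis using i(3,4) by (simp add: field_simps)
  qed
  have "\<bar>x i - y i\<bar> * (2 / (real m + 1)) <= real m * (2 / real D)"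
   using s1 s2 s3 mult_left_mono[OF s3, of "\<bar>x i - y i\<bar>"] by simp
  then have di: "\<bar>x i - y i\<bar> <= real m * (real m + 1) / real D"
   using D0 by (simp add: field_simps)
  have "d1 m x y = \<bar>x i - y i\<bar> + (\<Sum>j\<in>{..m}-{i}. \<bar>x j - y j\<bar>)"
   unfolding d1_def using i(2) by (intro sum.remove) auto
  also have "(\<Sum>j\<in>{..m}-{i}. \<bar>x j - y j\<bar>) <= (\<Sum>j\<in>{..m}-{i}. 1 / real D)"
   using dj by (intro sum_mono) auto
  also have "... = real m / real D" using i(2) by simp
  finally have "d1 m x y <= (real m * (real m + 1) + real m) / real D" using di by (simp add: add_divide_distrib)
  also have "... <= Bc / real D" using D0 by (intro divide_right_mono) (auto simp: Bc_def power2_eq_square algebra_simps)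
  finally show ?thesis .
 qed
 \<comment> \<open>Two distinct grid directions differ by at least \<eta>/M in some coordinate, and
   points of one cell allow strictly less.\<close>
 have inj: "inj_on (cell \<circ> X) G"
 proof (rule inj_onI)
  fix k l assume kl: "k : G" "l : G" "(cell \<circ> X) k = (cell \<circ> X) l"
  then have cl: "d1 m (X k) (X l) <= Bc / real D" using close X by auto
  have "k i = l i" if i: "i <= m" for i
  proof -
   let ?P = "p (Suc m)"
   have "?P (X k) * (vv k i - vv l i) = (p i (X k) - p i (X l)) + (?P (X l) - ?P (X k)) * vv l i"
    using X(2)[OF kl(1) i] X(2)[OF kl(2) i] by (simp add: algebra_simps)
   then have "\<bar>?P (X k)\<bar> * \<bar>vv k i - vv l i\<bar> <= \<bar>p i (X k) - p i (X l)\<bar> + \<bar>?P (X l) - ?P (X k)\<bar> * \<bar>vv l i\<bar>"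
    by (metis abs_mult abs_triangle_ineq)
   also have "... <= L * (Bc / real D) + (L * (Bc / real D)) * 1"
   proof (intro add_mono mult_mono)
    show "\<bar>p i (X k) - p i (X l)\<bar> <= L * (Bc / real D)"
     using L[of i "X k" "X l"] i X(1) kl cl mult_left_mono[OF cl L0] by force
    have "\<bar>?P (X k) - ?P (X l)\<bar> <= L * (Bc / real D)"
     using L[of "Suc m" "X k" "X l"] X(1) kl cl mult_left_mono[OF cl L0] by force
    then show "\<bar>?P (X l) - ?P (X k)\<bar> <= L * (Bc / real D)" by (simp add: abs_minus_commute)
   qed (use vle[OF kl(2) i] L0 in "auto simp: Bc_def")
   finally have a: "\<bar>?P (X k)\<bar> * \<bar>vv k i - vv l i\<bar> <= 2 * L * Bc / real D" by (simp add: mult.commute)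
   have "c * \<bar>vv k i - vv l i\<bar> <= 2 * L * Bc / real D"
    using a P[OF kl(1)] mult_right_mono[OF P[OF kl(1)], of "\<bar>vv k i - vv l i\<bar>"] by simp
   also have "... < real \<kappa> * (c * \<eta>) / real D"
   proof (rule divide_strict_right_mono)
    show "2 * L * Bc < real \<kappa> * (c * \<eta>)" using kap c eta by (simp only: pos_divide_less_eq mult_pos_pos)
   qed (use D0 in simp)
   also have "... = c * (\<eta> / real M)" using kap0 by (simp add: D_def)
   finally have "c * \<bar>vv k i - vv l i\<bar> < c * (\<eta> / real M)" .
   then have lt: "\<bar>vv k i - vv l i\<bar> < \<eta> / real M" using c(1) by (simp only: mult_less_cancel_left_pos)
   have "vv k i - vv l i = \<eta> / real M * (real (k i) - real (l i))" by (simp add: vv_def right_diff_distrib)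
   then have "\<bar>vv k i - vv l i\<bar> = \<eta> / real M * \<bar>real (k i) - real (l i)\<bar>" using eta by (simp only: abs_mult) simp
   then have "\<eta> / real M * \<bar>real (k i) - real (l i)\<bar> < \<eta> / real M * 1" using lt by simp
   then have "\<bar>real (k i) - real (l i)\<bar> < 1" by (rule mult_less_cancel_left_pos[THEN iffD1, rotated]) (use eta M0 in simp)
   then show ?thesis by linarith
  qed
  then show "k = l" by (intro PiE_ext[OF kl(1,2)[unfolded G_def]]) simp
 qed
 let ?T = "SIGMA i:{..m}. (UNIV::bool set) \<times> (PiE {..m} (%j. if j = i then {0} else {- int D..int D}))"
 have img: "(cell \<circ> X) ` G \<subseteq> ?T"
 proof
  fix z assume "z : (cell \<circ> X) ` G"
  then obtain k where k: "k : G" "z = cell (X k)" unfolding comp_def by (rule imageE) blast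
  have "\<lfloor>X k j * real D\<rfloor> : {- int D..int D}" for j
  proof -
   have "\<bar>X k j\<bar> * real D <= 1 * real D" using nsph_abs_le[OF X(1)[OF k(1)]] by (intro mult_right_mono) auto
   then have "\<bar>X k j * real D\<bar> <= real D" by (simp add: abs_mult)
   then show ?thesis by (auto simp: floor_le_iff le_floor_iff)
  qed
  then have "(\<lambda>j\<in>{..m}. if j = i0 (X k) then 0 else \<lfloor>X k j * real D\<rfloor>)
    : PiE {..m} (%j. if j = i0 (X k) then {0} else {- int D..int D})"
   by (intro PiE_I) (simp_all split: if_split)
  then show "z : ?T" using i0(1)[OF X(1)[OF k(1)]] unfolding k(2) cell_def
   by (intro SigmaI) simp_all
 qed
 have "finite ?T" by (auto intro!: finite_SigmaI finite_PiE)
 then have "card G <= card ?T" using inj img card_inj_on_le by blast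
 moreover have "card G = M^(m+1)" by (simp add: G_def card_PiE)
 ultimately have "M^(m+1) <= (m+1) * (2 * (2*D+1)^m)" using card_cells[of m D] by simp
 also have "... <= (m+1) * (2 * (3*\<kappa>*M)^m)"
  using kap0 M0 by (intro mult_le_mono power_mono) (auto simp: D_def)
 also have "... = ((m+1) * (2 * (3*\<kappa>)^m)) * M^m" by (simp only: power_mult_distrib mult.assoc)
 also have "... < M * M^m"
 proof (rule mult_strict_right_mono)
  show "(m+1) * (2 * (3*\<kappa>)^m) < M" unfolding M_def by (rule less_add_one)
 qed (use M0 in simp)
 finally show False by simp
qed

lemma nsph_mono: "nsph m \<subseteq> nsph (Suc m)"
 by (auto simp: nsph_def)

lemma nsph_Suc_equator: "x : nsph (Suc m) ==> x (Suc m) = 0 ==> x : nsph m"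
proof -
 assume x: "x : nsph (Suc m)" "x (Suc m) = 0"
 have "x i = 0" if "m < i" for i using x that by (cases "i = Suc m") (simp_all add: nsph_def)
 then show "x : nsph m" using x by (simp add: nsph_def)
qed

lemma lips_restrict: "p : lips (Suc m) ==> p : lips m"
proof -
 assume "p : lips (Suc m)"
 then obtain L where L: "continuous_on (nsph (Suc m)) p" "L >= 0"
  "!!x y. x : nsph (Suc m) ==> y : nsph (Suc m) ==> \<bar>p x - p y\<bar> <= L * d1 (Suc m) x y"
  by (auto simp: lips_def)
 have "d1 (Suc m) x y = d1 m x y" if "x : nsph m" "y : nsph m" for x y
  using that by (simp add: d1_def nsph_def)
 then have "\<bar>p x - p y\<bar> <= L * d1 m x y" if "x : nsph m" "y : nsph m" for x y
  using L(3)[of x y] that nsph_mono by (metis subsetD)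
 then show ?thesis using L continuous_on_subset[OF L(1) nsph_mono] by (auto simp: lips_def)
qed

text \<open>Induction on the dimension: the map is deformed to an odd map that sends the equator
  into itself, and \<open>Borsuk_odd_mapping_degree_step\<close> says that the degrees of this map
  and of its restriction to the equator have the same parity.\<close>

theorem odd_map_degree_odd:
 assumes "continuous_on (nsph n) f" "f ` nsph n \<subseteq> nsph n"
  "!!x. x : nsph n ==> f (%i. - x i) = (%i. - f x i)"
 shows "odd (Brouwer_degree2 n f)"
 using assms
proof (induction n arbitrary: f)
 case 0
 have cm: "continuous_map (nsphere 0) (nsphere 0) f" using 0 by (simp add: cmap_nsphere)
 have s0: "x = y \<or> x = (%i. - y i)" if "x : nsph 0" "y : nsph 0" for x y :: "nat => real"
 proof -
  have "(x 0)^2 = (y 0)^2" "!!i. i > 0 ==> x i = 0" "!!i. i > 0 ==> y i = 0" using that by (auto simp: nsph_def)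
  then show ?thesis by (metis (no_types, lifting) ext gr0I minus_zero power2_eq_iff)
 qed
 have ff: "(f \<circ> f) x = id x" if x: "x : nsph 0" for x
 proof -
  have "f x : nsph 0" using 0 x by auto
  from s0[OF this x] show ?thesis using 0(3)[OF x] by auto
 qed
 have "Brouwer_degree2 0 (f \<circ> f) = Brouwer_degree2 0 id"
  by (rule Brouwer_degree2_eq) (simp add: topspace_nsphere_nsph ff del: comp_apply id_apply)
 then have "Brouwer_degree2 0 f * Brouwer_degree2 0 f = 1" using Brouwer_degree2_compose[OF cm cm] by simp
 then show ?case by (metis even_mult_iff odd_one)
next
 case (Suc m)
 define \<mu> where "\<mu> = 1 / (real m + 2)"
 have mu: "0 < \<mu>" "\<mu> <= 1/2" by (auto simp: \<mu>_def field_simps)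
 have cf: "continuous_on (nsph (Suc m)) (%x. f x i)" for i
  by (rule continuous_on_product_then_coordinatewise[OF Suc.prems(1)])
 have "EX g. g : lips (Suc m) & (ALL x:nsph (Suc m). \<bar>f x i - g x\<bar> < \<mu> / 4)" for i
  using lips_dense[OF cf[of i], of "\<mu> / 4"] mu by (metis divide_pos_pos zero_less_numeral)
 then obtain g where g: "!!i. g i : lips (Suc m)" "!!i x. x : nsph (Suc m) ==> \<bar>f x i - g i x\<bar> < \<mu> / 4"
  by metis
 \<comment> \<open>The odd part of the approximation. Since \<open>f\<close> is odd, taking it costs
   no accuracy.\<close>
 define p where "p i x = (1/2) * g i x + (-1/2) * g i (%j. - x j)" for i and x :: "nat => real"
 have plip: "p i : lips (Suc m)" for i
  unfolding p_def by (intro lips_add lips_mult lips_const g lips_neg)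
 have podd: "p i (%j. - x j) = - p i x" for i x by (simp add: p_def)
 have pf: "\<bar>f x i - p i x\<bar> < \<mu> / 4" if x: "x : nsph (Suc m)" for i x
 proof -
  have 1: "\<bar>f x i - g i x\<bar> < \<mu> / 4" using g(2)[OF x] .
  have 2: "\<bar>- f x i - g i (%j. - x j)\<bar> < \<mu> / 4" using g(2)[OF nsph_uminus[OF x], of i] Suc.prems(3)[OF x] by simp
  show ?thesis using 1 2 by (simp add: p_def abs_if split: if_splits)
 qed
 have big: "EX i<=Suc m. \<bar>f x i\<bar> >= \<mu>" if "x : nsph (Suc m)" for x
  using exists_large_coord[of "f x" "Suc m"] Suc.prems(2) that by (auto simp: \<mu>_def add.commute)
 define \<eta> where "\<eta> = \<mu> / 16"
 have "EX v. (ALL i<=m. \<bar>v i\<bar> <= \<eta>) & (ALL x:nsph m. EX i<=m. p i x ~= p (Suc m) x * v i)"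
 proof (rule avoid_direction[where c="\<mu>/2"])
  fix x assume "x : nsph m"
  then have x: "x : nsph (Suc m)" using nsph_mono by auto
  obtain i where "i <= Suc m" "\<bar>f x i\<bar> >= \<mu>" using big[OF x] by auto
  then show "EX i<=Suc m. \<mu> / 2 <= \<bar>p i x\<bar>" using pf[OF x, of i] mu by (intro exI[of _ i]) linarith
 qed (use mu plip lips_restrict in \<open>auto simp: \<eta>_def\<close>)
 then obtain v where v: "!!i. i <= m ==> \<bar>v i\<bar> <= \<eta>" "!!x. x : nsph m ==> EX i<=m. p i x ~= p (Suc m) x * v i"
  by auto
 \<comment> \<open>A shear that moves the avoided direction (v, 1) onto the last axis: on the
   equator the coordinates up to \<open>m\<close> then have no common zero.\<close>
 define q0 where "q0 x i = (if i <= m then p i x - p (Suc m) x * v i else p (Suc m) x)" for x i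
 \<comment> \<open>The last coordinate is damped by the even factor |x_(m+1)|. Oddness survives, and
   at t = 1 the image of the equator has last coordinate 0.\<close>
 define h where "h t x i = (if i <= m then q0 x i else p (Suc m) x * ((1 - t) + t * \<bar>x (Suc m)\<bar>))" for t :: real and x i
 have q0f: "\<bar>f x i - q0 x i\<bar> < \<mu> / 2" if x: "x : nsph (Suc m)" and i: "i <= Suc m" for x i
 proof (cases "i <= m")
  case True
  have "\<bar>f x (Suc m)\<bar> <= 1" using Suc.prems(2) x nsph_abs_le by blast
  then have "\<bar>p (Suc m) x\<bar> <= 2" using pf[OF x, of "Suc m"] mu by linarith
  then have "\<bar>p (Suc m) x * v i\<bar> <= 2 * \<eta>" using v(1)[OF True] by (simp add: abs_mult mult_mono)
  moreover have "f x i - q0 x i = (f x i - p i x) + p (Suc m) x * v i" using True by (simp add: q0_def)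
  ultimately show ?thesis using pf[OF x, of i] mu unfolding \<eta>_def by linarith
 next
  case False
  then have "i = Suc m" using i by simp
  then show ?thesis using pf[OF x, of i] mu by (simp add: q0_def)
 qed
 have cp: "continuous_on (nsph (Suc m)) (p i)" for i using plip by (simp add: lips_def)
 have cq: "continuous_on (nsph (Suc m)) (%x. q0 x i)" for i
  unfolding q0_def by (cases "i <= m") (simp_all add: continuous_intros cp)
 have csnd: "continuous_on ({0..1::real} \<times> nsph (Suc m)) (%z. k (snd z))" if "continuous_on (nsph (Suc m)) k"
  for k :: "(nat => real) => real"
  by (rule continuous_on_compose2[OF that]) (auto intro: continuous_on_snd continuous_on_id)
 have "Brouwer_degree2 (Suc m) (%x. nrml (Suc m) (%i. (1 - 0) * f x i + 0 * q0 x i))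
   = Brouwer_degree2 (Suc m) (%x. nrml (Suc m) (%i. (1 - 1) * f x i + 1 * q0 x i))"
 proof (rule degree_nrml_homotopic[where h="%t x i. (1 - t) * f x i + t * q0 x i"])
  fix t :: real and x assume t: "t : {0..1}" and x: "x : nsph (Suc m)"
  obtain i where i: "i <= Suc m" "\<bar>f x i\<bar> >= \<mu>" using big[OF x] by auto
  have "(1 - t) * f x i + t * q0 x i = f x i - t * (f x i - q0 x i)" by (simp add: algebra_simps)
  moreover have "\<bar>t * (f x i - q0 x i)\<bar> <= 1 * \<bar>f x i - q0 x i\<bar>"
   unfolding abs_mult using t by (intro mult_right_mono) auto
  moreover have "\<bar>f x i\<bar> - \<bar>t * (f x i - q0 x i)\<bar> <= \<bar>f x i - t * (f x i - q0 x i)\<bar>" by (rule abs_triangle_ineq2)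
  moreover have "\<bar>f x i\<bar> - 1 * \<bar>f x i - q0 x i\<bar> > 0" using q0f[OF x i(1)] i mu by simp
  ultimately have "\<bar>(1 - t) * f x i + t * q0 x i\<bar> > 0" by (metis diff_left_mono less_le_trans)
  then have "(1 - t) * f x i + t * q0 x i ~= 0" by simp
  then show "EX i<=Suc m. (1 - t) * f x i + t * q0 x i ~= 0" using i by auto
 next
  fix i
  show "continuous_on ({0..1} \<times> nsph (Suc m)) (%(t, x). (1 - t) * f x i + t * q0 x i)"
   unfolding case_prod_unfold
   by (intro continuous_on_add continuous_on_mult continuous_on_diff continuous_on_const continuous_on_fst
     continuous_on_id csnd[OF cf] csnd[OF cq])
 qed
 then have d1: "Brouwer_degree2 (Suc m) (%x. nrml (Suc m) (f x)) = Brouwer_degree2 (Suc m) (%x. nrml (Suc m) (q0 x))"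
  by simp
 have nz: "EX i<=Suc m. h t x i ~= 0" if t: "t : {0..1}" and x: "x : nsph (Suc m)" for t :: real and x
 proof (cases "EX i<=m. q0 x i ~= 0")
  case True then show ?thesis by (auto simp: h_def)
 next
  case False
  have "x (Suc m) ~= 0"
  proof
   assume "x (Suc m) = 0"
   then have "x : nsph m" using nsph_Suc_equator x by blast
   from v(2)[OF this] False show False by (auto simp: q0_def)
  qed
  obtain i where i: "i <= Suc m" "\<bar>f x i\<bar> >= \<mu>" using big[OF x] by auto
  have "\<bar>q0 x i\<bar> > 0" using q0f[OF x i(1)] i mu by linarith
  then have "q0 x i ~= 0" by simp
  moreover have "~ i <= m" using False \<open>q0 x i ~= 0\<close> by blast
  ultimately have "p (Suc m) x ~= 0" by (simp add: q0_def)
  moreover have "(1 - t) + t * \<bar>x (Suc m)\<bar> > 0"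
   using t \<open>x (Suc m) ~= 0\<close> by (cases "t = 1") (auto intro: add_pos_nonneg)
  ultimately have "h t x (Suc m) ~= 0" by (simp add: h_def)
  then show ?thesis by blast
 qed
 have d2: "Brouwer_degree2 (Suc m) (%x. nrml (Suc m) (h 0 x)) = Brouwer_degree2 (Suc m) (%x. nrml (Suc m) (h 1 x))"
 proof (rule degree_nrml_homotopic)
  fix i assume "i <= Suc m"
  show "continuous_on ({0..1} \<times> nsph (Suc m)) (%(t, x). h t x i)"
   unfolding h_def case_prod_unfold
  proof (cases "i <= m")
   case True
   then show "continuous_on ({0..1} \<times> nsph (Suc m)) (%p'. if i <= m then q0 (snd p') i
     else p (Suc m) (snd p') * (1 - fst p' + fst p' * \<bar>snd p' (Suc m)\<bar>))"
    using csnd[OF cq] by simp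
  next
   case False
   have "continuous_on ({0..1} \<times> nsph (Suc m)) (%p'. p (Suc m) (snd p') * (1 - fst p' + fst p' * \<bar>snd p' (Suc m)\<bar>))"
    by (intro continuous_on_add continuous_on_mult continuous_on_diff continuous_on_const continuous_on_fst
     continuous_on_rabs continuous_on_id csnd[OF cp] csnd[OF continuous_on_coord])
   then show "continuous_on ({0..1} \<times> nsph (Suc m)) (%p'. if i <= m then q0 (snd p') i
     else p (Suc m) (snd p') * (1 - fst p' + fst p' * \<bar>snd p' (Suc m)\<bar>))"
    using False by simp
  qed
 qed (use nz in auto)
 have h0: "nrml (Suc m) (h 0 x) = nrml (Suc m) (q0 x)" for x
 proof -
  have "h 0 x = q0 x" by (auto simp: h_def q0_def)
  then show ?thesis by simp
 qed
 define F where "F x = nrml (Suc m) (h 1 x)" for x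
 have degf: "Brouwer_degree2 (Suc m) f = Brouwer_degree2 (Suc m) F"
 proof -
  have "Brouwer_degree2 (Suc m) f = Brouwer_degree2 (Suc m) (%x. nrml (Suc m) (f x))"
   using Suc.prems(2) by (intro Brouwer_degree2_eq) (auto simp: topspace_nsphere_nsph nrml_id image_subset_iff)
  then show ?thesis using d1 d2 h0 by (simp add: F_def[abs_def])
 qed
 have Fin: "F x : nsph (Suc m)" if "x : nsph (Suc m)" for x
  unfolding F_def by (rule nrml_in) (use nz[of 1 x] that in auto)
 have Fodd: "F (%i. - x i) = (%i. - F x i)" for x
 proof -
  have "h 1 (%i. - x i) = (%i. - h 1 x i)" by (auto simp: h_def q0_def podd fun_eq_iff)
  then show ?thesis by (simp add: F_def nrml_uminus)
 qed
 have Fc: "continuous_on (nsph (Suc m)) F"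
  unfolding F_def
 proof (rule continuous_on_nrml)
  show "continuous_on (nsph (Suc m)) (%x. h 1 x i)" for i
   unfolding h_def by (cases "i <= m") (auto intro!: continuous_intros cq cp continuous_on_coord)
 qed (use nz in auto)
 have Feq: "F x : nsph m" if "x : nsph m" for x
 proof (rule nsph_Suc_equator)
  show "F x : nsph (Suc m)" using Fin that nsph_mono by auto
  have "x (Suc m) = 0" using that by (simp add: nsph_def)
  then show "F x (Suc m) = 0" by (simp add: F_def nrml_def h_def)
 qed
 have "even (Brouwer_degree2 (Suc m) F - Brouwer_degree2 (Suc m - Suc 0) F)"
 proof (rule Borsuk_odd_mapping_degree_step)
  show "continuous_map (nsphere (Suc m)) (nsphere (Suc m)) F" using Fc Fin by (auto simp: cmap_nsphere)
 qed (use Feq in "auto simp: topspace_nsphere_nsph Fodd")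
 moreover have "odd (Brouwer_degree2 m F)"
  using Suc.IH[of F] continuous_on_subset[OF Fc nsph_mono] Feq Fodd by auto
 ultimately show ?case using degf by simp
qed

text \<open>Without a common zero, padding by a zero coordinate and normalising would give an odd
  self-map of the sphere. It misses a pole, so its degree would be 0 and not odd.\<close>

theorem borsuk_ulam_nsph:
 fixes f :: "nat => (nat => real) => real"
 assumes c: "!!i. i < n ==> continuous_on (nsph n) (f i)"
  and o: "!!i x. i < n ==> x : nsph n ==> f i (%j. - x j) = - f i x"
 shows "EX x:nsph n. ALL i<n. f i x = 0"
proof (rule ccontr)
 assume neg: "~ ?thesis"
 define k where "k x i = (if i < n then f i x else 0)" for x i
 define g where "g x = nrml n (k x)" for x
 have nz: "EX i<=n. k x i ~= 0" if "x : nsph n" for x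
  using neg that by (force simp: k_def)
 have gc: "continuous_on (nsph n) g" unfolding g_def
 proof (rule continuous_on_nrml)
  show "continuous_on (nsph n) (%x. k x i)" for i by (cases "i < n") (auto simp: k_def c)
 qed (use nz in auto)
 have gin: "g x : nsph n" if "x : nsph n" for x
  unfolding g_def by (rule nrml_in[OF nz[OF that]])
 have godd: "g (%i. - x i) = (%i. - g x i)" if "x : nsph n" for x
 proof -
  have "k (%i. - x i) = (%i. - k x i)" using o that by (auto simp: k_def fun_eq_iff)
  then show ?thesis by (simp add: g_def nrml_uminus)
 qed
 have "odd (Brouwer_degree2 n g)"
  using odd_map_degree_odd[of n g] gc gin godd by auto
 moreover have "Brouwer_degree2 n g = 0"
 proof (rule Brouwer_degree2_nonsurjective)
  show "continuous_map (nsphere n) (nsphere n) g" using gc gin unfolding cmap_nsphere by (simp add: image_subset_iff)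
  let ?e = "%i. if i = n then 1 else (0::real)"
  have "?e : nsph n"
  proof -
   have "(\<Sum>i\<le>n. (if i = n then 1 else 0::real)^2) = (\<Sum>i\<le>n. (if i = n then 1 else 0))" by (intro sum.cong) auto
   then show ?thesis by (simp add: nsph_def)
  qed
  moreover have "?e ~: g ` nsph n"
  proof
   assume "?e : g ` nsph n"
   then obtain x where "x : nsph n" "?e = g x" by (rule imageE) blast
   then have "g x n = 1" using fun_cong[of ?e "g x" n] by simp
   then show False by (simp add: g_def nrml_def k_def)
  qed
  ultimately show "g ` topspace (nsphere n) ~= topspace (nsphere n)" unfolding topspace_nsphere_nsph by metis
 qed
 ultimately show False by simp
qed

section \<open>Minimisation in Hilbert spaces and the Riesz representation\<close>

lemma parallelogram: "(norm (x - y))^2 = 2 * (norm x)^2 + 2 * (norm y)^2 - (norm (x + y))^2"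
 for x y :: "'a::real_inner"
 by (simp add: power2_norm_eq_inner inner_diff_left inner_diff_right inner_add_left inner_add_right inner_commute)

text \<open>Points of nearly minimal norm form a Cauchy sequence by the parallelogram law. This
  replaces weak compactness of bounded closed convex sets, both for the Riesz representation and for
  the coercivity of the nonlocal term.\<close>

lemma nested_midconvex_nonempty:
 fixes C :: "nat => 'a::{real_inner,banach} set"
 assumes cl: "!!n. closed (C n)" and ne: "!!n. C n ~= {}" and dec: "!!n m. n <= m ==> C m \<subseteq> C n"
  and mid: "!!n x y. x : C n ==> y : C n ==> (1/2) *\<^sub>R (x + y) : C n"
  and bd: "!!n x. x : C n ==> norm x <= R"
 shows "EX x. ALL n. x : C n"
proof -
 define d where "d n = Inf (norm ` C n)" for n
 have bb: "bdd_below (norm ` C n)" for n by (rule bdd_belowI[of _ 0]) auto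
 have dle: "d n <= norm x" if "x : C n" for n x
  unfolding d_def using that bb by (intro cInf_lower) auto
 have inc: "incseq d"
  unfolding d_def
 proof (intro incseq_SucI cInf_superset_mono)
  show "norm ` C (Suc n) \<subseteq> norm ` C n" for n using dec[of n "Suc n"] by (intro image_mono) simp
 qed (use ne bb in auto)
 have dR: "d n <= R" for n using ne[of n] dle bd by (meson equals0I order_trans)
 have d0: "0 <= d n" for n unfolding d_def using ne by (intro cInf_greatest) auto
 obtain D where D: "d \<longlonglongrightarrow> D" by (rule incseq_convergent[OF inc, of R]) (use dR in auto)
 have "EX x:C n. norm x < d n + 1 / (real n + 1)" for n
  using cInf_lessD[of "norm ` C n" "d n + 1 / (real n + 1)"] ne[of n] by (auto simp: d_def)
 then obtain x where x: "!!n. x n : C n" "!!n. norm (x n) < d n + 1 / (real n + 1)" by metis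
 have "(%n. d n + 1 / (real n + 1)) \<longlonglongrightarrow> D + 0"
  by (intro tendsto_add D) (use LIMSEQ_inverse_real_of_nat in "simp add: inverse_eq_divide add.commute")
 then have nD: "(%n. norm (x n)) \<longlonglongrightarrow> D"
  using tendsto_sandwich[of d "%n. norm (x n)" sequentially "%n. d n + 1 / (real n + 1)" D] D x dle
  by (auto simp: less_imp_le)
 have "Cauchy x"
 proof (rule metric_CauchyI)
  fix e :: real assume e: "0 < e"
  \<comment> \<open>The parallelogram law leaves an error of 4(D^2 + \<delta>) - 4(D^2 - \<delta>) =
    8\<delta>, which must stay below e^2.\<close>
  define \<delta> where "\<delta> = e^2 / 9"
  have de: "\<delta> > 0" using e by (simp add: \<delta>_def)
  have l1: "(%n. (norm (x n))^2) \<longlonglongrightarrow> D^2" and l2: "(%n. (d n)^2) \<longlonglongrightarrow> D^2"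
   by (intro tendsto_power nD D)+
  have "\<forall>\<^sub>F n in sequentially. (norm (x n))^2 < D^2 + \<delta> & D^2 - \<delta> < (d n)^2"
   by (intro eventually_conj order_tendstoD(2)[OF l1] order_tendstoD(1)[OF l2]) (use de in auto)
  then obtain N where N: "!!n. n >= N ==> (norm (x n))^2 < D^2 + \<delta> & D^2 - \<delta> < (d n)^2"
   by (auto simp: eventually_sequentially)
  have key: "dist (x m) (x n) < e" if "N <= n" "n <= m" for n m
  proof -
   have "(1/2) *\<^sub>R (x m + x n) : C n" using mid[of "x m" n "x n"] x(1) dec[OF that(2)] by blast
   then have "d n <= norm (x m + x n) / 2" using dle by fastforce
   then have "(d n)^2 <= (norm (x m + x n) / 2)^2" using d0 by (intro power_mono) auto
   then have "4 * (d n)^2 <= (norm (x m + x n))^2" by (simp add: power_divide)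
   then have "(norm (x m - x n))^2 < 8 * \<delta>" 
    using parallelogram[of "x m" "x n"] N[of n] N[of m] that by linarith
   also have "... <= e^2" by (simp add: \<delta>_def)
   finally show ?thesis using e by (simp add: dist_norm power2_less_imp_less)
  qed
  show "EX M. ALL m>=M. ALL n>=M. dist (x m) (x n) < e"
  proof (intro exI allI impI)
   fix m n assume "N <= m" "N <= n"
   then show "dist (x m) (x n) < e" using key[of n m] key[of m n] by (cases "n <= m") (auto simp: dist_commute)
  qed
 qed
 then obtain l where l: "x \<longlonglongrightarrow> l" using Cauchy_convergent_iff convergent_def by blast
 have "l : C n" for n
 proof (rule closed_sequentially[OF cl])
  show "(%k. x (k + n)) \<longlonglongrightarrow> l" using l by (rule LIMSEQ_ignore_initial_segment)
  show "x (k + n) : C n" for k using x(1)[of "k+n"] dec[of n "k+n"] by auto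
 qed
 then show ?thesis by blast
qed

lemma quadratic_nonneg_imp_zero:
 fixes a b :: real assumes "!!t. a * t + b * t^2 >= 0" shows "a = 0"
proof (rule ccontr)
 assume a: "a ~= 0"
 define M where "M = \<bar>b\<bar> + 1"
 have M: "M > 0" "b < M" by (auto simp: M_def)
 have "a * (- a / M) + b * (- a / M)^2 = a^2 * (b - M) / M^2"
  using M by (simp add: field_simps power2_eq_square)
 also have "... < 0" using a M by (intro divide_neg_pos mult_pos_neg) auto
 finally show False using assms[of "- a / M"] by simp
qed

lemma le_one_plus_square: "a <= 1 + a^2" for a :: real
proof -
 have "0 <= (a - 1/2)^2" by simp
 then show ?thesis by (simp add: power2_eq_square algebra_simps)
qed

text \<open>A minimiser of |x|^2/2 - l x represents \<open>l\<close>, by its first variation. It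
  exists because the sublevel sets near the infimum are closed, bounded, nested and midpoint
  convex.\<close>

theorem riesz_representation:
 fixes l :: "'a::{real_inner,banach} => real"
 assumes "bounded_linear l"
 shows "EX y. ALL x. l x = inner y x"
proof -
 interpret bounded_linear l by fact
 obtain K where K: "K > 0" "!!x. \<bar>l x\<bar> <= norm x * K" using pos_bounded by auto
 define F where "F x = (norm x)^2 / 2 - l x" for x
 have Flow: "F x >= (norm x)^2 / 4 - K^2" for x
 proof -
  have "0 <= (norm x / 2 - K)^2" by simp
  then have "norm x * K <= (norm x)^2 / 4 + K^2" by (simp add: power2_diff power_divide field_simps)
  then show ?thesis using K(2)[of x] by (simp add: F_def) 
 qed
 have bb: "bdd_below (range F)"
 proof (rule bdd_belowI[of _ "- (K^2)"])
  fix y assume "y : range F"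
  then obtain x where "y = F x" by (rule imageE)
  then show "- (K^2) <= y" using Flow[of x] zero_le_power2[of "norm x"] by linarith
 qed
 define m where "m = Inf (range F)"
 have mle: "m <= F x" for x unfolding m_def using bb by (intro cInf_lower) auto
 define C where "C n = {x. F x <= m + 1 / (real n + 1)}" for n :: nat
 have "EX x. ALL n. x : C n"
 proof (rule nested_midconvex_nonempty)
  show "closed (C n)" for n
   unfolding C_def F_def by (intro closed_Collect_le continuous_intros continuous_on) simp_all
  show "C n ~= {}" for n
  proof -
   have "Inf (range F) < m + 1 / (real n + 1)" by (simp add: m_def)
   from cInf_lessD[OF _ this] obtain x where "F x < m + 1 / (real n + 1)" by auto
   then have "x : C n" by (simp add: C_def)
   then show ?thesis by blast
  qed
  show "C k \<subseteq> C n" if "n <= k" for n k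
  proof -
   have "1 / (real k + 1) <= 1 / (real n + 1)" using that by (simp add: field_simps)
   then show ?thesis by (auto simp: C_def)
  qed
  show "(1/2) *\<^sub>R (x + y) : C n" if "x : C n" "y : C n" for n x y
  proof -
   have "(norm (x + y))^2 <= 2 * (norm x)^2 + 2 * (norm y)^2" using parallelogram[of x y] by (smt (verit) zero_le_power2)
   moreover have "(norm ((1/2) *\<^sub>R (x + y)))^2 = (norm (x + y))^2 / 4"
    unfolding norm_scaleR power_mult_distrib by (simp add: power_divide)
   moreover have "l ((1/2) *\<^sub>R (x + y)) = (l x + l y) / 2" unfolding scale add by simp
   ultimately have "F ((1/2) *\<^sub>R (x + y)) <= (F x + F y) / 2"
    unfolding F_def by argo
   then show ?thesis using that by (simp add: C_def)
  qed
  show "norm x <= 1 + 4 * (m + 1 + K^2)" if "x : C n" for n x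
  proof -
   have "1 / (real n + 1) <= 1" by simp
   then have "F x <= m + 1" using that unfolding C_def by (metis add_left_mono mem_Collect_eq order_trans)
   then have "(norm x)^2 <= 4 * (m + 1 + K^2)" using Flow[of x] by argo
   then show ?thesis using le_one_plus_square[of "norm x"] by argo
  qed
 qed
 then obtain y where y: "!!n. F y <= m + 1 / (real n + 1)" unfolding C_def by blast
 have "F y <= m"
 proof (rule LIMSEQ_le_const)
  show "(%n. m + 1 / (real n + 1)) \<longlonglongrightarrow> m"
   using tendsto_add[OF tendsto_const LIMSEQ_inverse_real_of_nat, of m] by (simp add: inverse_eq_divide add.commute)
 qed (use y in auto)
 have "l x = inner y x" for x
 proof -
  have "(inner y x - l x) * t + ((norm x)^2 / 2) * t^2 >= 0" for t
  proof -
   have "F (y + t *\<^sub>R x) - F y >= 0" using mle[of "y + t *\<^sub>R x"] \<open>F y <= m\<close> by linarith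
   moreover have "(norm (y + t *\<^sub>R x))^2 = (norm y)^2 + 2 * t * inner y x + t^2 * (norm x)^2"
    unfolding power2_norm_eq_inner by (simp add: inner_add_left inner_add_right inner_commute power2_eq_square)
   ultimately show ?thesis by (simp add: F_def add scale field_simps)
  qed
  from quadratic_nonneg_imp_zero[OF this] show ?thesis by simp
 qed
 then show ?thesis by blast
qed

section \<open>Finite orthonormal systems\<close>

definition orthon :: "'a::real_inner set => bool" where
 "orthon O' \<longleftrightarrow> finite O' & (ALL x:O'. ALL y:O'. inner x y = (if x = y then 1 else 0))"

definition prj :: "'a::real_inner set => 'a => 'a" where
 "prj O' u = (\<Sum>e\<in>O'. inner u e *\<^sub>R e)"

lemma inner_prj_basis: assumes "orthon O'" "e : O'" shows "inner (prj O' u) e = inner u e"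
proof -
 have "inner (prj O' u) e = (\<Sum>f\<in>O'. inner u f * inner f e)" by (simp add: prj_def inner_sum_left)
 also have "... = (\<Sum>f\<in>O'. if f = e then inner u e else 0)"
  using assms by (intro sum.cong) (auto simp: orthon_def)
 also have "... = inner u e" using assms by (simp add: orthon_def)
 finally show ?thesis .
qed

lemma prj_in_span: "prj O' u : span O'"
 unfolding prj_def by (intro span_sum span_scale span_base)

lemma orth_span: assumes "!!e. e : E ==> inner v e = 0" "x : span E" shows "inner v x = 0"
 using assms(2) by (induction rule: span_induct_alt) (auto simp: inner_add_right assms(1))

lemma inner_sub_prj: assumes "orthon O'" "x : span O'" shows "inner (u - prj O' u) x = 0"
 by (rule orth_span[OF _ assms(2)]) (simp add: inner_diff_left inner_prj_basis[OF assms(1)])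

lemma prj_id: assumes "orthon O'" "x : span O'" shows "prj O' x = x"
proof -
 have "x - prj O' x : span O'" using assms prj_in_span by (intro span_diff)
 then have "inner (x - prj O' x) (x - prj O' x) = 0" by (rule inner_sub_prj[OF assms(1)])
 then show ?thesis by simp
qed

lemma prj_pythagoras: assumes "orthon O'" shows "(norm u)^2 = (norm (prj O' u))^2 + (norm (u - prj O' u))^2"
proof -
 have "inner (u - prj O' u) (prj O' u) = 0" by (rule inner_sub_prj[OF assms prj_in_span])
 then have "inner u u = inner (prj O' u) (prj O' u) + inner (u - prj O' u) (u - prj O' u)"
  by (simp add: inner_diff_left inner_diff_right inner_commute)
 then show ?thesis by (simp add: power2_norm_eq_inner)
qed

lemma norm_prj_le: "orthon O' ==> norm (prj O' u) <= norm u"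
 using prj_pythagoras[of O' u] by (simp add: power2_le_imp_le)

lemma inner_prj_self: assumes "orthon O'" shows "inner v (prj O' v) = (norm (prj O' v))^2"
proof -
 have "inner (v - prj O' v) (prj O' v) = 0" by (rule inner_sub_prj[OF assms prj_in_span])
 then show ?thesis by (simp add: inner_diff_left power2_norm_eq_inner)
qed

lemma bounded_linear_prj: "bounded_linear (prj O')"
 unfolding prj_def
 by (rule bounded_linear_sum) (rule bounded_linear_compose[OF bounded_linear_scaleR_left bounded_linear_inner_left])

lemma norm_sum_orthon:
 assumes "orthon O'" "inj_on z I" "z ` I \<subseteq> O'" "finite I"
 shows "(norm (\<Sum>i\<in>I. c i *\<^sub>R z i))^2 = (\<Sum>i\<in>I. (c i)^2)"
proof -
 have "(norm (\<Sum>i\<in>I. c i *\<^sub>R z i))^2 = (\<Sum>i\<in>I. \<Sum>j\<in>I. c i * c j * inner (z i) (z j))"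
  by (simp add: power2_norm_eq_inner inner_sum_left inner_sum_right sum_distrib_left algebra_simps)
    (subst sum.swap, simp add: mult.left_commute)
 also have "... = (\<Sum>i\<in>I. \<Sum>j\<in>I. if i = j then (c i)^2 else 0)"
  using assms by (intro sum.cong refl) (auto simp: orthon_def inj_on_def power2_eq_square image_subset_iff)
 finally show ?thesis using assms(4) by simp
qed

lemma gram_schmidt:
 assumes "orthon O'" "finite S"
 shows "EX P. O' \<subseteq> P & orthon P & span P = span (O' \<union> S)"
 using assms(2)
proof induction
 case empty then show ?case using assms(1) by auto
next
 case (insert s S)
 then obtain P where P: "O' \<subseteq> P" "orthon P" "span P = span (O' \<union> S)" by auto
 define w where "w = s - prj P s"
 have sp: "span (insert s P) = span (O' \<union> insert s S)"
 proof -
  have "span (insert s P) = span ({s} \<union> P)" by simp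
  also have "... = span ({s} \<union> (O' \<union> S))" using P(3) by (simp only: span_Un)
  finally show ?thesis by simp
 qed
 show ?case
 proof (cases "w = 0")
  case True
  then have "s : span P" using prj_in_span[of P s] by (simp add: w_def)
  then have "span (insert s P) = span P" by (rule span_redundant)
  then show ?thesis using P sp by auto
 next
  case False
  define e where "e = (1 / norm w) *\<^sub>R w"
  have orth: "inner e x = 0" if "x : P" for x
   using inner_sub_prj[OF P(2) span_base[OF that], of s] by (simp add: e_def w_def)
  have ee: "inner e e = 1" using False by (simp add: e_def power2_norm_eq_inner[symmetric] power2_eq_square)
  have "orthon (insert e P)" using P(2) orth ee by (auto simp: orthon_def inner_commute)
  moreover have "span (insert e P) = span (insert s P)"
  proof (rule span_eq[THEN iffD2], safe)
   fix x
   show "e : span (insert s P)"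
    unfolding e_def w_def using prj_in_span[of P s] span_mono[of P "insert s P"]
    by (intro span_scale span_diff) (auto intro: span_base)
   have "s = norm w *\<^sub>R e + prj P s" using False by (simp add: e_def w_def)
   moreover have "norm w *\<^sub>R e + prj P s : span (insert e P)"
    using prj_in_span[of P s] span_mono[of P "insert e P"] by (intro span_add span_scale) (auto intro: span_base)
   ultimately show "s : span (insert e P)" by simp
  qed (auto intro: span_base)
  ultimately show ?thesis using P sp by (intro exI[of _ "insert e P"]) auto
 qed
qed

lemma compact_finite_combinations:
 fixes S :: "'a::real_normed_vector set"
 assumes "finite S"
 shows "compact {\<Sum>e\<in>S. c e *\<^sub>R e | c. ALL e:S. \<bar>c e\<bar> <= R}"
 using assms
proof induction
 case (insert x S)
 let ?K = "{\<Sum>e\<in>S. c e *\<^sub>R e | c. ALL e:S. \<bar>c e\<bar> <= R}"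
 have "compact ((%p. fst p *\<^sub>R x + snd p) ` ({-R..R} \<times> ?K))"
  using insert by (intro compact_continuous_image compact_Times continuous_intros) auto
 moreover have "(%p. fst p *\<^sub>R x + snd p) ` ({-R..R} \<times> ?K) = {\<Sum>e\<in>insert x S. c e *\<^sub>R e | c. ALL e:insert x S. \<bar>c e\<bar> <= R}"
 proof (intro equalityI subsetI)
  fix y assume "y : (%p. fst p *\<^sub>R x + snd p) ` ({-R..R} \<times> ?K)"
  then obtain k c where kc: "y = k *\<^sub>R x + (\<Sum>e\<in>S. c e *\<^sub>R e)" "\<bar>k\<bar> <= R" "ALL e:S. \<bar>c e\<bar> <= R" by auto
  have "(\<Sum>e\<in>S. (c(x := k)) e *\<^sub>R e) = (\<Sum>e\<in>S. c e *\<^sub>R e)" using insert by (intro sum.cong) auto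
  then have "y = (\<Sum>e\<in>insert x S. (c(x := k)) e *\<^sub>R e)" using kc insert by simp
  then show "y : {\<Sum>e\<in>insert x S. c e *\<^sub>R e | c. ALL e:insert x S. \<bar>c e\<bar> <= R}" using kc by fastforce
 next
  fix y assume "y : {\<Sum>e\<in>insert x S. c e *\<^sub>R e | c. ALL e:insert x S. \<bar>c e\<bar> <= R}"
  then obtain c where c: "y = (\<Sum>e\<in>insert x S. c e *\<^sub>R e)" "ALL e:insert x S. \<bar>c e\<bar> <= R" by auto
  then show "y : (%p. fst p *\<^sub>R x + snd p) ` ({-R..R} \<times> ?K)"
   using insert by (intro image_eqI[of _ _ "(c x, \<Sum>e\<in>S. c e *\<^sub>R e)"]) auto
 qed
 ultimately show ?case by simp
qed simp

lemma span_ball_in_compact: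
 assumes "orthon O'"
 shows "EX K. compact K & K \<subseteq> span O' & (ALL x:span O'. norm x <= R --> x : K)"
proof (intro exI conjI)
 let ?K = "{\<Sum>e\<in>O'. c e *\<^sub>R e | c. ALL e:O'. \<bar>c e\<bar> <= R}"
 show "compact ?K" using assms by (intro compact_finite_combinations) (simp add: orthon_def)
 show "?K \<subseteq> span O'"
 proof
  fix y assume "y : ?K"
  then obtain c where "y = (\<Sum>e\<in>O'. c e *\<^sub>R e)" by auto
  then show "y : span O'" by (simp add: span_sum span_scale span_base)
 qed
 show "ALL x:span O'. norm x <= R --> x : ?K"
 proof (intro ballI impI)
  fix x assume x: "x : span O'" "norm x <= R"
  have "\<bar>inner x e\<bar> <= R" if "e : O'" for e
  proof -
   have "norm e = 1" using assms that by (simp add: orthon_def norm_eq_sqrt_inner)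
   then show ?thesis using Cauchy_Schwarz_ineq2[of x e] x by simp
  qed
  moreover have "x = (\<Sum>e\<in>O'. inner x e *\<^sub>R e)" using prj_id[OF assms x(1)] by (simp add: prj_def)
  ultimately show "x : ?K" by blast
 qed
qed

section \<open>Polar decomposition of invertible self-adjoint operators\<close>

definition sadj :: "('a::real_inner \<Rightarrow>\<^sub>L 'a) => bool" where
 "sadj T \<longleftrightarrow> (ALL x y. inner (blinfun_apply T x) y = inner x (blinfun_apply T y))"

text \<open>The inverse at y is the fixed point of the contraction x -> y + Z x; no operator series
  is summed.\<close>

lemma neumann_inverse:
 fixes Z :: "'a::{real_normed_vector,banach} \<Rightarrow>\<^sub>L 'a"
 assumes "norm Z < 1"
 shows "EX W. W o\<^sub>L (id_blinfun - Z) = id_blinfun & (id_blinfun - Z) o\<^sub>L W = id_blinfun"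
proof -
 have ex: "EX! x. y + blinfun_apply Z x = x" for y
 proof (rule banach_fix_type[of "norm Z"])
  show "ALL x x'. dist (y + Z x) (y + Z x') <= norm Z * dist x x'"
   by (simp add: dist_norm flip: blinfun.diff_right) (simp add: norm_blinfun)
 qed (use assms in auto)
 then obtain w where w: "!!y. y + Z (w y) = w y" by metis
 have uniq: "x = w y" if "y + Z x = x" for x y using ex[of y] w[of y] that by auto
 have lb: "(1 - norm Z) * norm (w y) <= norm y" for y
 proof -
  have "norm (w y) <= norm y + norm (Z (w y))" by (metis norm_triangle_ineq w)
  also have "norm (Z (w y)) <= norm Z * norm (w y)" by (rule norm_blinfun)
  finally show ?thesis by (simp add: algebra_simps)
 qed
 have bl: "bounded_linear w"
 proof (rule bounded_linear_intro[where K="1 / (1 - norm Z)"])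
  show "w (x + y) = w x + w y" for x y
  proof -
   have "(x + y) + Z (w x + w y) = w x + w y"
    using w[of x] w[of y] by (simp add: blinfun.add_right) (metis add.assoc add.commute)
   then show ?thesis by (rule uniq[symmetric])
  qed
  show "w (r *\<^sub>R x) = r *\<^sub>R w x" for r x
  proof -
   have "r *\<^sub>R x + Z (r *\<^sub>R w x) = r *\<^sub>R w x"
    using w[of x] by (simp add: blinfun.scaleR_right flip: scaleR_add_right)
   then show ?thesis by (rule uniq[symmetric])
  qed
  show "norm (w x) <= norm x * (1 / (1 - norm Z))" for x using lb[of x] assms by (simp add: field_simps)
 qed
 have W: "blinfun_apply (Blinfun w) = w" using bl by (rule bounded_linear_Blinfun_apply)
 have "Blinfun w o\<^sub>L (id_blinfun - Z) = id_blinfun"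
 proof (rule blinfun_eqI)
  fix x
  have "x = w (x - Z x)" by (rule uniq) simp
  then show "(Blinfun w o\<^sub>L (id_blinfun - Z)) x = id_blinfun x" by (simp add: W blinfun.diff_left)
 qed
 moreover have "(id_blinfun - Z) o\<^sub>L Blinfun w = id_blinfun"
 proof (rule blinfun_eqI)
  fix x
  show "((id_blinfun - Z) o\<^sub>L Blinfun w) x = id_blinfun x" using w[of x] by (simp add: W blinfun.diff_left algebra_simps)
 qed
 ultimately show ?thesis by blast
qed

definition comms :: "('a::real_normed_vector \<Rightarrow>\<^sub>L 'a) => ('a \<Rightarrow>\<^sub>L 'a) => bool" where
 "comms C T \<longleftrightarrow> C o\<^sub>L T = T o\<^sub>L C"

lemma comms_apply: "comms C T \<longleftrightarrow> (ALL x. blinfun_apply C (T x) = T (C x))"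
 unfolding comms_def by (metis blinfun_eqI blinfun_apply_blinfun_compose)

text \<open>\<open>1 - Z\<close> is the square root of \<open>1 - T\<close>; \<open>Z\<close> is the fixed point of a contraction.\<close>
lemma sqrt_fixed_point:
 fixes T :: "'a::{real_inner,banach} \<Rightarrow>\<^sub>L 'a"
 assumes T: "norm T < 1" "sadj T"
 shows "EX Z. norm Z < 1 & sadj Z & (ALL C. comms C T --> comms C Z)
   & (id_blinfun - Z) o\<^sub>L (id_blinfun - Z) = id_blinfun - T"
proof -
 \<comment> \<open>The smaller root of r^2 - 2r + |T| = 0: the map Z -> (T + Z^2)/2 sends the ball
   of radius \<rho> into itself and contracts it by the factor \<rho> < 1.\<close>
 define \<rho> where "\<rho> = 1 - sqrt (1 - norm T)"
 have rho: "0 <= \<rho>" "\<rho> < 1" "norm T + \<rho>^2 = 2 * \<rho>"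
  using T by (auto simp: \<rho>_def power2_diff)
 \<comment> \<open>Self-adjointness and the commutation relations are closed conditions preserved by
   the iteration, so putting them into the domain hands them to the fixed point.\<close>
 define S where "S = {Z :: 'a \<Rightarrow>\<^sub>L 'a. norm Z <= \<rho> & (ALL x y. inner (blinfun_apply Z x) y - inner x (blinfun_apply Z y) = 0)
    & (ALL C. comms C T --> (C o\<^sub>L Z) - (Z o\<^sub>L C) = 0)}"
 define F where "F Z = (1/2) *\<^sub>R (T + (Z o\<^sub>L Z))" for Z
 have "closed S"
 proof -
  have a: "closed {Z :: 'a \<Rightarrow>\<^sub>L 'a. inner (blinfun_apply Z x) y - inner x (blinfun_apply Z y) = 0}" for x y :: 'a
   by (intro closed_Collect_eq continuous_intros)
  have b: "closed {Z :: 'a \<Rightarrow>\<^sub>L 'a. (C o\<^sub>L Z) - (Z o\<^sub>L C) = 0}" for C :: "'a \<Rightarrow>\<^sub>L 'a"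
   by (intro closed_Collect_eq continuous_intros bounded_linear.continuous_on[OF bounded_bilinear.bounded_linear_right[OF bounded_bilinear_blinfun_compose]]
     bounded_linear.continuous_on[OF bounded_bilinear.bounded_linear_left[OF bounded_bilinear_blinfun_compose]])
  have c: "closed {Z :: 'a \<Rightarrow>\<^sub>L 'a. norm Z <= \<rho>}" by (intro closed_Collect_le continuous_intros)
  have "S = {Z. norm Z <= \<rho>} \<inter> (\<Inter>x. \<Inter>y. {Z. inner (blinfun_apply Z x) y - inner x (blinfun_apply Z y) = 0})
    \<inter> (\<Inter>C\<in>{C. comms C T}. {Z. (C o\<^sub>L Z) - (Z o\<^sub>L C) = 0})" by (auto simp: S_def)
  then show ?thesis using a b c by (simp add: closed_Int closed_INT)
 qed
 then have "uniform_space_class.complete S" by (simp add: complete_eq_closed)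
 moreover have "0 : S" using rho by (simp add: S_def)
 moreover have "F ` S \<subseteq> S"
 proof (rule image_subsetI)
  fix Z assume Z: "Z : S"
  have zn: "norm Z <= \<rho>" and zs: "!!x y. inner (Z x) y = inner x (Z y)"
   and zc: "!!C x. comms C T ==> C (Z x) = Z (C x)"
   using Z by (auto simp: S_def comms_apply[unfolded comms_def])
  have "norm (Z o\<^sub>L Z) <= \<rho>^2"
   using norm_blinfun_compose[of Z Z] mult_mono[OF zn zn] rho by (simp add: power2_eq_square)
  then have "norm (T + (Z o\<^sub>L Z)) <= 2 * \<rho>" using norm_triangle_ineq[of T "Z o\<^sub>L Z"] rho by linarith
  then have "norm (F Z) <= \<rho>" by (simp add: F_def)
  moreover have "inner (F Z x) y - inner x (F Z y) = 0" for x y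
   using T(2) by (simp add: F_def zs sadj_def blinfun.add_left blinfun.scaleR_left inner_add_left inner_add_right)
  moreover have "(C o\<^sub>L F Z) - (F Z o\<^sub>L C) = 0" if "comms C T" for C
  proof -
   have "C (T x) = T (C x)" for x using that by (simp add: comms_apply)
   then have "(C o\<^sub>L F Z) = (F Z o\<^sub>L C)"
    by (intro blinfun_eqI) (simp add: F_def blinfun.add_left blinfun.scaleR_left blinfun.add_right blinfun.scaleR_right zc[OF that])
   then show ?thesis by simp
  qed
  ultimately show "F Z : S" unfolding S_def by blast
 qed
 moreover have "dist (F Z) (F Z') <= \<rho> * dist Z Z'" if "Z : S" "Z' : S" for Z Z'
 proof -
  \<comment> \<open>Z and Z' need not commute, so the difference of their squares is a symmetrised
    product.\<close>
  have "F Z - F Z' = (1/4) *\<^sub>R (((Z + Z') o\<^sub>L (Z - Z')) + ((Z - Z') o\<^sub>L (Z + Z')))"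
  proof (rule blinfun_eqI)
   fix x
   define a b c d where "a = Z (Z x)" and "b = Z (Z' x)" and "c = Z' (Z x)" and "d = Z' (Z' x)"
   have "(F Z - F Z') x = (1/2) *\<^sub>R (T x + a) - (1/2) *\<^sub>R (T x + d)"
    unfolding F_def a_def d_def by (simp add: blinfun.diff_left blinfun.scaleR_left blinfun.add_left)
   also have "... = (1/2) *\<^sub>R (a - d)" by (simp only: scaleR_right_diff_distrib[symmetric] add_diff_cancel_left)
   finally have l: "(F Z - F Z') x = (1/2) *\<^sub>R (a - d)" .
   have "((Z + Z') o\<^sub>L (Z - Z')) x + ((Z - Z') o\<^sub>L (Z + Z')) x = ((a - b) + (c - d)) + ((a + b) - (c + d))"
    unfolding a_def b_def c_def d_def
    by (simp only: blinfun_apply_blinfun_compose blinfun.add_left blinfun.diff_left blinfun.add_right blinfun.diff_right)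
     (simp only: add.commute add.left_commute add.assoc diff_conv_add_uminus minus_add_distrib minus_minus)
   also have "... = 2 *\<^sub>R (a - d)" by (simp add: scaleR_2)
   finally show "(F Z - F Z') x = ((1/4) *\<^sub>R (((Z + Z') o\<^sub>L (Z - Z')) + ((Z - Z') o\<^sub>L (Z + Z')))) x"
    unfolding l blinfun.scaleR_left blinfun.add_left by simp
  qed
  then have "norm (F Z - F Z') <= (1/4) * (norm ((Z + Z') o\<^sub>L (Z - Z')) + norm ((Z - Z') o\<^sub>L (Z + Z')))"
   by (simp add: norm_triangle_ineq)
  also have "... <= (1/4) * (norm (Z + Z') * norm (Z - Z') + norm (Z - Z') * norm (Z + Z'))"
   by (intro mult_left_mono add_mono norm_blinfun_compose) auto
  also have "... = (norm (Z + Z') / 2) * norm (Z - Z')" by simp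
  also have "... <= \<rho> * norm (Z - Z')"
  proof (rule mult_right_mono)
   have "norm Z <= \<rho>" "norm Z' <= \<rho>" using that by (auto simp: S_def)
   then show "norm (Z + Z') / 2 <= \<rho>" using norm_triangle_ineq[of Z Z'] by linarith
  qed simp
  finally show ?thesis by (simp add: dist_norm)
 qed
 ultimately have "EX! Z. Z : S & F Z = Z"
  using Banach_fix[of S \<rho> F] rho by blast
 then obtain Z where Z: "Z : S" "F Z = Z" by blast
 have n: "norm Z < 1" using Z rho by (auto simp: S_def)
 have "2 *\<^sub>R Z = T + (Z o\<^sub>L Z)"
 proof -
  have "2 *\<^sub>R Z = 2 *\<^sub>R F Z" by (simp add: Z(2))
  then show ?thesis by (simp add: F_def)
 qed
 then have TZ: "T = Z + Z - (Z o\<^sub>L Z)" by (simp add: scaleR_2)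
 have "(id_blinfun - Z) o\<^sub>L (id_blinfun - Z) = id_blinfun - T"
  unfolding TZ by (intro blinfun_eqI) (simp add: blinfun.diff_left blinfun.add_left blinfun.diff_right)
 moreover have "sadj Z" "ALL C. comms C T --> comms C Z" using Z(1) by (auto simp: S_def sadj_def comms_def)
 ultimately show ?thesis using n by blast
qed

text \<open>Cauchy-Schwarz for the nonnegative form (T u, v), applied to the pair x and T x.\<close>

lemma positive_op_norm_bound:
 fixes T :: "'a::real_inner \<Rightarrow>\<^sub>L 'a"
 assumes "sadj T" "!!x. 0 <= inner (T x) x" "!!x. inner (T x) x <= k * (norm x)^2" "0 <= k"
 shows "norm T <= k"
proof (rule norm_blinfun_bound)
 fix x
 define B where "B u v = inner (T u) v" for u v
 have CS: "(B x y)^2 <= B x x * B y y" for x y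
 proof -
  have sym: "B y x = B x y" using assms(1) by (simp add: B_def sadj_def inner_commute)
  have q: "B x x + 2 * t * B x y + t^2 * B y y >= 0" for t
  proof -
   have "B (x + t *\<^sub>R y) (x + t *\<^sub>R y) >= 0" unfolding B_def by (rule assms(2))
   then show ?thesis using sym by (simp add: B_def blinfun.add_right blinfun.scaleR_right inner_add_left inner_add_right power2_eq_square algebra_simps)
  qed
  show ?thesis
  proof (cases "B y y = 0")
   case True
   have "B x y = 0"
   proof (rule ccontr)
    assume "B x y ~= 0"
    then show False using q[of "- (B x x + 1) / (2 * B x y)"] True by (simp add: field_simps)
   qed
   then show ?thesis using True by simp
  next
   case False
   then have pos: "B y y > 0" using assms(2)[of y] by (simp add: B_def order_less_le)
   have "0 <= B x x + 2 * (- B x y / B y y) * B x y + (- B x y / B y y)^2 * B y y" by (rule q)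
   also have "... = B x x - (B x y)^2 / B y y" using pos by (simp add: field_simps power2_eq_square)
   finally show ?thesis using pos by (simp add: field_simps)
  qed
 qed
 have "(norm (T x))^2 = B x (T x)" by (simp add: B_def power2_norm_eq_inner)
 then have "((norm (T x))^2)^2 <= B x x * B (T x) (T x)" using CS[of x "T x"] by simp
 also have "... <= (k * (norm x)^2) * (k * (norm (T x))^2)"
  unfolding B_def using assms by (intro mult_mono) auto
 finally have *: "(norm (T x))^2 * (norm (T x))^2 <= (k * norm x)^2 * (norm (T x))^2"
  by (simp add: power2_eq_square algebra_simps)
 have "(norm (T x))^2 <= (k * norm x)^2"
 proof (cases "norm (T x) = 0")
  case False
  then have "0 < (norm (T x))^2" by simp
  then show ?thesis using * by (rule mult_right_le_imp_le[rotated])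
 qed simp
 then show "norm (T x) <= k * norm x" by (rule power2_le_imp_le) (use assms(4) in simp)
qed (use assms in auto)

text \<open>Spectral calculus through two square roots. After scaling, L0^2 = 1 - T with |T| < 1, so
  there is an invertible self-adjoint Q with Q^4 = L0^2 that commutes with L0. With V the inverse of
  Q, the operator J = V^2 L0 satisfies J^2 = V^4 L0^2 = 1, and the congruence by V/sqrt l carries L
  = l L0 to J.\<close>

theorem symmetric_congruent_involution:
 fixes L :: "'a::{real_inner,banach} \<Rightarrow>\<^sub>L 'a"
 assumes L: "sadj L" and c: "0 < c" "!!x. c * norm x <= norm (L x)"
 shows "EX S W J :: 'a \<Rightarrow>\<^sub>L 'a. S o\<^sub>L W = id_blinfun & W o\<^sub>L S = id_blinfun & sadj S & sadj J
    & J o\<^sub>L J = id_blinfun & (ALL x y. inner (L (S x)) (S y) = inner (J x) y)"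
proof (cases "norm L = 0")
 case True
 then have "norm x <= 0" for x :: 'a using c(2)[of x] c(1) by (simp add: mult_le_0_iff)
 then have z: "x = 0" for x :: 'a by simp
 have "sadj (id_blinfun :: 'a \<Rightarrow>\<^sub>L 'a)" by (simp add: sadj_def)
 moreover have "inner (L x) y = inner (id_blinfun x) y" for x y using z[of x] by simp
 ultimately show ?thesis by (intro exI[of _ id_blinfun]) (auto intro: blinfun_eqI)
next
 case False
 define l where "l = norm L"
 have l: "l > 0" using False by (simp add: l_def)
 define L0 where "L0 = (1 / l) *\<^sub>R L"
 have L0s: "sadj L0" using L by (simp add: sadj_def L0_def blinfun.scaleR_left)
 have L0n: "norm (L0 x) <= norm x" for x
  using norm_blinfun[of L x] l by (simp add: L0_def blinfun.scaleR_left l_def field_simps)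
 define d where "d = min 1 (c / l)"
 have d: "0 < d" "d <= 1" using c l by (auto simp: d_def)
 have L0b: "d * norm x <= norm (L0 x)" for x
 proof -
  have "d * norm x <= (c / l) * norm x" by (intro mult_right_mono) (auto simp: d_def)
  also have "... <= norm (L0 x)" using c(2)[of x] l by (simp add: L0_def blinfun.scaleR_left field_simps)
  finally show ?thesis .
 qed
 define T where "T = id_blinfun - (L0 o\<^sub>L L0)"
 have Tx: "inner (T x) x = (norm x)^2 - (norm (L0 x))^2" for x
  using L0s by (simp add: T_def blinfun.diff_left inner_diff_left power2_norm_eq_inner sadj_def)
 have Ts: "sadj T" using L0s by (simp add: sadj_def T_def blinfun.diff_left inner_diff_left inner_diff_right)
 have "norm T <= 1 - d^2"
 proof (rule positive_op_norm_bound[OF Ts])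
  show "0 <= inner (T x) x" for x using L0n[of x] by (simp add: Tx power_mono)
  show "inner (T x) x <= (1 - d^2) * (norm x)^2" for x
   using power_mono[OF L0b[of x], of 2] d by (simp add: Tx power_mult_distrib algebra_simps)
  show "0 <= 1 - d^2" using d by (simp add: power_le_one)
 qed
 then have "norm T < 1" using d by (smt (verit) zero_less_power)
 from sqrt_fixed_point[OF this Ts] obtain Z where Z: "norm Z < 1" "sadj Z" "!!C. comms C T ==> comms C Z"
  "(id_blinfun - Z) o\<^sub>L (id_blinfun - Z) = id_blinfun - T" by blast
 from sqrt_fixed_point[OF Z(1,2)] obtain Y where Y: "norm Y < 1" "sadj Y" "!!C. comms C Z ==> comms C Y"
  "(id_blinfun - Y) o\<^sub>L (id_blinfun - Y) = id_blinfun - Z" by blast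
 have "comms L0 T" by (simp add: comms_apply T_def blinfun.diff_left blinfun.diff_right)
 then have cY: "comms L0 Y" using Z(3) Y(3) by blast
 define Q where "Q = id_blinfun - Y"
 obtain V where V: "V o\<^sub>L Q = id_blinfun" "Q o\<^sub>L V = id_blinfun"
  using neumann_inverse[OF Y(1)] by (auto simp: Q_def)
 have QV: "Q (V x) = x" "V (Q x) = x" for x
  using V by (metis blinfun_apply_blinfun_compose id_blinfun.rep_eq)+
 have Qs: "inner (Q x) y = inner x (Q y)" for x y
  using Y(2) by (simp add: Q_def sadj_def blinfun.diff_left inner_diff_left inner_diff_right)
 have Vs: "inner (V x) y = inner x (V y)" for x y
 proof -
  have "inner (V x) y = inner (V x) (Q (V y))" by (simp add: QV)
  also have "... = inner (Q (V x)) (V y)" by (simp add: Qs)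
  finally show ?thesis by (simp add: QV)
 qed
 have QL: "Q (L0 x) = L0 (Q x)" for x
  using cY by (simp add: comms_apply Q_def blinfun.diff_left blinfun.diff_right)
 have VL: "V (L0 x) = L0 (V x)" for x
  using QL[of "V x"] by (metis QV)
 have Q4: "Q (Q (Q (Q x))) = L0 (L0 x)" for x
 proof -
  have "Q (Q x) = (id_blinfun - Z) x" for x using Y(4) by (metis Q_def blinfun_apply_blinfun_compose)
  moreover have "(id_blinfun - Z) ((id_blinfun - Z) x) = L0 (L0 x)" for x
   using Z(4) by (metis T_def blinfun_apply_blinfun_compose add_diff_cancel_left' diff_diff_eq2 diff_add_cancel)
  ultimately show ?thesis by simp
 qed
 define S where "S = (1 / sqrt l) *\<^sub>R V"
 define W where "W = sqrt l *\<^sub>R Q"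
 define J where "J = V o\<^sub>L (V o\<^sub>L L0)"
 have "S o\<^sub>L W = id_blinfun" "W o\<^sub>L S = id_blinfun"
  using l by (auto intro!: blinfun_eqI simp: S_def W_def blinfun.scaleR_left blinfun.scaleR_right QV)
 moreover have "sadj S" by (simp add: sadj_def S_def blinfun.scaleR_left Vs)
 moreover have "sadj J" using L0s by (simp add: sadj_def J_def Vs VL)
 moreover have "J o\<^sub>L J = id_blinfun"
 proof (rule blinfun_eqI)
  fix x
  have "J (J x) = V (V (V (V (L0 (L0 x)))))" by (simp add: J_def VL)
  also have "... = x" by (simp add: QV flip: Q4)
  finally show "(J o\<^sub>L J) x = id_blinfun x" by simp
 qed
 moreover have "inner (L (S x)) (S y) = inner (J x) y" for x y
 proof -
  have "inner (L (S x)) (S y) = (1 / l) * inner (L (V x)) (V y)"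
  proof -
   have "sqrt l * sqrt l = l" using l by simp
   then show ?thesis using l by (simp add: S_def blinfun.scaleR_left blinfun.scaleR_right)
  qed
  also have "... = inner (L0 (V x)) (V y)" by (simp add: L0_def blinfun.scaleR_left)
  also have "... = inner (V (V (L0 x))) y" by (simp only: VL[symmetric] Vs)
  also have "... = inner (J x) y" by (simp add: J_def)
  finally show ?thesis .
 qed
 ultimately show ?thesis by blast
qed

text \<open>Serves for the values of a compact gradient, which lie arbitrarily close to balls of
  finite dimensional spaces.\<close>

lemma convergent_subseq_totally_bounded:
 fixes f :: "nat => 'a::complete_space"
 assumes tb: "!!e. e > 0 ==> EX K. compact K & (ALL n. EX y:K. dist (f n) y <= e)"
 shows "EX r l. strict_mono r & (f \<circ> r) \<longlonglongrightarrow> l"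
proof -
 have "EX k. finite k & closure (range f) \<subseteq> (\<Union>x\<in>k. ball x e)" if e: "e > 0" for e
 proof -
  obtain K where K: "compact K" "!!n. EX y:K. dist (f n) y <= e/4" using tb[of "e/4"] e by auto
  obtain k where k: "finite k" "K \<subseteq> (\<Union>x\<in>k. ball x (e/4))"
   using K(1) e by (metis compact_eq_totally_bounded divide_pos_pos zero_less_numeral)
  have "closure (range f) \<subseteq> (\<Union>x\<in>k. ball x e)"
  proof
   fix z assume "z : closure (range f)"
   then obtain n where n: "dist (f n) z < e/4" using e by (metis closure_approachable divide_pos_pos rangeE zero_less_numeral)
   obtain y where y: "y : K" "dist (f n) y <= e/4" using K(2) by blast
   then obtain x where x: "x : k" "dist x y < e/4" using k(2) by (force simp: mem_ball)
   have "dist x z <= dist x y + dist y (f n) + dist (f n) z" by (metis dist_triangle add_right_mono order_trans)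
   then have "dist x z < e" using n y x e by (simp add: dist_commute)
   then show "z : (\<Union>x\<in>k. ball x e)" using x by (auto simp: mem_ball)
  qed
  then show ?thesis using k(1) by blast
 qed
 then have "compact (closure (range f))" by (simp add: compact_eq_totally_bounded complete_eq_closed)
 then have "seq_compact (closure (range f))" by (simp add: compact_eq_seq_compact_metric)
 moreover have "ALL n. f n : closure (range f)" using closure_subset by fastforce
 ultimately show ?thesis unfolding seq_compact_def by metis
qed

section \<open>Critical points of strongly indefinite even functionals\<close>

text \<open>\<open>G_compact\<close> states compactness of the gradient without weak convergence: on
  a ball, \<open>G\<close> is nearly orthogonal to all directions outside a finite dimensional
  space. \<open>G_ucont\<close> asks for uniform rather than Lipschitz continuity because the map
  |u|^(q-2) u with q < 2 has infinite slope at 0.\<close>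

locale indefinite_functional =
 fixes J :: "'a::{real_inner,banach} => 'a" and Psi :: "'a => real" and G :: "'a => 'a"
 assumes linJ: "bounded_linear J" and selfJ: "!!x y. inner (J x) y = inner x (J y)" and JJ: "!!x. J (J x) = x"
  and Psi_even: "!!u. Psi (- u) = Psi u" and Psi0: "Psi 0 = 0" and G_odd: "!!u. G (- u) = - G u"
  and Psi_deriv: "!!u v. ((%t. Psi (u + t *\<^sub>R v)) has_real_derivative inner (G u) v) (at 0)"
  and G_bdd: "!!R. EX B. ALL u. norm u <= R --> norm (G u) <= B"
  and G_ucont: "!!R e. e > 0 ==> EX h>0. ALL x y. norm x <= R --> norm y <= R --> norm (x - y) <= h --> norm (G x - G y) <= e"
  and G_compact: "!!R e. e > 0 ==> EX E. finite E & (ALL u v. norm u <= R --> (ALL x:E. inner v x = 0) --> \<bar>inner (G u) v\<bar> <= e * norm v)"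
begin

definition I :: "'a => real" where "I u = inner (J u) u / 2 - Psi u"
definition dI :: "'a => 'a" where "dI u = J u - G u"

sublocale J: bounded_linear J by (rule linJ)

lemma norm_J [simp]: "norm (J x) = norm x"
 by (simp add: norm_eq_sqrt_inner selfJ JJ)

lemma dI_uminus: "dI (- u) = - dI u" by (simp add: dI_def G_odd J.neg)

lemma Psi_deriv_at: "((%t. Psi (u + t *\<^sub>R v)) has_real_derivative inner (G (u + t *\<^sub>R v)) v) (at t)"
proof -
 have "((%s. Psi ((u + t *\<^sub>R v) + s *\<^sub>R v)) has_real_derivative inner (G (u + t *\<^sub>R v)) v) (at 0)"
  by (rule Psi_deriv)
 then have "((%s. Psi (u + (s + t) *\<^sub>R v)) has_real_derivative inner (G (u + t *\<^sub>R v)) v) (at 0)"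
  by (simp add: scaleR_add_left add_ac)
 then show ?thesis using DERIV_shift[of "%x. Psi (u + x *\<^sub>R v)" _ 0 t] by simp
qed

lemma I_deriv_at: "((%t. I (u + t *\<^sub>R v)) has_real_derivative inner (dI (u + t *\<^sub>R v)) v) (at t)"
proof -
 have q: "inner (J (u + t *\<^sub>R v)) (u + t *\<^sub>R v) = inner (J u) u + 2 * t * inner (J u) v + t^2 * inner (J v) v" for t
  using selfJ[of v u] by (simp add: J.add J.scale inner_add_left inner_add_right inner_commute power2_eq_square algebra_simps)
 have "((%t. (inner (J u) u + 2 * t * inner (J u) v + t^2 * inner (J v) v) / 2) has_real_derivative
   inner (J (u + t *\<^sub>R v)) v) (at t)"
  by (auto intro!: derivative_eq_intros simp: J.add J.scale inner_add_left field_simps)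
 from DERIV_diff[OF this Psi_deriv_at[of u v t]] show ?thesis
  unfolding I_def dI_def q by (simp add: inner_diff_left)
qed

lemma I_mvt: "EX s. 0 < s & s < 1 & I (u + v) - I u = inner (dI (u + s *\<^sub>R v)) v"
 using MVT2[of 0 1 "%t. I (u + t *\<^sub>R v)" "%t. inner (dI (u + t *\<^sub>R v)) v"] I_deriv_at by auto

text \<open>The mean value theorem along the ray from 0 to z integrates \<open>G_compact\<close>. It
  keeps I high on a sphere of the positive space once finitely many directions are removed.\<close>

lemma Psi_small:
 assumes e: "e > 0"
 shows "EX E. finite E & (ALL z. norm z <= R --> (ALL x:E. inner z x = 0) --> \<bar>Psi z\<bar> <= e * norm z)"
proof -
 obtain E where E: "finite E" "!!u v. norm u <= R ==> (ALL x:E. inner v x = 0) ==> \<bar>inner (G u) v\<bar> <= e * norm v"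
  using G_compact[OF e, of R] by blast
 have "\<bar>Psi z\<bar> <= e * norm z" if z: "norm z <= R" "ALL x:E. inner z x = 0" for z
 proof -
  obtain s where s: "0 < s" "s < 1" "Psi (0 + 1 *\<^sub>R z) - Psi (0 + 0 *\<^sub>R z) = (1 - 0) * inner (G (0 + s *\<^sub>R z)) z"
   using MVT2[of 0 1 "%t. Psi (0 + t *\<^sub>R z)" "%t. inner (G (0 + t *\<^sub>R z)) z"] Psi_deriv_at[of 0 z] by auto
  have "norm (s *\<^sub>R z) <= R" using s z(1) mult_right_mono[of s 1 "norm z"] by simp
  then show ?thesis using E(2)[of "s *\<^sub>R z" z] z(2) s(3) Psi0 by simp
 qed
 then show ?thesis using E(1) by blast
qed

lemma continuous_dI: "continuous_on UNIV dI"
 unfolding continuous_on_iff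
proof (intro ballI allI impI)
 fix x :: 'a and e :: real assume e: "0 < e"
 obtain h where h: "h > 0" "!!y y'. norm y <= norm x + 1 ==> norm y' <= norm x + 1 ==> norm (y - y') <= h ==> norm (G y - G y') <= e/3"
  using G_ucont[of "e/3" "norm x + 1"] e by auto
 show "EX d>0. ALL x':UNIV. dist x' x < d --> dist (dI x') (dI x) < e"
 proof (intro exI[of _ "min h (min 1 (e/3))"] conjI ballI impI)
  fix x' :: 'a assume d: "dist x' x < min h (min 1 (e/3))"
  have "norm x' <= norm x + 1" using d norm_triangle_ineq2[of x' x] by (simp add: dist_norm)
  then have "norm (G x' - G x) <= e/3" using h(2)[of x' x] d by (simp add: dist_norm)
  moreover have "dI x' - dI x = J (x' - x) - (G x' - G x)" by (simp add: dI_def J.diff)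
  then have "norm (dI x' - dI x) <= norm (J (x' - x)) + norm (G x' - G x)" by (metis norm_triangle_ineq4)
  ultimately show "dist (dI x') (dI x) < e" using d e by (simp add: dist_norm)
 qed (use h e in auto)
qed

text \<open>Explicit Euler steps along the normalised projected gradient replace a gradient flow.\<close>
lemma euler_ascent:
 assumes O': "orthon O'" and de: "0 < \<delta>" and ab: "b <= a"
  and grad: "!!u. u : span O' ==> b <= I u ==> I u <= a + 1 ==> \<delta> <= norm (prj O' (dI u))"
  and r: "0 <= r"
 shows "EX \<eta>. continuous_on UNIV \<eta> & (ALL u. \<eta> (- u) = - \<eta> u) & (ALL u:span O'. \<eta> u : span O')
   & (ALL u:span O'. norm u <= r --> b <= I u --> a + 1/2 <= I (\<eta> u))"
proof -
 \<comment> \<open>The ascent is at least \<delta>/2 per unit length, so the length T - 1 suffices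
   to climb from \<open>b\<close> to a + 1.\<close>
 define T where "T = 2 * (a + 1 - b) / \<delta> + 1"
 have T1: "1 <= T" using de ab by (simp add: T_def)
 \<comment> \<open>The oscillation of the gradient allowed along one step: \<delta>/2 preserves half
   of the slope, and 1/2 limits a loss above the gradient zone to 1/2.\<close>
 define \<omega> where "\<omega> = min (\<delta>/2) (1/2)"
 have om: "0 < \<omega>" "\<omega> <= \<delta>/2" "\<omega> <= 1/2" using de by (auto simp: \<omega>_def)
 define R where "R = r + T + 2"
 obtain h0 where h0: "h0 > 0" "!!x y. norm x <= R ==> norm y <= R ==> norm (x - y) <= h0 ==> norm (G x - G y) <= \<omega>/2"
  using G_ucont[of "\<omega>/2" R] om by auto
 define h where "h = min h0 (min (\<omega>/2) 1)"
 have h: "0 < h" "h <= h0" "h <= \<omega>/2" "h <= 1" using h0 om by (auto simp: h_def)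
 have dIuc: "norm (dI x - dI y) <= \<omega>" if "norm x <= R" "norm y <= R" "norm (x - y) <= h" for x y
 proof -
  have "dI x - dI y = J (x - y) - (G x - G y)" by (simp add: dI_def J.diff)
  then have "norm (dI x - dI y) <= norm (J (x - y)) + norm (G x - G y)" by (metis norm_triangle_ineq4)
  then show ?thesis using h0(2)[of x y] that h by simp
 qed
 define V where "V u = prj O' (dI u)" for u
 \<comment> \<open>The maximum keeps the step continuous where the gradient vanishes. Wherever the
   gradient bound holds the step has length exactly \<open>h\<close>.\<close>
 define E where "E u = u + (h / max \<delta> (norm (V u))) *\<^sub>R V u" for u
 have mpos: "max \<delta> (norm (V u)) > 0" for u using de by simp
 have contV: "continuous_on UNIV V"
  unfolding V_def using bounded_linear.continuous_on[OF bounded_linear_prj continuous_dI] .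
 have contE: "continuous_on UNIV E"
 proof -
  have "max \<delta> (norm (V u)) ~= 0" for u using mpos[of u] by simp
  then show ?thesis unfolding E_def by (intro continuous_intros contV) auto
 qed
 have oddV: "V (- u) = - V u" for u
  by (simp add: V_def dI_uminus linear_neg[OF bounded_linear.linear[OF bounded_linear_prj]])
 have oddE: "E (- u) = - E u" for u by (simp add: E_def oddV)
 have spanE: "E u : span O'" if "u : span O'" for u
  unfolding E_def V_def using that prj_in_span by (intro span_add span_scale)
 have stepE: "norm (E u - u) <= h" for u
 proof -
  have "norm (E u - u) = h / max \<delta> (norm (V u)) * norm (V u)" using h mpos[of u] by (simp add: E_def)
  also have "... = h * (norm (V u) / max \<delta> (norm (V u)))" by simp
  also have "... <= h * 1" using mpos[of u] h by (intro mult_left_mono) (auto simp: divide_le_eq)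
  finally show ?thesis by simp
 qed
  have *: "EX g. norm (g - dI u) <= \<omega> & I (E u) - I u = (h / max \<delta> (norm (V u))) * inner g (V u)" if nu: "norm u <= R - 1" for u
  proof -
   define w where "w = (h / max \<delta> (norm (V u))) *\<^sub>R V u"
   obtain s where s: "0 < s" "s < 1" "I (u + w) - I u = inner (dI (u + s *\<^sub>R w)) w" using I_mvt by blast
   have nw: "norm w <= h" using stepE[of u] by (simp add: E_def w_def)
   then have nsw: "norm (s *\<^sub>R w) <= h" using s mult_mono[of s 1 "norm w" h] by simp
   have "norm (u + s *\<^sub>R w) <= R" using norm_triangle_ineq[of u "s *\<^sub>R w"] nu nsw h by linarith
   then have "norm (dI (u + s *\<^sub>R w) - dI u) <= \<omega>" using dIuc[of "u + s *\<^sub>R w" u] nu nsw by simp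
   moreover have "I (E u) - I u = (h / max \<delta> (norm (V u))) * inner (dI (u + s *\<^sub>R w)) (V u)"
    using s(3) by (simp add: E_def w_def)
   ultimately show ?thesis by blast
  qed
  have low: "norm (V u) * (norm (V u) - \<omega>) <= inner g (V u)" if "norm (g - dI u) <= \<omega>" for g u
  proof -
   have "inner (dI u) (V u) = (norm (V u))^2" unfolding V_def by (rule inner_prj_self[OF O'])
   moreover have "\<bar>inner (g - dI u) (V u)\<bar> <= \<omega> * norm (V u)"
    using Cauchy_Schwarz_ineq2[of "g - dI u" "V u"] mult_right_mono[OF that, of "norm (V u)"] by simp
   ultimately show ?thesis by (simp add: inner_diff_left power2_eq_square algebra_simps)
  qed
  have gain: "h * \<delta> / 2 <= I (E u) - I u" if nu: "norm u <= R - 1" and big: "\<delta> <= norm (V u)" for u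
  proof -
   obtain g where g: "norm (g - dI u) <= \<omega>" "I (E u) - I u = (h / max \<delta> (norm (V u))) * inner g (V u)" using *[OF nu] by blast
   have pos: "norm (V u) > 0" using big de by linarith
   have eq: "I (E u) - I u = (h / norm (V u)) * inner g (V u)" using g(2) big by simp
   have "h * \<delta> / 2 = h * (\<delta> / 2)" by simp
   also have "... <= h * (norm (V u) - \<omega>)" using big om h by (intro mult_left_mono) auto
   also have "... = (h / norm (V u)) * (norm (V u) * (norm (V u) - \<omega>))" using pos by simp
   also have "... <= (h / norm (V u)) * inner g (V u)"
    using low[OF g(1)] h by (intro mult_left_mono) auto
   finally show ?thesis by (simp only: eq)
  qed
  have loss: "- (1/2) <= I (E u) - I u" if nu: "norm u <= R - 1" for u
  proof -
   obtain g where g: "norm (g - dI u) <= \<omega>" "I (E u) - I u = (h / max \<delta> (norm (V u))) * inner g (V u)" using *[OF nu] by blast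
   define k where "k = h / max \<delta> (norm (V u))"
   have k0: "0 <= k" using h mpos[of u] by (simp add: k_def)
   have kV: "k * norm (V u) <= h" using stepE[of u] h mpos[of u] by (simp add: E_def k_def)
   have "- (norm (V u) * \<omega>) <= norm (V u) * (norm (V u) - \<omega>)" by (simp add: algebra_simps)
   then have "k * (- (norm (V u) * \<omega>)) <= k * inner g (V u)" using low[OF g(1)] k0 by (intro mult_left_mono) auto
   moreover have "(k * norm (V u)) * \<omega> <= h * \<omega>" using kV om by (intro mult_right_mono) auto
   moreover have "h * \<omega> <= 1 * (1/2)" using h om by (intro mult_mono) auto
   ultimately show ?thesis using g(2) by (simp add: k_def mult.assoc) 
  qed
 obtain N :: nat where N: "real N * h >= T - 1" "real N * h <= T"
 proof -
  define N where "N = nat \<lfloor>T / h\<rfloor>"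
  have "real N = of_int \<lfloor>T / h\<rfloor>" using T1 h by (simp add: N_def)
  then have "real N <= T / h" "T / h < real N + 1" by linarith+
  then have "real N * h <= T" "T < real N * h + h" using h by (auto simp: field_simps)
  then show ?thesis using that[of N] h by linarith
 qed
 \<comment> \<open>The minimum in the invariant is needed because the gradient bound ends at the
   level a + 1. An iterate above it may sink, but by at most 1/2 in one step.\<close>
 have iter: "norm ((E ^^ j) u) <= r + real j * h & (E ^^ j) u : span O' & min (b + real j * (h * \<delta> / 2)) (a + 1/2) <= I ((E ^^ j) u)"
  if u: "u : span O'" "norm u <= r" "b <= I u" and j: "j <= N" for j u
  using j
 proof (induction j)
  case 0 then show ?case using u by simp
 next
  case (Suc j)
  define y where "y = (E ^^ j) u"
  have IH: "norm y <= r + real j * h" "y : span O'" "min (b + real j * (h * \<delta> / 2)) (a + 1/2) <= I y"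
   using Suc by (auto simp: y_def)
  have "real (Suc j) * h <= real N * h" using Suc(2) h by (intro mult_right_mono) auto
  then have jT: "real j * h + h <= T" using N(2) by (simp add: algebra_simps)
  have yR: "norm y <= R - 1" using IH(1) jT h by (simp add: R_def)
  have "norm (E y) <= norm y + norm (E y - y)" by (metis norm_triangle_sub)
  then have n1: "norm (E y) <= r + real (Suc j) * h" using IH(1) stepE[of y] by (simp add: algebra_simps)
  have "0 <= real j * (h * \<delta> / 2)" using h de by simp
  then have by': "b <= I y" using IH(3) ab by linarith
  have "min (b + real (Suc j) * (h * \<delta> / 2)) (a + 1/2) <= I (E y)"
  proof (cases "I y <= a + 1")
   case True
   then have "h * \<delta> / 2 <= I (E y) - I y" using gain[OF yR] grad[OF IH(2) by'] by (simp add: V_def)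
   moreover have "real (Suc j) * (h * \<delta> / 2) = real j * (h * \<delta> / 2) + h * \<delta> / 2" by (simp add: algebra_simps)
   moreover have "0 <= h * \<delta> / 2" using h de by simp
   ultimately show ?thesis using IH(3) by linarith
  next
   case False
   then show ?thesis using loss[OF yR] by linarith
  qed
  then show ?case using n1 spanE[OF IH(2)] by (simp add: y_def)
 qed
 have "b + real N * (h * \<delta> / 2) >= a + 1/2"
 proof -
  have "(T - 1) * (\<delta> / 2) <= (real N * h) * (\<delta> / 2)" using N(1) de by (intro mult_right_mono) auto
  moreover have "(T - 1) * (\<delta> / 2) = a + 1 - b" using de by (simp add: T_def)
  moreover have "real N * (h * \<delta> / 2) = (real N * h) * (\<delta> / 2)" by simp
  ultimately show ?thesis by linarith
 qed
 then have fin: "a + 1/2 <= I ((E ^^ N) u)" if "u : span O'" "norm u <= r" "b <= I u" for u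
  using iter[OF that, of N] by simp
 have cont: "continuous_on UNIV (E ^^ j)" for j
 proof (induction j)
  case (Suc j) then show ?case using continuous_on_compose[OF Suc continuous_on_subset[OF contE]] by (simp add: o_def)
 qed (simp add: continuous_on_id[unfolded id_def] id_def)
 have oddN: "(E ^^ j) (- u) = - (E ^^ j) u" for j u by (induction j) (auto simp: oddE)
 have spanN: "(E ^^ j) u : span O'" if "u : span O'" for j u using that by (induction j) (auto simp: spanE)
 show ?thesis using cont[of N] oddN fin spanN by (intro exI[of _ "E ^^ N"]) blast
qed

end

text \<open>\<open>apriori\<close> tests the gradient only with u and J u. Both lie in any
  J-invariant Galerkin space that contains u, so the bound applies to almost critical points of the
  restricted functional.\<close>

locale fountain = indefinite_functional +
 assumes I_bdd_above: "!!Y. finite Y ==> (ALL y:Y. J y = y) ==> EX a. ALL v. ALL y:span Y. J v = - v --> I (v + y) <= a"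
  and apriori: "!!a. EX R. ALL u. I u <= a --> \<bar>inner (dI u) u\<bar> <= norm u --> \<bar>inner (dI u) (J u)\<bar> <= norm u --> norm u <= R"
  and pos_infinite: "!!S. finite S ==> EX z. z ~= 0 & J z = z & (ALL x:S. inner z x = 0)"
begin

definition pp :: "'a => 'a" where "pp x = (1/2) *\<^sub>R (x + J x)"
definition pm :: "'a => 'a" where "pm x = (1/2) *\<^sub>R (x - J x)"

lemma J_pp: "J (pp x) = pp x" by (simp add: pp_def J.scale J.add JJ add.commute)
lemma J_pm: "J (pm x) = - pm x" by (simp add: pm_def J.scale J.diff JJ flip: scaleR_minus_right)
lemma pp_pm: "pp x + pm x = x"
 by (simp add: pp_def pm_def flip: scaleR_add_right)

lemma J_fix_span: "(!!y. y : Y ==> J y = y) ==> x : span Y ==> J x = x"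
 by (rule linear_eq_on_span[of J "%x. x"]) (auto simp: J.linear linear_ident)

lemma J_neg_span: "(!!y. y : Y ==> J y = - y) ==> x : span Y ==> J x = - x"
 by (rule linear_eq_on_span[of J "%x. - x"]) (auto simp: J.linear linear_uminus)

lemma inner_pp: "J z = z ==> inner z (pp e) = inner z e"
 using selfJ[of z e] by (simp add: pp_def inner_add_right)

lemma pos_neg_orth: "J x = x ==> J y = - y ==> inner x y = 0"
 using selfJ[of x y] by simp

lemma gram_schmidt_empty: "finite S ==> EX P. orthon P & span P = span (S :: 'a set)"
 using gram_schmidt[of "{}" S] by (auto simp: orthon_def)

text \<open>If \<open>I\<close> had no almost critical points between the levels, Euler steps would push the sphere above the
 supremum of \<open>I\<close> over \<open>H\<^sup>- + Y\<close>, but by Borsuk-Ulam every odd image of the sphere meets \<open>H\<^sup>- + Y\<close>.\<close>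
lemma almost_critical_galerkin:
 "EX a>=b. ALL \<delta>>0. ALL E. finite E --> (EX P u. orthon P & (ALL e:E. e : span P) & (ALL x:span P. J x : span P) & u : span P
   & b <= I u & I u <= a + 1 & norm (prj P (dI u)) < \<delta>)"
proof -
 \<comment> \<open>Here r^2/2 = |b| + 1; the surplus 1 pays for \<open>Psi\<close>, which is at most
   1 on the chosen sphere of radius \<open>r\<close>.\<close>
 define r where "r = sqrt (2 * \<bar>b\<bar> + 2)"
 have r: "r > 0" "r^2 / 2 >= b + 1" by (auto simp: r_def real_sqrt_gt_0_iff)
 obtain E0 where E0: "finite E0" "!!z. norm z <= r ==> (ALL x:E0. inner z x = 0) ==> \<bar>Psi z\<bar> <= (1/r) * norm z"
  using Psi_small[of "1/r" r] r(1) by auto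
 \<comment> \<open>A vector of the positive space is orthogonal to e as soon as it is orthogonal to
   the positive part of e.\<close>
 obtain O1 where O1: "orthon O1" "span O1 = span (pp ` E0)"
  using gram_schmidt_empty[of "pp ` E0"] E0(1) by auto
 have O1J: "J x = x" if "x : span O1" for x
  using J_fix_span[of "pp ` E0" x] that O1(2) J_pp by auto
 have finO1: "finite O1" using O1 by (simp add: orthon_def)
 \<comment> \<open>One positive direction beyond \<open>O1\<close>. It belongs both to
   \<open>Y\<close> and to the span of the sphere, whose n + 1 directions thereby outnumber by one
   the n conditions that force a point into H^- + Y.\<close>
 obtain z0 where z0: "z0 ~= 0" "J z0 = z0" "ALL x:O1. inner z0 x = 0" using pos_infinite[OF finO1] by auto
 define y0 where "y0 = (1 / norm z0) *\<^sub>R z0"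
 have y0: "J y0 = y0" "inner y0 y0 = 1" "ALL x:O1. inner y0 x = 0"
  using z0 by (auto simp: y0_def J.scale power2_norm_eq_inner[symmetric] power2_eq_square)
 define Y where "Y = insert y0 O1"
 have orthY: "orthon Y" using O1(1) y0 by (auto simp: Y_def orthon_def inner_commute)
 have YJ: "ALL y:Y. J y = y" using y0 O1J span_base by (auto simp: Y_def)
 have finY: "finite Y" using finO1 by (simp add: Y_def)
 obtain a0 where a0: "!!v y. y : span Y ==> J v = - v ==> I (v + y) <= a0"
  using I_bdd_above[OF finY YJ] by blast
 define a where "a = max a0 b"
 have "EX P u. orthon P & (ALL e:E. e : span P) & (ALL x:span P. J x : span P) & u : span P
   & b <= I u & I u <= a + 1 & norm (prj P (dI u)) < \<delta>" if de: "\<delta> > 0" and fE: "finite E" for \<delta> E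
 proof -
  obtain O3 where O3: "Y \<subseteq> O3" "orthon O3" "span O3 = span (Y \<union> pp ` E)"
   using gram_schmidt[OF orthY, of "pp ` E"] fE by auto
  obtain Om where Om: "orthon Om" "span Om = span (pm ` E)" using gram_schmidt_empty[of "pm ` E"] fE by auto
  have O3J: "J x = x" if "x : span O3" for x
   using J_fix_span[of "Y \<union> pp ` E" x] that O3(3) YJ J_pp by auto
  have OmJ: "J x = - x" if "x : span Om" for x
   using J_neg_span[of "pm ` E" x] that Om(2) J_pm by auto
  define P where "P = O3 \<union> Om"
  have orthP: "orthon P"
  proof -
   have "inner x y = 0" "inner y x = 0" "x ~= y" if "x : O3" "y : Om" for x y
   proof -
    show "inner x y = 0" using pos_neg_orth[OF O3J[OF span_base[OF that(1)]] OmJ[OF span_base[OF that(2)]]] .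
    then show "inner y x = 0" by (simp add: inner_commute)
    have "inner x x = 1" using O3(2) that by (simp add: orthon_def)
    then show "x ~= y" using \<open>inner x y = 0\<close> by auto
   qed
   then show ?thesis using O3(2) Om(1) unfolding P_def orthon_def by (auto; metis)
  qed
  have sub: "span O3 \<subseteq> span P" "span Om \<subseteq> span P" by (auto simp: P_def intro!: span_mono)
  have Ein: "e : span P" if "e : E" for e
  proof -
   have "pp e : span P" using that O3(3) sub by (metis Un_iff image_eqI span_base subsetD)
   moreover have "pm e : span P" using that Om(2) sub by (metis image_eqI span_base subsetD)
   ultimately show ?thesis using pp_pm[of e] span_add by metis
  qed
  have decomp: "EX x:span O3. EX v:span Om. w = x + v" if "w : span P" for w
   using that unfolding P_def by (auto simp: span_Un)
  have JP: "J x : span P" if x: "x : span P" for x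
  proof -
   obtain x1 x2 where "x1 : span O3" "x2 : span Om" "x = x1 + x2" using decomp[OF x] by auto
   then have "J x = x1 - x2" by (simp add: J.add O3J OmJ)
   then show ?thesis using \<open>x1 : span O3\<close> \<open>x2 : span Om\<close> sub by (metis span_diff subsetD)
  qed
  show ?thesis
  proof (rule ccontr)
   assume neg: "~ ?thesis"
   have grad: "\<delta> <= norm (prj P (dI u))" if "u : span P" "b <= I u" "I u <= a + 1" for u
   proof (rule ccontr)
    assume "~ \<delta> <= norm (prj P (dI u))"
    then have "norm (prj P (dI u)) < \<delta>" by simp
    then show False using neg orthP Ein JP that by blast
   qed
   have ba: "b <= a" by (simp add: a_def)
   obtain \<eta> where eta: "continuous_on UNIV \<eta>" "!!u. \<eta> (- u) = - \<eta> u" "!!u. u : span P ==> \<eta> u : span P"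
    "!!u. u : span P ==> norm u <= r ==> b <= I u ==> a + 1/2 <= I (\<eta> u)"
    using euler_ascent[OF orthP de ba grad less_imp_le[OF r(1)]] by blast
   define D where "D = O3 - Y"
   have finD: "finite D" using O3(2) by (simp add: D_def orthon_def)
   define n where "n = card D"
   obtain z where z: "bij_betw z {..<n} D" using ex_bij_betw_nat_finite[OF finD] by (auto simp: n_def atLeast0LessThan)
   define e where "e i = (if i < n then z i else y0)" for i
   have ein: "e i : O3 - O1" for i
   proof (cases "i < n")
    case True
    then have "z i : D" using z by (auto simp: bij_betw_def)
    then show ?thesis using True by (auto simp: e_def D_def Y_def)
   next
    case False
    have "y0 ~: O1" using y0(2,3) by auto
    then show ?thesis using False O3(1) by (auto simp: e_def Y_def)
   qed
   have einj: "inj_on e {..n}"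
   proof (rule inj_onI)
    fix i j assume ij: "i : {..n}" "j : {..n}" "e i = e j"
    have zin: "z k : D" if "k < n" for k using z that by (auto simp: bij_betw_def)
    have "y0 ~: D" by (simp add: D_def Y_def)
    then show "i = j" using ij z zin[of i] zin[of j] by (auto simp: e_def bij_betw_def inj_on_def split: if_splits)
   qed
   define U where "U x = r *\<^sub>R (\<Sum>i\<le>n. x i *\<^sub>R e i)" for x :: "nat => real"
   have Uspan: "U x : span O3" for x
    unfolding U_def using ein by (intro span_scale span_sum) (auto intro: span_base)
   have Unorm: "norm (U x) = r" if "x : nsph n" for x
   proof -
    have "(norm (\<Sum>i\<le>n. x i *\<^sub>R e i))^2 = (\<Sum>i\<le>n. (x i)^2)"
     by (rule norm_sum_orthon[OF O3(2) einj]) (use ein in auto)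
    then have "(norm (\<Sum>i\<le>n. x i *\<^sub>R e i))^2 = 1^2" using that by (simp add: nsph_def)
    then have "norm (\<Sum>i\<le>n. x i *\<^sub>R e i) = 1" by (rule power2_eq_imp_eq) auto
    then show ?thesis using r by (simp add: U_def)
   qed
   have UO1: "inner (U x) k = 0" if "k : O1" for x k
   proof -
    have "inner (e i) k = 0" for i
    proof -
     have "e i : O3" "k : O3" "e i ~= k" using ein[of i] that O3(1) by (auto simp: Y_def)
     then show ?thesis using O3(2) by (simp add: orthon_def)
    qed
    then show ?thesis by (simp add: U_def inner_sum_left)
   qed
   have UI: "b <= I (U x)" if x: "x : nsph n" for x
   proof -
    have "inner (U x) k = 0" if "k : E0" for k
    proof -
     have "pp k : span O1" using O1(2) that by (simp add: span_base)
     then have "inner (U x) (pp k) = 0" using orth_span[of O1 "U x"] UO1 by blast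
     then show ?thesis using inner_pp[OF O3J[OF Uspan]] by simp
    qed
    then have "\<bar>Psi (U x)\<bar> <= (1/r) * r" using E0(2)[of "U x"] Unorm[OF x] by simp
    moreover have "inner (J (U x)) (U x) = r^2" using O3J[OF Uspan] Unorm[OF x] by (simp add: power2_norm_eq_inner[symmetric])
    ultimately show ?thesis using r by (simp add: I_def)
   qed
   have contU: "continuous_on (nsph n) U"
    unfolding U_def by (intro continuous_intros continuous_on_coord)
   have "EX x:nsph n. ALL i<n. inner (\<eta> (U x)) (e i) = 0"
   proof (rule borsuk_ulam_nsph)
    show "continuous_on (nsph n) (%x. inner (\<eta> (U x)) (e i))" for i
     by (intro continuous_intros continuous_on_compose2[OF eta(1) contU]) auto
    show "inner (\<eta> (U (%j. - x j))) (e i) = - inner (\<eta> (U x)) (e i)" for i x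
    proof -
     have "U (%j. - x j) = - U x" by (simp add: U_def sum_negf)
     then show ?thesis by (simp add: eta(2))
    qed
   qed
   then obtain x where x: "x : nsph n" "!!i. i < n ==> inner (\<eta> (U x)) (e i) = 0" by blast
   define w where "w = \<eta> (U x)"
   have UP: "U x : span P" using Uspan sub by blast
   have wP: "w : span P" unfolding w_def by (rule eta(3)[OF UP])
   have wbig: "a + 1/2 <= I w" unfolding w_def using eta(4)[OF UP _ UI[OF x(1)]] Unorm[OF x(1)] by simp
   obtain w1 w2 where w12: "w1 : span O3" "w2 : span Om" "w = w1 + w2" using decomp[OF wP] by auto
   \<comment> \<open>With its coordinates along \<open>D\<close> gone, the positive part of
     \<open>w\<close> lies in the span of \<open>Y\<close>. Hence I w <= a0 <= a, against the level
     a + 1/2 reached by the deformation.\<close>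
   have "inner w1 d = 0" if d: "d : D" for d
   proof -
    obtain i where i: "i < n" "z i = d" using z d by (auto simp: bij_betw_def)
    have "d : O3" using d by (simp add: D_def)
    then have "inner d w2 = 0" using pos_neg_orth O3J OmJ w12(2) span_base by metis
    moreover have "inner w d = 0" using x(2)[OF i(1)] i by (simp add: w_def e_def)
    ultimately show ?thesis by (simp add: w12(3) inner_add_left inner_add_right inner_commute)
   qed
   moreover have "w1 = (\<Sum>k\<in>O3. inner w1 k *\<^sub>R k)" using prj_id[OF O3(2) w12(1)] by (simp add: prj_def)
   moreover have "(\<Sum>k\<in>O3. inner w1 k *\<^sub>R k) = (\<Sum>k\<in>Y. inner w1 k *\<^sub>R k) + (\<Sum>k\<in>D. inner w1 k *\<^sub>R k)"
    unfolding D_def using sum.subset_diff[of Y O3 "%k. inner w1 k *\<^sub>R k"] O3(1,2) by (simp add: orthon_def add.commute)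
   ultimately have "w1 = (\<Sum>k\<in>Y. inner w1 k *\<^sub>R k)" by simp
   then have "w1 : span Y" by (metis prj_def prj_in_span)
   then have "I (w2 + w1) <= a0" using a0 OmJ[OF w12(2)] by blast
   then show False using wbig by (simp add: w12(3) add.commute a_def)
  qed
 qed
 then show ?thesis by (intro exI[of _ a]) (auto simp: a_def)
qed

text \<open>Galerkin spaces that contain the finite set of \<open>G_compact\<close> yield bounded
  almost critical points of I itself. Compactness gives a limit of G(u_n), hence of J u_n, since
  their difference tends to 0, and hence of u_n, since J is an involution.\<close>

theorem critical_point_above:
 "EX u. J u = G u & b <= I u"
proof -
 obtain a where a: "!!\<delta> E. \<delta> > 0 ==> finite E ==> EX P u. orthon P & (ALL e:E. e : span P) & (ALL x:span P. J x : span P)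
   & u : span P & b <= I u & I u <= a + 1 & norm (prj P (dI u)) < \<delta>"
  using almost_critical_galerkin[of b] by blast
 obtain R0 where R0: "!!u. I u <= a + 1 ==> \<bar>inner (dI u) u\<bar> <= norm u ==> \<bar>inner (dI u) (J u)\<bar> <= norm u ==> norm u <= R0"
  using apriori[of "a+1"] by blast
 \<comment> \<open>The extra 1 keeps the segments from the limit to nearby iterates inside the ball
   on which \<open>G\<close> is bounded.\<close>
 define R where "R = max R0 0 + 1"
 have approx: "EX u. norm u <= R - 1 & b <= I u & norm (dI u) <= 2 * e" if e: "0 < e" "e <= 1" for e
 proof -
  obtain E where E: "finite E" "!!u v. norm u <= R ==> (ALL x:E. inner v x = 0) ==> \<bar>inner (G u) v\<bar> <= e * norm v"
   using G_compact[OF e(1), of R] by blast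
  obtain P u where P: "orthon P" "!!x. x : E ==> x : span P" "!!x. x : span P ==> J x : span P" "u : span P"
    "b <= I u" "I u <= a + 1" "norm (prj P (dI u)) < e"
   using a[OF e(1) E(1)] by blast
  have t: "\<bar>inner (dI u) x\<bar> <= norm x" if "x : span P" for x
  proof -
   have "inner (dI u) x = inner (prj P (dI u)) x"
    using inner_sub_prj[OF P(1) that, of "dI u"] by (simp add: inner_diff_left)
   then have "\<bar>inner (dI u) x\<bar> <= norm (prj P (dI u)) * norm x" by (simp add: Cauchy_Schwarz_ineq2)
   also have "... <= 1 * norm x" using P(7) e by (intro mult_right_mono) auto
   finally show ?thesis by simp
  qed
  have "norm u <= R0" using R0[OF P(6) t[OF P(4)]] t[OF P(3)[OF P(4)]] by simp
  then have uR: "norm u <= R - 1" by (simp add: R_def)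
  \<comment> \<open>The part of \<open>G u\<close> that the Galerkin space misses is orthogonal to
    \<open>E\<close>; testing it with itself shows that its norm is at most
    \<open>e\<close>.\<close>
  define v where "v = G u - prj P (G u)"
  have "inner v x = 0" if "x : E" for x unfolding v_def by (rule inner_sub_prj[OF P(1) P(2)[OF that]])
  then have "\<bar>inner (G u) v\<bar> <= e * norm v" using E(2) uR by simp
  moreover have "inner (G u) v = (norm v)^2"
  proof -
   have "inner v (prj P (G u)) = 0" unfolding v_def by (rule inner_sub_prj[OF P(1) prj_in_span])
   then show ?thesis by (simp add: v_def power2_norm_eq_inner inner_diff_left inner_diff_right inner_commute)
  qed
  ultimately have "norm v * norm v <= e * norm v" by (simp add: power2_eq_square)
  then have nv: "norm v <= e" using e by (cases "norm v = 0") (auto simp: mult_le_cancel_right)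
  have "prj P (dI u) = J u - prj P (G u)"
   using prj_id[OF P(1) P(3)[OF P(4)]] by (simp add: dI_def linear_diff[OF bounded_linear.linear[OF bounded_linear_prj]])
  then have "dI u = prj P (dI u) - v" by (simp add: v_def dI_def)
  then have "norm (dI u) <= norm (prj P (dI u)) + norm v" by (metis norm_triangle_ineq4)
  then show ?thesis using nv P(7) uR P(5) by (intro exI[of _ u]) auto
 qed
 have "EX u. norm u <= R - 1 & b <= I u & norm (dI u) <= 2 * (1 / (real n + 1))" for n
  by (rule approx) auto
 then obtain u where u: "!!n. norm (u n) <= R - 1" "!!n. b <= I (u n)" "!!n. norm (dI (u n)) <= 2 * (1 / (real n + 1))"
  by metis
 obtain B where B: "!!x. norm x <= R ==> norm (G x) <= B" using G_bdd[of R] by blast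
 have "EX s l. strict_mono s & ((%n. G (u n)) \<circ> s) \<longlonglongrightarrow> l"
 proof (rule convergent_subseq_totally_bounded)
  fix e :: real assume e: "e > 0"
  obtain E where E: "finite E" "!!u v. norm u <= R ==> (ALL x:E. inner v x = 0) ==> \<bar>inner (G u) v\<bar> <= e * norm v"
   using G_compact[OF e(1), of R] by blast
  obtain P where P: "orthon P" "span P = span E" using gram_schmidt_empty[OF E(1)] by blast
  obtain K where K: "compact K" "!!x. x : span P ==> norm x <= B ==> x : K" using span_ball_in_compact[OF P(1), of B] by blast
  have "EX y:K. dist (G (u n)) y <= e" for n
  proof (rule bexI)
   have un: "norm (u n) <= R" using u(1)[of n] by simp
   define v where "v = G (u n) - prj P (G (u n))"
   have "inner v x = 0" if "x : E" for x
    unfolding v_def by (rule inner_sub_prj[OF P(1)]) (use that P(2) span_base in auto)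
   then have "\<bar>inner (G (u n)) v\<bar> <= e * norm v" using E(2)[OF un] by simp
   moreover have "inner (G (u n)) v = (norm v)^2"
   proof -
    have "inner v (prj P (G (u n))) = 0" unfolding v_def by (rule inner_sub_prj[OF P(1) prj_in_span])
    then show ?thesis by (simp add: v_def power2_norm_eq_inner inner_diff_left inner_diff_right inner_commute)
   qed
   ultimately have "norm v * norm v <= e * norm v" by (simp add: power2_eq_square)
   then have "norm v <= e" using e by (cases "norm v = 0") (auto simp: mult_le_cancel_right)
   then show "dist (G (u n)) (prj P (G (u n))) <= e" by (simp add: v_def dist_norm)
   show "prj P (G (u n)) : K"
    using K(2)[OF prj_in_span] norm_prj_le[OF P(1)] B[OF un] order_trans by blast
  qed
  then show "EX K. compact K & (ALL n. EX y:K. dist (G (u n)) y <= e)" using K(1) by blast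
 qed
 then obtain s l where s: "strict_mono s" "(%n. G (u (s n))) \<longlonglongrightarrow> l" by (auto simp: o_def)
 have dI0: "(%n. dI (u (s n))) \<longlonglongrightarrow> 0"
 proof -
  have "(%n. 2 * (1 / (real n + 1))) \<longlonglongrightarrow> 2 * 0"
   by (intro tendsto_mult tendsto_const) (use LIMSEQ_inverse_real_of_nat in "simp add: inverse_eq_divide add.commute")
  then have lim: "(%n. 2 * (1 / (real n + 1))) \<longlonglongrightarrow> 0" by simp
  have "\<forall>\<^sub>F n in sequentially. norm (dI (u n)) <= 2 * (1 / (real n + 1))"
   by (rule always_eventually) (use u(3) in blast)
  then have "(%n. dI (u n)) \<longlonglongrightarrow> 0" by (rule Lim_null_comparison[OF _ lim])
  from LIMSEQ_subseq_LIMSEQ[OF this s(1)] show ?thesis by (simp add: o_def)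
 qed
 have "(%n. dI (u (s n)) + G (u (s n))) \<longlonglongrightarrow> 0 + l" by (intro tendsto_add dI0 s(2))
 then have "(%n. J (u (s n))) \<longlonglongrightarrow> l" by (simp add: dI_def)
 from J.tendsto[OF this] have ul: "(%n. u (s n)) \<longlonglongrightarrow> J l" by (simp add: JJ)
 define x where "x = J l"
 have ux: "(%n. u (s n)) \<longlonglongrightarrow> x" using ul by (simp add: x_def)
 have "(%n. dI (u (s n))) \<longlonglongrightarrow> dI x"
  using continuous_on_tendsto_compose[OF continuous_dI ux] by simp
 then have dx: "dI x = 0" using dI0 LIMSEQ_unique by blast
 have "b <= I x"
 proof (rule field_le_epsilon)
  fix e :: real assume e: "0 < e"
  have nx: "norm x <= R - 1"
   by (rule LIMSEQ_le_const2[OF tendsto_norm[OF ux]]) (use u(1) in auto)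
  \<comment> \<open>A bound for the gradient on the ball of radius \<open>R\<close>, hence a
    Lipschitz constant of I there, which carries the level \<open>b\<close> over to the
    limit.\<close>
  define C where "C = R + B + 1"
  have "B >= 0" using B[of 0] R_def norm_ge_zero[of "G 0"] by (smt (verit) norm_zero)
  then have C: "C > 0" by (simp add: C_def R_def)
  obtain n where n: "norm (u (s n) - x) < min 1 (e / C)"
   using LIMSEQ_D[OF ux, of "min 1 (e/C)"] e C by auto
  obtain \<theta> where th: "0 < \<theta>" "\<theta> < 1" "I (x + (u (s n) - x)) - I x = inner (dI (x + \<theta> *\<^sub>R (u (s n) - x))) (u (s n) - x)"
   using I_mvt[of x "u (s n) - x"] by blast
  define y where "y = x + \<theta> *\<^sub>R (u (s n) - x)"
  have "norm (\<theta> *\<^sub>R (u (s n) - x)) <= 1 * norm (u (s n) - x)" unfolding norm_scaleR using th by (intro mult_right_mono) auto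
  then have ny: "norm y <= R" unfolding y_def using n nx norm_triangle_ineq[of x "\<theta> *\<^sub>R (u (s n) - x)"] by linarith
  have "norm (dI y) <= norm (J y) + norm (G y)" unfolding dI_def by (rule norm_triangle_ineq4)
  then have "norm (dI y) <= C" using ny B[OF ny] by (simp add: C_def)
  have "I (u (s n)) - I x <= norm (dI y) * norm (u (s n) - x)"
   using th(3) norm_cauchy_schwarz[of "dI y" "u (s n) - x"] by (simp add: y_def)
  also have "... <= C * (e / C)" using \<open>norm (dI y) <= C\<close> n C by (intro mult_mono) auto
  also have "... = e" using C by simp
  finally show "b <= I x + e" using u(2)[of "s n"] by linarith
 qed
 then show ?thesis using dx by (intro exI[of _ x]) (simp add: dI_def)
qed

end

section \<open>The Hilbert space of square integrable functions\<close>

definition l2fun :: "(r3 => real) => bool" where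
 "l2fun f \<longleftrightarrow> f : borel_measurable borel & integrable lborel (%x. (f x)^2)"

lemma l2fun_meas: "l2fun f ==> f : borel_measurable borel" by (simp add: l2fun_def)

lemma l2fun_mult_integrable:
 assumes "l2fun f" "l2fun g" shows "integrable lborel (%x. f x * g x)"
proof (rule bint_bound)
 show "integrable lborel (%x. (f x)^2 + (g x)^2)" using assms by (auto simp: l2fun_def)
 show "(%x. f x * g x) : borel_measurable lborel" using assms by (auto simp: l2fun_def)
 have "\<bar>a * b\<bar> <= a^2 + b^2" for a b :: real
  using sum_squares_bound[of "\<bar>a\<bar>" "\<bar>b\<bar>"] zero_le_power2[of a] zero_le_power2[of b] unfolding abs_mult power2_abs by linarith
 then show "AE x in lborel. norm (f x * g x) <= norm ((f x)^2 + (g x)^2)" by (intro AE_I2) simp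
qed

lemma l2fun_add: assumes "l2fun f" "l2fun g" shows "l2fun (%x. f x + g x)"
proof -
 have "integrable lborel (%x. (f x)^2 + (g x)^2 + 2 * (f x * g x))"
  using assms l2fun_mult_integrable[OF assms] by (auto simp: l2fun_def)
 moreover have "(%x. f x + g x) : borel_measurable borel"
  by (intro borel_measurable_add l2fun_meas assms)
 ultimately show ?thesis by (simp add: l2fun_def power2_sum mult.assoc)
qed

lemma l2fun_scale: assumes "l2fun f" shows "l2fun (%x. c * f x)"
 using assms by (auto simp: l2fun_def power_mult_distrib)

lemma l2fun_zero: "l2fun (%x. 0)" by (simp add: l2fun_def)

lemma l2fun_bound:
 assumes "g : borel_measurable borel" "l2fun f" "AE x in lborel. \<bar>g x\<bar> <= \<bar>f x\<bar>" shows "l2fun g"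
 unfolding l2fun_def
proof
 show "integrable lborel (%x. (g x)^2)"
 proof (rule bint_bound)
  show "integrable lborel (%x. (f x)^2)" using assms by (simp add: l2fun_def)
  show "AE x in lborel. norm ((g x)^2) <= norm ((f x)^2)"
   using assms(3) by eventually_elim (simp add: abs_le_square_iff)
 qed (use assms in auto)
qed fact

\<comment> \<open>A type of its own, so that the classes \<open>real_inner\<close> and
  \<open>banach\<close> can be instantiated and the abstract theorems apply to it. The relation is
  partial because only square integrable functions have a class.\<close>
quotient_type l2 = "r3 => real" / partial: "%f g. l2fun f & l2fun g & (AE x in lborel. f x = g x)"
proof (rule part_equivpI)
 show "EX x. l2fun x & l2fun x & (AE xa in lborel. x xa = x xa)" using l2fun_zero by auto
 show "symp (%f g. l2fun f & l2fun g & (AE x in lborel. f x = g x))" by (auto intro!: sympI elim: eventually_mono)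
 show "transp (%f g. l2fun f & l2fun g & (AE x in lborel. f x = g x))"
 proof (rule transpI, intro conjI)
  fix f g h :: "r3 => real"
  assume a: "l2fun f & l2fun g & (AE x in lborel. f x = g x)" "l2fun g & l2fun h & (AE x in lborel. g x = h x)"
  then have "AE x in lborel. f x = g x" "AE x in lborel. g x = h x" by auto
  then show "AE x in lborel. f x = h x" by eventually_elim simp
 qed auto
qed

definition fn :: "l2 => r3 => real" where "fn = rep_l2"
definition cl :: "(r3 => real) => l2" where "cl = abs_l2"

lemma l2fun_fn: "l2fun (fn a)"
 using Quotient3_rep_reflp[OF Quotient3_l2, of a] by (simp add: fn_def)

lemma fn_meas [measurable]: "fn a : borel_measurable borel" using l2fun_fn by (rule l2fun_meas)

lemma cl_fn [simp]: "cl (fn a) = a"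
 using Quotient3_abs_rep[OF Quotient3_l2] by (simp add: fn_def cl_def)

lemma cl_eq: "l2fun f ==> l2fun g ==> AE x in lborel. f x = g x ==> cl f = cl g"
 unfolding cl_def by (rule Quotient3_rel_abs[OF Quotient3_l2]) auto

lemma fn_cl: "l2fun f ==> AE x in lborel. fn (cl f) x = f x"
 using Quotient3_rep_abs[OF Quotient3_l2, of f] by (auto simp: fn_def cl_def)

lemma l2_eqI: "AE x in lborel. fn a x = fn b x ==> a = b"
 using cl_eq[OF l2fun_fn l2fun_fn, of a b] by simp

lemma cl_eqI: "l2fun f ==> AE x in lborel. f x = fn b x ==> cl f = b"
 using cl_eq[OF _ l2fun_fn, of f b] by simp

instantiation l2 :: real_inner
begin
definition "zero_l2 = cl (%x. 0)"
definition "plus_l2 a b = cl (%x. fn a x + fn b x)"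
definition "scaleR_l2 c a = cl (%x. c * fn a x)"
definition "uminus_l2 a = (-1) *\<^sub>R (a::l2)"
definition "minus_l2 a b = a + (-1) *\<^sub>R (b::l2)"
definition "inner_l2 a b = (LB x. fn a x * fn b x)"
definition "norm_l2 a = sqrt (inner a (a::l2))"
definition "sgn_l2 a = inverse (norm a) *\<^sub>R (a::l2)"
definition "dist_l2 a b = norm (a - b :: l2)"
definition "uniformity_l2 = (INF e\<in>{0 <..}. principal {(x, y). dist x (y::l2) < e})"
definition "open_l2 U \<longleftrightarrow> (ALL x:U. eventually (%(x', y). x' = x --> y : U) (uniformity :: (l2 \<times> l2) filter))"

lemma fn_zero: "AE x in lborel. fn 0 x = 0" unfolding zero_l2_def by (rule fn_cl[OF l2fun_zero])
lemma fn_plus: "AE x in lborel. fn (a + b) x = fn a x + fn b x"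
 unfolding plus_l2_def by (rule fn_cl[OF l2fun_add[OF l2fun_fn l2fun_fn]])
lemma fn_scaleR: "AE x in lborel. fn (c *\<^sub>R a) x = c * fn a x"
 unfolding scaleR_l2_def by (rule fn_cl[OF l2fun_scale[OF l2fun_fn]])

instance
proof
 fix a b c :: l2 and r s :: real
 have P: "AE x in lborel. fn (a + b) x = fn a x + fn b x" for a b by (rule fn_plus)
 have S: "AE x in lborel. fn (c *\<^sub>R a) x = c * fn a x" for c a by (rule fn_scaleR)
 show "a + b + c = a + (b + c)"
  by (rule l2_eqI) (use P[of "a + b" c] P[of a b] P[of a "b + c"] P[of b c] in "eventually_elim, simp")
 show "a + b = b + a" by (rule l2_eqI) (use P[of a b] P[of b a] in "eventually_elim, simp")
 show "0 + a = a" by (rule l2_eqI) (use P[of 0 a] fn_zero in "eventually_elim, simp")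
 show "- a + a = 0"
  by (rule l2_eqI) (use P[of "-a" a] fn_zero S[of "-1" a] in "eventually_elim, simp add: uminus_l2_def")
 show "a - b = a + - b" by (simp add: minus_l2_def uminus_l2_def)
 show "r *\<^sub>R (a + b) = r *\<^sub>R a + r *\<^sub>R b"
  by (rule l2_eqI) (use S[of r "a + b"] P[of a b] S[of r a] S[of r b] P[of "r *\<^sub>R a" "r *\<^sub>R b"] in "eventually_elim, simp add: algebra_simps")
 show "(r + s) *\<^sub>R a = r *\<^sub>R a + s *\<^sub>R a"
  by (rule l2_eqI) (use S[of "r + s" a] S[of r a] S[of s a] P[of "r *\<^sub>R a" "s *\<^sub>R a"] in "eventually_elim, simp add: algebra_simps")
 show "r *\<^sub>R s *\<^sub>R a = (r * s) *\<^sub>R a"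
  by (rule l2_eqI) (use S[of r "s *\<^sub>R a"] S[of s a] S[of "r * s" a] in "eventually_elim, simp")
 show "1 *\<^sub>R a = a" by (rule l2_eqI) (use S[of 1 a] in "eventually_elim, simp")
 show "dist a b = norm (a - b)" by (simp add: dist_l2_def)
 show "sgn a = inverse (norm a) *\<^sub>R a" by (simp add: sgn_l2_def)
 show "uniformity = (INF e\<in>{0<..}. principal {(x, y). dist x (y::l2) < e})" by (simp add: uniformity_l2_def)
 fix U :: "l2 set"
 show "open U = (ALL x:U. \<forall>\<^sub>F (x', y) in uniformity. x' = x --> y : U)" by (simp add: open_l2_def)
 show "inner a b = inner b a" by (simp add: inner_l2_def mult.commute)
 have i: "integrable lborel (%x. fn a x * fn b x)" for a b by (rule l2fun_mult_integrable[OF l2fun_fn l2fun_fn])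
 show "inner (a + b) c = inner a c + inner b c"
 proof -
  have "inner (a + b) c = (LB x. fn a x * fn c x + fn b x * fn c x)"
   unfolding inner_l2_def
   by (rule integral_cong_AE) (use P[of a b] in "auto simp: distrib_right")
  also have "... = inner a c + inner b c" unfolding inner_l2_def by (rule bintegral_add[OF i i])
  finally show ?thesis .
 qed
 show "inner (r *\<^sub>R a) b = r * inner a b"
 proof -
  have "inner (r *\<^sub>R a) b = (LB x. r * (fn a x * fn b x))"
   unfolding inner_l2_def by (rule integral_cong_AE) (use S[of r a] in auto)
  then show ?thesis by (simp add: inner_l2_def)
 qed
 show "0 <= inner a a" by (simp add: inner_l2_def)
 show "(inner a a = 0) = (a = 0)"
 proof
  assume "inner a a = 0"
  then have "(LB x. fn a x * fn a x) = 0" by (simp add: inner_l2_def)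
  then have "AE x in lborel. fn a x * fn a x = 0"
   by (subst (asm) integral_nonneg_eq_0_iff_AE[OF i]) auto
  then have "AE x in lborel. fn a x = fn 0 x" using fn_zero by eventually_elim simp
  then show "a = 0" by (rule l2_eqI)
 next
  assume a0: "a = 0"
  have "AE x in lborel. fn a x * fn a x = 0" using fn_zero by eventually_elim (simp add: a0)
  then show "inner a a = 0" unfolding inner_l2_def by (subst integral_nonneg_eq_0_iff_AE[OF i]) auto
 qed
 show "norm a = sqrt (inner a a)" by (simp add: norm_l2_def)
qed
end

lemma fn_minus: "AE x in lborel. fn (a - b) x = fn a x - fn b x"
proof -
 have "a - b = a + (-1) *\<^sub>R b" by (rule minus_l2_def)
 then have "AE x in lborel. fn (a - b) x = fn a x + fn ((-1) *\<^sub>R b) x" using fn_plus[of a "(-1) *\<^sub>R b"] by (simp only:)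
 then show ?thesis using fn_scaleR[of "-1" b] by eventually_elim (simp only: mult_minus1 add_uminus_conv_diff)
qed

lemma inner_l2: "inner a b = (LB x. fn a x * fn b x)" by (simp add: inner_l2_def)
lemma norm_l2_sq: "(norm a)^2 = (LB x. (fn a x)^2)"
 unfolding power2_norm_eq_inner inner_l2_def by (simp add: power2_eq_square)

lemma inner_cl: assumes "l2fun f" "l2fun g" shows "inner (cl f) (cl g) = (LB x. f x * g x)"
proof -
 have [measurable]: "f : borel_measurable borel" "g : borel_measurable borel" using assms by (auto dest: l2fun_meas)
 show ?thesis unfolding inner_l2
 proof (rule integral_cong_AE)
  show "AE x in lborel. fn (cl f) x * fn (cl g) x = f x * g x"
   using fn_cl[OF assms(1)] fn_cl[OF assms(2)] by eventually_elim simp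
 qed measurable
qed

lemma inner_cl_left: assumes "l2fun f" shows "inner (cl f) b = (LB x. f x * fn b x)"
 using inner_cl[OF assms l2fun_fn[of b]] by simp

lemma norm_cl: assumes "l2fun f" shows "(norm (cl f))^2 = (LB x. (f x)^2)"
 unfolding power2_norm_eq_inner inner_cl[OF assms assms] by (simp add: power2_eq_square)

lemma nn_integral_norm_l2: "(NB x. ennreal ((fn a x)^2)) = ennreal ((norm a)^2)"
 unfolding norm_l2_sq using l2fun_fn[of a] by (intro nn_integral_eq_integral) (auto simp: l2fun_def)

lemma nn_integral_norm_diff:
 "(NB x. ennreal ((fn a x - fn b x)^2)) = ennreal ((norm (a - b))^2)"
 unfolding nn_integral_norm_l2[symmetric]
 by (rule nn_integral_cong_AE) (use fn_minus[of a b] in "eventually_elim, simp")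

lemma l2fun_nn: "l2fun f \<longleftrightarrow> f : borel_measurable borel & (NB x. ennreal ((f x)^2)) < \<infinity>"
 by (auto simp: l2fun_def integrable_iff_bounded)

text \<open>A weighted sum of squared increments has finite integral, hence is finite almost
  everywhere, and there the increments decay geometrically.\<close>

lemma l2_ae_summable:
 fixes Y :: "nat => l2"
 assumes "!!k. norm (Y (Suc k) - Y k) <= (1/4)^k"
 shows "AE x in lborel. convergent (%k. fn (Y k) x)"
proof -
 \<comment> \<open>The weight 2^k still leaves integrals of size 8^-k, while mere boundedness of the
   weighted terms at a point forces increments of order 2^(-k/2).\<close>
 define d where "d k x = (2::real)^k * (fn (Y (Suc k)) x - fn (Y k) x)^2" for k x
 have dm [measurable]: "d k : borel_measurable borel" for k unfolding d_def by measurable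
 have "(NB x. ennreal (d k x)) <= ennreal ((1/8)^k)" for k
 proof -
  have "(NB x. ennreal (d k x)) = ennreal (2^k) * (NB x. ennreal ((fn (Y (Suc k)) x - fn (Y k) x)^2))"
   unfolding d_def by (subst nn_integral_cmult[symmetric]) (auto simp: ennreal_mult)
  also have "... = ennreal (2^k * (norm (Y (Suc k) - Y k))^2)" by (simp add: nn_integral_norm_diff ennreal_mult)
  also have "2^k * (norm (Y (Suc k) - Y k))^2 <= 2^k * ((1/4)^k)^2"
   using assms by (intro mult_left_mono power_mono) auto
  also have "2^k * ((1/4::real)^k)^2 = (1/8)^k"
   by (simp add: power2_eq_square flip: power_mult_distrib)
  finally show ?thesis by (simp add: ennreal_leI)
 qed
 then have "suminf (%k. (NB x. ennreal (d k x))) <= suminf (%k. ennreal ((1/8)^k))"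
  by (intro suminf_le) auto
 also have "... = ennreal (suminf (%k. (1/8)^k))" by (intro suminf_ennreal2) (auto intro: summable_geometric)
 also have "... < \<infinity>" by simp
 finally have "(NB x. (suminf (%k. ennreal (d k x)))) < \<infinity>"
  by (subst nn_integral_suminf) auto
 then have "AE x in lborel. (suminf (%k. ennreal (d k x))) ~= \<infinity>"
  by (intro nn_integral_PInf_AE) auto
 then show ?thesis
 proof eventually_elim
  fix x assume fin: "(suminf (%k. ennreal (d k x))) ~= \<infinity>"
  have "summable (%k. d k x)" using fin by (intro summable_suminf_not_top) (auto simp: d_def)
  then have "(%k. d k x) \<longlonglongrightarrow> 0" by (rule summable_LIMSEQ_zero)
  then have "Bseq (%k. d k x)" by (intro convergent_imp_Bseq) (auto simp: convergent_def)
  then obtain B where B: "B > 0" "!!k. \<bar>d k x\<bar> <= B" by (auto simp: Bseq_def)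
  have bnd: "norm (fn (Y (Suc k)) x - fn (Y k) x) <= sqrt B * (1 / sqrt 2)^k" for k
  proof -
   have "(fn (Y (Suc k)) x - fn (Y k) x)^2 <= B / 2^k"
    using B(2)[of k] by (simp add: d_def field_simps)
   then have "\<bar>fn (Y (Suc k)) x - fn (Y k) x\<bar> <= sqrt (B / 2^k)" by (rule real_le_rsqrt[of "\<bar>_\<bar>", simplified])
   also have "... = sqrt B * (1 / sqrt 2)^k" by (simp add: real_sqrt_divide real_sqrt_power power_divide)
   finally show ?thesis by simp
  qed
  have "summable (%k. fn (Y (Suc k)) x - fn (Y k) x)"
   by (rule summable_comparison_test'[OF _ bnd]) (auto intro!: summable_mult summable_geometric)
  then have "convergent (%n. \<Sum>k<n. fn (Y (Suc k)) x - fn (Y k) x)" by (simp add: summable_iff_convergent)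
  then have "convergent (%n. fn (Y n) x - fn (Y 0) x)" by (simp only: sum_lessThan_telescope[of "%k. fn (Y k) x"])
  then have "convergent (%n. (fn (Y n) x - fn (Y 0) x) + fn (Y 0) x)" by (intro convergent_add convergent_const)
  then show "convergent (%k. fn (Y k) x)" by simp
 qed
qed

lemma l2_fatou:
 fixes Y :: "nat => l2"
 assumes F: "F : borel_measurable borel" "AE x in lborel. (%j. fn (Y j) x) \<longlonglongrightarrow> F x"
  and b: "!!j. j >= N ==> norm (Y j - a) <= e"
 shows "(NB x. ennreal ((F x - fn a x)^2)) <= ennreal (e^2)"
proof -
 have e0: "0 <= e" using b[of N] norm_ge_zero order_trans by blast
 have "(NB x. ennreal ((F x - fn a x)^2)) = (NB x. liminf (%j. ennreal ((fn (Y j) x - fn a x)^2)))"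
 proof (rule nn_integral_cong_AE)
  show "AE x in lborel. ennreal ((F x - fn a x)^2) = liminf (%j. ennreal ((fn (Y j) x - fn a x)^2))"
   using F(2)
  proof eventually_elim
   fix x assume "(%j. fn (Y j) x) \<longlonglongrightarrow> F x"
   then have "(%j. ennreal ((fn (Y j) x - fn a x)^2)) \<longlonglongrightarrow> ennreal ((F x - fn a x)^2)"
    by (intro tendsto_intros)
   then show "ennreal ((F x - fn a x)^2) = liminf (%j. ennreal ((fn (Y j) x - fn a x)^2))"
    by (rule lim_imp_Liminf[symmetric, OF trivial_limit_sequentially])
  qed
 qed
 also have "... <= liminf (%j. (NB x. ennreal ((fn (Y j) x - fn a x)^2)))"
  by (rule nn_integral_liminf) measurable
 also have "... <= ennreal (e^2)"
 proof (rule Liminf_le)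
  show "\<forall>\<^sub>F j in sequentially. (NB x. ennreal ((fn (Y j) x - fn a x)^2)) <= ennreal (e^2)"
   using eventually_ge_at_top[of N]
   by eventually_elim (auto simp: nn_integral_norm_diff intro!: ennreal_leI power_mono b)
 qed simp
 finally show ?thesis .
qed

text \<open>Riesz-Fischer: a fast subsequence converges almost everywhere, and Fatou turns the
  pointwise limit into a limit in norm.\<close>

instance l2 :: banach
proof
 fix X :: "nat => l2" assume "Cauchy X"
 then have "ALL k. EX N. ALL m>=N. ALL n>=N. norm (X m - X n) < (1/4)^k"
  by (auto simp: Cauchy_iff)
 then obtain N where N: "!!k m n. m >= N k ==> n >= N k ==> norm (X m - X n) < (1/4)^k" by metis
 \<comment> \<open>Partial sums make the indices monotone while each stays at least
   \<open>N k\<close>.\<close>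
 define M where "M k = (\<Sum>j\<le>k. N j)" for k
 have MN: "N k <= M k" for k unfolding M_def by (rule member_le_sum) auto
 have Mm: "M k <= M j" if "k <= j" for k j unfolding M_def using that by (intro sum_mono2) auto
 define Y where "Y k = X (M k)" for k
 have Yj: "norm (Y j - Y k) <= (1/4)^k" if "k <= j" for j k
  unfolding Y_def using N[of k "M j" "M k"] MN[of k] Mm[OF that] by (meson less_imp_le order_trans)
 have "AE x in lborel. convergent (%k. fn (Y k) x)"
  by (rule l2_ae_summable) (rule Yj, simp)
 then have conv: "AE x in lborel. (%k. fn (Y k) x) \<longlonglongrightarrow> lim (%k. fn (Y k) x)"
  by eventually_elim (simp add: convergent_LIMSEQ_iff)
 define F where "F x = lim (%k. fn (Y k) x)" for x
 have Fm: "F : borel_measurable borel" unfolding F_def by measurable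
 have fat: "(NB x. ennreal ((F x - fn (Y k) x)^2)) <= ennreal (((1/4)^k)^2)" for k
  by (rule l2_fatou[OF Fm conv[folded F_def]]) (rule Yj)
 have "l2fun (%x. F x - fn (Y 0) x)"
  unfolding l2fun_nn using fat[of 0] Fm by (auto intro: le_less_trans)
 from l2fun_add[OF this l2fun_fn[of "Y 0"]] have F: "l2fun F" by simp
 have dF: "norm (cl F - Y k) <= (1/4)^k" for k
 proof -
  have "ennreal ((norm (cl F - Y k))^2) = (NB x. ennreal ((fn (cl F) x - fn (Y k) x)^2))"
   by (simp add: nn_integral_norm_diff)
  also have "... = (NB x. ennreal ((F x - fn (Y k) x)^2))"
   by (rule nn_integral_cong_AE) (use fn_cl[OF F] in "eventually_elim, simp")
  also have "... <= ennreal (((1/4)^k)^2)" by (rule fat)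
  finally have "(norm (cl F - Y k))^2 <= ((1/4)^k)^2" by (subst (asm) ennreal_le_iff) auto
  then show ?thesis by (rule power2_le_imp_le) simp
 qed
 have "X \<longlonglongrightarrow> cl F"
 proof (rule metric_LIMSEQ_I)
  fix e :: real assume e: "0 < e"
  obtain k where k: "(1/4::real)^k < e / 2" using real_arch_pow_inv[of "e/2" "1/4"] e by auto
  have "dist (X n) (cl F) < e" if n: "n >= M k" for n
  proof -
   have "norm (X n - Y k) < (1/4)^k" unfolding Y_def using N[of k n "M k"] MN[of k] n by auto
   moreover have "norm (X n - cl F) <= norm (X n - Y k) + norm (cl F - Y k)"
    using norm_triangle_ineq4[of "X n - Y k" "cl F - Y k"] by simp
   ultimately show ?thesis using dF[of k] k by (simp add: dist_norm)
  qed
  then show "EX no. ALL n>=no. dist (X n) (cl F) < e" by blast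
 qed
 then show "convergent X" by (auto simp: convergent_def)
qed

section \<open>The Hartley transform\<close>

text \<open>The Hartley kernel cos + sin, a real substitute for the exponential. With the factor
  \<open>c0\<close> its transform will extend to a self-adjoint involution of L^2.\<close>

definition cas :: "real => real" where "cas \<theta> = cos \<theta> + sin \<theta>"
definition c0 :: real where "c0 = (2 * pi) powr (-3/2)"

lemma c0_pos: "c0 > 0" by (simp add: c0_def)

lemma abs_cas_le: "\<bar>cas \<theta>\<bar> <= 2"
 unfolding cas_def using abs_triangle_ineq[of "cos \<theta>" "sin \<theta>"] abs_cos_le_one[of \<theta>] abs_sin_le_one[of \<theta>] by linarith

lemma cas_mult: "cas a * cas b = cos (a - b) + sin (a + b)"
 by (simp add: cas_def cos_diff sin_add algebra_simps)

lemma cas_meas [measurable]: "cas : borel_measurable borel"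
 unfolding cas_def[abs_def] by measurable

definition h0 :: "(r3 => real) => r3 => real" where
 "h0 f Z = c0 * (LB x. f x * cas (Z \<bullet> x))"

lemma integrable_cas:
 assumes "integrable lborel f" shows "integrable lborel (%x::r3. f x * cas (Z \<bullet> x))"
proof (rule bint_bound)
 have [measurable]: "f : borel_measurable borel" using assms by auto
 show "integrable lborel (%x. 2 * f x)" using assms by simp
 show "(%x. f x * cas (Z \<bullet> x)) : borel_measurable lborel" by measurable
 show "AE x in lborel. norm (f x * cas (Z \<bullet> x)) <= norm (2 * f x)"
 proof (rule AE_I2)
  fix x
  have "\<bar>f x\<bar> * \<bar>cas (Z \<bullet> x)\<bar> <= \<bar>f x\<bar> * 2" by (intro mult_left_mono abs_cas_le) simp
  then show "norm (f x * cas (Z \<bullet> x)) <= norm (2 * f x)" by (simp add: abs_mult mult.commute)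
 qed
qed

lemma h0_meas [measurable]:
 assumes [measurable]: "f : borel_measurable borel" shows "h0 f : borel_measurable borel"
 unfolding h0_def[abs_def] by measurable

lemma h0_bound: assumes "integrable lborel f" shows "\<bar>h0 f Z\<bar> <= 2 * c0 * (LB x. \<bar>f x\<bar>)"
proof -
 have "\<bar>(LB x. f x * cas (Z \<bullet> x))\<bar> <= (LB x. \<bar>f x * cas (Z \<bullet> x)\<bar>)" by (rule integral_abs_bound)
 also have "... <= (LB x. \<bar>f x\<bar> * 2)"
  by (intro integral_mono integrable_abs integrable_cas assms integrable_mult_left)
    (auto simp: abs_mult intro!: mult_left_mono abs_cas_le)
 finally show ?thesis using c0_pos by (simp add: h0_def abs_mult mult.commute mult_left_mono)
qed

lemma h0_add: "integrable lborel f ==> integrable lborel g ==> h0 (%x. f x + g x) Z = h0 f Z + h0 g Z"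
 by (simp add: h0_def distrib_right distrib_left integrable_cas)

lemma h0_diff: "integrable lborel f ==> integrable lborel g ==> h0 (%x. f x - g x) Z = h0 f Z - h0 g Z"
 by (simp add: h0_def left_diff_distrib right_diff_distrib integrable_cas)

lemma h0_scale: "h0 (%x. c * f x) Z = c * h0 f Z"
 by (simp add: h0_def mult.assoc)

lemma h0_adjoint:
 assumes f: "integrable lborel f" and g: "integrable lborel g"
 shows "(LB Z. g Z * h0 f Z) = (LB x. f x * h0 g x)"
proof -
 have [measurable]: "f : borel_measurable borel" "g : borel_measurable borel" using f g by auto
 have int: "integrable (lborel \<Otimes>\<^sub>M lborel) (%(Z, x). g Z * (f x * cas (Z \<bullet> x)))"
 proof (rule lborel_pair.Fubini_integrable)
  show "(%(Z, x). g Z * (f x * cas (Z \<bullet> x))) : borel_measurable (lborel \<Otimes>\<^sub>M lborel)" by measurable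
  show "AE Z in lborel. integrable lborel (%x. case (Z, x) of (Z, x) => g Z * (f x * cas (Z \<bullet> x)))"
   by (simp add: integrable_cas[OF f])
  show "integrable lborel (%Z. (LB x. norm (case (Z, x) of (Z, x) => g Z * (f x * cas (Z \<bullet> x)))))"
  proof (rule bint_bound)
   show "integrable lborel (%Z. \<bar>g Z\<bar> * (LB x. \<bar>f x\<bar> * 2))" using g by simp
   show "(%Z. (LB x. norm (case (Z, x) of (Z, x) => g Z * (f x * cas (Z \<bullet> x))))) : borel_measurable lborel"
    by measurable
   have "(LB x. \<bar>f x\<bar> * \<bar>cas (Z \<bullet> x)\<bar>) <= (LB x. \<bar>f x\<bar> * 2)" for Z
    by (intro integral_mono) (use f integrable_abs[OF integrable_cas[OF f]] in "auto simp: abs_mult intro!: mult_left_mono abs_cas_le")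
   then show "AE Z in lborel. norm (LB x. norm (case (Z, x) of (Z, x) => g Z * (f x * cas (Z \<bullet> x))))
     <= norm (\<bar>g Z\<bar> * (LB x. \<bar>f x\<bar> * 2))"
    by (intro AE_I2) (simp add: abs_mult mult_left_mono abs_of_nonneg)
  qed
 qed
 have "(LB Z. g Z * h0 f Z) = c0 * (LB Z. (LB x. g Z * (f x * cas (Z \<bullet> x))))"
  by (simp only: h0_def mult.left_commute[of _ c0] integral_mult_right_zero)
 also have "(LB Z. (LB x. g Z * (f x * cas (Z \<bullet> x)))) = (LB x. (LB Z. g Z * (f x * cas (Z \<bullet> x))))"
  using lborel_pair.Fubini_integral[OF int] by simp
 also have "... = (LB x. f x * (LB Z. g Z * cas (x \<bullet> Z)))"
 proof -
  have "(%Z. g Z * (f x * cas (Z \<bullet> x))) = (%Z. f x * (g Z * cas (x \<bullet> Z)))" for x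
   by (auto simp: inner_commute)
  then show ?thesis by (simp only: integral_mult_right_zero)
 qed
 also have "c0 * ... = (LB x. f x * h0 g x)"
  by (simp only: h0_def mult.left_commute[of _ c0] integral_mult_right_zero)
 finally show ?thesis .
qed

lemma lborel_integral_Basis_prod:
 fixes f :: "'a::euclidean_space => real => complex"
 assumes "!!b. b : Basis ==> integrable lborel (f b)"
 shows "integrable lborel (%x. \<Prod>b\<in>Basis. f b (x \<bullet> b))"
  and "(LB x. (\<Prod>b\<in>Basis. f b (x \<bullet> b))) = (\<Prod>b\<in>Basis. (LB x. f b x))"
proof -
 interpret product_sigma_finite "%_::'a. lborel :: real measure" by standard
 have [measurable]: "b : Basis ==> f b : borel_measurable borel" for b using assms by auto
 have m: "(%x. \<Prod>b\<in>Basis. f b (x \<bullet> b)) : borel_measurable borel" by measurable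
 have T: "(%f. \<Sum>b\<in>Basis. f b *\<^sub>R b) : measurable (\<Pi>\<^sub>M b\<in>(Basis::'a set). (lborel::real measure)) borel" by measurable
 have e: "(\<Prod>b\<in>Basis. f b ((\<Sum>b\<in>Basis. x b *\<^sub>R b) \<bullet> b)) = (\<Prod>b\<in>Basis. f b (x b))" for x :: "'a => real"
  by (intro prod.cong refl) simp
 have i: "integrable (\<Pi>\<^sub>M b\<in>Basis. lborel) (%x. \<Prod>b\<in>Basis. f b (x b))"
  by (rule product_integrable_prod) (use assms in auto)
 show "integrable lborel (%x. \<Prod>b\<in>Basis. f b (x \<bullet> b))"
  unfolding lborel_eq[where 'a='a] by (subst integrable_distr_eq[OF T m]) (simp only: e i)
 have "(LB x. (\<Prod>b\<in>Basis. f b (x \<bullet> b))) = (\<integral>x. (\<Prod>b\<in>Basis. f b (x b)) \<partial>(\<Pi>\<^sub>M b\<in>Basis. lborel))"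
  unfolding lborel_eq[where 'a='a] by (subst integral_distr[OF T m]) (simp only: e)
 also have "... = (\<Prod>b\<in>Basis. (LB x. f b x))"
  by (rule product_integral_prod) (use assms in auto)
 finally show "(LB x. (\<Prod>b\<in>Basis. f b (x \<bullet> b))) = (\<Prod>b\<in>Basis. (LB x. f b x))" .
qed

text \<open>A rescaling of the characteristic function of the standard normal law.\<close>

lemma gaussian_1d:
 assumes t: "\<tau> > 0"
 shows "integrable lborel (%x::real. complex_of_real (exp (- (\<tau>^2 * x^2 / 2))) * cis (x * z))"
  and "(LB x. complex_of_real (exp (- (\<tau>^2 * x^2 / 2))) * cis (x * z))
    = complex_of_real (sqrt (2 * pi) / \<tau> * exp (- (z^2 / (2 * \<tau>^2))))"
proof -
 let ?g = "%x. complex_of_real (std_normal_density x) * cis (z / \<tau> * x)"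
 have [measurable]: "cis : borel_measurable borel" by (intro borel_measurable_continuous_onI continuous_intros)
 have gi: "integrable lborel ?g"
 proof (rule bint_bound)
  show "integrable lborel std_normal_density" by simp
 qed (auto simp: norm_mult)
 have "char std_normal_distribution (z / \<tau>) = (LB x. ?g x)"
  unfolding char_def by (subst integral_density) (auto simp: cis_conv_exp scaleR_conv_of_real)
 then have gv: "(LB x. ?g x) = complex_of_real (exp (- ((z / \<tau>)^2 / 2)))"
  by (simp add: char_std_normal_distribution)
 have s: "complex_of_real (exp (- (\<tau>^2 * x^2 / 2))) * cis (x * z) = complex_of_real (sqrt (2 * pi)) * ?g (0 + \<tau> * x)" for x
  using t by (simp add: std_normal_density_def power_mult_distrib mult.commute flip: of_real_mult)
 have "integrable lborel (%x. ?g (0 + \<tau> * x))" using gi t by (intro lborel_integrable_real_affine) auto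
 then show "integrable lborel (%x::real. complex_of_real (exp (- (\<tau>^2 * x^2 / 2))) * cis (x * z))"
  unfolding s by (rule integrable_mult_right)
 define Jn where "Jn = (LB x. ?g (0 + \<tau> * x))"
 have "(LB x. ?g x) = \<tau> *\<^sub>R Jn"
  unfolding Jn_def using lborel_integral_real_affine[of \<tau> ?g 0] t by simp
 then have "complex_of_real (exp (- ((z / \<tau>)^2 / 2))) = \<tau> *\<^sub>R Jn" unfolding gv .
 then have "(1 / \<tau>) *\<^sub>R complex_of_real (exp (- ((z / \<tau>)^2 / 2))) = (1 / \<tau>) *\<^sub>R (\<tau> *\<^sub>R Jn)" by (rule arg_cong)
 then have "Jn = complex_of_real (1 / \<tau> * exp (- ((z / \<tau>)^2 / 2)))"
  using t by (simp add: scaleR_conv_of_real del: of_real_exp exp_of_real)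
 then have "(LB x. ?g (0 + \<tau> * x)) = complex_of_real (1 / \<tau> * exp (- ((z / \<tau>)^2 / 2)))"
  unfolding Jn_def .
 then have "(LB x. complex_of_real (sqrt (2 * pi)) * ?g (0 + \<tau> * x))
   = complex_of_real (sqrt (2 * pi)) * complex_of_real (1 / \<tau> * exp (- ((z / \<tau>)^2 / 2)))" by simp
 then show "(LB x. complex_of_real (exp (- (\<tau>^2 * x^2 / 2))) * cis (x * z))
    = complex_of_real (sqrt (2 * pi) / \<tau> * exp (- (z^2 / (2 * \<tau>^2))))"
  unfolding s by (simp add: power_divide mult.commute)
qed

definition gs :: "real => r3 => real" where "gs \<tau> Z = exp (- (\<tau>^2 * (Z \<bullet> Z) / 2))"

lemma gs_meas [measurable]: "gs \<tau> : borel_measurable borel" unfolding gs_def[abs_def] by measurable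
lemma gs_pos: "0 < gs \<tau> Z" by (simp add: gs_def)
lemma gs_le1: "gs \<tau> Z <= 1" by (simp add: gs_def)

lemma gs_prod: "complex_of_real (gs \<tau> Z) * cis (Z \<bullet> z)
 = (\<Prod>b\<in>Basis. complex_of_real (exp (- (\<tau>^2 * (Z \<bullet> b)^2 / 2))) * cis ((Z \<bullet> b) * (z \<bullet> b)))"
proof -
 have "(\<Prod>b\<in>(Basis::r3 set). exp (- (\<tau>^2 * (Z \<bullet> b)^2 / 2))) = exp (\<Sum>b\<in>Basis. - (\<tau>^2 * (Z \<bullet> b)^2 / 2))" by (simp add: exp_sum)
 also have "(\<Sum>b\<in>Basis. - (\<tau>^2 * (Z \<bullet> b)^2 / 2)) = - (\<tau>^2 * (\<Sum>b\<in>Basis. (Z \<bullet> b)^2) / 2)"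
  by (simp add: sum_negf sum_distrib_left sum_divide_distrib)
 also have "(\<Sum>b\<in>Basis. (Z \<bullet> b)^2) = Z \<bullet> Z" by (simp add: euclidean_inner[of Z Z] power2_eq_square)
 finally have 1: "(\<Prod>b\<in>(Basis::r3 set). exp (- (\<tau>^2 * (Z \<bullet> b)^2 / 2))) = gs \<tau> Z" by (simp add: gs_def)
 have "(\<Prod>b\<in>(Basis::r3 set). cis ((Z \<bullet> b) * (z \<bullet> b))) = exp (\<Sum>b\<in>Basis. \<i> * complex_of_real ((Z \<bullet> b) * (z \<bullet> b)))"
  by (simp add: cis_conv_exp exp_sum)
 also have "... = cis (Z \<bullet> z)" by (simp add: cis_conv_exp euclidean_inner[of Z z] sum_distrib_left)
 finally show ?thesis using 1 by (simp add: prod.distrib flip: of_real_prod)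
qed

lemma gs_fourier:
 assumes t: "\<tau> > 0"
 shows "integrable lborel (%Z. complex_of_real (gs \<tau> Z) * cis (Z \<bullet> z))"
  and "(LB Z. complex_of_real (gs \<tau> Z) * cis (Z \<bullet> z)) = complex_of_real ((sqrt (2 * pi) / \<tau>)^3 * gs (1/\<tau>) z)"
proof -
 show "integrable lborel (%Z. complex_of_real (gs \<tau> Z) * cis (Z \<bullet> z))"
  unfolding gs_prod by (rule lborel_integral_Basis_prod) (rule gaussian_1d[OF t])
 have "(LB Z. complex_of_real (gs \<tau> Z) * cis (Z \<bullet> z))
   = (\<Prod>b\<in>(Basis::r3 set). complex_of_real (sqrt (2 * pi) / \<tau> * exp (- ((z \<bullet> b)^2 / (2 * \<tau>^2)))))"
  unfolding gs_prod by (subst lborel_integral_Basis_prod) (auto simp: gaussian_1d[OF t])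
 also have "... = complex_of_real ((sqrt (2 * pi) / \<tau>)^3 * (\<Prod>b\<in>(Basis::r3 set). exp (- ((z \<bullet> b)^2 / (2 * \<tau>^2)))))"
 proof -
  have "(\<Prod>b\<in>(Basis::r3 set). sqrt (2 * pi) / \<tau> * exp (- ((z \<bullet> b)^2 / (2 * \<tau>^2))))
   = (sqrt (2 * pi) / \<tau>)^3 * (\<Prod>b\<in>(Basis::r3 set). exp (- ((z \<bullet> b)^2 / (2 * \<tau>^2))))"
   by (simp only: prod.distrib prod_constant) simp
  then show ?thesis by (simp only: of_real_prod[symmetric])
 qed
 also have "(\<Prod>b\<in>(Basis::r3 set). exp (- ((z \<bullet> b)^2 / (2 * \<tau>^2)))) = gs (1/\<tau>) z"
  using gs_prod[of "1/\<tau>" z 0] by (simp add: power_divide mult.commute flip: of_real_prod)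
 finally show "(LB Z. complex_of_real (gs \<tau> Z) * cis (Z \<bullet> z)) = complex_of_real ((sqrt (2 * pi) / \<tau>)^3 * gs (1/\<tau>) z)" .
qed

lemma gs_integrable: assumes "\<tau> > 0" shows "integrable lborel (gs \<tau>)" 
 using integrable_norm[OF gs_fourier(1)[OF assms, of 0]] by (simp add: norm_mult gs_pos less_imp_le)

lemma gs_integral: assumes "\<tau> > 0" shows "(LB Z. gs \<tau> Z) = (sqrt (2 * pi) / \<tau>)^3"
proof -
 have "complex_of_real (LB Z. gs \<tau> Z) = complex_of_real ((sqrt (2 * pi) / \<tau>)^3)"
  using gs_fourier(2)[OF assms, of 0] by (simp add: gs_def)
 then show ?thesis by (simp only: of_real_eq_iff)
qed

lemma gs_cos_sin:
 assumes "\<tau> > 0"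
 shows "(LB Z. gs \<tau> Z * cos (Z \<bullet> z)) = (sqrt (2 * pi) / \<tau>)^3 * gs (1/\<tau>) z"
  and "(LB Z. gs \<tau> Z * sin (Z \<bullet> z)) = 0"
  and "integrable lborel (%Z. gs \<tau> Z * cos (Z \<bullet> z))" "integrable lborel (%Z. gs \<tau> Z * sin (Z \<bullet> z))"
 using integral_Re[OF gs_fourier(1)[OF assms, of z]] integral_Im[OF gs_fourier(1)[OF assms, of z]]
   integrable_Re[OF gs_fourier(1)[OF assms, of z]] integrable_Im[OF gs_fourier(1)[OF assms, of z]]
 by (simp_all add: gs_fourier(2)[OF assms] del: of_real_mult of_real_power of_real_divide)

text \<open>The centred normal density with variance \<tau>^2 in each coordinate, that is, the
  convolution kernel of the multiplier \<open>gs \<tau>\<close>.\<close>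

definition hk :: "real => r3 => real" where "hk \<tau> z = c0 / \<tau>^3 * gs (1/\<tau>) z"

lemma c0_sqrt: "c0 * sqrt (2 * pi)^3 = 1"
proof -
 have "sqrt (2 * pi) ^ 3 = ((2 * pi) powr (1/2)) powr real 3"
  by (subst powr_realpow) (simp_all add: powr_half_sqrt)
 also have "... = (2 * pi) powr (3/2)" by (simp only: powr_powr) simp
 finally show ?thesis by (simp only: c0_def powr_add[symmetric]) simp
qed

lemma hk_pos: "\<tau> > 0 ==> 0 < hk \<tau> z" using c0_pos gs_pos by (simp add: hk_def)
lemma hk_meas [measurable]: "hk \<tau> : borel_measurable borel" unfolding hk_def[abs_def] by measurable
lemma hk_integrable: "\<tau> > 0 ==> integrable lborel (hk \<tau>)" unfolding hk_def using gs_integrable[of "1/\<tau>"] by simp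
lemma hk_integral: assumes "\<tau> > 0" shows "(LB z. hk \<tau> z) = 1"
 using gs_integral[of "1/\<tau>"] assms c0_sqrt by (simp add: hk_def power_mult_distrib field_simps)
lemma hk_even: "hk \<tau> (x - y) = hk \<tau> (y - x)"
 by (simp add: hk_def gs_def inner_diff_left inner_diff_right inner_commute)

lemma h0_gauss_cas:
 assumes t: "\<tau> > 0" shows "h0 (%Z. gs \<tau> Z * cas (Z \<bullet> x)) y = hk \<tau> (x - y) / c0"
proof -
 have "(LB Z. gs \<tau> Z * cas (Z \<bullet> x) * cas (y \<bullet> Z))
   = (LB Z. gs \<tau> Z * cos (Z \<bullet> (x - y)) + gs \<tau> Z * sin (Z \<bullet> (x + y)))"
  by (simp add: mult.assoc cas_mult inner_commute inner_diff_right inner_add_right distrib_left)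
 also have "... = (sqrt (2 * pi) / \<tau>)^3 * gs (1/\<tau>) (x - y)"
  using gs_cos_sin[OF t] by simp
 finally have "h0 (%Z. gs \<tau> Z * cas (Z \<bullet> x)) y = (c0 * sqrt (2 * pi)^3) / \<tau>^3 * gs (1/\<tau>) (x - y)"
  by (simp add: h0_def power_divide)
 then show ?thesis using c0_pos by (simp add: c0_sqrt hk_def)
qed

text \<open>Parseval with a Gaussian regulariser. The factor \<open>gs\<close> makes all integrals
  absolutely convergent, so adjointness can be used twice: once to move the transform off
  \<open>f\<close>, and once to evaluate the inner transform through the Gaussian integral.\<close>

lemma gaussian_form:
 assumes t: "\<tau> > 0" and f: "integrable lborel f" and g: "integrable lborel g"
 shows "(LB Z. gs \<tau> Z * (h0 f Z * h0 g Z)) = (LB x. f x * (LB y. g y * hk \<tau> (x - y)))"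
proof -
 have [measurable]: "f : borel_measurable borel" "g : borel_measurable borel" using f g by auto
 have gh: "integrable lborel (%Z. gs \<tau> Z * h0 g Z)"
 proof (rule bint_bound)
  show "integrable lborel (%Z. gs \<tau> Z * (2 * c0 * (LB x. \<bar>g x\<bar>)))" using gs_integrable[OF t] by simp
  show "AE Z in lborel. norm (gs \<tau> Z * h0 g Z) <= norm (gs \<tau> Z * (2 * c0 * (LB x. \<bar>g x\<bar>)))"
   using h0_bound[OF g] by (intro AE_I2) (simp add: abs_mult mult_left_mono abs_of_pos[OF c0_pos])
 qed measurable
 have gc: "integrable lborel (%Z. gs \<tau> Z * cas (Z \<bullet> x))" for x
  using integrable_cas[OF gs_integrable[OF t], of x] by (simp add: inner_commute)
 have hh: "h0 (%Z. gs \<tau> Z * h0 g Z) x = (LB y. g y * hk \<tau> (x - y))" for x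
 proof -
  have "h0 (%Z. gs \<tau> Z * h0 g Z) x = c0 * (LB Z. (gs \<tau> Z * cas (Z \<bullet> x)) * h0 g Z)"
   unfolding h0_def[of "%Z. gs \<tau> Z * h0 g Z"] by (simp add: inner_commute mult_ac)
  also have "... = c0 * (LB y. g y * (hk \<tau> (x - y) / c0))"
   by (simp only: h0_adjoint[OF g gc] h0_gauss_cas[OF t])
  also have "... = (LB y. g y * hk \<tau> (x - y))" using c0_pos by simp
  finally show ?thesis .
 qed
 have "(LB Z. gs \<tau> Z * (h0 f Z * h0 g Z)) = (LB x. f x * h0 (%Z. gs \<tau> Z * h0 g Z) x)"
  using h0_adjoint[OF f gh] by (simp add: mult_ac)
 also have "... = (LB x. f x * (LB y. g y * hk \<tau> (x - y)))" by (simp only: hh)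
 finally show ?thesis .
qed

lemma lborel_reflect: "lborel = distr lborel borel (%y::r3. x - y)"
 using lborel_affine[of "-1" x] by (simp add: density_1)

lemma nn_integral_reflect:
 assumes [measurable]: "F : borel_measurable borel"
 shows "(NB y. F (x - y :: r3)) = (NB y. F y)"
 by (subst (2) lborel_reflect[of x]) (simp add: nn_integral_distr)

lemma nn_hk: assumes "\<tau> > 0" shows "(NB y. ennreal (hk \<tau> (x - y))) = 1"
proof -
 have "(NB y. ennreal (hk \<tau> (x - y))) = (NB y. ennreal (hk \<tau> y))"
  by (rule nn_integral_reflect[of "%y. ennreal (hk \<tau> y)"]) measurable
 also have "... = ennreal (LB y. hk \<tau> y)"
  by (rule nn_integral_eq_integral[OF hk_integrable[OF assms]]) (simp add: hk_pos[OF assms] less_imp_le)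
 finally show ?thesis by (simp add: hk_integral[OF assms])
qed

lemma ennreal_abs_integral_le:
 fixes f :: "'a => real" shows "ennreal \<bar>integral\<^sup>L M f\<bar> <= (\<integral>\<^sup>+x. ennreal \<bar>f x\<bar> \<partial>M)"
proof (cases "integrable M f")
 case True then show ?thesis using integral_norm_bound_ennreal[OF True] by simp
qed (simp add: not_integrable_integral_eq)

text \<open>Schur's test for a symmetric kernel of mass 1: bound |f(x) g(y)| by half the sum of the
  squares and integrate out one variable.\<close>

lemma gaussian_double_le:
 assumes t: "\<tau> > 0" and [measurable]: "f : borel_measurable borel" "g : borel_measurable borel"
 shows "(NB x. ennreal \<bar>f x * (LB y. g y * hk \<tau> (x - y))\<bar>)
  <= (NB x. ennreal ((f x)^2 / 2)) + (NB x. ennreal ((g x)^2 / 2))"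
proof -
 have hp: "0 <= hk \<tau> z" for z using hk_pos[OF t, of z] by simp
 have "(NB x. ennreal \<bar>f x * (LB y. g y * hk \<tau> (x - y))\<bar>)
   <= (NB x. (NB y. ennreal ((f x)^2 / 2) * ennreal (hk \<tau> (x - y)) + ennreal ((g y)^2 / 2) * ennreal (hk \<tau> (x - y))))"
 proof (rule nn_integral_mono)
  fix x
  have "ennreal \<bar>f x * (LB y. g y * hk \<tau> (x - y))\<bar> = ennreal \<bar>(LB y. f x * (g y * hk \<tau> (x - y)))\<bar>" by simp
  also have "... <= (NB y. ennreal \<bar>f x * (g y * hk \<tau> (x - y))\<bar>)" by (rule ennreal_abs_integral_le)
  also have "... <= (NB y. ennreal ((f x)^2 / 2) * ennreal (hk \<tau> (x - y)) + ennreal ((g y)^2 / 2) * ennreal (hk \<tau> (x - y)))"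
  proof (rule nn_integral_mono)
   fix y
   have "\<bar>f x\<bar> * \<bar>g y\<bar> <= (f x)^2 / 2 + (g y)^2 / 2"
    using sum_squares_bound[of "\<bar>f x\<bar>" "\<bar>g y\<bar>"] by simp
   then have "(\<bar>f x\<bar> * \<bar>g y\<bar>) * hk \<tau> (x - y) <= ((f x)^2 / 2 + (g y)^2 / 2) * hk \<tau> (x - y)"
    using hp by (rule mult_right_mono)
   then have "\<bar>f x * (g y * hk \<tau> (x - y))\<bar> <= (f x)^2 / 2 * hk \<tau> (x - y) + (g y)^2 / 2 * hk \<tau> (x - y)"
    using hp by (simp add: abs_mult distrib_right)
   then have "ennreal \<bar>f x * (g y * hk \<tau> (x - y))\<bar> <= ennreal ((f x)^2 / 2 * hk \<tau> (x - y) + (g y)^2 / 2 * hk \<tau> (x - y))"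
    by (rule ennreal_leI)
   also have "... = ennreal ((f x)^2 / 2) * ennreal (hk \<tau> (x - y)) + ennreal ((g y)^2 / 2) * ennreal (hk \<tau> (x - y))"
   proof -
    have "ennreal ((f x)^2 / 2 * hk \<tau> (x - y)) = ennreal ((f x)^2 / 2) * ennreal (hk \<tau> (x - y))"
     "ennreal ((g y)^2 / 2 * hk \<tau> (x - y)) = ennreal ((g y)^2 / 2) * ennreal (hk \<tau> (x - y))"
     by (rule ennreal_mult; use hp in simp)+
    moreover have "ennreal ((f x)^2 / 2 * hk \<tau> (x - y) + (g y)^2 / 2 * hk \<tau> (x - y))
     = ennreal ((f x)^2 / 2 * hk \<tau> (x - y)) + ennreal ((g y)^2 / 2 * hk \<tau> (x - y))"
     by (rule ennreal_plus) (use hp in simp_all)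
    ultimately show ?thesis by (simp only:)
   qed
   finally show "ennreal \<bar>f x * (g y * hk \<tau> (x - y))\<bar> <= ennreal ((f x)^2 / 2) * ennreal (hk \<tau> (x - y)) + ennreal ((g y)^2 / 2) * ennreal (hk \<tau> (x - y))" .
  qed
  finally show "ennreal \<bar>f x * (LB y. g y * hk \<tau> (x - y))\<bar> <= (NB y. ennreal ((f x)^2 / 2) * ennreal (hk \<tau> (x - y)) + ennreal ((g y)^2 / 2) * ennreal (hk \<tau> (x - y)))" .
 qed
 also have "... = (NB x. (NB y. ennreal ((f x)^2 / 2) * ennreal (hk \<tau> (x - y))))
   + (NB x. (NB y. ennreal ((g y)^2 / 2) * ennreal (hk \<tau> (x - y))))"
  by (subst nn_integral_add, measurable)+
 also have "(NB x. (NB y. ennreal ((g y)^2 / 2) * ennreal (hk \<tau> (x - y))))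
   = (NB y. (NB x. ennreal ((g y)^2 / 2) * ennreal (hk \<tau> (y - x))))"
  by (subst lborel_pair.Fubini') (simp_all add: hk_even)
 also have "... = (NB y. ennreal ((g y)^2 / 2))"
  by (simp add: nn_integral_cmult nn_hk[OF t])
 also have "(NB x. (NB y. ennreal ((f x)^2 / 2) * ennreal (hk \<tau> (x - y)))) = (NB x. ennreal ((f x)^2 / 2))"
  by (simp add: nn_integral_cmult nn_hk[OF t])
 finally show ?thesis .
qed

definition l12 :: "(r3 => real) => bool" where "l12 f \<longleftrightarrow> integrable lborel f & l2fun f"

lemma gs_tendsto: "(%n. gs (1 / (real n + 1)) Z) \<longlonglongrightarrow> 1"
proof -
 have "(%n. 1 / (real n + 1)) \<longlonglongrightarrow> 0" using LIMSEQ_inverse_real_of_nat by (simp add: inverse_eq_divide add.commute)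
 then have "(%n. exp (- ((1 / (real n + 1))^2 * (Z \<bullet> Z) / 2))) \<longlonglongrightarrow> exp (- (0^2 * (Z \<bullet> Z) / 2))"
  by (intro tendsto_intros) auto
 then show ?thesis by (simp add: gs_def)
qed

lemma gs_h0_integrable: assumes "l12 f" "\<tau> > 0" shows "integrable lborel (%Z. gs \<tau> Z * (h0 f Z)^2)"
proof (rule bint_bound)
 have [measurable]: "f : borel_measurable borel" using assms(1) by (auto simp: l12_def)
 let ?B = "(2 * c0 * (LB x. \<bar>f x\<bar>))^2"
 show "integrable lborel (%Z. gs \<tau> Z * ?B)" using gs_integrable[OF assms(2)] by simp
 have "(h0 f Z)^2 <= ?B" for Z
  using h0_bound[of f Z] assms(1) power_mono[of "\<bar>h0 f Z\<bar>" "2 * c0 * (LB x. \<bar>f x\<bar>)" 2] by (simp add: l12_def)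
 then show "AE Z in lborel. norm (gs \<tau> Z * (h0 f Z)^2) <= norm (gs \<tau> Z * ?B)"
  by (intro AE_I2) (simp add: abs_mult mult_left_mono)
qed (use assms in "auto simp: l12_def")

lemma gauss_h0_le:
 assumes f: "l12 f" and t: "\<tau> > 0"
 shows "(NB Z. ennreal (gs \<tau> Z * (h0 f Z)^2)) <= (NB x. ennreal ((f x)^2))"
proof -
 have [measurable]: "f : borel_measurable borel" and fi: "integrable lborel f" using f by (auto simp: l12_def)
 have "(NB Z. ennreal (gs \<tau> Z * (h0 f Z)^2)) = ennreal (LB Z. gs \<tau> Z * (h0 f Z)^2)"
  by (rule nn_integral_eq_integral[OF gs_h0_integrable[OF f t]]) (simp add: gs_pos less_imp_le)
 also have "(LB Z. gs \<tau> Z * (h0 f Z)^2) = (LB x. f x * (LB y. f y * hk \<tau> (x - y)))"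
  using gaussian_form[OF t fi fi] by (simp add: power2_eq_square)
 also have "ennreal ... <= ennreal \<bar>...\<bar>" by (intro ennreal_leI) simp
 also have "... <= (NB x. ennreal \<bar>f x * (LB y. f y * hk \<tau> (x - y))\<bar>)" by (rule ennreal_abs_integral_le)
 also have "... <= (NB x. ennreal ((f x)^2 / 2)) + (NB x. ennreal ((f x)^2 / 2))"
  by (rule gaussian_double_le[OF t]) measurable
 also have "... = (NB x. ennreal ((f x)^2 / 2) + ennreal ((f x)^2 / 2))"
  by (rule nn_integral_add[symmetric]) measurable
 also have "... = (NB x. ennreal ((f x)^2))"
  by (intro nn_integral_cong) (simp flip: ennreal_plus)
 finally show ?thesis .
qed

text \<open>Fatou for \<tau> -> 0 gives only an inequality. The isometry is recovered later, from
  indicators of open sets.\<close>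

lemma h0_contraction:
 assumes f: "l12 f" shows "(NB Z. ennreal ((h0 f Z)^2)) <= (NB x. ennreal ((f x)^2))"
proof -
 have [measurable]: "f : borel_measurable borel" using f by (auto simp: l12_def)
 have "(NB Z. ennreal ((h0 f Z)^2)) = (NB Z. liminf (%n. ennreal (gs (1 / (real n + 1)) Z * (h0 f Z)^2)))"
 proof (rule nn_integral_cong)
  fix Z
  have "(%n. ennreal (gs (1 / (real n + 1)) Z * (h0 f Z)^2)) \<longlonglongrightarrow> ennreal (1 * (h0 f Z)^2)"
   by (intro tendsto_ennrealI tendsto_mult gs_tendsto tendsto_const)
  then show "ennreal ((h0 f Z)^2) = liminf (%n. ennreal (gs (1 / (real n + 1)) Z * (h0 f Z)^2))"
   by (simp only: lim_imp_Liminf[OF trivial_limit_sequentially] mult_1)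
 qed
 also have "... <= liminf (%n. (NB Z. ennreal (gs (1 / (real n + 1)) Z * (h0 f Z)^2)))"
  by (rule nn_integral_liminf) measurable
 also have "... <= (NB x. ennreal ((f x)^2))"
  by (rule Liminf_le) (auto intro!: always_eventually gauss_h0_le[OF f])
 finally show ?thesis .
qed

lemma l2fun_h0: assumes "l12 f" shows "l2fun (h0 f)"
 unfolding l2fun_nn
proof
 show "h0 f : borel_measurable borel" using assms by (intro h0_meas) (auto simp: l12_def)
 have "(NB x. ennreal ((f x)^2)) < \<infinity>" using assms by (simp add: l12_def l2fun_nn)
 then show "(NB x. ennreal ((h0 f x)^2)) < \<infinity>" using h0_contraction[OF assms] le_less_trans by blast
qed

lemma l12_diff: "l12 f ==> l12 g ==> l12 (%x. f x - g x)"
 using l2fun_add[OF _ l2fun_scale[of g "-1"], of f] by (simp add: l12_def)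
lemma l12_add: "l12 f ==> l12 g ==> l12 (%x. f x + g x)"
 using l2fun_add[of f g] by (simp add: l12_def)
lemma l12_scale: "l12 f ==> l12 (%x. c * f x)"
 using l2fun_scale[of f c] by (simp add: l12_def)

definition hc :: "(r3 => real) => l2" where "hc f = cl (h0 f)"

lemma cl_diff: assumes "l2fun f" "l2fun g" shows "cl (%x. f x - g x) = cl f - cl g"
proof (rule cl_eqI)
 show "l2fun (%x. f x - g x)" using l2fun_add[OF assms(1) l2fun_scale[OF assms(2), of "-1"]] by simp
 show "AE x in lborel. f x - g x = fn (cl f - cl g) x"
  using fn_minus[of "cl f" "cl g"] fn_cl[OF assms(1)] fn_cl[OF assms(2)] by eventually_elim simp
qed

lemma cl_add: assumes "l2fun f" "l2fun g" shows "cl (%x. f x + g x) = cl f + cl g"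
proof (rule cl_eqI)
 show "l2fun (%x. f x + g x)" by (rule l2fun_add[OF assms])
 show "AE x in lborel. f x + g x = fn (cl f + cl g) x"
  using fn_plus[of "cl f" "cl g"] fn_cl[OF assms(1)] fn_cl[OF assms(2)] by eventually_elim simp
qed

lemma cl_scale: assumes "l2fun f" shows "cl (%x. c * f x) = c *\<^sub>R cl f"
proof (rule cl_eqI)
 show "l2fun (%x. c * f x)" by (rule l2fun_scale[OF assms])
 show "AE x in lborel. c * f x = fn (c *\<^sub>R cl f) x"
  using fn_scaleR[of c "cl f"] fn_cl[OF assms(1)] by eventually_elim simp
qed

lemma norm_cl_le_nn:
 assumes "l2fun f" "l2fun g" "(NB x. ennreal ((f x)^2)) <= (NB x. ennreal ((g x)^2))"
 shows "norm (cl f) <= norm (cl g)"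
proof -
 have nn: "(NB x. ennreal ((f x)^2)) = ennreal ((norm (cl f))^2)" if "l2fun f" for f
  unfolding nn_integral_norm_l2[symmetric] by (rule nn_integral_cong_AE) (use fn_cl[OF that] in "eventually_elim, simp")
 have "(norm (cl f))^2 <= (norm (cl g))^2" using assms(3) unfolding nn[OF assms(1)] nn[OF assms(2)] by (subst (asm) ennreal_le_iff) auto
 then show ?thesis by (rule power2_le_imp_le) simp
qed

lemma hc_lipschitz: assumes "l12 f" "l12 g" shows "norm (hc f - hc g) <= norm (cl f - cl g)"
proof -
 have d: "l12 (%x. f x - g x)" by (rule l12_diff[OF assms])
 have "h0 (%x. f x - g x) = (%Z. h0 f Z - h0 g Z)" using assms by (auto simp: l12_def h0_diff)
 then have "hc f - hc g = cl (h0 (%x. f x - g x))" unfolding hc_def by (simp add: cl_diff l2fun_h0 assms)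
 moreover have "cl f - cl g = cl (%x. f x - g x)" using assms by (simp add: cl_diff l12_def)
 moreover have "norm (cl (h0 (%x. f x - g x))) <= norm (cl (%x. f x - g x))"
  by (rule norm_cl_le_nn[OF l2fun_h0[OF d] _ h0_contraction[OF d]]) (use d in "simp add: l12_def")
 ultimately show ?thesis by simp
qed

definition tr :: "real => (r3 => real) => r3 => real" where "tr R f = (%x. indicator (ball 0 R) x * f x)"

lemma l12_tr: assumes f: "l2fun f" shows "l12 (tr R f)"
 unfolding l12_def
proof
 have [measurable]: "f : borel_measurable borel" using f by (rule l2fun_meas)
 have m: "tr R f : borel_measurable borel" unfolding tr_def
  by (intro borel_measurable_times borel_measurable_indicator l2fun_meas[OF f]) simp
 show l2: "l2fun (tr R f)"
  by (rule l2fun_bound[OF m f]) (auto simp: tr_def indicator_def)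
 have "emeasure lborel (ball (0::r3) R) < \<infinity>"
  using emeasure_lborel_ball_finite[of 0 R] by simp
 then have "l2fun (indicator (ball (0::r3) R))"
 proof -
  have "(%x::r3. ennreal ((indicator (ball 0 R) x)^2)) = (%x. indicator (ball 0 R) x)" by (auto simp: indicator_def)
  then show ?thesis using \<open>emeasure lborel (ball (0::r3) R) < \<infinity>\<close> unfolding l2fun_nn by (simp add: borel_measurable_indicator)
 qed
 from l2fun_mult_integrable[OF this f] show "integrable lborel (tr R f)" by (simp add: tr_def)
qed

lemma tr_tendsto: assumes f: "l2fun f" shows "((%R. cl (tr R f)) \<longlongrightarrow> cl f) at_top"
proof -
 have [measurable]: "f : borel_measurable borel" using f by (rule l2fun_meas)
 have "((%R. (LB x. (tr R f x - f x)^2)) \<longlongrightarrow> (\<integral>x. (0::real) \<partial>(lborel :: r3 measure))) at_top"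
 proof (rule integral_dominated_convergence_at_top)
  show "integrable lborel (%x. (f x)^2)" using f by (simp add: l2fun_def)
  show "\<forall>\<^sub>F R in at_top. AE x in lborel. norm ((tr R f x - f x)^2) <= (f x)^2"
   by (intro always_eventually allI AE_I2) (simp add: tr_def indicator_def)
  show "AE x in lborel. ((%R. (tr R f x - f x)^2) \<longlongrightarrow> 0) at_top"
  proof (rule AE_I2)
   fix x
   have "\<forall>\<^sub>F R in at_top. (tr R f x - f x)^2 = 0"
    using eventually_gt_at_top[of "norm x"] by eventually_elim (simp add: tr_def indicator_def mem_ball)
   then show "((%R. (tr R f x - f x)^2) \<longlongrightarrow> 0) at_top" by (rule tendsto_eventually)
  qed
  show "(%x. (tr R f x - f x)^2) : borel_measurable lborel" for R
  proof -
   have [measurable]: "tr R f : borel_measurable borel" using l12_tr[OF f, of R] by (simp add: l12_def l2fun_meas)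
   show ?thesis by measurable
  qed
 qed auto
 moreover have "(LB x. (tr R f x - f x)^2) = (norm (cl (tr R f) - cl f))^2" for R
 proof -
  have t: "l2fun (tr R f)" using l12_tr[OF f] by (simp add: l12_def)
  have "l2fun (%x. tr R f x - f x)" using l2fun_add[OF t l2fun_scale[OF f, of "-1"]] by simp
  from norm_cl[OF this] show ?thesis by (simp only: cl_diff[OF t f])
 qed
 ultimately have "((%R. (norm (cl (tr R f) - cl f))^2) \<longlongrightarrow> 0) at_top" by simp
 then have "((%R. sqrt ((norm (cl (tr R f) - cl f))^2)) \<longlongrightarrow> sqrt 0) at_top" by (rule tendsto_real_sqrt)
 then have "((%R. norm (cl (tr R f) - cl f)) \<longlongrightarrow> 0) at_top" by simp
 then have "((%R. cl (tr R f) - cl f) \<longlongrightarrow> 0) at_top" by (rule tendsto_norm_zero_cancel)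
 then show ?thesis by (simp add: LIM_zero_iff)
qed

text \<open>Extension of a contraction from the dense class \<open>l12\<close>: the limit along
  truncations works. Stating it by inequalities against every \<open>f\<close> of the class gives
  continuity of the extension at once.\<close>

lemma ex_hartley: "EX b. ALL f. l12 f --> norm (hc f - b) <= norm (cl f - a)"
proof -
 define X where "X n = hc (tr (real n) (fn a))" for n
 have t: "l12 (tr R (fn a))" for R by (rule l12_tr[OF l2fun_fn])
 have lim: "(%n. cl (tr (real n) (fn a))) \<longlonglongrightarrow> a"
  using filterlim_compose[OF tr_tendsto[OF l2fun_fn] filterlim_real_sequentially] by simp
 then have "Cauchy (%n. cl (tr (real n) (fn a)))" using Cauchy_convergent_iff convergent_def by blast
 then have "Cauchy X"
  unfolding Cauchy_iff X_def using hc_lipschitz[OF t t] by (meson le_less_trans)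
 then obtain b where b: "X \<longlonglongrightarrow> b" using Cauchy_convergent_iff convergent_def by blast
 have "norm (hc f - b) <= norm (cl f - a)" if f: "l12 f" for f
 proof (rule LIMSEQ_le)
  show "(%n. norm (hc f - X n)) \<longlonglongrightarrow> norm (hc f - b)" by (intro tendsto_norm tendsto_diff tendsto_const b)
  show "(%n. norm (cl f - cl (tr (real n) (fn a)))) \<longlonglongrightarrow> norm (cl f - a)" by (intro tendsto_norm tendsto_diff tendsto_const lim)
  show "EX N. ALL n>=N. norm (hc f - X n) <= norm (cl f - cl (tr (real n) (fn a)))"
   unfolding X_def using hc_lipschitz[OF f t] by blast
 qed
 then show ?thesis by blast
qed

definition Hh :: "l2 => l2" where "Hh a = (SOME b. ALL f. l12 f --> norm (hc f - b) <= norm (cl f - a))"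

lemma Hh: "l12 f ==> norm (hc f - Hh a) <= norm (cl f - a)"
 using someI_ex[OF ex_hartley[of a]] unfolding Hh_def by blast

lemma Hh_cl: assumes "l12 f" shows "Hh (cl f) = cl (h0 f)"
 using Hh[OF assms, of "cl f"] by (simp add: hc_def)

lemma Hh_tendsto: assumes "!!R. l12 (X R)" "((%R. cl (X R)) \<longlongrightarrow> a) F" shows "((%R. hc (X R)) \<longlongrightarrow> Hh a) F"
proof -
 have "((%R. cl (X R) - a) \<longlongrightarrow> 0) F" using assms(2) by (simp add: LIM_zero_iff)
 then have "((%R. norm (cl (X R) - a)) \<longlongrightarrow> 0) F" by (rule tendsto_norm_zero)
 then have "((%R. hc (X R) - Hh a) \<longlongrightarrow> 0) F"
  by (rule Lim_null_comparison[rotated]) (intro always_eventually allI Hh assms)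
 then show ?thesis by (simp add: LIM_zero_iff)
qed

lemma tr_fn_tendsto: "((%R. cl (tr R (fn a))) \<longlongrightarrow> a) at_top"
 using tr_tendsto[OF l2fun_fn[of a]] by simp

lemma l12_tr_fn: "l12 (tr R (fn a))" by (rule l12_tr[OF l2fun_fn])

lemma Hh_tr_tendsto: "((%R. hc (tr R (fn a))) \<longlongrightarrow> Hh a) at_top"
 by (rule Hh_tendsto[OF l12_tr_fn tr_fn_tendsto])

lemma Hh_add: "Hh (a + b) = Hh a + Hh b"
proof (rule tendsto_unique)
 let ?X = "%R x. tr R (fn a) x + tr R (fn b) x"
 have l: "l12 (?X R)" for R by (intro l12_add l12_tr_fn)
 have l2: "l2fun (tr R (fn c))" for R c using l12_tr_fn by (simp add: l12_def)
 have "((%R. cl (tr R (fn a)) + cl (tr R (fn b))) \<longlongrightarrow> a + b) at_top" by (intro tendsto_add tr_fn_tendsto)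
 then have "((%R. cl (?X R)) \<longlongrightarrow> a + b) at_top" by (simp only: cl_add[OF l2 l2])
 then show "((%R. hc (?X R)) \<longlongrightarrow> Hh (a + b)) at_top" by (rule Hh_tendsto[OF l])
 have "hc (?X R) = hc (tr R (fn a)) + hc (tr R (fn b))" for R
 proof -
  have "h0 (?X R) = (%Z. h0 (tr R (fn a)) Z + h0 (tr R (fn b)) Z)" 
   using l12_tr_fn by (auto simp: l12_def h0_add)
  then show ?thesis by (simp add: hc_def cl_add l2fun_h0 l12_tr_fn)
 qed
 then show "((%R. hc (?X R)) \<longlongrightarrow> Hh a + Hh b) at_top" by (simp only:) (intro tendsto_add Hh_tr_tendsto)
qed simp

lemma Hh_scale: "Hh (c *\<^sub>R a) = c *\<^sub>R Hh a"
proof (rule tendsto_unique)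
 let ?X = "%R x. c * tr R (fn a) x"
 have l: "l12 (?X R)" for R by (intro l12_scale l12_tr_fn)
 have l2: "l2fun (tr R (fn c))" for R c using l12_tr_fn by (simp add: l12_def)
 have "((%R. c *\<^sub>R cl (tr R (fn a))) \<longlongrightarrow> c *\<^sub>R a) at_top" by (intro tendsto_scaleR tendsto_const tr_fn_tendsto)
 then have "((%R. cl (?X R)) \<longlongrightarrow> c *\<^sub>R a) at_top" by (simp only: cl_scale[OF l2])
 then show "((%R. hc (?X R)) \<longlongrightarrow> Hh (c *\<^sub>R a)) at_top" by (rule Hh_tendsto[OF l])
 have "hc (?X R) = c *\<^sub>R hc (tr R (fn a))" for R
 proof -
  have "h0 (?X R) = (%Z. c * h0 (tr R (fn a)) Z)" by (auto simp: h0_scale)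
  then show ?thesis by (simp add: hc_def cl_scale l2fun_h0 l12_tr_fn)
 qed
 then show "((%R. hc (?X R)) \<longlongrightarrow> c *\<^sub>R Hh a) at_top" by (simp only:) (intro tendsto_scaleR tendsto_const Hh_tr_tendsto)
qed simp

lemma l12_zero: "l12 (%x. 0)" by (simp add: l12_def l2fun_zero)

lemma norm_Hh_le: "norm (Hh a) <= norm a"
proof -
 have "hc (%x. 0) = 0" by (simp add: hc_def h0_def[abs_def] zero_l2_def)
 moreover have "cl (%x. 0) = 0" by (simp add: zero_l2_def)
 ultimately show ?thesis using Hh[OF l12_zero, of a] by simp
qed

lemma Hh_self_adjoint: "inner (Hh a) b = inner a (Hh b)"
proof (rule tendsto_unique)
 have "inner (hc (tr R (fn a))) (cl (tr R (fn b))) = inner (cl (tr R (fn a))) (hc (tr R (fn b)))" for R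
 proof -
  have l2: "l2fun (tr R (fn c))" "integrable lborel (tr R (fn c))" for c using l12_tr_fn by (auto simp: l12_def)
  show ?thesis
   unfolding hc_def inner_cl[OF l2fun_h0[OF l12_tr_fn] l2(1)] inner_cl[OF l2(1) l2fun_h0[OF l12_tr_fn]]
   using h0_adjoint[OF l2(2) l2(2), of b a] by (simp add: mult.commute)
 qed
 moreover have "((%R. inner (cl (tr R (fn a))) (hc (tr R (fn b)))) \<longlongrightarrow> inner a (Hh b)) at_top"
  by (intro tendsto_inner tr_fn_tendsto Hh_tr_tendsto)
 ultimately show "((%R. inner (hc (tr R (fn a))) (cl (tr R (fn b)))) \<longlongrightarrow> inner a (Hh b)) at_top" by simp
 show "((%R. inner (hc (tr R (fn a))) (cl (tr R (fn b)))) \<longlongrightarrow> inner (Hh a) b) at_top"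
  by (intro tendsto_inner tr_fn_tendsto Hh_tr_tendsto)
qed simp

text \<open>Boxes are stable under intersection and generate the Borel sets, so by a Dynkin argument
  the integral vanishes over every Borel set.\<close>

lemma l2_zero_of_boxes:
 assumes box0: "!!u v. (LB x. indicator (box u v) x * fn d x) = 0"
 shows "d = 0"
proof -
 have ae: "AE x in lborel. indicator (box (- (real n *\<^sub>R One)) (real n *\<^sub>R One)) x * fn d x = 0" for n
 proof -
  \<comment> \<open>Inside a bounded box \<open>fn d\<close> is integrable, as complements and
    countable unions require.\<close>
  define B :: "r3 set" where "B = box (- (real n *\<^sub>R One)) (real n *\<^sub>R One)"
  have Bl2: "l2fun (indicator B)"
  proof -
   have "(%x. ennreal ((indicator B x)^2)) = (%x. indicator B x)" by (auto simp: indicator_def)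
   moreover have "emeasure lborel B < \<infinity>" unfolding B_def by (simp add: emeasure_lborel_box_eq)
   ultimately show ?thesis unfolding l2fun_nn by (simp add: borel_measurable_indicator B_def)
  qed
  define f where "f x = indicator B x * fn d x" for x
  have fi: "integrable lborel f" unfolding f_def by (rule l2fun_mult_integrable[OF Bl2 l2fun_fn])
  have "set_lebesgue_integral lborel A f = 0" if A: "A : sets lborel" for A
  proof -
   have "A : sets borel" using A by simp
   then have AS: "A : sigma_sets UNIV (range (%(a, b). box a b :: r3 set))" unfolding borel_eq_box by simp
   have "Int_stable (range (%(a, b). box a b :: r3 set))" by (auto simp: Int_stable_def box_Int_box)
   moreover have "range (%(a, b). box a b :: r3 set) \<subseteq> Pow UNIV" by auto
   moreover note AS
   ultimately show ?thesis
   proof (induction rule: sigma_sets_induct_disjoint)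
    case (basic A)
    then obtain u v where A: "A = box u v" by auto
    obtain u' v' where uv: "box u v \<inter> B = box u' v'" unfolding B_def box_Int_box by blast
    have "indicator A x *\<^sub>R f x = indicator (box u' v') x * fn d x" for x
     by (simp add: f_def A uv[symmetric] indicator_inter_arith mult.assoc)
    then show ?case unfolding set_lebesgue_integral_def by (simp only: box0)
   next
    case empty then show ?case by (simp add: set_lebesgue_integral_def)
   next
    case (compl A)
    then have [measurable]: "A : sets borel" by (simp add: borel_eq_box)
    have iA: "integrable lborel (%x. indicator A x *\<^sub>R f x)" by (rule integrable_mult_indicator[OF _ fi]) simp
    have "set_lebesgue_integral lborel (UNIV - A) f = (LB x. f x - indicator A x *\<^sub>R f x)"
     unfolding set_lebesgue_integral_def by (intro bintegral_cong) (auto simp: indicator_def)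
    also have "... = (LB x. f x) - set_lebesgue_integral lborel A f"
     unfolding set_lebesgue_integral_def by (rule bintegral_diff[OF fi iA])
    also have "(LB x. f x) = 0" unfolding f_def B_def by (rule box0)
    finally show ?case using compl by simp
   next
    case (union F)
    then have m: "!!i. F i : sets lborel" by (simp add: borel_eq_box subset_eq)
    have "set_integrable lborel (\<Union>i. F i) f"
     unfolding set_integrable_def by (rule integrable_mult_indicator[OF _ fi]) (use m in auto)
    then have "set_lebesgue_integral lborel (\<Union>i. F i) f = suminf (%i. set_lebesgue_integral lborel (F i) f)"
     by (intro lebesgue_integral_countable_add m) (use union(1) in "auto simp: disjoint_family_on_def")
    then show ?case using union by simp
   qed
  qed
  then have "AE x in lborel. f x = 0" by (intro density_unique_real[OF fi, of "%_. 0"]) (simp_all add: set_lebesgue_integral_def)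
  then show ?thesis by (simp add: f_def B_def)
 qed
 have "AE x in lborel. ALL n. indicator (box (- (real n *\<^sub>R One)) (real n *\<^sub>R One)) x * fn d x = 0"
  unfolding AE_all_countable by (intro allI ae)
 then have "AE x in lborel. fn d x = 0"
 proof eventually_elim
  fix x :: r3 assume a: "ALL n. indicator (box (- (real n *\<^sub>R One)) (real n *\<^sub>R One)) x * fn d x = 0"
  have "x : (\<Union>n. box (- (real n *\<^sub>R One)) (real n *\<^sub>R One))" by (simp add: UN_box_eq_UNIV)
  then obtain n where "x : box (- (real n *\<^sub>R One)) (real n *\<^sub>R One)" by auto
  then show "fn d x = 0" using a[rule_format, of n] by simp
 qed
 then have "AE x in lborel. fn d x = fn 0 x" using fn_zero by eventually_elim simp
 then show ?thesis by (rule l2_eqI)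
qed

lemma hk_scaling: assumes "\<tau> > 0" shows "\<tau>^3 * hk \<tau> (\<tau> *\<^sub>R w) = hk 1 w"
 using assms by (simp add: hk_def gs_def power2_eq_square)

lemma nn_integral_affine3:
 assumes t: "\<tau> > 0" and [measurable]: "F : borel_measurable borel"
 shows "(NB y. F y) = ennreal (\<tau>^3) * (NB w. F (x - \<tau> *\<^sub>R w :: r3))"
proof -
 have "lborel = density (distr lborel borel (%w::r3. x + (-\<tau>) *\<^sub>R w)) (%_. ennreal \<bar>-\<tau>\<bar>^DIM(r3))"
  using lborel_affine[of "-\<tau>" x] t by (simp add: ennreal_power)
 then have "(NB y. F y) = (\<integral>\<^sup>+y. F y \<partial>density (distr lborel borel (%w::r3. x + (-\<tau>) *\<^sub>R w)) (%_. ennreal \<bar>-\<tau>\<bar>^DIM(r3)))"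
  by (rule arg_cong)
 also have "... = ennreal (\<tau>^3) * (NB w. F (x - \<tau> *\<^sub>R w))"
  using t by (simp add: nn_integral_density nn_integral_distr nn_integral_cmult ennreal_power)
 finally show ?thesis .
qed

text \<open>After rescaling, the kernel no longer depends on n and the indicator of the open set is
  lower semicontinuous, so Fatou gives the bound.\<close>

lemma gaussian_average_tendsto:
 fixes U :: "r3 set"
 assumes U: "open U" "x : U"
 shows "1 <= liminf (%n. (NB y. indicator U y * ennreal (hk (1 / (real n + 1)) (x - y))))"
proof -
 have [measurable]: "U : sets borel" using U by simp
 have ind: "(%w. indicator U (x - c *\<^sub>R w) :: ennreal) : borel_measurable borel" for c
 proof -
  have "(%w. x - c *\<^sub>R w) : borel \<rightarrow>\<^sub>M borel" by measurable
  from measurable_compose[OF this, of "indicator U :: r3 => ennreal" borel] show ?thesis by simp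
 qed
 let ?t = "%n. 1 / (real n + 1)"
 have t0: "(%n. ?t n) \<longlonglongrightarrow> 0" using LIMSEQ_inverse_real_of_nat by (simp add: inverse_eq_divide add.commute)
 have eq: "(NB y. indicator U y * ennreal (hk (?t n) (x - y)))
   = (NB w. indicator U (x - ?t n *\<^sub>R w) * ennreal (hk 1 w))" for n
 proof -
  have tp: "?t n > 0" by simp
  have hs: "ennreal (?t n ^ 3) * ennreal (hk (?t n) (?t n *\<^sub>R w)) = ennreal (hk 1 w)" for w
   using hk_scaling[OF tp, of w] hk_pos[OF tp] by (simp only: ennreal_mult[symmetric] less_imp_le zero_le_power tp)
  have "(NB y. indicator U y * ennreal (hk (?t n) (x - y)))
    = ennreal (?t n ^ 3) * (NB w. indicator U (x - ?t n *\<^sub>R w) * ennreal (hk (?t n) (x - (x - ?t n *\<^sub>R w))))"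
   by (rule nn_integral_affine3[OF tp, of "%y. indicator U y * ennreal (hk (?t n) (x - y))"]) measurable
  also have "... = (NB w. ennreal (?t n ^ 3) * (indicator U (x - ?t n *\<^sub>R w) * ennreal (hk (?t n) (?t n *\<^sub>R w))))"
  proof -
   have m1: "(%w. indicator U (x - ?t n *\<^sub>R w) :: ennreal) : borel_measurable lborel" using ind[of "?t n"] by simp
   have m2: "(%w. ennreal (hk (?t n) (?t n *\<^sub>R w))) : borel_measurable lborel" by measurable
   show ?thesis by (subst nn_integral_cmult[OF borel_measurable_times_ennreal[OF m1 m2]]) simp
  qed
  also have "... = (NB w. indicator U (x - ?t n *\<^sub>R w) * ennreal (hk 1 w))"
   by (simp only: mult.left_commute[of "ennreal (?t n ^ 3)"] hs)
  finally show ?thesis .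
 qed
 have "1 = (NB w. ennreal (hk 1 (0 - w)))" using nn_hk[of 1 0] by simp
 also have "... = (NB w. ennreal (hk 1 w))" by (simp add: hk_def gs_def)
 also have "... <= (NB w. liminf (%n. indicator U (x - ?t n *\<^sub>R w) * ennreal (hk 1 w)))"
 proof (rule nn_integral_mono)
  fix w :: r3
  have "(%n. x - ?t n *\<^sub>R w) \<longlonglongrightarrow> x - 0 *\<^sub>R w" by (intro tendsto_intros t0)
  then have "\<forall>\<^sub>F n in sequentially. x - ?t n *\<^sub>R w : U" using U by (intro topological_tendstoD) auto
  then have "\<forall>\<^sub>F n in sequentially. ennreal (hk 1 w) <= indicator U (x - ?t n *\<^sub>R w) * ennreal (hk 1 w)"
   by eventually_elim simp
  then show "ennreal (hk 1 w) <= liminf (%n. indicator U (x - ?t n *\<^sub>R w) * ennreal (hk 1 w))"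
   by (rule Liminf_bounded)
 qed
 also have "... <= liminf (%n. (NB w. indicator U (x - ?t n *\<^sub>R w) * ennreal (hk 1 w)))"
  by (rule nn_integral_liminf) (intro borel_measurable_times_ennreal, use ind in simp, measurable)
 finally show ?thesis by (simp only: eq)
qed

lemma l12_indicator: assumes [measurable]: "U : sets borel" and fin: "emeasure lborel U < \<infinity>" shows "l12 (indicator U)"
proof -
 have "(%x. ennreal ((indicator U x)^2)) = (%x. indicator U x)" by (auto simp: indicator_def)
 then have "l2fun (indicator U)" using fin unfolding l2fun_nn by (simp add: borel_measurable_indicator)
 moreover have "integrable lborel (indicator U :: r3 => real)" using fin by simp
 ultimately show ?thesis by (simp add: l12_def)
qed

lemma hk_le: "\<tau> > 0 ==> hk \<tau> z <= c0 / \<tau>^3"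
 using mult_left_mono[OF gs_le1[of "1/\<tau>" z], of "c0 / \<tau>^3"] c0_pos by (simp add: hk_def)

lemma hk_conv_integrable:
 assumes t: "\<tau> > 0" and g: "integrable lborel g" shows "integrable lborel (%y::r3. g y * hk \<tau> (x - y))"
proof (rule bint_bound)
 have [measurable]: "g : borel_measurable borel" using g by auto
 show "integrable lborel (%y. g y * (c0 / \<tau>^3))" using g by simp
 show "(%y. g y * hk \<tau> (x - y)) : borel_measurable lborel" by measurable
 have "\<bar>hk \<tau> z\<bar> <= \<bar>c0 / \<tau>^3\<bar>" for z using hk_le[OF t, of z] hk_pos[OF t, of z] abs_ge_self[of "c0 / \<tau>^3"] by linarith
 then show "AE y in lborel. norm (g y * hk \<tau> (x - y)) <= norm (g y * (c0 / \<tau>^3))"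
  by (intro AE_I2) (simp only: real_norm_def abs_mult mult_left_mono abs_ge_zero)
qed

text \<open>The reverse of the contraction. The Gaussian form of an indicator is at most the squared
  norm of its transform, since \<open>gs\<close> is at most 1, and Fatou bounds its limit below by
  the measure of the open set.\<close>

lemma norm_Hh_indicator:
 fixes U :: "r3 set"
 assumes U: "open U" "emeasure lborel U < \<infinity>"
 shows "norm (cl (indicator U)) <= norm (Hh (cl (indicator U)))"
proof -
 let ?g = "indicator U :: r3 => real"
 have [measurable]: "U : sets borel" using U by simp
 have l: "l12 ?g" using l12_indicator U by simp
 have gi: "integrable lborel ?g" using l by (simp add: l12_def)
 let ?t = "%n. 1 / (real n + 1)"
 let ?k = "%n x. (NB y. indicator U y * ennreal (hk (?t n) (x - y)))"
 have up: "(NB x. indicator U x * ?k n x) <= (NB x. ennreal ((h0 ?g x)^2))" for n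
 proof -
  have tp: "?t n > 0" by simp
  have hp: "0 <= hk (?t n) z" for z using hk_pos[OF tp, of z] by simp
  define K where "K x = (LB y. ?g y * hk (?t n) (x - y))" for x
  have kK: "?k n x = ennreal (K x)" for x
  proof -
   have "ennreal (K x) = (NB y. ennreal (?g y * hk (?t n) (x - y)))"
    unfolding K_def using hp by (intro nn_integral_eq_integral[symmetric] hk_conv_integrable[OF tp gi]) auto
   also have "... = ?k n x" by (intro nn_integral_cong) (simp add: indicator_def)
   finally show ?thesis by simp
  qed
  have K1: "ennreal (K x) <= 1" for x
  proof -
   have "?k n x <= (NB y. ennreal (hk (?t n) (x - y)))" by (intro nn_integral_mono) (simp add: indicator_def)
   then show ?thesis by (simp only: kK nn_hk[OF tp])
  qed
  have K0: "0 <= K x" for x unfolding K_def by (rule Bochner_Integration.integral_nonneg) (simp add: hp)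
  have Km [measurable]: "K : borel_measurable borel" unfolding K_def[abs_def] by measurable
  have Ki: "integrable lborel (%x. ?g x * K x)"
  proof (rule bint_bound[OF gi])
   show "AE x in lborel. norm (?g x * K x) <= norm (?g x)" using K1 K0 by (intro AE_I2) (auto simp: indicator_def)
  qed measurable
  have "(NB x. indicator U x * ?k n x) = (NB x. ennreal (?g x * K x))"
  proof (rule nn_integral_cong)
   fix x show "indicator U x * ?k n x = ennreal (?g x * K x)" unfolding kK by (cases "x : U") simp_all
  qed
  also have "... = ennreal (LB x. ?g x * K x)" by (rule nn_integral_eq_integral[OF Ki]) (use K0 in auto)
  also have "(LB x. ?g x * K x) = (LB Z. gs (?t n) Z * (h0 ?g Z)^2)"
   unfolding K_def using gaussian_form[OF tp gi gi] by (simp add: power2_eq_square)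
  also have "ennreal ... = (NB Z. ennreal (gs (?t n) Z * (h0 ?g Z)^2))"
   by (rule nn_integral_eq_integral[OF gs_h0_integrable[OF l tp], symmetric]) (simp add: gs_pos less_imp_le)
  also have "... <= (NB x. ennreal ((h0 ?g x)^2))"
   by (intro nn_integral_mono ennreal_leI) (simp add: mult_left_le_one_le gs_le1 gs_pos less_imp_le)
  finally show ?thesis .
 qed
 have "(NB x. ennreal ((?g x)^2)) = (NB x. indicator U x * 1)" by (intro nn_integral_cong) (simp add: indicator_def)
 also have "... <= (NB x. liminf (%n. indicator U x * ?k n x))"
 proof (rule nn_integral_mono)
  fix x show "indicator U x * 1 <= liminf (%n. indicator U x * ?k n x)"
   using gaussian_average_tendsto[OF U(1), of x] by (cases "x : U") auto
 qed
 also have "... <= liminf (%n. (NB x. indicator U x * ?k n x))"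
  by (rule nn_integral_liminf) measurable
 also have "... <= (NB x. ennreal ((h0 ?g x)^2))"
  by (rule Liminf_le) (use up in auto)
 finally have "norm (cl ?g) <= norm (cl (h0 ?g))"
  by (intro norm_cl_le_nn l2fun_h0 l) (use l in "auto simp: l12_def")
 then show ?thesis by (simp add: Hh_cl[OF l])
qed

text \<open>If a self-adjoint contraction H preserves the norm of x, then expanding |H H x - x|^2
  gives H H x = x. This settles indicators of open sets of finite measure, and testing with boxes
  settles every vector.\<close>

theorem Hh_involution: "Hh (Hh a) = a"
proof -
 have ind: "Hh (Hh (cl (indicator U))) = cl (indicator U)" if "open U" "emeasure lborel U < \<infinity>" for U :: "r3 set"
 proof -
  let ?g = "cl (indicator U)"
  have n: "norm (Hh ?g) = norm ?g" using norm_Hh_indicator[OF that] norm_Hh_le[of ?g] by simp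
  have "(norm (Hh (Hh ?g) - ?g))^2 = (norm (Hh (Hh ?g)))^2 - 2 * inner (Hh (Hh ?g)) ?g + (norm ?g)^2"
   by (simp add: power2_norm_eq_inner inner_diff_left inner_diff_right inner_commute)
  also have "inner (Hh (Hh ?g)) ?g = (norm (Hh ?g))^2" by (simp add: Hh_self_adjoint power2_norm_eq_inner)
  also have "(norm (Hh (Hh ?g)))^2 <= (norm ?g)^2" using norm_Hh_le[of "Hh ?g"] n by (simp add: power_mono)
  finally have "(norm (Hh (Hh ?g) - ?g))^2 <= 0" using n by simp
  then show ?thesis by simp
 qed
 define d where "d = a - Hh (Hh a)"
 have "(LB x. indicator (box u v) x * fn d x) = 0" for u v
 proof -
  have fin: "emeasure lborel (box u v) < \<infinity>" by (simp add: emeasure_lborel_box_eq)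
  have l: "l2fun (indicator (box u v))" using l12_indicator[OF _ fin] by (simp add: l12_def)
  have "(LB x. indicator (box u v) x * fn d x) = inner (cl (indicator (box u v))) d" by (simp add: inner_cl_left[OF l])
  also have "... = inner (cl (indicator (box u v))) a - inner (Hh (Hh (cl (indicator (box u v))))) a"
   by (simp add: d_def inner_diff_right Hh_self_adjoint)
  also have "... = 0" using ind[OF open_box fin] by simp
  finally show ?thesis .
 qed
 then have "d = 0" by (rule l2_zero_of_boxes)
 then show ?thesis by (simp add: d_def)
qed

lemma norm_Hh [simp]: "norm (Hh a) = norm a"
 by (metis norm_Hh_le Hh_involution order_antisym)

lemma inner_Hh: "inner (Hh a) (Hh b) = inner a b"
 by (simp add: Hh_self_adjoint Hh_involution)

section \<open>Multiplication by bounded functions\<close>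

definition bm :: "(r3 => real) => bool" where
 "bm m \<longleftrightarrow> m : borel_measurable borel & (EX C. ALL x. \<bar>m x\<bar> <= C)"

definition mul :: "(r3 => real) => l2 => l2" where "mul m a = cl (%x. m x * fn a x)"

lemma bmI: "m : borel_measurable borel ==> (!!x. \<bar>m x\<bar> <= C) ==> bm m" by (auto simp: bm_def)

lemma bm_mult: assumes "bm m" "bm k" shows "bm (%x. m x * k x)"
proof -
 obtain C D where "!!x. \<bar>m x\<bar> <= C" "!!x. \<bar>k x\<bar> <= D" using assms by (auto simp: bm_def)
 then have "\<bar>m x * k x\<bar> <= C * D" for x
  unfolding abs_mult by (intro mult_mono) (auto intro: order_trans[OF abs_ge_zero])
 then show ?thesis using assms by (auto simp: bm_def)
qed

lemma l2fun_mul: assumes "bm m" "l2fun f" shows "l2fun (%x. m x * f x)"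
proof -
 obtain C where C: "!!x. \<bar>m x\<bar> <= C" and [measurable]: "m : borel_measurable borel" using assms by (auto simp: bm_def)
 have [measurable]: "f : borel_measurable borel" using assms by (auto dest: l2fun_meas)
 show ?thesis
 proof (rule l2fun_bound[OF _ l2fun_scale[OF assms(2), of C]])
  show "AE x in lborel. \<bar>m x * f x\<bar> <= \<bar>C * f x\<bar>"
  proof (rule AE_I2)
   fix x have "\<bar>m x\<bar> <= \<bar>C\<bar>" using C[of x] by simp
   then show "\<bar>m x * f x\<bar> <= \<bar>C * f x\<bar>" unfolding abs_mult by (rule mult_right_mono) simp
  qed
 qed measurable
qed

lemma fn_mul: "bm m ==> AE x in lborel. fn (mul m a) x = m x * fn a x"
 unfolding mul_def by (rule fn_cl[OF l2fun_mul[OF _ l2fun_fn]])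

lemma mul_cl: assumes "bm m" "l2fun f" shows "mul m (cl f) = cl (%x. m x * f x)"
 by (rule l2_eqI) (use fn_mul[OF assms(1), of "cl f"] fn_cl[OF assms(2)] fn_cl[OF l2fun_mul[OF assms]] in "eventually_elim, simp")

lemma mul_mul: assumes "bm m" "bm k" shows "mul m (mul k a) = mul (%x. m x * k x) a"
 by (rule l2_eqI) (use fn_mul[OF assms(1), of "mul k a"] fn_mul[OF assms(2), of a] fn_mul[OF bm_mult[OF assms], of a] in "eventually_elim, simp")

lemma inner_mul: assumes "bm m" shows "inner (mul m a) b = (LB x. m x * (fn a x * fn b x))"
proof -
 have [measurable]: "m : borel_measurable borel" using assms by (auto simp: bm_def)
 show ?thesis unfolding inner_l2
 proof (rule integral_cong_AE)
  show "AE x in lborel. fn (mul m a) x * fn b x = m x * (fn a x * fn b x)"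
   using fn_mul[OF assms, of a] by eventually_elim simp
 qed measurable
qed

lemma bm_integrable: assumes "bm m" "integrable lborel w" shows "integrable lborel (%x. m x * w x)"
proof -
 obtain C where C: "!!x. \<bar>m x\<bar> <= C" and [measurable]: "m : borel_measurable borel" using assms by (auto simp: bm_def)
 have [measurable]: "w : borel_measurable borel" using assms by auto
 show ?thesis
 proof (rule bint_bound)
  show "integrable lborel (%x. C * w x)" using assms by simp
  show "AE x in lborel. norm (m x * w x) <= norm (C * w x)"
  proof (rule AE_I2)
   fix x have "\<bar>m x\<bar> <= \<bar>C\<bar>" using C[of x] by simp
   then show "norm (m x * w x) <= norm (C * w x)" unfolding real_norm_def abs_mult by (rule mult_right_mono) simp
  qed
 qed measurable
qed

lemma inner_mul_integrable: "bm m ==> integrable lborel (%x. m x * (fn a x * fn b x))"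
 by (rule bm_integrable[OF _ l2fun_mult_integrable[OF l2fun_fn l2fun_fn]])

lemma inner_mul_commute: "bm m ==> inner (mul m a) b = inner a (mul m b)"
 by (subst inner_commute[of a]) (simp add: inner_mul mult.commute)

lemma norm_mul_le: assumes m: "bm m" and C: "!!x. \<bar>m x\<bar> <= C" shows "norm (mul m a) <= C * norm a"
proof -
 have C0: "0 <= C" using C[of 0] by linarith
 have "(norm (mul m a))^2 = inner (mul (%x. m x * m x) a) a"
  using inner_mul_commute[OF m, of a "mul m a"] by (simp add: power2_norm_eq_inner mul_mul[OF m m] inner_commute)
 also have "... = (LB x. (m x * m x) * (fn a x * fn a x))" by (rule inner_mul[OF bm_mult[OF m m]])
 also have "... <= (LB x. C^2 * (fn a x * fn a x))"
 proof (rule integral_mono)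
  show "integrable lborel (%x. (m x * m x) * (fn a x * fn a x))" by (rule inner_mul_integrable[OF bm_mult[OF m m]])
  show "integrable lborel (%x. C^2 * (fn a x * fn a x))" using l2fun_mult_integrable[OF l2fun_fn l2fun_fn] by simp
  fix x
  have "\<bar>m x\<bar> * \<bar>m x\<bar> <= C * C" using C[of x] by (intro mult_mono) auto
  then have "m x * m x <= C^2" by (simp add: power2_eq_square)
  then show "(m x * m x) * (fn a x * fn a x) <= C^2 * (fn a x * fn a x)" by (rule mult_right_mono) simp
 qed
 also have "... = (C * norm a)^2" by (simp only: power_mult_distrib norm_l2_sq) (simp add: power2_eq_square)
 finally show ?thesis by (rule power2_le_imp_le) (simp add: C0)
qed

lemma mul_add: assumes "bm m" shows "mul m (a + b) = mul m a + mul m b"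
 by (rule l2_eqI) (use fn_mul[OF assms, of "a + b"] fn_mul[OF assms, of a] fn_mul[OF assms, of b] fn_plus[of a b] fn_plus[of "mul m a" "mul m b"]
  in "eventually_elim, simp add: distrib_left")

lemma mul_scale: assumes "bm m" shows "mul m (c *\<^sub>R a) = c *\<^sub>R mul m a"
 by (rule l2_eqI) (use fn_mul[OF assms, of "c *\<^sub>R a"] fn_mul[OF assms, of a] fn_scaleR[of c a] fn_scaleR[of c "mul m a"]
  in "eventually_elim, simp")

lemma bounded_linear_mul: assumes "bm m" shows "bounded_linear (mul m)"
proof -
 obtain C where C: "!!x. \<bar>m x\<bar> <= C" using assms by (auto simp: bm_def)
 show ?thesis
  by (rule bounded_linear_intro[of _ C]) (auto simp: mul_add[OF assms] mul_scale[OF assms] mult.commute intro: norm_mul_le[OF assms C])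
qed

lemma bounded_linear_Hh: "bounded_linear Hh"
 by (rule bounded_linear_intro[of _ 1]) (auto simp: Hh_add Hh_scale)

lemma bm_gs: "bm (gs \<tau>)"
 by (rule bmI[of _ 1]) (auto simp: gs_le1 less_imp_le[OF gs_pos] abs_of_pos[OF gs_pos])

section \<open>Positivity of the Bessel kernel\<close>

text \<open>For an even symbol \<open>m\<close>, the bilinear form of the Fourier multiplier with
  that symbol.\<close>

definition Qf :: "(r3 => real) => l2 => l2 => real" where "Qf m a b = inner (mul m (Hh a)) (Hh b)"

lemma Qf_commute: "bm m ==> Qf m a b = Qf m b a"
 unfolding Qf_def by (metis inner_mul_commute inner_commute)

lemma Qf_tendsto:
 assumes m: "bm m" and "(X \<longlongrightarrow> a) F" "(Y \<longlongrightarrow> b) F" shows "((%R. Qf m (X R) (Y R)) \<longlongrightarrow> Qf m a b) F"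
 unfolding Qf_def
 by (intro tendsto_inner bounded_linear.tendsto[OF bounded_linear_mul[OF m]] bounded_linear.tendsto[OF bounded_linear_Hh] assms)

definition gconv :: "real => (r3 => real) => r3 => real" where "gconv \<tau> g x = (LB y. g y * hk \<tau> (x - y))"

lemma gconv_meas [measurable]:
 assumes [measurable]: "g : borel_measurable borel" shows "gconv \<tau> g : borel_measurable borel"
 unfolding gconv_def[abs_def] by measurable

lemma gconv_prod_integrable:
 assumes t: "\<tau> > 0" and f: "integrable lborel f" and g: "integrable lborel g"
 shows "integrable lborel (%x. f x * gconv \<tau> g x)"
proof -
 have [measurable]: "f : borel_measurable borel" "g : borel_measurable borel" using f g by auto
 have "\<bar>gconv \<tau> g x\<bar> <= (LB y. \<bar>g y\<bar> * (c0 / \<tau>^3))" for x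
 proof -
  have "\<bar>gconv \<tau> g x\<bar> <= (LB y. \<bar>g y * hk \<tau> (x - y)\<bar>)" unfolding gconv_def by (rule integral_abs_bound)
  also have "... <= (LB y. \<bar>g y\<bar> * (c0 / \<tau>^3))"
  proof (rule integral_mono)
   show "integrable lborel (%y. \<bar>g y * hk \<tau> (x - y)\<bar>)" using hk_conv_integrable[OF t g] by (rule integrable_abs)
   show "integrable lborel (%y. \<bar>g y\<bar> * (c0 / \<tau>^3))" using g by simp
   fix y show "\<bar>g y * hk \<tau> (x - y)\<bar> <= \<bar>g y\<bar> * (c0 / \<tau>^3)"
    using hk_le[OF t, of "x - y"] hk_pos[OF t, of "x - y"] unfolding abs_mult by (intro mult_left_mono) auto
  qed
  finally show ?thesis .
 qed
 then have "bm (gconv \<tau> g)" by (intro bmI) measurable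
 from bm_integrable[OF this f] show ?thesis by (simp add: mult.commute)
qed

lemma Qf_gauss_l12:
 assumes t: "\<tau> > 0" and F: "l12 F" and G: "l12 G" shows "Qf (gs \<tau>) (cl F) (cl G) = (LB x. F x * gconv \<tau> G x)"
proof -
 have "Qf (gs \<tau>) (cl F) (cl G) = (LB x. gs \<tau> x * (fn (cl (h0 F)) x * fn (cl (h0 G)) x))"
  unfolding Qf_def Hh_cl[OF F] Hh_cl[OF G] by (rule inner_mul[OF bm_gs])
 also have "... = (LB x. gs \<tau> x * (h0 F x * h0 G x))"
 proof (rule integral_cong_AE)
  have [measurable]: "F : borel_measurable borel" "G : borel_measurable borel" using F G by (auto simp: l12_def)
  show "AE x in lborel. gs \<tau> x * (fn (cl (h0 F)) x * fn (cl (h0 G)) x) = gs \<tau> x * (h0 F x * h0 G x)"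
   using fn_cl[OF l2fun_h0[OF F]] fn_cl[OF l2fun_h0[OF G]] by eventually_elim simp
  show "(%x. gs \<tau> x * (h0 F x * h0 G x)) : borel_measurable lborel" by measurable
 qed measurable
 also have "... = (LB x. F x * gconv \<tau> G x)"
  unfolding gconv_def by (rule gaussian_form[OF t]) (use F G in "auto simp: l12_def")
 finally show ?thesis .
qed

text \<open>Both parts express that the convolution kernel of \<open>m\<close> is nonnegative: a
  Cauchy-Schwarz inequality for products, and positivity on nonnegative densities. As no kernel is
  mentioned, the property passes to mixtures of Gaussians.\<close>

definition pform :: "(r3 => real) => bool" where
 "pform m \<longleftrightarrow> (ALL f g. f : borel_measurable borel --> g : borel_measurable borel --> l2fun (%x. (f x)^2) --> l2fun (%x. (g x)^2) -->
   l2fun (%x. f x * g x) -->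
   Qf m (cl (%x. f x * g x)) (cl (%x. f x * g x)) <= Qf m (cl (%x. (f x)^2)) (cl (%x. (g x)^2)))
  & (ALL p q. l2fun p --> l2fun q --> (ALL x. 0 <= p x) --> (ALL x. 0 <= q x) --> 0 <= Qf m (cl p) (cl q))"

text \<open>Twice the difference of the two sides is the double integral of (f(x) g(y) - g(x)
  f(y))^2 against the positive kernel.\<close>

lemma Qf_gauss_l12_prod:
 assumes t: "\<tau> > 0" and l: "l12 (%x. (f x)^2)" "l12 (%x. (g x)^2)" "l12 (%x. f x * g x)"
 shows "Qf (gs \<tau>) (cl (%x. f x * g x)) (cl (%x. f x * g x)) <= Qf (gs \<tau>) (cl (%x. (f x)^2)) (cl (%x. (g x)^2))"
proof -
 let ?F = "%x. (f x)^2" and ?G = "%x. (g x)^2" and ?P = "%x. f x * g x"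
 have i: "integrable lborel ?F" "integrable lborel ?G" "integrable lborel ?P" using l by (auto simp: l12_def)
 have "0 <= (LB x. (?F x * gconv \<tau> ?G x + ?G x * gconv \<tau> ?F x) - 2 * (?P x * gconv \<tau> ?P x))"
 proof (rule Bochner_Integration.integral_nonneg)
  fix x
  have "(?F x * gconv \<tau> ?G x + ?G x * gconv \<tau> ?F x) - 2 * (?P x * gconv \<tau> ?P x)
   = (LB y. (?F x * (?G y * hk \<tau> (x - y)) + ?G x * (?F y * hk \<tau> (x - y))) - 2 * (?P x * (?P y * hk \<tau> (x - y))))"
   unfolding gconv_def using hk_conv_integrable[OF t i(1), of x] hk_conv_integrable[OF t i(2), of x] hk_conv_integrable[OF t i(3), of x]
   by simp
  also have "... >= 0"
  proof (rule Bochner_Integration.integral_nonneg)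
   fix y
   have "(?F x * (?G y * hk \<tau> (x - y)) + ?G x * (?F y * hk \<tau> (x - y))) - 2 * (?P x * (?P y * hk \<tau> (x - y)))
     = (f x * g y - g x * f y)^2 * hk \<tau> (x - y)" by (simp add: power2_eq_square algebra_simps)
   then show "0 <= (?F x * (?G y * hk \<tau> (x - y)) + ?G x * (?F y * hk \<tau> (x - y))) - 2 * (?P x * (?P y * hk \<tau> (x - y)))"
    using hk_pos[OF t, of "x - y"] by simp
  qed
  finally show "0 <= (?F x * gconv \<tau> ?G x + ?G x * gconv \<tau> ?F x) - 2 * (?P x * gconv \<tau> ?P x)" .
 qed
 also have "... = (LB x. ?F x * gconv \<tau> ?G x) + (LB x. ?G x * gconv \<tau> ?F x) - 2 * (LB x. ?P x * gconv \<tau> ?P x)"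
  using gconv_prod_integrable[OF t i(1) i(2)] gconv_prod_integrable[OF t i(2) i(1)] gconv_prod_integrable[OF t i(3) i(3)] by simp
 also have "... = Qf (gs \<tau>) (cl ?F) (cl ?G) + Qf (gs \<tau>) (cl ?G) (cl ?F) - 2 * Qf (gs \<tau>) (cl ?P) (cl ?P)"
  by (simp only: Qf_gauss_l12[OF t l(1) l(2)] Qf_gauss_l12[OF t l(2) l(1)] Qf_gauss_l12[OF t l(3) l(3)])
 finally show ?thesis using Qf_commute[OF bm_gs, of \<tau> "cl ?G" "cl ?F"] by simp
qed

lemma pform_gs: assumes t: "\<tau> > 0" shows "pform (gs \<tau>)"
 unfolding pform_def
proof (intro conjI allI impI)
 fix f g :: "r3 => real"
 assume l: "l2fun (%x. (f x)^2)" "l2fun (%x. (g x)^2)" "l2fun (%x. f x * g x)"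
 have e: "tr R (%x. (f x)^2) = (%x. (tr R f x)^2)" "tr R (%x. f x * g x) = (%x. tr R f x * tr R g x)" for R f g
  by (auto simp: tr_def indicator_def)
 have "Qf (gs \<tau>) (cl (tr R (%x. f x * g x))) (cl (tr R (%x. f x * g x)))
  <= Qf (gs \<tau>) (cl (tr R (%x. (f x)^2))) (cl (tr R (%x. (g x)^2)))" for R
  unfolding e by (rule Qf_gauss_l12_prod[OF t]) (use l12_tr[OF l(1), of R] l12_tr[OF l(2), of R] l12_tr[OF l(3), of R] in "simp_all add: e")
 then show "Qf (gs \<tau>) (cl (%x. f x * g x)) (cl (%x. f x * g x)) <= Qf (gs \<tau>) (cl (%x. (f x)^2)) (cl (%x. (g x)^2))"
  by (intro tendsto_le[OF trivial_limit_at_top_linorder Qf_tendsto[OF bm_gs tr_tendsto[OF l(1)] tr_tendsto[OF l(2)]]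
     Qf_tendsto[OF bm_gs tr_tendsto[OF l(3)] tr_tendsto[OF l(3)]]] always_eventually allI)
next
 fix p q :: "r3 => real"
 assume l: "l2fun p" "l2fun q" and pq: "ALL x. 0 <= p x" "ALL x. 0 <= q x"
 have "0 <= Qf (gs \<tau>) (cl (tr R p)) (cl (tr R q))" for R
  unfolding Qf_gauss_l12[OF t l12_tr[OF l(1)] l12_tr[OF l(2)]] gconv_def
  using pq hk_pos[OF t] by (intro Bochner_Integration.integral_nonneg mult_nonneg_nonneg) (auto simp: tr_def less_imp_le)
 then show "0 <= Qf (gs \<tau>) (cl p) (cl q)"
  by (intro tendsto_lowerbound[OF Qf_tendsto[OF bm_gs tr_tendsto[OF l(1)] tr_tendsto[OF l(2)]]] always_eventually allI) auto
qed

text \<open>The symbol of (I - \<Delta>)^(-t). A Bessel potential of order s therefore belongs to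
  \<open>kap (s/2)\<close>.\<close>

definition kap :: "real => r3 => real" where "kap t Z = (1 + (norm Z)^2) powr (- t)"

lemma one_plus_ge: "1 <= 1 + (norm (Z::r3))^2" by simp

lemma kap_bounds: assumes "0 <= t" shows "0 < kap t Z" "kap t Z <= 1"
proof -
 have p: "1 + (norm Z)^2 ~= 0" using one_plus_ge[of Z] by linarith
 show "0 < kap t Z" using p by (simp only: kap_def powr_gt_zero simp_thms)
 have "(1 + (norm Z)^2) powr (- t) <= (1 + (norm Z)^2) powr 0" using assms by (intro powr_mono) auto
 then show "kap t Z <= 1" using p by (simp only: kap_def powr_zero_eq_one if_False)
qed

lemma bm_kap: "0 <= t ==> bm (kap t)"
 by (rule bmI[of _ 1]) (use kap_bounds in "auto simp: kap_def[abs_def] abs_of_pos")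

text \<open>The Gamma density, which serves as the mixing measure over Gaussians.\<close>

definition rho :: "real => real => real" where
 "rho t \<sigma> = indicator {0<..} \<sigma> * (\<sigma> powr (t - 1) * exp (- \<sigma>)) / Gamma t"

lemma rho_meas [measurable]: "rho t : borel_measurable borel" unfolding rho_def[abs_def] by measurable

lemma rho_nonneg: "0 < t ==> 0 <= rho t \<sigma>"
 unfolding rho_def using Gamma_real_pos[of t] by (auto simp: indicator_def)

text \<open>The Gamma integral for \<lambda>^(-t) at \<lambda> = 1 + |Z|^2. The width
  sqrt(2\<sigma>) makes \<open>gs\<close> equal to exp(-\<sigma> |Z|^2).\<close>

lemma kap_subordination:
 assumes t: "0 < t"
 shows "(NB \<sigma>. ennreal (rho t \<sigma> * gs (sqrt (2 * \<sigma>)) Z)) = ennreal (kap t Z)"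
proof -
 define c where "c = 1 + (norm Z)^2"
 have c: "c >= 1" "c > 0" by (auto simp: c_def intro: add_pos_nonneg)
 have G: "Gamma t > 0" using t by (rule Gamma_real_pos)
 let ?f = "%\<sigma>. ennreal (indicator {0..} \<sigma> * \<sigma> powr (t - 1) / exp \<sigma>)"
 have "ennreal (Gamma t) = ennreal \<bar>c\<bar> * (NB \<sigma>. ?f (0 + c * \<sigma>))"
  unfolding Gamma_conv_nn_integral_real[OF t] by (rule nn_integral_real_affine) (use c in auto)
 then have "ennreal (1 / Gamma t * c powr (-t)) * ennreal (Gamma t)
   = (ennreal (1 / Gamma t * c powr (-t)) * ennreal \<bar>c\<bar>) * (NB \<sigma>. ?f (0 + c * \<sigma>))"
  by (simp add: mult.assoc)
 also have "ennreal (1 / Gamma t * c powr (-t)) * ennreal (Gamma t) = ennreal (c powr (-t))"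
  using G by (simp flip: ennreal_mult)
 also have "ennreal (1 / Gamma t * c powr (-t)) * ennreal \<bar>c\<bar> = ennreal (1 / Gamma t * c powr (1 - t))"
  using G c by (simp add: powr_diff powr_minus field_simps flip: ennreal_mult)
 also have "ennreal (1 / Gamma t * c powr (1 - t)) * (NB \<sigma>. ?f (0 + c * \<sigma>))
   = (NB \<sigma>. ennreal (1 / Gamma t * c powr (1 - t)) * ?f (0 + c * \<sigma>))"
  by (rule nn_integral_cmult[symmetric]) measurable
 also have "... = (NB \<sigma>. ennreal (rho t \<sigma> * gs (sqrt (2 * \<sigma>)) Z))"
 proof (rule nn_integral_cong_AE)
  show "AE \<sigma> in lborel. ennreal (1 / Gamma t * c powr (1 - t)) * ?f (0 + c * \<sigma>) = ennreal (rho t \<sigma> * gs (sqrt (2 * \<sigma>)) Z)"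
   using AE_lborel_singleton[of "0::real"]
  proof eventually_elim
   fix \<sigma> :: real assume n: "\<sigma> ~= 0"
   show "ennreal (1 / Gamma t * c powr (1 - t)) * ?f (0 + c * \<sigma>) = ennreal (rho t \<sigma> * gs (sqrt (2 * \<sigma>)) Z)"
   proof (cases "\<sigma> > 0")
    case True
    have "1 / Gamma t * c powr (1 - t) * (1 * (c * \<sigma>) powr (t - 1) / exp (c * \<sigma>))
      = (c powr (1 - t) * c powr (t - 1)) * (\<sigma> powr (t - 1) * exp (- (c * \<sigma>))) / Gamma t"
     using True c by (simp add: powr_mult exp_minus field_simps)
    also have "c powr (1 - t) * c powr (t - 1) = 1" using c by (simp flip: powr_add)
    also have "exp (- (c * \<sigma>)) = exp (- \<sigma>) * gs (sqrt (2 * \<sigma>)) Z"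
     using True by (simp add: gs_def c_def power2_norm_eq_inner algebra_simps flip: exp_add)
    finally have e: "1 / Gamma t * c powr (1 - t) * (1 * (c * \<sigma>) powr (t - 1) / exp (c * \<sigma>)) = rho t \<sigma> * gs (sqrt (2 * \<sigma>)) Z"
     using True by (simp add: rho_def)
    have ind: "indicator {0..} (0 + c * \<sigma>) = (1::real)" using True c by simp
    show ?thesis unfolding ind using e G c by (simp flip: ennreal_mult)
   next
    case False
    then have "c * \<sigma> < 0" "~ 0 < \<sigma>" using n c by (auto simp: mult_less_0_iff)
    then show ?thesis by (simp add: rho_def)
   qed
  qed
 qed
 finally show ?thesis by (simp add: kap_def c_def)
qed

lemma integral_nonneg_iff_nn:
 fixes f :: "'a => real" assumes "integrable M f"
 shows "0 <= integral\<^sup>L M f \<longleftrightarrow> (\<integral>\<^sup>+x. ennreal (- f x) \<partial>M) <= (\<integral>\<^sup>+x. ennreal (f x) \<partial>M)"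
proof -
 have fin: "(\<integral>\<^sup>+x. ennreal (f x) \<partial>M) < \<infinity>" "(\<integral>\<^sup>+x. ennreal (- f x) \<partial>M) < \<infinity>"
  using integrableD(2)[OF assms] integrableD(2)[OF integrable_minus[OF assms]]
  by (auto intro!: le_less_trans[OF nn_integral_mono] simp: ennreal_leI less_top)
 have "integral\<^sup>L M f = enn2real (\<integral>\<^sup>+x. ennreal (f x) \<partial>M) - enn2real (\<integral>\<^sup>+x. ennreal (- f x) \<partial>M)"
  by (rule real_lebesgue_integral_def[OF assms])
 then show ?thesis using fin
  by (cases "\<integral>\<^sup>+x. ennreal (f x) \<partial>M"; cases "\<integral>\<^sup>+x. ennreal (- f x) \<partial>M") (auto simp: ennreal_le_iff top_unique)
qed

text \<open>Positivity for each Gaussian is averaged over the mixture. Positive and negative parts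
  are compared as nonnegative integrals, so Tonelli suffices for the exchange.\<close>

lemma kap_nonneg_of_gauss:
 assumes t: "0 < t" and w: "integrable lborel w" and g: "!!\<tau>. \<tau> > 0 ==> 0 <= (LB Z. gs \<tau> Z * w Z)"
 shows "0 <= (LB Z. kap t Z * w Z)"
proof -
 have [measurable]: "w : borel_measurable borel" using w by auto
 have "(NB Z. ennreal (kap t Z * v Z)) = (NB \<sigma>. ennreal (rho t \<sigma>) * (NB Z. ennreal (gs (sqrt (2 * \<sigma>)) Z * v Z)))"
  if [measurable]: "v : borel_measurable borel" for v
 proof -
  have "(%p. gs (sqrt (2 * fst p)) (snd p)) : borel_measurable (lborel \<Otimes>\<^sub>M lborel)" unfolding gs_def by measurable
  then have gm [measurable]: "(%(\<sigma>, Z). gs (sqrt (2 * \<sigma>)) Z) : borel_measurable (borel \<Otimes>\<^sub>M borel)" by (simp add: case_prod_unfold)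
  have "(NB Z. ennreal (kap t Z * v Z)) = (NB Z. (NB \<sigma>. ennreal (rho t \<sigma> * gs (sqrt (2 * \<sigma>)) Z) * ennreal (v Z)))"
  proof (rule nn_integral_cong)
   fix Z
   have "ennreal (kap t Z * v Z) = ennreal (kap t Z) * ennreal (v Z)" using kap_bounds[of t Z] t by (simp add: ennreal_mult')
   also have "... = (NB \<sigma>. ennreal (rho t \<sigma> * gs (sqrt (2 * \<sigma>)) Z) * ennreal (v Z))"
    unfolding kap_subordination[OF t, symmetric] by (rule nn_integral_multc[symmetric]) (unfold gs_def, measurable)
   finally show "ennreal (kap t Z * v Z) = (NB \<sigma>. ennreal (rho t \<sigma> * gs (sqrt (2 * \<sigma>)) Z) * ennreal (v Z))" .
  qed
  also have "... = (NB \<sigma>. (NB Z. ennreal (rho t \<sigma> * gs (sqrt (2 * \<sigma>)) Z) * ennreal (v Z)))"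
   by (rule lborel_pair.Fubini') (unfold gs_def, measurable)
  also have "... = (NB \<sigma>. ennreal (rho t \<sigma>) * (NB Z. ennreal (gs (sqrt (2 * \<sigma>)) Z * v Z)))"
  proof (rule nn_integral_cong)
   fix \<sigma>
   have "ennreal (rho t \<sigma> * gs (sqrt (2 * \<sigma>)) Z) * ennreal (v Z) = ennreal (rho t \<sigma>) * ennreal (gs (sqrt (2 * \<sigma>)) Z * v Z)" for Z
    using rho_nonneg[OF t, of \<sigma>] gs_pos[of "sqrt (2 * \<sigma>)" Z] by (simp add: ennreal_mult' mult.assoc)
   then show "(NB Z. ennreal (rho t \<sigma> * gs (sqrt (2 * \<sigma>)) Z) * ennreal (v Z))
    = ennreal (rho t \<sigma>) * (NB Z. ennreal (gs (sqrt (2 * \<sigma>)) Z * v Z))"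
    by (simp only:) (rule nn_integral_cmult, measurable)
  qed
  finally show ?thesis .
 qed
 note rep = this
 have le: "(NB Z. ennreal (gs (sqrt (2 * \<sigma>)) Z * - w Z)) <= (NB Z. ennreal (gs (sqrt (2 * \<sigma>)) Z * w Z))" if "\<sigma> > 0" for \<sigma>
  using integral_nonneg_iff_nn[OF bm_integrable[OF bm_gs w, of "sqrt (2 * \<sigma>)"]] g[of "sqrt (2 * \<sigma>)"] that by simp
 have "(NB Z. ennreal (kap t Z * - w Z)) <= (NB Z. ennreal (kap t Z * w Z))"
 proof -
  have m: "w : borel_measurable borel" "(%Z. - w Z) : borel_measurable borel" by measurable
  show ?thesis unfolding rep[OF m(1)] rep[OF m(2)]
 proof (rule nn_integral_mono)
  fix \<sigma>
  show "ennreal (rho t \<sigma>) * (NB Z. ennreal (gs (sqrt (2 * \<sigma>)) Z * - w Z))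
    <= ennreal (rho t \<sigma>) * (NB Z. ennreal (gs (sqrt (2 * \<sigma>)) Z * w Z))"
   using le[of \<sigma>] by (cases "\<sigma> > 0") (auto simp: rho_def intro!: mult_left_mono)
 qed
 qed
 then show ?thesis using integral_nonneg_iff_nn[OF bm_integrable[OF bm_kap w, of t]] t by simp
qed

lemma pform_kap: assumes t: "0 < t" shows "pform (kap t)"
proof -
 have bk: "bm (kap t)" using bm_kap t by simp
 have key: "Qf (kap t) a b <= Qf (kap t) c d" if "!!\<tau>. \<tau> > 0 ==> Qf (gs \<tau>) a b <= Qf (gs \<tau>) c d" for a b c d
 proof -
  let ?w = "%x. fn (Hh c) x * fn (Hh d) x - fn (Hh a) x * fn (Hh b) x"
  have i: "integrable lborel (%x. fn (Hh c) x * fn (Hh d) x)" "integrable lborel (%x. fn (Hh a) x * fn (Hh b) x)"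
   by (rule l2fun_mult_integrable[OF l2fun_fn l2fun_fn])+
  have e: "(LB x. m x * ?w x) = Qf m c d - Qf m a b" if "bm m" for m
   unfolding Qf_def inner_mul[OF that] right_diff_distrib
   by (rule bintegral_diff) (rule bm_integrable[OF that i(1)], rule bm_integrable[OF that i(2)])
  have "0 <= (LB x. kap t x * ?w x)"
   by (rule kap_nonneg_of_gauss[OF t]) (use i that in "auto simp: e[OF bm_gs]")
  then show ?thesis by (simp add: e[OF bk])
 qed
 have z: "Qf m 0 b = 0" if "bm m" for m b
  using bounded_linear.linear[OF bounded_linear_mul[OF that]] bounded_linear.linear[OF bounded_linear_Hh] by (simp add: Qf_def linear_0)
 show ?thesis unfolding pform_def
 proof (intro conjI allI impI)
  fix f g :: "r3 => real"
  assume "f : borel_measurable borel" "g : borel_measurable borel" "l2fun (%x. (f x)^2)" "l2fun (%x. (g x)^2)" "l2fun (%x. f x * g x)"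
  then show "Qf (kap t) (cl (%x. f x * g x)) (cl (%x. f x * g x)) <= Qf (kap t) (cl (%x. (f x)^2)) (cl (%x. (g x)^2))"
   using pform_gs unfolding pform_def by (intro key) blast
 next
  fix p q :: "r3 => real"
  assume a: "l2fun p" "l2fun q" "ALL x. 0 <= p x" "ALL x. 0 <= q x"
  have "Qf (gs \<tau>) 0 0 <= Qf (gs \<tau>) (cl p) (cl q)" if "\<tau> > 0" for \<tau>
   using pform_gs[OF that] a unfolding pform_def z[OF bm_gs] by blast
  from key[OF this] show "0 <= Qf (kap t) (cl p) (cl q)" by (simp add: z[OF bk])
 qed
qed

section \<open>Fourier transform and Sobolev spaces through the Hartley transform\<close>

text \<open>The bridge between the Lebesgue measurable functions of the statement and the classes in
  \<open>l2\<close>, whose members are Borel functions.\<close>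

definition is_rep :: "(r3 => real) => l2 => bool" where
 "is_rep u a \<longleftrightarrow> u : borel_measurable lebesgue & (AE x in lebesgue. u x = fn a x)"

lemma lebesgue_meas [intro]: "f : borel_measurable (borel :: r3 measure) ==> f : borel_measurable lebesgue"
 by (simp add: measurable_completion)

lemma AE_lebesgue: "AE x in lborel. P x ==> AE x in lebesgue. P x"
 by (rule AE_completion)

lemma lp2_nn: "(\<integral>\<^sup>+ x. ennreal (\<bar>f x\<bar> powr 2) \<partial>M) = (\<integral>\<^sup>+ x. ennreal ((f x)^2) \<partial>M)"
proof (rule nn_integral_cong)
 fix x
 show "ennreal (\<bar>f x\<bar> powr 2) = ennreal ((f x)^2)"
  by (cases "f x = 0") (simp_all add: powr_numeral)
qed

lemma is_rep_fn: "is_rep (fn a) a" by (auto simp: is_rep_def)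

lemma lp2_iff: "lp 2 u \<longleftrightarrow> (EX a. is_rep u a)"
proof
 assume u: "lp 2 u"
 obtain g where g: "g : borel_measurable lborel" "AE x in lborel. u x = g x"
  using completion_ex_borel_measurable_real[of u lborel] u by (auto simp: lp_def)
 have gb: "g : borel_measurable borel" using g(1) by simp
 have "(NB x. ennreal ((g x)^2)) = (NB x. ennreal ((u x)^2))"
  by (rule nn_integral_cong_AE) (use g(2) in "eventually_elim, simp")
 also have "... < \<infinity>" using u by (simp add: lp_def lp2_nn nn_integral_completion)
 finally have l: "l2fun g" using gb by (simp add: l2fun_nn)
 have "AE x in lborel. u x = fn (cl g) x" using g(2) fn_cl[OF l] by eventually_elim simp
 then have "is_rep u (cl g)" using u by (auto simp: is_rep_def lp_def intro: AE_lebesgue)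
 then show "EX a. is_rep u a" ..
next
 assume "EX a. is_rep u a"
 then obtain a where a: "is_rep u a" ..
 have "(\<integral>\<^sup>+ x. ennreal ((u x)^2) \<partial>lebesgue) = (\<integral>\<^sup>+ x. ennreal ((fn a x)^2) \<partial>lebesgue)"
  by (rule nn_integral_cong_AE) (use a in "auto simp: is_rep_def")
 also have "... < \<infinity>" by (simp add: nn_integral_completion nn_integral_norm_l2)
 finally show "lp 2 u" using a by (simp add: lp_def lp2_nn is_rep_def)
qed

lemma leb_integral:
 fixes f h :: "r3 => 'b::{banach, second_countable_topology}"
 assumes "h : borel_measurable lebesgue" "f : borel_measurable borel" "AE x in lebesgue. h x = f x"
 shows "(\<integral>x. h x \<partial>lebesgue) = (LB x. f x)"
proof -
 have "(\<integral>x. h x \<partial>lebesgue) = (\<integral>x. f x \<partial>lebesgue)"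
  by (rule integral_cong_AE) (use assms in auto)
 also have "... = (LB x. f x)" by (rule integral_completion) (use assms in simp)
 finally show ?thesis .
qed

lemma leb_integrable:
 fixes f h :: "r3 => 'b::{banach, second_countable_topology}"
 assumes "h : borel_measurable lebesgue" "f : borel_measurable borel" "AE x in lebesgue. h x = f x"
 shows "integrable lebesgue h \<longleftrightarrow> integrable lborel f"
proof -
 have "integrable lebesgue h \<longleftrightarrow> integrable lebesgue f"
  by (rule integrable_cong_AE) (use assms in auto)
 also have "... \<longleftrightarrow> integrable lborel f" by (rule integrable_completion) (use assms in simp)
 finally show ?thesis .
qed

text \<open>Turns the Hartley transform of a real function into its Fourier transform.\<close>
definition Ef :: "(r3 => real) => r3 => complex" where
 "Ef p Z = Complex ((p Z + p (- Z)) / 2) ((p (- Z) - p Z) / 2)"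

lemma Ef_cmod: "(cmod (Ef p Z))^2 = ((p Z)^2 + (p (- Z))^2) / 2"
 unfolding cmod_power2 Ef_def by (simp add: power2_eq_square field_simps)

lemma Ef_diff: "Ef p Z - Ef q Z = Ef (%x. p x - q x) Z"
 by (simp add: Ef_def complex_eq_iff diff_divide_distrib add_divide_distrib)

lemma Ef_recover: "p Z = Re (Ef p Z) - Im (Ef p Z)" by (simp add: Ef_def field_simps)

lemma Ef_meas [measurable]:
 assumes [measurable]: "p : borel_measurable borel" shows "Ef p : borel_measurable borel"
proof -
 have "Ef p = (%Z. complex_of_real ((p Z + p (- Z)) / 2) + \<i> * complex_of_real ((p (- Z) - p Z) / 2))"
  by (auto simp: Ef_def complex_eq_iff)
 then show ?thesis by simp
qed

lemma nn_integral_uminus3: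
 assumes [measurable]: "F : borel_measurable borel" shows "(NB Z. F (- Z)) = (NB Z. F (Z::r3))"
 using nn_integral_reflect[OF assms, of 0] by simp

text \<open>|Ef p|^2 is the mean of p^2 at Z and -Z, which an even weight cannot tell apart.\<close>

lemma nn_Ef:
 assumes [measurable]: "p : borel_measurable borel" "m : borel_measurable borel" and m: "!!Z. m (- Z) = m Z" "!!Z. 0 <= m Z"
 shows "(NB Z. ennreal (m Z * (cmod (Ef p Z))^2)) = (NB Z. ennreal (m Z * (p Z)^2))"
proof -
 have "(NB Z. ennreal (m Z * (cmod (Ef p Z))^2))
  = (NB Z. ennreal (m Z * (p Z)^2 / 2) + ennreal (m (- Z) * (p (- Z))^2 / 2))"
 proof (rule nn_integral_cong)
  fix Z
  have "m Z * (cmod (Ef p Z))^2 = m Z * (p Z)^2 / 2 + m (- Z) * (p (- Z))^2 / 2"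
   by (simp add: Ef_cmod m(1) field_simps)
  then show "ennreal (m Z * (cmod (Ef p Z))^2) = ennreal (m Z * (p Z)^2 / 2) + ennreal (m (- Z) * (p (- Z))^2 / 2)"
   using m(2) by (simp only:) (rule ennreal_plus, simp_all)
 qed
 also have "... = (NB Z. ennreal (m Z * (p Z)^2 / 2)) + (NB Z. ennreal (m (- Z) * (p (- Z))^2 / 2))"
  by (rule nn_integral_add) measurable
 also have "(NB Z. ennreal (m (- Z) * (p (- Z))^2 / 2)) = (NB Z. ennreal (m Z * (p Z)^2 / 2))"
  by (rule nn_integral_uminus3[of "%Z. ennreal (m Z * (p Z)^2 / 2)"]) measurable
 also have "(NB Z. ennreal (m Z * (p Z)^2 / 2)) + (NB Z. ennreal (m Z * (p Z)^2 / 2))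
  = (NB Z. ennreal (m Z * (p Z)^2 / 2) + ennreal (m Z * (p Z)^2 / 2))"
  by (rule nn_integral_add[symmetric]) measurable
 also have "... = (NB Z. ennreal (m Z * (p Z)^2))"
  using m(2) by (intro nn_integral_cong) (simp flip: ennreal_plus)
 finally show ?thesis .
qed

lemma fourier_l1_Ef:
 assumes h: "h : borel_measurable lebesgue" "AE x in lebesgue. h x = g x" and g: "integrable lborel g"
 shows "fourier_l1 h Z = Ef (h0 g) Z"
proof -
 have [measurable]: "g : borel_measurable borel" using g by auto
 have [measurable]: "cis : borel_measurable borel" by (intro borel_measurable_continuous_onI continuous_intros)
 have hm: "(%x. complex_of_real (h x) * cis (- (Z \<bullet> x))) : borel_measurable lebesgue"
 proof (rule borel_measurable_times)
  show "(%x. complex_of_real (h x)) : borel_measurable lebesgue" using h(1) by measurable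
  show "(%x. cis (- (Z \<bullet> x))) : borel_measurable lebesgue" by (rule lebesgue_meas) measurable
 qed
 let ?k = "%x. complex_of_real (g x) * cis (- (Z \<bullet> x))"
 have k: "integrable lborel ?k"
  by (rule bint_bound[OF g]) (measurable, simp add: norm_mult)
 have e: "(\<integral>x. complex_of_real (h x) * cis (- (Z \<bullet> x)) \<partial>lebesgue) = (LB x. ?k x)"
  by (rule leb_integral[OF hm]) (measurable, use h(2) in "eventually_elim, simp")
 have R: "Re (LB x. ?k x) = (LB x. g x * cos (Z \<bullet> x))" using integral_Re[OF k] by simp
 have I: "Im (LB x. ?k x) = - (LB x. g x * sin (Z \<bullet> x))" using integral_Im[OF k] by simp
 have ic: "integrable lborel (%x. g x * cos (Z \<bullet> x))" using integrable_Re[OF k] by simp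
 have isn: "integrable lborel (%x. g x * sin (Z \<bullet> x))" using integrable_Im[OF k] by simp
 have p: "h0 g Z = c0 * ((LB x. g x * cos (Z \<bullet> x)) + (LB x. g x * sin (Z \<bullet> x)))"
  unfolding h0_def cas_def distrib_left[of "g _"] by (simp only: bintegral_add[OF ic isn])
 have m: "h0 g (- Z) = c0 * ((LB x. g x * cos (Z \<bullet> x)) - (LB x. g x * sin (Z \<bullet> x)))"
  unfolding h0_def cas_def inner_minus_left cos_minus sin_minus distrib_left[of "g _"] mult_minus_right
  using bintegral_diff[OF ic isn] by simp
 show ?thesis
  unfolding fourier_l1_def e
  by (rule complex_eqI) (simp_all add: R I Ef_def p m c0_def field_simps)
qed

lemma is_fourier_Ef:
 assumes u: "is_rep u a" shows "is_fourier u (Ef (fn (Hh a)))"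
 unfolding is_fourier_def
proof
 show "Ef (fn (Hh a)) : borel_measurable lebesgue" by (rule lebesgue_meas) measurable
 have "(\<integral>\<^sup>+ Z. ennreal ((cmod (fourier_l1 (%x. indicator (ball 0 R) x * u x) Z - Ef (fn (Hh a)) Z))^2) \<partial>lebesgue)
   = ennreal ((norm (hc (tr R (fn a)) - Hh a))^2)" for R
 proof -
  have l: "l12 (tr R (fn a))" by (rule l12_tr_fn)
  have [measurable]: "tr R (fn a) : borel_measurable borel" using l by (auto simp: l12_def)
  have m: "(%x. indicator (ball 0 R) x * u x) : borel_measurable lebesgue"
   by (rule borel_measurable_times, rule lebesgue_meas, rule borel_measurable_indicator) (use u in "auto simp: is_rep_def")
  have ae: "AE x in lebesgue. indicator (ball 0 R) x * u x = tr R (fn a) x"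
   using u unfolding is_rep_def tr_def by (auto elim: eventually_mono)
  have "fourier_l1 (%x. indicator (ball 0 R) x * u x) Z - Ef (fn (Hh a)) Z = Ef (%x. h0 (tr R (fn a)) x - fn (Hh a) x) Z" for Z
   using fourier_l1_Ef[OF m ae] l by (simp add: l12_def Ef_diff)
  then have "(\<integral>\<^sup>+ Z. ennreal ((cmod (fourier_l1 (%x. indicator (ball 0 R) x * u x) Z - Ef (fn (Hh a)) Z))^2) \<partial>lebesgue)
    = (NB Z. ennreal (1 * (cmod (Ef (%x. h0 (tr R (fn a)) x - fn (Hh a) x) Z))^2))"
   by (simp add: nn_integral_completion)
  also have "... = (NB Z. ennreal (1 * (h0 (tr R (fn a)) Z - fn (Hh a) Z)^2))"
   by (rule nn_Ef) auto
  also have "... = (NB Z. ennreal ((fn (hc (tr R (fn a))) Z - fn (Hh a) Z)^2))"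
   unfolding hc_def by (rule nn_integral_cong_AE) (use fn_cl[OF l2fun_h0[OF l]] in "eventually_elim, simp")
  finally show ?thesis by (simp only: nn_integral_norm_diff)
 qed
 moreover have "((%R. ennreal ((norm (hc (tr R (fn a)) - Hh a))^2)) \<longlongrightarrow> ennreal (0^2)) at_top"
  by (intro tendsto_ennrealI tendsto_power tendsto_norm_zero LIM_zero Hh_tr_tendsto)
 ultimately show "((%R. \<integral>\<^sup>+ Z. ennreal ((cmod (fourier_l1 (%x. indicator (ball 0 R) x * u x) Z - Ef (fn (Hh a)) Z))^2) \<partial>lebesgue) \<longlongrightarrow> 0) at_top"
  by simp
qed

text \<open>Two L^2 limits of the same truncated transforms agree. This pins down, up to null sets,
  the values that the statement takes by choice.\<close>

lemma is_fourier_unique: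
 assumes u: "is_rep u a" and w: "is_fourier u w"
 shows "AE Z in lebesgue. w Z = Ef (fn (Hh a)) Z"
proof -
 let ?F = "%R. fourier_l1 (%x. indicator (ball 0 R) x * u x)"
 let ?W = "Ef (fn (Hh a))"
 have wm: "w : borel_measurable lebesgue" using w by (simp add: is_fourier_def)
 have Wm: "?W : borel_measurable lebesgue" by (rule lebesgue_meas) measurable
 have Fm: "?F R : borel_measurable lebesgue" for R
 proof -
  have l: "l12 (tr R (fn a))" by (rule l12_tr_fn)
  have [measurable]: "tr R (fn a) : borel_measurable borel" using l by (auto simp: l12_def)
  have m: "(%x. indicator (ball 0 R) x * u x) : borel_measurable lebesgue"
   by (rule borel_measurable_times, rule lebesgue_meas, rule borel_measurable_indicator) (use u in "auto simp: is_rep_def")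
  have ae: "AE x in lebesgue. indicator (ball 0 R) x * u x = tr R (fn a) x"
   using u unfolding is_rep_def tr_def by (auto elim: eventually_mono)
  have "?F R = Ef (h0 (tr R (fn a)))" using fourier_l1_Ef[OF m ae] l by (auto simp: l12_def)
  moreover have "Ef (h0 (tr R (fn a))) : borel_measurable lebesgue" by (rule lebesgue_meas) measurable
  ultimately show ?thesis by simp
 qed
 define A where "A R = (\<integral>\<^sup>+ Z. ennreal ((cmod (?F R Z - w Z))^2) \<partial>lebesgue)" for R
 define B where "B R = (\<integral>\<^sup>+ Z. ennreal ((cmod (?F R Z - ?W Z))^2) \<partial>lebesgue)" for R
 have A: "(A \<longlongrightarrow> 0) at_top" unfolding A_def[abs_def] using w by (simp add: is_fourier_def)
 have B: "(B \<longlongrightarrow> 0) at_top" unfolding B_def[abs_def] using is_fourier_Ef[OF u] by (simp add: is_fourier_def)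
 have le: "(\<integral>\<^sup>+ Z. ennreal ((cmod (w Z - ?W Z))^2) \<partial>lebesgue) <= 2 * A R + 2 * B R" for R
 proof -
   have "(%Z. ?F R Z - w Z) : borel_measurable lebesgue" "(%Z. ?F R Z - ?W Z) : borel_measurable lebesgue"
    by (rule borel_measurable_diff[OF Fm wm], rule borel_measurable_diff[OF Fm Wm])
   then have mm: "(%Z. ennreal ((cmod (?F R Z - w Z))^2)) : borel_measurable lebesgue"
     "(%Z. ennreal ((cmod (?F R Z - ?W Z))^2)) : borel_measurable lebesgue"
    by measurable
  have "(\<integral>\<^sup>+ Z. ennreal ((cmod (w Z - ?W Z))^2) \<partial>lebesgue)
   <= (\<integral>\<^sup>+ Z. 2 * ennreal ((cmod (?F R Z - w Z))^2) + 2 * ennreal ((cmod (?F R Z - ?W Z))^2) \<partial>lebesgue)"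
  proof (rule nn_integral_mono)
   fix Z
   let ?a = "cmod (?F R Z - w Z)" and ?b = "cmod (?F R Z - ?W Z)"
   have "cmod (w Z - ?W Z) <= ?a + ?b" using norm_triangle_ineq4[of "?F R Z - ?W Z" "?F R Z - w Z"] by simp
   then have "(cmod (w Z - ?W Z))^2 <= (?a + ?b)^2" by (intro power_mono) auto
   also have "... <= 2 * ?a^2 + 2 * ?b^2" using sum_squares_bound[of ?a ?b] by (simp add: power2_sum)
   finally have "ennreal ((cmod (w Z - ?W Z))^2) <= ennreal (2 * ?a^2 + 2 * ?b^2)" by (rule ennreal_leI)
   also have "... = 2 * ennreal (?a^2) + 2 * ennreal (?b^2)" by (simp add: ennreal_plus ennreal_mult)
   finally show "ennreal ((cmod (w Z - ?W Z))^2) <= 2 * ennreal (?a^2) + 2 * ennreal (?b^2)" .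
  qed
  also have "... = (\<integral>\<^sup>+ Z. 2 * ennreal ((cmod (?F R Z - w Z))^2) \<partial>lebesgue) + (\<integral>\<^sup>+ Z. 2 * ennreal ((cmod (?F R Z - ?W Z))^2) \<partial>lebesgue)"
   by (rule nn_integral_add; rule borel_measurable_times_ennreal[OF measurable_const[of 2] mm(1)] borel_measurable_times_ennreal[OF measurable_const[of 2] mm(2)]; simp)
  also have "... = 2 * A R + 2 * B R"
  proof -
   show ?thesis unfolding A_def B_def by (simp add: nn_integral_cmult[OF mm(1)] nn_integral_cmult[OF mm(2)])
  qed
  finally show ?thesis .
 qed
 have "((%R. 2 * A R + 2 * B R) \<longlongrightarrow> 2 * 0 + 2 * 0) at_top"
  by (intro tendsto_add ennreal_tendsto_cmult A B) auto
 then have "((%R. 2 * A R + 2 * B R) \<longlongrightarrow> 0) at_top" by simp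
 then have "(\<integral>\<^sup>+ Z. ennreal ((cmod (w Z - ?W Z))^2) \<partial>lebesgue) <= 0"
  by (rule tendsto_lowerbound) (use le in auto)
 then have z: "(\<integral>\<^sup>+ Z. ennreal ((cmod (w Z - ?W Z))^2) \<partial>lebesgue) = 0" by simp
 have "AE Z in lebesgue. ennreal ((cmod (w Z - ?W Z))^2) = 0"
  using z wm Wm by (subst (asm) nn_integral_0_iff_AE) measurable
 then show ?thesis by eventually_elim simp
qed

lemma fourier_rep:
 assumes u: "is_rep u a"
 shows "is_fourier u (fourier u)" "fourier u : borel_measurable lebesgue" "AE Z in lebesgue. fourier u Z = Ef (fn (Hh a)) Z"
proof -
 show f: "is_fourier u (fourier u)" unfolding fourier_def by (rule someI[of "is_fourier u", OF is_fourier_Ef[OF u]])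
 then show "fourier u : borel_measurable lebesgue" by (simp add: is_fourier_def)
 show "AE Z in lebesgue. fourier u Z = Ef (fn (Hh a)) Z" by (rule is_fourier_unique[OF u f])
qed

lemma is_fourier_cong:
 assumes "is_fourier u w" "w' : borel_measurable lebesgue" "AE Z in lebesgue. w' Z = w Z"
 shows "is_fourier u w'"
proof -
 have "(\<integral>\<^sup>+ Z. ennreal ((cmod (g Z - w' Z))^2) \<partial>lebesgue) = (\<integral>\<^sup>+ Z. ennreal ((cmod (g Z - w Z))^2) \<partial>lebesgue)" for g
  by (rule nn_integral_cong_AE) (use assms(3) in "eventually_elim, simp")
 then show ?thesis using assms(1,2) by (simp add: is_fourier_def)
qed

lemma AE_lborel_reflect:
 assumes "AE x in lborel. P (x::r3)" shows "AE x in lborel. P (- x)"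
proof -
 have e: "distr lborel borel (%y::r3. 0 - y) = lborel" by (rule lborel_reflect[symmetric])
 have "AE x in distr lborel borel (%y::r3. 0 - y). P x" unfolding e by (rule assms)
 from AE_distrD[OF _ this] show ?thesis by simp
qed

lemma Ef_cong_AE: assumes "AE x in lborel. p x = q x" shows "AE x in lborel. Ef p x = Ef q x"
 using assms AE_lborel_reflect[OF assms] by eventually_elim (simp add: Ef_def)

lemma Ef_even_mult: "m (- Z) = m Z ==> Ef (%x. m x * p x) Z = complex_of_real (m Z) * Ef p Z"
 by (simp add: Ef_def complex_eq_iff field_simps)

lemma AE_lebesgue_iff: "{x. P x} : sets borel ==> (AE x in lebesgue. P x) \<longleftrightarrow> (AE x in lborel. P (x::r3))"
 by (simp add: AE_completion_iff)

lemma kap_even: "kap t (- Z) = kap t Z" by (simp add: kap_def)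

lemma kap_pos: "0 < kap t Z"
proof -
 have "0 < 1 + (norm Z)^2" using one_plus_ge[of Z] by linarith
 then show ?thesis by (simp add: kap_def)
qed

lemma kap_mult: "kap a Z * kap b Z = kap (a + b) Z"
 by (simp add: kap_def powr_add[symmetric] add.commute)

lemma kap_0 [simp]: "kap 0 Z = 1"
proof -
 have "1 + (norm Z)^2 ~= 0" using one_plus_ge[of Z] by linarith
 then show ?thesis by (simp add: kap_def)
qed

lemma kap_meas [measurable]: "kap t : borel_measurable borel" unfolding kap_def[abs_def] by measurable

text \<open>\<open>Us s\<close> is the Bessel potential \<open>(1 - \<Delta>)\<^sup>-\<^sup>s\<^sup>/\<^sup>2\<close> after the Hartley isometry; it identifies \<open>H\<^sup>s\<close> isometrically with \<open>L\<^sup>2\<close>.\<close>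
definition Us :: "real => l2 => l2" where "Us s f = Hh (mul (kap (s/2)) f)"

lemma bounded_linear_Us: "0 <= s ==> bounded_linear (Us s)"
 unfolding Us_def[abs_def] by (rule bounded_linear_compose[OF bounded_linear_Hh bounded_linear_mul[OF bm_kap]]) simp

lemma inner_Us: "0 <= s ==> inner (Us s f) g = inner f (mul (kap (s/2)) (Hh g))"
 unfolding Us_def Hh_self_adjoint by (rule inner_mul_commute[OF bm_kap]) simp

lemma Us_inj: assumes s: "0 <= s" and e: "Us s f = Us s g" shows "f = g"
proof -
 have "mul (kap (s/2)) f = mul (kap (s/2)) g" using e Hh_involution unfolding Us_def by metis
 moreover have "AE x in lborel. fn (mul (kap (s/2)) f) x = kap (s/2) x * fn f x"
  by (rule fn_mul[OF bm_kap]) (use s in simp)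
 moreover have "AE x in lborel. fn (mul (kap (s/2)) g) x = kap (s/2) x * fn g x"
  by (rule fn_mul[OF bm_kap]) (use s in simp)
 ultimately have "AE x in lborel. kap (s/2) x * fn f x = kap (s/2) x * fn g x" by auto
 then have "AE x in lborel. fn f x = fn g x"
  by eventually_elim (use kap_pos[of "s/2"] in "simp add: less_imp_neq[symmetric]")
 then show ?thesis by (rule l2_eqI)
qed

lemma weighted_fourier_nn:
 assumes "is_rep u a"
 shows "(\<integral>\<^sup>+ Z. ennreal ((1 + (norm Z)^2) powr s * (cmod (fourier u Z))^2) \<partial>lebesgue)
  = (NB Z. ennreal (kap (- s) Z * (fn (Hh a) Z)^2))"
proof -
 have "(\<integral>\<^sup>+ Z. ennreal ((1 + (norm Z)^2) powr s * (cmod (fourier u Z))^2) \<partial>lebesgue)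
  = (\<integral>\<^sup>+ Z. ennreal (kap (- s) Z * (cmod (Ef (fn (Hh a)) Z))^2) \<partial>lebesgue)"
  by (rule nn_integral_cong_AE) (use fourier_rep(3)[OF assms] in "eventually_elim, simp add: kap_def")
 also have "... = (NB Z. ennreal (kap (- s) Z * (cmod (Ef (fn (Hh a)) Z))^2))"
  by (simp add: nn_integral_completion)
 also have "... = (NB Z. ennreal (kap (- s) Z * (fn (Hh a) Z)^2))"
  by (rule nn_Ef) (auto simp: kap_even intro: less_imp_le kap_pos)
 finally show ?thesis .
qed

lemma Us_weight:
 assumes "0 <= s"
 shows "(NB Z. ennreal (kap (- s) Z * (fn (Hh (Us s f)) Z)^2)) = ennreal ((norm f)^2)"
proof -
 have ae: "AE x in lborel. fn (mul (kap (s/2)) f) x = kap (s/2) x * fn f x"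
  by (rule fn_mul[OF bm_kap]) (use assms in simp)
 have "(NB Z. ennreal (kap (- s) Z * (fn (Hh (Us s f)) Z)^2)) = (NB Z. ennreal ((fn f Z)^2))"
  unfolding Us_def Hh_involution
 proof (rule nn_integral_cong_AE, use ae in eventually_elim)
  fix x assume e: "fn (mul (kap (s/2)) f) x = kap (s/2) x * fn f x"
  have "kap (- s) x * (kap (s/2) x * fn f x)^2 = (kap (- s) x * (kap (s/2) x * kap (s/2) x)) * (fn f x)^2"
   by (simp add: power2_eq_square)
  also have "kap (- s) x * (kap (s/2) x * kap (s/2) x) = 1" by (simp only: kap_mult) simp
  finally show "ennreal (kap (- s) x * (fn (mul (kap (s/2)) f) x)^2) = ennreal ((fn f x)^2)" by (simp add: e)
 qed
 then show ?thesis by (simp only: nn_integral_norm_l2)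
qed

text \<open>The preimage under \<open>Us s\<close> is the Hartley transform multiplied by (1 +
  |Z|^2)^(s/2), which the defining integral makes square integrable.\<close>

lemma hs_iff: assumes s: "0 <= s" shows "hs s u \<longleftrightarrow> (EX f. is_rep u (Us s f))"
proof
 assume h: "hs s u"
 then obtain a where a: "is_rep u a" unfolding hs_def lp2_iff by blast
 define p where "p = fn (Hh a)"
 have pm [measurable]: "p : borel_measurable borel" by (simp add: p_def)
 have "(NB Z. ennreal ((kap (- (s/2)) Z * p Z)^2)) = (NB Z. ennreal (kap (- s) Z * (p Z)^2))"
  by (rule nn_integral_cong) (simp add: power_mult_distrib power2_eq_square[of "kap _ _"] kap_mult)
 also have "... < \<infinity>" using h weighted_fourier_nn[OF a, of s] by (simp add: hs_def p_def)
 finally have l: "l2fun (%Z. kap (- (s/2)) Z * p Z)" by (simp add: l2fun_nn)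
 have "mul (kap (s/2)) (cl (%Z. kap (- (s/2)) Z * p Z)) = cl (%Z. kap (s/2) Z * (kap (- (s/2)) Z * p Z))"
  by (rule mul_cl[OF bm_kap l]) (use s in simp)
 also have "... = cl p" by (simp add: mult.assoc[symmetric] kap_mult)
 finally have "Us s (cl (%Z. kap (- (s/2)) Z * p Z)) = a" by (simp add: Us_def p_def Hh_involution)
 then show "EX f. is_rep u (Us s f)" using a by metis
next
 assume "EX f. is_rep u (Us s f)"
 then obtain f where f: "is_rep u (Us s f)" ..
 show "hs s u" unfolding hs_def
  using weighted_fourier_nn[OF f, of s] Us_weight[OF s, of f] is_fourier_Ef[OF f] f lp2_iff by auto
qed

lemma hs_norm_rep: assumes s: "0 <= s" and f: "is_rep u (Us s f)" shows "hs_norm s u = norm f"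
proof -
 have m: "(%Z::r3. (1 + (norm Z)^2) powr s) : borel_measurable lebesgue" by (rule lebesgue_meas) measurable
 have c: "(%Z. cmod (fourier u Z)) : borel_measurable lebesgue"
  by (rule measurable_compose[OF fourier_rep(2)[OF f] borel_measurable_norm])
 have M: "(%Z. (1 + (norm Z)^2) powr s * (cmod (fourier u Z))^2) : borel_measurable lebesgue"
  by (rule borel_measurable_times[OF m borel_measurable_power[OF c]])
 have "(\<integral>Z. (1 + (norm Z)^2) powr s * (cmod (fourier u Z))^2 \<partial>lebesgue) = enn2real (ennreal ((norm f)^2))"
  unfolding Us_weight[OF s, symmetric] weighted_fourier_nn[OF f, symmetric]
  by (rule integral_eq_nn_integral[OF M]) simp
 then show ?thesis by (simp add: hs_norm_def)
qed

lemma Ef_eq_imp_eq: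
 assumes "AE Z in lebesgue. Ef (fn a) Z = Ef (fn b) Z" shows "a = b"
proof -
 have "AE Z in lborel. Ef (fn a) Z = Ef (fn b) Z" using assms by (subst (asm) AE_lebesgue_iff) measurable
 then have "AE Z in lborel. fn a Z = fn b Z" by eventually_elim (metis Ef_recover)
 then show ?thesis by (rule l2_eqI)
qed

text \<open>The symbol of (-\<Delta>)^(s/2) composed with the Bessel potential of order s; unlike
  |Z|^s it is bounded.\<close>

definition fm :: "real => r3 => real" where "fm s Z = norm Z powr s * kap (s/2) Z"

lemma fm_bounds: assumes s: "0 <= s" shows "0 <= fm s Z" "fm s Z <= 1"
proof -
 show "0 <= fm s Z" using kap_pos[of "s/2" Z] by (simp add: fm_def)
 have "norm Z <= sqrt (1 + (norm Z)^2)" by (rule real_le_rsqrt) simp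
 then have "norm Z powr s <= (sqrt (1 + (norm Z)^2)) powr s" by (intro powr_mono2) (use s in auto)
 also have "... = kap (- (s/2)) Z" using one_plus_ge[of Z]
  by (simp add: kap_def powr_half_sqrt[symmetric] powr_powr)
 finally have "fm s Z <= kap (- (s/2)) Z * kap (s/2) Z" unfolding fm_def using kap_pos[of "s/2" Z] by (intro mult_right_mono) auto
 then show "fm s Z <= 1" by (simp add: kap_mult)
qed

lemma bm_fm: "0 <= s ==> bm (fm s)"
 by (rule bmI[where C=1]) (use fm_bounds in "auto simp: fm_def[abs_def]")

text \<open>\<open>frac_half\<close> is chosen by its transform. The explicit candidate shows that
  the choice is not void, and uniqueness of the transform identifies the chosen function with
  it.\<close>

lemma frac_half_rep:
 assumes s: "0 <= s" and f: "is_rep u (Us s f)"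
 shows "is_rep (frac_half s u) (Hh (mul (fm s) f))"
proof -
 define b where "b = Hh (mul (fm s) f)"
 define W where "W = (%Z. complex_of_real (norm Z powr s) * fourier u Z)"
 have "(%Z::r3. complex_of_real (norm Z powr s)) : borel_measurable lebesgue" by (rule lebesgue_meas) measurable
 then have Wm: "W : borel_measurable lebesgue" unfolding W_def
  by (rule borel_measurable_times) (rule fourier_rep[OF f])
 have k: "bm (kap (s/2))" using s by (intro bm_kap) simp
 have 1: "AE Z in lebesgue. Ef (fn (mul (kap (s/2)) f)) Z = Ef (%x. kap (s/2) x * fn f x) Z"
  by (rule AE_lebesgue[OF Ef_cong_AE[OF fn_mul[OF k]]])
 have 2: "AE Z in lebesgue. Ef (fn (mul (fm s) f)) Z = Ef (%x. fm s x * fn f x) Z"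
  by (rule AE_lebesgue[OF Ef_cong_AE[OF fn_mul[OF bm_fm[OF s]]]])
 have We: "AE Z in lebesgue. W Z = Ef (fn (Hh b)) Z"
  using 1 2 fourier_rep(3)[OF f]
 proof eventually_elim
  fix Z
  assume a: "Ef (fn (mul (kap (s/2)) f)) Z = Ef (%x. kap (s/2) x * fn f x) Z"
   "Ef (fn (mul (fm s) f)) Z = Ef (%x. fm s x * fn f x) Z"
   "fourier u Z = Ef (fn (Hh (Us s f))) Z"
  have "fm s (- Z) = fm s Z" by (simp add: fm_def kap_even)
  then show "W Z = Ef (fn (Hh b)) Z"
   unfolding W_def b_def Hh_involution a(3) Us_def a(1,2)
   by (simp add: Ef_even_mult kap_even) (simp add: fm_def)
 qed
 have "is_fourier (fn b) W" by (rule is_fourier_cong[OF is_fourier_Ef[OF is_rep_fn] Wm We])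
 then have "lp 2 (fn b) & is_fourier (fn b) W" using lp2_iff is_rep_fn by blast
 then have F: "lp 2 (frac_half s u) & is_fourier (frac_half s u) W"
  using someI[of "%F. lp 2 F & is_fourier F W" "fn b"] unfolding frac_half_def W_def by blast
 then obtain c where c: "is_rep (frac_half s u) c" using lp2_iff by blast
 have "AE Z in lebesgue. Ef (fn (Hh c)) Z = Ef (fn (Hh b)) Z"
  using is_fourier_unique[OF c] F We by fastforce
 then have "Hh c = Hh b" by (rule Ef_eq_imp_eq)
 then have "c = b" by (metis Hh_involution)
 then show ?thesis using c by (simp add: b_def)
qed

lemma bessel_space_eq: "bessel_space t = hs t" by (simp add: bessel_space_def[abs_def] hs_def[abs_def])

lemma Ef_prod_integrable: "integrable lborel (%Z. Ef (fn f) Z * cnj (Ef (fn g) Z))"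
proof (rule integrableI_bounded)
 have [measurable]: "(%Z. cnj (Ef (fn g) Z)) : borel_measurable borel"
  by (rule borel_measurable_continuous_on[where f=cnj]) (auto intro!: continuous_intros)
 show "(%Z. Ef (fn f) Z * cnj (Ef (fn g) Z)) : borel_measurable lborel" by measurable
 have "(NB Z. ennreal (norm (Ef (fn f) Z * cnj (Ef (fn g) Z))))
   <= (NB Z. ennreal (1 * (cmod (Ef (fn f) Z))^2) + ennreal (1 * (cmod (Ef (fn g) Z))^2))"
 proof (rule nn_integral_mono)
  fix Z
  let ?a = "cmod (Ef (fn f) Z)" and ?b = "cmod (Ef (fn g) Z)"
  have "2 * (?a * ?b) <= ?a^2 + ?b^2" using sum_squares_bound[of ?a ?b] by simp
  moreover have "0 <= ?a * ?b" by simp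
  ultimately have "norm (Ef (fn f) Z * cnj (Ef (fn g) Z)) <= 1 * ?a^2 + 1 * ?b^2" unfolding norm_mult complex_mod_cnj by linarith
  then have "ennreal (norm (Ef (fn f) Z * cnj (Ef (fn g) Z))) <= ennreal (1 * ?a^2 + 1 * ?b^2)" by (rule ennreal_leI)
  also have "... = ennreal (1 * ?a^2) + ennreal (1 * ?b^2)" by (rule ennreal_plus) auto
  finally show "ennreal (norm (Ef (fn f) Z * cnj (Ef (fn g) Z))) <= ennreal (1 * ?a^2) + ennreal (1 * ?b^2)" .
 qed
 also have "... = (NB Z. ennreal (1 * (cmod (Ef (fn f) Z))^2)) + (NB Z. ennreal (1 * (cmod (Ef (fn g) Z))^2))"
  by (rule nn_integral_add) measurable
 also have "... = ennreal ((norm f)^2) + ennreal ((norm g)^2)"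
  by (subst (1 2) nn_Ef) (auto simp: nn_integral_norm_l2)
 also have "... < \<infinity>" by simp
 finally show "(NB Z. ennreal (norm (Ef (fn f) Z * cnj (Ef (fn g) Z)))) < \<infinity>" .
qed

lemma lborel_integral_reflect:
 fixes k :: "r3 => real"
 assumes [measurable]: "k : borel_measurable borel"
 shows "(LB x. k (- x)) = (LB x. k x)" "integrable lborel (%x. k (- x)) \<longleftrightarrow> integrable lborel k"
proof -
 have "integral\<^sup>L (distr lborel borel (%y::r3. 0 - y)) k = (LB x. k (- x))"
  by (subst integral_distr) auto
 then show "(LB x. k (- x)) = (LB x. k x)" using lborel_reflect[of 0] by simp
 have "integrable (distr lborel borel (%y::r3. 0 - y)) k \<longleftrightarrow> integrable lborel (%x. k (- x))"
  by (subst integrable_distr_eq) auto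
 then show "integrable lborel (%x. k (- x)) \<longleftrightarrow> integrable lborel k" using lborel_reflect[of 0] by simp
qed

text \<open>The weight cancels the two Bessel symbols. The real part of Ef f times the conjugate of
  Ef g is the mean of f g at Z and -Z, and reflection makes both contributions equal.\<close>

lemma bessel_inner_rep:
 assumes t: "0 <= t" and u: "is_rep u (Us t f)" and v: "is_rep v (Us t g)"
 shows "bessel_inner t u v = inner f g"
proof -
 have k: "bm (kap (t/2))" using t by (intro bm_kap) simp
 have 1: "AE Z in lebesgue. Ef (fn (mul (kap (t/2)) f)) Z = Ef (%x. kap (t/2) x * fn f x) Z"
  by (rule AE_lebesgue[OF Ef_cong_AE[OF fn_mul[OF k]]])
 have 2: "AE Z in lebesgue. Ef (fn (mul (kap (t/2)) g)) Z = Ef (%x. kap (t/2) x * fn g x) Z"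
  by (rule AE_lebesgue[OF Ef_cong_AE[OF fn_mul[OF k]]])
 let ?h = "%Z. Ef (fn f) Z * cnj (Ef (fn g) Z)"
 have cm: "cnj : borel_measurable borel" by (intro borel_measurable_continuous_onI continuous_intros)
 have hm: "?h : borel_measurable borel" using Ef_prod_integrable[of f g] by auto
 have "(%Z::r3. complex_of_real ((1 + (norm Z)^2) powr t)) : borel_measurable lebesgue" by (rule lebesgue_meas) measurable
 then have m: "(%Z. complex_of_real ((1 + (norm Z)^2) powr t) * fourier u Z * cnj (fourier v Z)) : borel_measurable lebesgue"
  by (intro borel_measurable_times fourier_rep(2)[OF u] measurable_compose[OF fourier_rep(2)[OF v] cm])
 have ae: "AE Z in lebesgue. complex_of_real ((1 + (norm Z)^2) powr t) * fourier u Z * cnj (fourier v Z) = ?h Z"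
  using 1 2 fourier_rep(3)[OF u] fourier_rep(3)[OF v]
 proof eventually_elim
  fix Z
  assume a: "Ef (fn (mul (kap (t/2)) f)) Z = Ef (%x. kap (t/2) x * fn f x) Z"
   "Ef (fn (mul (kap (t/2)) g)) Z = Ef (%x. kap (t/2) x * fn g x) Z"
   "fourier u Z = Ef (fn (Hh (Us t f))) Z" "fourier v Z = Ef (fn (Hh (Us t g))) Z"
  have "kap (- t) Z * (kap (t/2) Z * kap (t/2) Z) = 1" by (simp only: kap_mult) simp
  then have e: "complex_of_real (kap (- t) Z) * (complex_of_real (kap (t/2) Z) * complex_of_real (kap (t/2) Z)) = 1"
   by (metis of_real_1 of_real_mult)
  have e0: "complex_of_real ((1 + (norm Z)^2) powr t) = complex_of_real (kap (- t) Z)" by (simp add: kap_def)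
  have "complex_of_real ((1 + (norm Z)^2) powr t) * fourier u Z * cnj (fourier v Z)
    = (complex_of_real (kap (- t) Z) * (complex_of_real (kap (t/2) Z) * complex_of_real (kap (t/2) Z))) * ?h Z"
   unfolding a(3,4) Us_def Hh_involution a(1,2) e0
   by (simp only: Ef_even_mult kap_even complex_cnj_mult complex_cnj_complex_of_real) (simp add: mult_ac)
  then show "complex_of_real ((1 + (norm Z)^2) powr t) * fourier u Z * cnj (fourier v Z) = ?h Z" by (simp only: e) simp
 qed
 have i: "integrable lborel (%Z. fn f Z * fn g Z)" by (rule l2fun_mult_integrable) (rule l2fun_fn)+
 have ir: "integrable lborel (%Z. fn f (- Z) * fn g (- Z))"
  using lborel_integral_reflect(2)[of "%Z. fn f Z * fn g Z"] i by simp
 have "bessel_inner t u v = Re (LB Z. ?h Z)"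
  unfolding bessel_inner_def leb_integral[OF m hm ae] ..
 also have "... = (LB Z. Re (?h Z))" by (rule integral_Re[OF Ef_prod_integrable, symmetric])
 also have "... = (LB Z. (1/2) * (fn f Z * fn g Z + fn f (- Z) * fn g (- Z)))"
  by (rule bintegral_cong) (auto simp: Ef_def field_simps)
 also have "... = (1/2) * ((LB Z. fn f Z * fn g Z) + (LB Z. fn f (- Z) * fn g (- Z)))"
  by (simp only: integral_mult_right_zero bintegral_add[OF i ir])
 also have "(LB Z. fn f (- Z) * fn g (- Z)) = (LB Z. fn f Z * fn g Z)"
  by (rule lborel_integral_reflect(1)[of "%Z. fn f Z * fn g Z"]) measurable
 finally show ?thesis by (simp add: inner_l2)
qed

lemma is_rep_mult:
 assumes u: "is_rep u a" and v: "is_rep v b"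
 shows "(\<integral>x. u x * v x \<partial>lebesgue) = inner a b" "integrable lebesgue (%x. u x * v x)"
proof -
 have m: "(%x. u x * v x) : borel_measurable lebesgue" using u v by (auto simp: is_rep_def)
 have ae: "AE x in lebesgue. u x * v x = fn a x * fn b x"
  using u[unfolded is_rep_def, THEN conjunct2] v[unfolded is_rep_def, THEN conjunct2] by eventually_elim simp
 have f: "(%x. fn a x * fn b x) : borel_measurable borel" by measurable
 show "(\<integral>x. u x * v x \<partial>lebesgue) = inner a b" unfolding leb_integral[OF m f ae] by (simp add: inner_l2)
 have "integrable lborel (%x. fn a x * fn b x)" by (rule l2fun_mult_integrable) (rule l2fun_fn)+
 then show "integrable lebesgue (%x. u x * v x)" unfolding leb_integrable[OF m f ae] .
qed

text \<open>(I - \<Delta>)^(-t) applied to K u^2 satisfies the defining equations, so the choice in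
  \<open>phi_of\<close> is not void. Testing those equations with all of the Bessel space leaves
  only one class.\<close>

lemma phi_of_rep:
 assumes t: "0 < t" and c: "is_rep (%x. K x * (u x)^2) c"
 shows "is_rep (phi_of t K u) (Hh (mul (kap t) (Hh c)))" "bessel_space t (phi_of t K u)"
proof -
 have t0: "0 <= t" using t by simp
 have k: "bm (kap (t/2))" using t by (intro bm_kap) simp
 define d where "d = mul (kap (t/2)) (Hh c)"
 have Ud: "Us t d = Hh (mul (kap t) (Hh c))"
  unfolding Us_def d_def mul_mul[OF k k] by (simp add: kap_mult)
 let ?P = "%\<phi>. bessel_space t \<phi> & (ALL v. bessel_space t v --> bessel_inner t \<phi> v = (\<integral>x. K x * (u x)^2 * v x \<partial>lebesgue))"
 have r: "(\<integral>x. K x * (u x)^2 * v x \<partial>lebesgue) = inner d g" if "is_rep v (Us t g)" for v g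
  using is_rep_mult(1)[OF c that] inner_Us[OF t0, of g c] by (simp add: d_def inner_commute)
 have "?P (fn (Us t d))"
  using bessel_inner_rep[OF t0 is_rep_fn] r is_rep_fn[of "Us t d"] by (auto simp: bessel_space_eq hs_iff[OF t0])
 then have P: "?P (phi_of t K u)" using someI[of ?P "fn (Us t d)"] unfolding phi_of_def by blast
 then show "bessel_space t (phi_of t K u)" by simp
 then obtain e where e: "is_rep (phi_of t K u) (Us t e)" by (auto simp: bessel_space_eq hs_iff[OF t0])
 have "inner e g = inner d g" for g
 proof -
  have "bessel_space t (fn (Us t g))" unfolding bessel_space_eq hs_iff[OF t0] using is_rep_fn by blast
  then have "bessel_inner t (phi_of t K u) (fn (Us t g)) = (\<integral>x. K x * (u x)^2 * fn (Us t g) x \<partial>lebesgue)" using P by blast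
  then show ?thesis using bessel_inner_rep[OF t0 e is_rep_fn] r[OF is_rep_fn] by simp
 qed
 then have "inner (e - d) (e - d) = 0" unfolding inner_diff_left by simp
 then have "e = d" by simp
 then show "is_rep (phi_of t K u) (Hh (mul (kap t) (Hh c)))" using e Ud by simp
qed

section \<open>Integrals of powers over intervals and balls\<close>

lemma nn_powr:
 assumes "0 <= a" "0 <= c"
 shows "(NB r. ennreal (if 0 <= r & r <= c then r powr a else 0)) = ennreal (c powr (a + 1) / (a + 1))"
proof (rule nn_integral_has_integral_lborel)
 have "((%x. if x : {0..c} then x powr a else 0) has_integral (c powr (a+1) / (a+1))) UNIV"
  unfolding has_integral_restrict_UNIV using has_integral_powr_from_0[of a c] assms by simp
 then show "((%r. if 0 <= r & r <= c then r powr a else 0) has_integral (c powr (a+1) / (a+1))) UNIV" by simp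
qed auto

lemma nn_negpowr:
 assumes "0 < b" "0 < c"
 shows "(NB r. ennreal (if c <= r then b * r powr (- b - 1) else 0)) = ennreal (c powr (- b))"
proof -
 have lim: "((%x::real. - (x powr (- b))) \<longlongrightarrow> - 0) at_top"
  by (intro tendsto_minus tendsto_neg_powr filterlim_ident) (use assms in simp)
 have "(NB r. ennreal (b * r powr (- b - 1)) * indicator {c..} r) = ennreal (- 0 - (- (c powr (- b))))"
 proof (rule nn_integral_FTC_atLeast[OF _ _ _ lim])
  fix x assume "c <= x"
  then have "0 < x" using assms by simp
  then show "DERIV (%x. - (x powr (- b))) x :> b * x powr (- b - 1)" by (auto intro!: derivative_eq_intros)
  show "0 <= b * x powr (- b - 1)" using assms by simp
 qed simp
 also have "(NB r. ennreal (b * r powr (- b - 1)) * indicator {c..} r)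
  = (NB r. ennreal (if c <= r then b * r powr (- b - 1) else 0))"
  by (rule nn_integral_cong) (auto simp: indicator_def)
 finally show ?thesis by simp
qed

abbreviation vb :: real where "vb \<equiv> unit_ball_vol 3"

lemma vb_pos: "0 < vb" by simp

lemma emeasure_cball3: "0 <= r ==> emeasure lborel (cball (0::r3) r) = ennreal (vb * r powr 3)"
 using emeasure_cball[of r "0::r3"] by (simp add: powr_numeral)

text \<open>|Z|^(-2s) is the integral of 2s r^(-2s-1) over r >= |Z|. After Tonelli only volumes of
  balls remain, of radius r for r < A and of radius A beyond; these two ranges give the two
  constants.\<close>

lemma norm_powr_ball:
 assumes s: "0 < s" "s < 1" and A: "0 < A"
 shows "(NB Z. ennreal (indicator (cball 0 A) Z * norm (Z::r3) powr (- 2 * s)))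
  <= ennreal ((2 * s * vb / (3 - 2 * s) + vb) * A powr (3 - 2 * s))"
proof -
 let ?h = "%(Z::r3) r. ennreal (if norm Z <= A & norm Z <= r then 2 * s * r powr (- (2 * s) - 1) else 0)"
 have "(NB Z. ennreal (indicator (cball 0 A) Z * norm (Z::r3) powr (- 2 * s))) <= (NB Z. NB r. ?h Z r)"
 proof (rule nn_integral_mono)
  fix Z :: r3
  show "ennreal (indicator (cball 0 A) Z * norm Z powr (- 2 * s)) <= (NB r. ?h Z r)"
  proof (cases "norm Z <= A & Z ~= 0")
   case True
   then show ?thesis using nn_negpowr[of "2 * s" "norm Z"] s by simp
  next
   case False then show ?thesis by auto
  qed
 qed
 also have "... = (NB r. NB Z. ?h Z r)"
  by (rule lborel_pair.Fubini'[symmetric]) measurable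
 also have "... <= (NB r. ennreal (2 * s * vb) * ennreal (if 0 <= r & r <= A then r powr (2 - 2 * s) else 0)
   + ennreal (vb * A powr 3) * ennreal (if A <= r then 2 * s * r powr (- (2 * s) - 1) else 0))"
 proof (rule nn_integral_mono)
  fix r :: real
  show "(NB Z. ?h Z r) <= ennreal (2 * s * vb) * ennreal (if 0 <= r & r <= A then r powr (2 - 2 * s) else 0)
   + ennreal (vb * A powr 3) * ennreal (if A <= r then 2 * s * r powr (- (2 * s) - 1) else 0)"
  proof (cases "r < 0")
   case True
   then have "?h Z r = 0" for Z using norm_ge_zero[of Z] by (auto simp del: norm_ge_zero)
   then show ?thesis by simp
  next
   case False
   let ?c = "2 * s * r powr (- (2 * s) - 1)"
   have "(NB Z. ?h Z r) = (NB Z. ennreal ?c * indicator (cball (0::r3) (min r A)) Z)"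
    by (rule nn_integral_cong) (auto simp: indicator_def)
   also have "... = ennreal ?c * ennreal (vb * (min r A) powr 3)"
    using False A by (simp add: nn_integral_cmult_indicator emeasure_cball3)
   also have "... = ennreal (vb * (min r A) powr 3 * ?c)" using s by (simp add: ennreal_mult[symmetric] mult.commute)
   finally have e: "(NB Z. ?h Z r) = ennreal (vb * (min r A) powr 3 * ?c)" .
   show ?thesis
   proof (cases "r < A")
    case True
    have "r powr 3 * r powr (- (2 * s) - 1) = r powr (2 - 2 * s)" by (subst powr_add[symmetric]) simp
    moreover have "vb * (min r A) powr 3 * ?c = (2 * s * vb) * (r powr 3 * r powr (- (2 * s) - 1))" using True
     by (simp del: powr_numeral)
    ultimately have q: "vb * (min r A) powr 3 * ?c = (2 * s * vb) * r powr (2 - 2 * s)" by (simp del: powr_numeral)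
    show ?thesis unfolding e q using True False s by (simp add: ennreal_mult)
   next
    case F: False
    then have "min r A = A" by simp
    then have "ennreal (vb * (min r A) powr 3 * ?c) = ennreal (vb * A powr 3) * ennreal (if A <= r then ?c else 0)"
     using F s by (simp add: ennreal_mult)
    then show ?thesis unfolding e by simp
   qed
  qed
 qed
 also have "... = ennreal (2 * s * vb) * (NB r. ennreal (if 0 <= r & r <= A then r powr (2 - 2 * s) else 0))
   + ennreal (vb * A powr 3) * (NB r. ennreal (if A <= r then 2 * s * r powr (- (2 * s) - 1) else 0))"
  by (subst nn_integral_add) (simp_all add: nn_integral_cmult)
 also have "... = ennreal (2 * s * vb) * ennreal (A powr (3 - 2 * s) / (3 - 2 * s)) + ennreal (vb * A powr 3) * ennreal (A powr (- (2 * s)))"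
  using nn_powr[of "2 - 2 * s" A] nn_negpowr[of "2 * s" A] s A by (simp add: algebra_simps)
 also have "... = ennreal (2 * s * vb * (A powr (3 - 2 * s) / (3 - 2 * s)) + vb * A powr 3 * A powr (- (2 * s)))"
  using s by (simp add: ennreal_mult[symmetric] ennreal_plus[symmetric] del: ennreal_plus)
 also have "vb * A powr 3 * A powr (- (2 * s)) = vb * A powr (3 - 2 * s)" by (simp add: powr_add[symmetric] mult.assoc)
 finally show ?thesis by (simp add: algebra_simps)
qed

section \<open>Sobolev embedding and local compactness\<close>

definition ib :: "real => r3 => real" where "ib A = indicator (cball 0 A)"

lemma cball_borel [measurable]: "cball (0::r3) R : sets borel" by simp

lemma ib_meas [measurable]: "ib A : borel_measurable borel" unfolding ib_def by (rule borel_measurable_indicator) simp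
lemma ib_01: "0 <= ib A Z" "ib A Z <= 1" by (simp_all add: ib_def indicator_def)
lemma bm_ib: "bm (ib A)" by (rule bmI[where C=1]) (use ib_01 in auto)

lemma l2fun_ib: "l2fun (ib A)"
proof -
 have "(NB x. ennreal ((ib A x)^2)) = emeasure lborel (cball (0::r3) A)"
 proof -
  have "ennreal ((ib A x)^2) = indicator (cball 0 A) x" for x by (simp add: ib_def indicator_def)
  then show ?thesis by simp
 qed
 also have "... < \<infinity>" by (rule emeasure_bounded_finite) simp
 finally show ?thesis by (simp add: l2fun_nn)
qed

lemma kap_le_norm: assumes "0 <= s" "Z ~= 0" shows "kap s Z <= norm Z powr (- 2 * s)"
proof -
 have "kap s Z <= ((norm Z)^2) powr (- s)" unfolding kap_def by (rule powr_mono2') (use assms in auto)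
 also have "... = norm Z powr (- 2 * s)" using assms by (simp add: powr_numeral[symmetric] powr_powr del: powr_numeral)
 finally show ?thesis .
qed

definition lo :: "real => l2 => l2" where "lo A f = mul (ib A) f"

text \<open>Inner products with \<open>kx s A x\<close> are the values at \<open>x\<close> of the part of \<open>Us s f\<close> with frequencies below \<open>A\<close>.\<close>
definition kx :: "real => real => r3 => l2" where
 "kx s A x = cl (%Z. (c0 * kap (s/2) Z * cas (Z \<bullet> x)) * ib A Z)"

lemma bm_kcas: assumes "0 <= s" shows "bm (%Z. c0 * kap (s/2) Z * cas (Z \<bullet> x))"
proof (rule bmI[where C="c0 * 1 * 2"])
 fix Z
 show "\<bar>c0 * kap (s/2) Z * cas (Z \<bullet> x)\<bar> <= c0 * 1 * 2"
  unfolding abs_mult using c0_pos kap_pos[of "s/2" Z] kap_bounds(2)[of "s/2" Z] assms abs_cas_le[of "Z \<bullet> x"]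
  by (intro mult_mono) auto
qed measurable

lemma l2fun_kx: "0 <= s ==> l2fun (%Z. (c0 * kap (s/2) Z * cas (Z \<bullet> x)) * ib A Z)"
 by (rule l2fun_mul[OF bm_kcas l2fun_ib])

text \<open>Cut off to a ball, the spectral density is integrable as well as square integrable, so
  its Hartley transform is given by the pointwise integral.\<close>

lemma low_rep:
 assumes s: "0 <= s" shows "AE x in lborel. fn (Us s (lo A f)) x = inner f (kx s A x)"
proof -
 have k: "bm (kap (s/2))" using s by (intro bm_kap) simp
 define g where "g = (%Z. (kap (s/2) Z * ib A Z) * fn f Z)"
 have b: "bm (%Z. kap (s/2) Z * ib A Z)" by (rule bm_mult[OF k bm_ib])
 have g2: "l2fun g" unfolding g_def by (rule l2fun_mul[OF b l2fun_fn])
 have "integrable lborel g" unfolding g_def by (rule l2fun_mult_integrable[OF l2fun_mul[OF k l2fun_ib] l2fun_fn])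
 then have g: "l12 g" using g2 by (simp add: l12_def)
 have "Us s (lo A f) = cl (h0 g)"
  unfolding Us_def lo_def mul_mul[OF k bm_ib] unfolding mul_def g_def[symmetric] by (rule Hh_cl[OF g])
 moreover have "h0 g x = inner f (kx s A x)" for x
 proof -
  have "inner f (kx s A x) = (LB Z. (c0 * kap (s/2) Z * cas (Z \<bullet> x)) * ib A Z * fn f Z)"
   unfolding kx_def by (subst inner_commute) (rule inner_cl_left[OF l2fun_kx[OF s]])
  also have "... = (LB Z. c0 * (g Z * cas (x \<bullet> Z)))"
   by (rule bintegral_cong) (auto simp: g_def inner_commute mult_ac)
  finally show ?thesis by (simp add: h0_def)
 qed
 ultimately show ?thesis using fn_cl[OF l2fun_h0[OF g]] by simp
qed

definition Dk :: "real => real" where "Dk s = 2 * c0 * sqrt (2 * s * vb / (3 - 2 * s) + vb)"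

lemma Dk_pos: "0 < s ==> s < 1 ==> 0 < Dk s"
 unfolding Dk_def using c0_pos vb_pos by (intro mult_pos_pos real_sqrt_gt_zero add_nonneg_pos divide_nonneg_pos mult_nonneg_nonneg) auto

lemma norm_kx_le:
 assumes s: "0 < s" "s < 1" and A: "0 < A"
 shows "norm (kx s A x) <= Dk s * A powr ((3 - 2 * s) / 2)"
proof -
 let ?g = "%Z. (c0 * kap (s/2) Z * cas (Z \<bullet> x)) * ib A Z"
 let ?D = "2 * s * vb / (3 - 2 * s) + vb"
 have D0: "0 <= ?D" using s vb_pos by (intro add_nonneg_nonneg divide_nonneg_nonneg) auto
 have s0: "0 <= s" using s by simp
 have nz: "AE Z in lborel. Z ~= (0::r3)" by (rule AE_lborel_singleton)
 have "ennreal ((norm (kx s A x))^2) = (NB Z. ennreal ((?g Z)^2))"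
  unfolding nn_integral_norm_l2[symmetric] kx_def
  by (rule nn_integral_cong_AE) (use fn_cl[OF l2fun_kx[OF s0, of x A]] in "eventually_elim, simp")
 also have "... <= (NB Z. ennreal ((2 * c0)^2) * ennreal (indicator (cball 0 A) Z * norm (Z::r3) powr (- 2 * s)))"
 proof (rule nn_integral_mono_AE, use nz in eventually_elim)
  fix Z :: r3 assume n: "Z ~= 0"
  have c: "(cas (Z \<bullet> x))^2 <= 2^2" using abs_cas_le[of "Z \<bullet> x"] by (subst abs_le_square_iff[symmetric]) simp
  have "(?g Z)^2 = c0^2 * (cas (Z \<bullet> x))^2 * (kap (s/2) Z * kap (s/2) Z) * ib A Z"
   by (simp add: power_mult_distrib power2_eq_square ib_def indicator_def)
  also have "... = c0^2 * (cas (Z \<bullet> x))^2 * kap s Z * ib A Z" by (simp only: kap_mult) simp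
  also have "... <= c0^2 * 2^2 * norm Z powr (- 2 * s) * ib A Z"
   using c kap_le_norm[OF s0 n] kap_pos[of s Z] ib_01[of A Z] by (intro mult_mono mult_nonneg_nonneg) auto
  also have "... = (2 * c0)^2 * (indicator (cball 0 A) Z * norm Z powr (- 2 * s))" by (simp add: ib_def power_mult_distrib)
  finally show "ennreal ((?g Z)^2) <= ennreal ((2 * c0)^2) * ennreal (indicator (cball 0 A) Z * norm Z powr (- 2 * s))"
   by (simp add: ennreal_mult[symmetric] ennreal_leI)
 qed
 also have "... = ennreal ((2 * c0)^2) * (NB Z. ennreal (indicator (cball 0 A) Z * norm (Z::r3) powr (- 2 * s)))"
  by (rule nn_integral_cmult) measurable
 also have "... <= ennreal ((2 * c0)^2) * ennreal (?D * A powr (3 - 2 * s))"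
  by (rule mult_left_mono[OF norm_powr_ball[OF s A]]) simp
 also have "... = ennreal ((2 * c0)^2 * (?D * A powr (3 - 2 * s)))" using D0 by (simp add: ennreal_mult)
 also have "(2 * c0)^2 * (?D * A powr (3 - 2 * s)) = (Dk s * A powr ((3 - 2 * s) / 2))^2"
 proof -
  have "(A powr ((3 - 2 * s) / 2))^2 = A powr (3 - 2 * s)" by (simp add: power2_eq_square powr_add[symmetric])
  then show ?thesis unfolding Dk_def power_mult_distrib unfolding real_sqrt_pow2[OF D0] by simp
 qed
 finally have "(norm (kx s A x))^2 <= (Dk s * A powr ((3 - 2 * s) / 2))^2" by simp
 then show ?thesis by (rule power2_le_imp_le) (use Dk_pos[OF s] in simp)
qed

lemma kx_lipschitz:
 assumes s: "0 <= s" and A: "0 <= A"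
 shows "norm (kx s A x - kx s A y) <= (2 * c0 * A * norm (cl (ib A))) * norm (x - y)"
proof -
 let ?m = "%Z. (c0 * kap (s/2) Z * cas (Z \<bullet> x) - c0 * kap (s/2) Z * cas (Z \<bullet> y)) * ib A Z"
 have cas_lip: "\<bar>cas a - cas b\<bar> <= 2 * \<bar>a - b\<bar>" for a b
 proof -
  have c: "\<bar>cos a - cos b\<bar> <= \<bar>a - b\<bar>" 
  proof -
   have "\<bar>cos a - cos b\<bar> = 2 * (\<bar>sin ((a + b) / 2)\<bar> * \<bar>sin ((b - a) / 2)\<bar>)" unfolding cos_diff_cos by (simp add: abs_mult)
   also have "... <= 2 * (1 * \<bar>(b - a) / 2\<bar>)" by (intro mult_left_mono mult_mono abs_sin_le_one abs_sin_x_le_abs_x) auto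
   finally show ?thesis by (simp add: abs_minus_commute)
  qed
  have d: "\<bar>sin a - sin b\<bar> <= \<bar>a - b\<bar>" 
  proof -
   have "\<bar>sin a - sin b\<bar> = 2 * (\<bar>sin ((a - b) / 2)\<bar> * \<bar>cos ((a + b) / 2)\<bar>)" unfolding sin_diff_sin by (simp add: abs_mult)
   also have "... <= 2 * (\<bar>(a - b) / 2\<bar> * 1)" by (intro mult_left_mono mult_mono abs_cos_le_one abs_sin_x_le_abs_x) auto
   finally show ?thesis by simp
  qed
  have "\<bar>cas a - cas b\<bar> <= \<bar>cos a - cos b\<bar> + \<bar>sin a - sin b\<bar>"
   using abs_triangle_ineq[of "cos a - cos b" "sin a - sin b"] by (simp add: cas_def algebra_simps)
  also have "... <= \<bar>a - b\<bar> + \<bar>a - b\<bar>" by (rule add_mono[OF c d])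
  finally show ?thesis by simp
 qed
 have mb: "\<bar>?m Z\<bar> <= 2 * c0 * A * norm (x - y)" for Z
 proof (cases "norm Z <= A")
  case True
  have "\<bar>cas (Z \<bullet> x) - cas (Z \<bullet> y)\<bar> <= 2 * \<bar>Z \<bullet> (x - y)\<bar>" using cas_lip[of "Z \<bullet> x" "Z \<bullet> y"] by (simp add: inner_diff_right)
  also have "... <= 2 * (A * norm (x - y))"
   using Cauchy_Schwarz_ineq2[of Z "x - y"] mult_right_mono[OF True, of "norm (x - y)"] by simp
  finally have c: "\<bar>cas (Z \<bullet> x) - cas (Z \<bullet> y)\<bar> <= 2 * (A * norm (x - y))" .
  have "\<bar>?m Z\<bar> = c0 * kap (s/2) Z * \<bar>cas (Z \<bullet> x) - cas (Z \<bullet> y)\<bar> * ib A Z"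
   using c0_pos kap_pos[of "s/2" Z] ib_01[of A Z] by (simp add: right_diff_distrib[symmetric] abs_mult)
  also have "... <= c0 * 1 * (2 * (A * norm (x - y))) * 1"
   using c c0_pos kap_pos[of "s/2" Z] kap_bounds(2)[of "s/2" Z] s ib_01[of A Z] A by (intro mult_mono mult_nonneg_nonneg) auto
  finally show ?thesis by (simp add: mult_ac)
 next
  case False
  then show ?thesis using c0_pos A by (simp add: ib_def)
 qed
 have bm: "bm ?m" by (rule bmI[OF _ mb]) measurable
 have "kx s A x - kx s A y = cl (%Z. (c0 * kap (s/2) Z * cas (Z \<bullet> x)) * ib A Z - (c0 * kap (s/2) Z * cas (Z \<bullet> y)) * ib A Z)"
  unfolding kx_def by (rule cl_diff[OF l2fun_kx[OF s] l2fun_kx[OF s], symmetric])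
 also have "(%Z. (c0 * kap (s/2) Z * cas (Z \<bullet> x)) * ib A Z - (c0 * kap (s/2) Z * cas (Z \<bullet> y)) * ib A Z) = (%Z. ?m Z * ib A Z)"
  by (auto simp: ib_def indicator_def)
 also have "cl (%Z. ?m Z * ib A Z) = mul ?m (cl (ib A))" by (rule mul_cl[OF bm l2fun_ib, symmetric])
 finally show ?thesis using norm_mul_le[OF bm mb, of "cl (ib A)"] by (simp add: mult_ac)
qed

lemma hi_rep:
 assumes s: "0 <= s"
 shows "Us s f - Us s (lo A f) = Hh (mul (%Z. kap (s/2) Z * (1 - ib A Z)) f)" "bm (%Z. kap (s/2) Z * (1 - ib A Z))"
proof -
 have k: "bm (kap (s/2))" using s by (intro bm_kap) simp
 have b: "bm (%Z. 1 - ib A Z)" by (rule bmI[where C=1]) (use ib_01[of A] in auto)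
 show "bm (%Z. kap (s/2) Z * (1 - ib A Z))" by (rule bm_mult[OF k b])
 have "f - lo A f = mul (%Z. 1 - ib A Z) f"
 proof (rule l2_eqI)
  show "AE x in lborel. fn (f - lo A f) x = fn (mul (%Z. 1 - ib A Z) f) x"
   using fn_minus[of f "lo A f"] fn_mul[OF bm_ib[of A], of f] fn_mul[OF b, of f]
   by eventually_elim (simp add: lo_def algebra_simps)
 qed
 then show "Us s f - Us s (lo A f) = Hh (mul (%Z. kap (s/2) Z * (1 - ib A Z)) f)"
  unfolding bounded_linear.linear[OF bounded_linear_Us[OF s], THEN linear_diff, symmetric] by (simp add: Us_def mul_mul[OF k b])
qed

text \<open>Rellich's theorem without sequences. Orthogonality to the kernels at a finite net makes
  the low frequencies small throughout the ball, as the kernels are Lipschitz in x; frequencies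
  above A contribute at most A^(-s) in L^2.\<close>

lemma local_compact:
 assumes s: "0 < s" and e: "0 < e" and R: "0 < R"
 shows "EX E. finite E & (ALL f. norm f <= 1 --> (ALL x:E. inner f x = 0) -->
   (NB x. ennreal (ib R x * (fn (Us s f) x)^2)) <= ennreal e)"
proof -
 have s0: "0 <= s" using s by simp
 have "((%A::real. A powr (- s)) \<longlongrightarrow> 0) at_top"
  by (intro tendsto_neg_powr filterlim_ident) (use s in simp)
 then have "\<forall>\<^sub>F A in at_top. A powr (- s) < sqrt (e / 4)" by (rule order_tendstoD(2)) (use e in simp)
 then have "\<forall>\<^sub>F A in at_top. A powr (- s) < sqrt (e / 4) & 0 < A" using eventually_gt_at_top[of 0] by (rule eventually_conj)
 then obtain A :: real where A: "A powr (- s) < sqrt (e / 4)" "0 < A" using eventually_happens'[OF trivial_limit_at_top_linorder] by blast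
 define v where "v = vb * R powr 3"
 have v0: "0 < v" using R by (simp add: v_def)
 define L where "L = 2 * c0 * A * norm (cl (ib A))"
 have L0: "0 <= L" using c0_pos A by (simp add: L_def)
 \<comment> \<open>The mesh of the net: the low part is then at most sqrt(e/(4v)) at every point of
   the ball, so twice its square integrates to at most e/2. The high part supplies the other
   half.\<close>
 define d where "d = sqrt (e / (4 * v)) / (L + 1)"
 have d0: "0 < d" unfolding d_def using e v0 L0 by (intro divide_pos_pos real_sqrt_gt_zero) auto
 have "compact (cball (0::r3) R)" by simp
 then obtain N where N: "finite N" "cball (0::r3) R \<subseteq> (\<Union>x\<in>N. ball x d)" unfolding compact_eq_totally_bounded using d0 by blast
 show ?thesis
 proof (intro exI[of _ "kx s A ` N"] conjI allI impI)
  show "finite (kx s A ` N)" using N by simp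
  fix f assume f: "norm f <= 1" and o: "ALL x:kx s A ` N. inner f x = 0"
  let ?h = "Us s f - Us s (lo A f)"
  have mb: "\<bar>kap (s/2) Z * (1 - ib A Z)\<bar> <= A powr (- s)" for Z
  proof (cases "norm Z <= A")
   case True then show ?thesis by (simp add: ib_def)
  next
   case False
   have n: "Z ~= 0" using False A by auto
   have "kap (s/2) Z <= norm Z powr (- 2 * (s/2))" by (rule kap_le_norm[OF _ n]) (use s in simp)
   also have "... <= A powr (- 2 * (s/2))" by (rule powr_mono2') (use s A False in auto)
   finally show ?thesis using False kap_pos[of "s/2" Z] by (simp add: ib_def)
  qed
  have "norm ?h <= A powr (- s) * norm f" unfolding hi_rep(1)[OF s0] norm_Hh by (rule norm_mul_le[OF hi_rep(2)[OF s0] mb])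
  also have "... <= A powr (- s) * 1" by (rule mult_left_mono[OF f]) simp
  finally have "norm ?h <= sqrt (e / 4)" using A by simp
  then have "(norm ?h)^2 <= (sqrt (e / 4))^2" by (rule power_mono) simp
  then have nh: "(norm ?h)^2 <= e / 4" using e by simp
  have lb: "\<bar>inner f (kx s A x)\<bar> <= sqrt (e / (4 * v))" if x: "x : cball 0 R" for x
  proof -
   obtain y where y: "y : N" "x : ball y d" using N(2) x by blast
   have "inner f (kx s A x) = inner f (kx s A x - kx s A y)" using o y by (simp add: inner_diff_right)
   then have "\<bar>inner f (kx s A x)\<bar> <= norm f * norm (kx s A x - kx s A y)" using Cauchy_Schwarz_ineq2 by metis
   also have "... <= 1 * (L * d)"
   proof (rule mult_mono[OF f])
    have "norm (kx s A x - kx s A y) <= L * norm (x - y)" unfolding L_def by (rule kx_lipschitz) (use s A in auto)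
    also have "... <= L * d" by (rule mult_left_mono[OF _ L0]) (use y in "simp add: dist_norm norm_minus_commute")
    finally show "norm (kx s A x - kx s A y) <= L * d" .
   qed auto
   also have "... <= (L + 1) * d" using d0 by (simp add: algebra_simps)
   also have "... = sqrt (e / (4 * v))" unfolding d_def using L0 by simp
   finally show ?thesis .
  qed
  have "(NB x. ennreal (ib R x * (fn (Us s f) x)^2))
   <= (NB x. ennreal (e / (2 * v)) * indicator (cball 0 R) x + 2 * ennreal ((fn ?h x)^2))"
  proof (rule nn_integral_mono_AE, use low_rep[OF s0, of A f] fn_minus[of "Us s f" "Us s (lo A f)"] in eventually_elim)
   fix x assume a: "fn (Us s (lo A f)) x = inner f (kx s A x)" "fn ?h x = fn (Us s f) x - fn (Us s (lo A f)) x"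
   show "ennreal (ib R x * (fn (Us s f) x)^2) <= ennreal (e / (2 * v)) * indicator (cball 0 R) x + 2 * ennreal ((fn ?h x)^2)"
   proof (cases "x : cball 0 R")
    case True
    let ?a = "inner f (kx s A x)" and ?b = "fn ?h x"
    have ab: "fn (Us s f) x = ?a + ?b" using a by simp
    have "?a^2 <= (sqrt (e / (4 * v)))^2" using lb[OF True] power_mono[of "\<bar>?a\<bar>" _ 2] by simp
    then have a2: "?a^2 <= e / (4 * v)" using e v0 by simp
    have "(?a + ?b)^2 <= 2 * ?a^2 + 2 * ?b^2" using sum_squares_bound[of ?a ?b] by (simp add: power2_sum)
    also have "... <= e / (2 * v) + 2 * ?b^2" using a2 by (simp add: field_simps)
    finally have "ennreal ((?a + ?b)^2) <= ennreal (e / (2 * v) + 2 * ?b^2)" by (rule ennreal_leI)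
    also have "... = ennreal (e / (2 * v)) + 2 * ennreal (?b^2)" using e v0 by (simp add: ennreal_plus ennreal_mult)
    finally show ?thesis using True ab by (simp add: ib_def)
   next
    case False then show ?thesis by (simp add: ib_def)
   qed
  qed
  also have "... = ennreal (e / (2 * v)) * emeasure lborel (cball (0::r3) R) + 2 * ennreal ((norm ?h)^2)"
   by (subst nn_integral_add) (auto simp: nn_integral_cmult nn_integral_cmult_indicator nn_integral_norm_l2)
  also have "... = ennreal (e / (2 * v) * v + 2 * (norm ?h)^2)"
  proof -
   have "emeasure lborel (cball (0::r3) R) = ennreal v" using emeasure_cball3[of R] R by (simp add: v_def)
   then have "ennreal (e / (2 * v)) * emeasure lborel (cball (0::r3) R) = ennreal (e / (2 * v) * v)"
    by (simp only:) (rule ennreal_mult[symmetric], use e v0 in auto)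
   moreover have "2 * ennreal ((norm ?h)^2) = ennreal (2 * (norm ?h)^2)" by (simp add: ennreal_mult)
   ultimately show ?thesis using e v0 by (simp only:) (rule ennreal_plus[symmetric], auto)
  qed
  also have "... <= ennreal e" by (rule ennreal_leI) (use nh e v0 in "simp add: field_simps")
  finally show "(NB x. ennreal (ib R x * (fn (Us s f) x)^2)) <= ennreal e" .
 qed
qed

text \<open>The critical Sobolev exponent.\<close>
definition pc :: "real => real" where "pc s = 6 / (3 - 2 * s)"

lemma pc_gt: "3/4 < s ==> s < 1 ==> 4 < pc s" by (simp add: pc_def field_simps)

lemma layer_cake:
 assumes p: "1 < p" and [measurable]: "u : borel_measurable (borel :: r3 measure)"
 shows "(NB x. ennreal (\<bar>u x\<bar> powr p))
  = (NB r. ennreal (if 0 <= r then p * r powr (p - 1) else 0) * emeasure lborel {x. r <= \<bar>u x\<bar>})"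
proof -
 let ?h = "%x r. ennreal (if 0 <= r & r <= \<bar>u x\<bar> then p * r powr (p - 1) else 0)"
 have "(NB x. ennreal (\<bar>u x\<bar> powr p)) = (NB x. NB r. ?h x r)"
 proof (rule nn_integral_cong)
  fix x
  have "(NB r. ?h x r) = (NB r. ennreal p * ennreal (if 0 <= r & r <= \<bar>u x\<bar> then r powr (p - 1) else 0))"
   using p by (intro nn_integral_cong) (simp add: ennreal_mult)
  also have "... = ennreal p * ennreal (\<bar>u x\<bar> powr (p - 1 + 1) / (p - 1 + 1))"
   using p by (subst nn_integral_cmult, measurable, subst nn_powr, auto)
  also have "... = ennreal (\<bar>u x\<bar> powr p)" using p by (simp add: ennreal_mult[symmetric])
  finally show "ennreal (\<bar>u x\<bar> powr p) = (NB r. ?h x r)" by simp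
 qed
 also have "... = (NB r. NB x. ?h x r)"
  by (rule lborel_pair.Fubini'[symmetric]) measurable
 also have "... = (NB r. ennreal (if 0 <= r then p * r powr (p - 1) else 0) * emeasure lborel {x. r <= \<bar>u x\<bar>})"
 proof (rule nn_integral_cong)
  fix r :: real
  have [measurable]: "{x. r <= \<bar>u x\<bar>} : sets borel" by measurable
  have "(NB x. ?h x r) = (NB x. ennreal (if 0 <= r then p * r powr (p - 1) else 0) * indicator {x. r <= \<bar>u x\<bar>} x)"
   by (rule nn_integral_cong) (auto simp: indicator_def)
  then show "(NB x. ?h x r) = ennreal (if 0 <= r then p * r powr (p - 1) else 0) * emeasure lborel {x. r <= \<bar>u x\<bar>}"
   by (simp add: nn_integral_cmult_indicator)
 qed
 finally show ?thesis .
qed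

text \<open>Chemin--Xu: at each height the frequency is cut at the radius where the low part is at most half the height.\<close>
lemma sobolev_bound:
 assumes s: "3/4 < s" "s < 1"
 shows "EX C>=0. ALL f. norm f <= 1 --> (NB x. ennreal (\<bar>fn (Us s f) x\<bar> powr pc s)) <= ennreal C"
proof -
 define p where "p = pc s"
 define b where "b = (3 - 2 * s) / 2"
 \<comment> \<open>Twice the constant of \<open>norm_kx_le\<close>, so that the cut-off with D A^b =
   r leaves a low part of at most r/2.\<close>
 define D where "D = 2 * Dk s"
 have s0: "0 <= s" "0 < s" using s by auto
 have D0: "0 < D" using Dk_pos s unfolding D_def by simp
 have b0: "0 < b" using s by (simp add: b_def)
 have p4: "4 < p" using pc_gt[OF s] by (simp add: p_def)
 \<comment> \<open>This identity singles out the critical exponent: the height integral produces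
   |Z|^(b(p-2)), which must be |Z|^(2s) to cancel against \<open>kap s\<close>.\<close>
 have bp: "b * (p - 2) = 2 * s"
 proof -
  have "3 - 2 * s ~= 0" using s by simp
  then have "(3 - 2 * s) * p = 6" unfolding p_def pc_def times_divide_eq_right by (rule nonzero_mult_div_cancel_left)
  then show ?thesis unfolding b_def by (simp add: algebra_simps)
 qed
 define C where "C = 4 * p * D powr (p - 2) / (p - 2)"
 have C0: "0 <= C" using p4 by (simp add: C_def)
 have "(NB x. ennreal (\<bar>fn (Us s f) x\<bar> powr p)) <= ennreal C" if f: "norm f <= 1" for f
 proof -
  let ?u = "fn (Us s f)"
  have k: "bm (kap (s/2))" using s by (intro bm_kap) simp
  have level: "emeasure lborel {x. r <= \<bar>?u x\<bar>}
    <= (NB Z. ennreal (if r <= D * norm Z powr b then 4 / r^2 * (kap s Z * (fn f Z)^2) else 0))" if r: "0 < r" for r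
  proof -
   define A where "A = (r / D) powr (1 / b)"
   have A0: "0 < A" using r D0 by (simp add: A_def)
   have Ab: "D * A powr b = r" using b0 r D0 by (simp add: A_def powr_powr)
   let ?h = "Us s f - Us s (lo A f)"
   have m [measurable]: "{x. r <= \<bar>?u x\<bar>} : sets borel" by measurable
   have "emeasure lborel {x. r <= \<bar>?u x\<bar>} = (NB x. indicator {x. r <= \<bar>?u x\<bar>} x)" by simp
   also have "... <= (NB x. ennreal (4 / r^2) * ennreal ((fn ?h x)^2))"
   proof (rule nn_integral_mono_AE, use low_rep[OF s0(1), of A f] fn_minus[of "Us s f" "Us s (lo A f)"] in eventually_elim)
    fix x assume a: "fn (Us s (lo A f)) x = inner f (kx s A x)" "fn ?h x = ?u x - fn (Us s (lo A f)) x"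
    show "indicator {x. r <= \<bar>?u x\<bar>} x <= ennreal (4 / r^2) * ennreal ((fn ?h x)^2)"
    proof (cases "r <= \<bar>?u x\<bar>")
     case True
     have "\<bar>inner f (kx s A x)\<bar> <= norm f * norm (kx s A x)" by (rule Cauchy_Schwarz_ineq2)
     also have "... <= 1 * (Dk s * A powr ((3 - 2 * s) / 2))" by (rule mult_mono[OF f norm_kx_le[OF s0(2) s(2) A0]]) auto
     also have "... = r / 2" using Ab unfolding D_def b_def by simp
     finally have "r / 2 <= \<bar>fn ?h x\<bar>" using True a by linarith
     then have "(r / 2)^2 <= (fn ?h x)^2" using r by (subst abs_le_square_iff[symmetric]) simp
     then have "1 <= 4 / r^2 * (fn ?h x)^2" using r by (simp add: field_simps)
     then have "ennreal 1 <= ennreal (4 / r^2 * (fn ?h x)^2)" by (rule ennreal_leI)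
     also have "... = ennreal (4 / r^2) * ennreal ((fn ?h x)^2)" by (rule ennreal_mult) auto
     finally show ?thesis using True by simp
    qed simp
   qed
   also have "... = ennreal (4 / r^2) * ennreal ((norm ?h)^2)" by (simp add: nn_integral_cmult nn_integral_norm_l2)
   also have "ennreal ((norm ?h)^2) = (NB Z. ennreal ((fn (mul (%Z. kap (s/2) Z * (1 - ib A Z)) f) Z)^2))"
    unfolding nn_integral_norm_l2 hi_rep(1)[OF s0(1)] norm_Hh ..
   also have "... = (NB Z. ennreal ((1 - ib A Z) * (kap s Z * (fn f Z)^2)))"
   proof (rule nn_integral_cong_AE, use fn_mul[OF hi_rep(2)[OF s0(1)], of A f] in eventually_elim)
    fix Z assume e: "fn (mul (%Z. kap (s/2) Z * (1 - ib A Z)) f) Z = kap (s/2) Z * (1 - ib A Z) * fn f Z"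
    have "(kap (s/2) Z * (1 - ib A Z) * fn f Z)^2 = (1 - ib A Z) * ((kap (s/2) Z * kap (s/2) Z) * (fn f Z)^2)"
     by (auto simp: power2_eq_square ib_def indicator_def)
    also have "kap (s/2) Z * kap (s/2) Z = kap s Z" by (simp only: kap_mult) simp
    finally show "ennreal ((fn (mul (%Z. kap (s/2) Z * (1 - ib A Z)) f) Z)^2) = ennreal ((1 - ib A Z) * (kap s Z * (fn f Z)^2))"
     by (simp add: e)
   qed
   also have "ennreal (4 / r^2) * ... = (NB Z. ennreal (4 / r^2) * ennreal ((1 - ib A Z) * (kap s Z * (fn f Z)^2)))"
    by (rule nn_integral_cmult[symmetric]) measurable
   also have "... <= (NB Z. ennreal (if r <= D * norm Z powr b then 4 / r^2 * (kap s Z * (fn f Z)^2) else 0))"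
   proof (rule nn_integral_mono)
    fix Z
    show "ennreal (4 / r^2) * ennreal ((1 - ib A Z) * (kap s Z * (fn f Z)^2))
     <= ennreal (if r <= D * norm Z powr b then 4 / r^2 * (kap s Z * (fn f Z)^2) else 0)"
    proof (cases "norm Z <= A")
     case True then show ?thesis by (simp add: ib_def)
    next
     case False
     then have "A powr b <= norm Z powr b" using A0 b0 by (intro powr_mono2) auto
     then have "r <= D * norm Z powr b" using Ab D0 by (metis mult_le_cancel_left_pos)
     then show ?thesis using False kap_pos[of s Z] by (simp add: ib_def ennreal_mult[symmetric])
    qed
   qed
   finally show ?thesis .
  qed
  \<comment> \<open>The layer weight p r^(p-1) times the factor 4/r^2 of the level estimate, with
    the condition on r kept for the inner integral.\<close>
  let ?g = "%r Z. ennreal (kap s Z * (fn f Z)^2 * (4 * p)) * ennreal (if 0 <= r & r <= D * norm Z powr b then r powr (p - 3) else 0)"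
  have "(NB x. ennreal (\<bar>?u x\<bar> powr p))
   = (NB r. ennreal (if 0 <= r then p * r powr (p - 1) else 0) * emeasure lborel {x. r <= \<bar>?u x\<bar>})"
   by (rule layer_cake) (use p4 in auto)
  also have "... <= (NB r. NB Z. ?g r Z)"
  proof (rule nn_integral_mono)
   fix r :: real
   show "ennreal (if 0 <= r then p * r powr (p - 1) else 0) * emeasure lborel {x. r <= \<bar>?u x\<bar>} <= (NB Z. ?g r Z)"
   proof (cases "0 < r")
    case True
    have "ennreal (if 0 <= r then p * r powr (p - 1) else 0) * emeasure lborel {x. r <= \<bar>?u x\<bar>}
     <= ennreal (p * r powr (p - 1)) * (NB Z. ennreal (if r <= D * norm Z powr b then 4 / r^2 * (kap s Z * (fn f Z)^2) else 0))"
     using True by (simp only: if_True less_imp_le) (rule mult_left_mono[OF level], auto)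
    also have "... = (NB Z. ennreal (p * r powr (p - 1)) * ennreal (if r <= D * norm Z powr b then 4 / r^2 * (kap s Z * (fn f Z)^2) else 0))"
     by (rule nn_integral_cmult[symmetric]) measurable
    also have "... = (NB Z. ?g r Z)"
    proof (rule nn_integral_cong)
     fix Z
     have "r powr (p - 1) = r powr (p - 3) * r powr 2" by (subst powr_add[symmetric]) simp
     then have q: "p * r powr (p - 1) * (4 / r^2 * (kap s Z * (fn f Z)^2)) = kap s Z * (fn f Z)^2 * (4 * p) * r powr (p - 3)"
      using True by (simp add: powr_numeral)
     have L: "ennreal (p * r powr (p - 1)) * ennreal (4 / r^2 * (kap s Z * (fn f Z)^2)) = ennreal (p * r powr (p - 1) * (4 / r^2 * (kap s Z * (fn f Z)^2)))"
      by (rule ennreal_mult[symmetric]) (use p4 kap_pos[of s Z] in auto)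
     have R: "ennreal (kap s Z * (fn f Z)^2 * (4 * p)) * ennreal (r powr (p - 3)) = ennreal (kap s Z * (fn f Z)^2 * (4 * p) * r powr (p - 3))"
      by (rule ennreal_mult[symmetric]) (use p4 kap_pos[of s Z] in auto)
     show "ennreal (p * r powr (p - 1)) * ennreal (if r <= D * norm Z powr b then 4 / r^2 * (kap s Z * (fn f Z)^2) else 0) = ?g r Z"
     proof (cases "r <= D * norm Z powr b")
      case c: True
      show ?thesis by (simp only: c less_imp_le[OF True] simp_thms if_True L R q)
     next
      case False then show ?thesis by simp
     qed
    qed
    finally show ?thesis .
   next
    case False then show ?thesis using p4 by auto
   qed
  qed
  also have "... = (NB Z. NB r. ?g r Z)"
   by (rule lborel_pair.Fubini'[symmetric]) measurable
  also have "... <= (NB Z. ennreal C * ennreal ((fn f Z)^2))"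
  proof (rule nn_integral_mono_AE, use AE_lborel_singleton[of "0::r3"] in eventually_elim)
   fix Z :: r3 assume n: "Z ~= 0"
   let ?c = "kap s Z * (fn f Z)^2 * (4 * p)" and ?d = "D * norm Z powr b"
   have c0: "0 <= ?c" using kap_pos[of s Z] p4 by simp
   have d0: "0 <= ?d" using D0 by simp
   have "(NB r. ?g r Z) = ennreal ?c * (NB r. ennreal (if 0 <= r & r <= ?d then r powr (p - 3) else 0))"
    by (rule nn_integral_cmult) measurable
   also have "... = ennreal ?c * ennreal (?d powr (p - 3 + 1) / (p - 3 + 1))"
    by (subst nn_powr) (use p4 d0 in auto)
   also have "... = ennreal (?c * (?d powr (p - 3 + 1) / (p - 3 + 1)))"
    by (rule ennreal_mult[symmetric, OF c0]) (use p4 in simp)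
   also have "... = ennreal (?c * (?d powr (p - 2) / (p - 2)))" by simp
   also have "... <= ennreal (C * (fn f Z)^2)"
   proof (rule ennreal_leI)
    have "?d powr (p - 2) = D powr (p - 2) * norm Z powr (2 * s)" using D0 by (simp add: powr_mult powr_powr bp)
    then have "?c * (?d powr (p - 2) / (p - 2)) = (kap s Z * norm Z powr (2 * s)) * (C * (fn f Z)^2)" by (simp add: C_def mult_ac)
    also have "... <= 1 * (C * (fn f Z)^2)"
    proof (rule mult_right_mono)
     have "kap s Z * norm Z powr (2 * s) <= norm Z powr (- 2 * s) * norm Z powr (2 * s)"
      by (rule mult_right_mono[OF kap_le_norm[OF s0(1) n]]) simp
     also have "... = 1" using n by (subst powr_add[symmetric]) simp
     finally show "kap s Z * norm Z powr (2 * s) <= 1" .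
     show "0 <= C * (fn f Z)^2" using C0 by simp
    qed
    finally show "?c * (?d powr (p - 2) / (p - 2)) <= C * (fn f Z)^2" by simp
   qed
   also have "... = ennreal C * ennreal ((fn f Z)^2)" using C0 by (simp add: ennreal_mult)
   finally show "(NB r. ?g r Z) <= ennreal C * ennreal ((fn f Z)^2)" .
  qed
  also have "... = ennreal C * ennreal ((norm f)^2)" by (simp add: nn_integral_cmult nn_integral_norm_l2)
  also have "... = ennreal (C * (norm f)^2)" using C0 by (simp add: ennreal_mult)
  also have "... <= ennreal C"
   using mult_left_mono[OF power_mono[OF f, of 2], of C] C0 by (intro ennreal_leI) simp
  finally show ?thesis .
 qed
 then show ?thesis using C0 unfolding p_def by blast
qed

text \<open>Young's inequality gives the bound. For smallness, \<open>w\<close> is split into a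
  bounded part of bounded support, where local compactness applies, and a remainder that is small in
  its Lebesgue class.\<close>

lemma weighted_bound:
 assumes s: "3/4 < s" "s < 1" and r: "0 < r" "r < pc s"
  and [measurable]: "w : borel_measurable (borel :: r3 measure)" and w0: "!!x. 0 <= w x"
  and wa: "(NB x. ennreal (w x powr (pc s / (pc s - r)))) < \<infinity>"
 shows "EX C>=0. ALL f. norm f <= 1 --> (NB x. ennreal (w x * \<bar>fn (Us s f) x\<bar> powr r)) <= ennreal C"
  and "0 < e ==> EX E. finite E & (ALL f. norm f <= 1 --> (ALL x:E. inner f x = 0) -->
   (NB x. ennreal (w x * \<bar>fn (Us s f) x\<bar> powr r)) <= ennreal e)"
proof -
 define p where "p = pc s"
 define a where "a = p / (p - r)"
 define b where "b = p / r"
 have p4: "4 < p" using pc_gt[OF s] by (simp add: p_def)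
 have rp: "r < p" using r by (simp add: p_def)
 have ab: "1 < a" "1 < b" "1 / a + 1 / b = 1" using r(1) rp p4 by (auto simp: a_def b_def field_simps)
 have s0: "0 < s" "0 <= s" using s by auto
 have young: "y * z powr r <= y powr a + z powr p" if "0 <= y" "0 <= z" for y z
 proof -
  have "y * z powr r <= y powr a / a + (z powr r) powr b / b" by (rule Youngs_inequality) (use ab that in auto)
  also have "(z powr r) powr b = z powr p" using r by (simp add: powr_powr b_def)
  also have "y powr a / a + z powr p / b <= y powr a + z powr p"
   using ab by (intro add_mono) (auto simp: field_simps mult_le_cancel_right1)
  finally show ?thesis .
 qed
 obtain C where C: "0 <= C" "!!f. norm f <= 1 ==> (NB x. ennreal (\<bar>fn (Us s f) x\<bar> powr p)) <= ennreal C"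
  using sobolev_bound[OF s] unfolding p_def by blast
 have wa': "(NB x. ennreal (w x powr a)) < \<infinity>" using wa by (simp add: a_def p_def)
 obtain I where I: "0 <= I" "(NB x. ennreal (w x powr a)) = ennreal I"
  using wa' by (cases "(NB x. ennreal (w x powr a))") auto
 show "EX C>=0. ALL f. norm f <= 1 --> (NB x. ennreal (w x * \<bar>fn (Us s f) x\<bar> powr r)) <= ennreal C"
 proof (intro exI[of _ "I + C"] conjI allI impI)
  show "0 <= I + C" using I C by simp
  fix f :: l2 assume f: "norm f <= 1"
  have "(NB x. ennreal (w x * \<bar>fn (Us s f) x\<bar> powr r))
   <= (NB x. ennreal (w x powr a) + ennreal (\<bar>fn (Us s f) x\<bar> powr p))"
   by (rule nn_integral_mono) (use young w0 in "simp flip: ennreal_plus add: ennreal_leI")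
  also have "... = ennreal I + (NB x. ennreal (\<bar>fn (Us s f) x\<bar> powr p))"
   by (subst nn_integral_add) (auto simp: I)
  also have "... <= ennreal I + ennreal C" by (rule add_left_mono[OF C(2)[OF f]])
  finally show "(NB x. ennreal (w x * \<bar>fn (Us s f) x\<bar> powr r)) <= ennreal (I + C)" using I C by (simp add: ennreal_plus)
 qed
 assume e: "0 < e"
 \<comment> \<open>The budget is e/5 for each of four contributions: the tail of \<open>w\<close>,
   the Young term for \<open>u\<close>, the interpolation error and the local L^2 norm. This \<eta>
   fixes the second of them.\<close>
 define \<eta> where "\<eta> = (e / (5 * (C + 1))) powr (1 / p)"
 have \<eta>0: "0 < \<eta>" using e C by (simp add: \<eta>_def)
 have \<eta>p: "\<eta> powr p = e / (5 * (C + 1))" using e C p4 by (simp add: \<eta>_def powr_powr)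
 define k where "k = \<eta> powr (- (r * a))"
 have k0: "0 < k" using \<eta>0 by (simp add: k_def)
 define w2 where "w2 n x = (if w x <= real n & norm x <= real n then 0 else w x)" for n x
 have [measurable]: "w2 n : borel_measurable borel" for n unfolding w2_def[abs_def] by measurable
 have w20: "0 <= w2 n x" for n x using w0 by (simp add: w2_def)
 have "(%n. (NB x. ennreal (w2 n x powr a))) \<longlonglongrightarrow> (\<integral>\<^sup>+x. 0 \<partial>(lborel :: r3 measure))"
 proof (rule nn_integral_dominated_convergence[where w="%x. ennreal (w x powr a)"])
  show "AE x in lborel. ennreal (w2 n x powr a) <= ennreal (w x powr a)" for n
   by (rule AE_I2) (auto simp: w2_def)
  show "AE x in lborel. (%n. ennreal (w2 n x powr a)) \<longlonglongrightarrow> 0"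
  proof (rule AE_I2)
   fix x :: r3
   have "w2 n x = 0" if "n >= nat \<lceil>max (w x) (norm x)\<rceil>" for n
    using that by (simp add: w2_def nat_le_iff ceiling_le_iff)
   then have "\<forall>\<^sub>F n in sequentially. ennreal (w2 n x powr a) = 0"
    unfolding eventually_sequentially by (intro exI[of _ "nat \<lceil>max (w x) (norm x)\<rceil>"]) simp
   then show "(%n. ennreal (w2 n x powr a)) \<longlonglongrightarrow> 0" by (rule tendsto_eventually)
  qed
 qed (use wa' in auto)
 then have "(%n. (NB x. ennreal (w2 n x powr a))) \<longlonglongrightarrow> 0" by simp
 then have "\<forall>\<^sub>F n in sequentially. (NB x. ennreal (w2 n x powr a)) < ennreal (e / (5 * k))"
  by (rule order_tendstoD(2)) (use e k0 in simp)
 then have "\<forall>\<^sub>F n in sequentially. (NB x. ennreal (w2 n x powr a)) < ennreal (e / (5 * k)) & 0 < n"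
  using eventually_gt_at_top[of 0] by (rule eventually_conj)
 then obtain n where n: "(NB x. ennreal (w2 n x powr a)) < ennreal (e / (5 * k))" "0 < n"
  using eventually_happens'[OF trivial_limit_sequentially] by blast
 define N where "N = real n"
 have N0: "0 < N" using n by (simp add: N_def)
 define v where "v = vb * N powr 3"
 have v0: "0 <= v" using N0 by (simp add: v_def)
 \<comment> \<open>The interpolation error is paid both on the p-th power integral, bounded by
   \<open>C\<close>, and on the volume \<open>v\<close> of the ball; hence the sum in the
   denominator.\<close>
 define \<theta> where "\<theta> = e / (5 * N * (C + v + 1))"
 have \<theta>0: "0 < \<theta>" using e N0 C v0 by (simp add: \<theta>_def)
 define lo' where "lo' = \<theta> powr (1 / r)"
 define up where "up = (1 / \<theta>) powr (1 / (p - r))"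
 have lu: "0 < lo'" "0 < up" using \<theta>0 by (auto simp: lo'_def up_def)
 define M where "M = up powr r / lo'^2"
 have M0: "0 < M" using lu by (simp add: M_def)
 \<comment> \<open>An intermediate power lies below a small multiple of 1 for small z, below a small
   multiple of z^p for large z, and below a large multiple of z^2 in between.\<close>
 have split: "z powr r <= \<theta> * (z powr p + 1) + M * z^2" if z: "0 <= z" for z
 proof -
  consider "z <= lo'" | "up <= z" | "lo' <= z" "z <= up" by linarith
  then show ?thesis
  proof cases
   case 1
   have "z powr r <= lo' powr r" using 1 z r by (intro powr_mono2) auto
   also have "... = \<theta>" using r \<theta>0 by (simp add: lo'_def powr_powr)
   also have "... <= \<theta> * (z powr p + 1) + M * z^2" using \<theta>0 M0 by (simp add: algebra_simps)
   finally show ?thesis .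
  next
   case 2
   then have zp: "0 < z" using lu by simp
   have "1 / \<theta> = up powr (p - r)" using rp \<theta>0 by (simp add: up_def powr_powr)
   also have "... <= z powr (p - r)" using 2 lu rp by (intro powr_mono2) auto
   finally have "1 <= \<theta> * z powr (p - r)" using \<theta>0 by (simp add: field_simps)
   then have "z powr r * 1 <= z powr r * (\<theta> * z powr (p - r))" by (rule mult_left_mono) simp
   also have "... = \<theta> * (z powr r * z powr (p - r))" by simp
   also have "z powr r * z powr (p - r) = z powr p" by (subst powr_add[symmetric]) simp
   finally have "z powr r <= \<theta> * z powr p" by simp
   also have "... <= \<theta> * (z powr p + 1) + M * z^2" using \<theta>0 M0 by (simp add: algebra_simps)
   finally show ?thesis .
  next
   case 3
   have "z powr r * lo'^2 <= up powr r * z^2" using 3 z r lu by (intro mult_mono powr_mono2 power_mono) auto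
   then have "z powr r <= M * z^2" unfolding M_def using lu by (simp add: field_simps)
   also have "... <= \<theta> * (z powr p + 1) + M * z^2" using \<theta>0 by simp
   finally show ?thesis .
  qed
 qed
 define \<delta> where "\<delta> = e / (5 * N * M)"
 have \<delta>0: "0 < \<delta>" using e N0 M0 by (simp add: \<delta>_def)
 obtain E where E: "finite E" "!!f. norm f <= 1 ==> (ALL x:E. inner f x = 0) ==>
   (NB x. ennreal (ib N x * (fn (Us s f) x)^2)) <= ennreal \<delta>"
  using local_compact[OF s0(1) \<delta>0 N0] by blast
 show "EX E. finite E & (ALL f. norm f <= 1 --> (ALL x:E. inner f x = 0) -->
   (NB x. ennreal (w x * \<bar>fn (Us s f) x\<bar> powr r)) <= ennreal e)"
 proof (intro exI[of _ E] conjI allI impI)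
  show "finite E" by (rule E)
  fix f :: l2 assume f: "norm f <= 1" "ALL x:E. inner f x = 0"
  let ?u = "fn (Us s f)"
  have kk: "k * \<eta> powr (r * a) = 1" unfolding k_def using \<eta>0 by (subst powr_add[symmetric]) simp
  have pw: "w x * \<bar>?u x\<bar> powr r <= k * w2 n x powr a + (\<eta> powr p + N * \<theta>) * \<bar>?u x\<bar> powr p + N * \<theta> * ib N x + N * M * (ib N x * (?u x)^2)" for x
  proof (cases "w x <= N & norm x <= N")
   case True
   have "w x * \<bar>?u x\<bar> powr r <= N * (\<theta> * (\<bar>?u x\<bar> powr p + 1) + M * \<bar>?u x\<bar>^2)"
    using True N0 by (intro mult_mono split) auto
   also have "... = 0 + N * \<theta> * \<bar>?u x\<bar> powr p + N * \<theta> * ib N x + N * M * (ib N x * (?u x)^2)"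
    using True by (simp add: ib_def algebra_simps)
   also have "... <= k * w2 n x powr a + (\<eta> powr p + N * \<theta>) * \<bar>?u x\<bar> powr p + N * \<theta> * ib N x + N * M * (ib N x * (?u x)^2)"
   proof -
    have "0 <= k * w2 n x powr a" "0 <= \<eta> powr p * \<bar>?u x\<bar> powr p" using k0 by auto
    then show ?thesis by (simp add: distrib_right)
   qed
   finally show ?thesis .
  next
   case False
   then have e2: "w2 n x = w x" unfolding w2_def N_def by auto
   have "w x * \<bar>?u x\<bar> powr r = (\<eta> powr (- r) * w x) * (\<eta> * \<bar>?u x\<bar>) powr r"
   proof -
    have "\<eta> powr (- r) * \<eta> powr r = 1" using \<eta>0 by (subst powr_add[symmetric]) simp
    then show ?thesis using \<eta>0 by (simp add: powr_mult)
   qed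
   also have "... <= (\<eta> powr (- r) * w x) powr a + (\<eta> * \<bar>?u x\<bar>) powr p" by (rule young) (use w0 \<eta>0 in auto)
   also have "... = k * w2 n x powr a + \<eta> powr p * \<bar>?u x\<bar> powr p"
    using w0[of x] \<eta>0 by (simp add: powr_mult powr_powr k_def e2)
   also have "... <= k * w2 n x powr a + (\<eta> powr p + N * \<theta>) * \<bar>?u x\<bar> powr p + N * \<theta> * ib N x + N * M * (ib N x * (?u x)^2)"
   proof -
    have "0 <= N * \<theta> * \<bar>?u x\<bar> powr p" "0 <= N * \<theta> * ib N x" "0 <= N * M * (ib N x * (?u x)^2)"
     using N0 \<theta>0 M0 ib_01[of N x] by auto
    then show ?thesis by (simp add: distrib_right)
   qed
   finally show ?thesis .
  qed
  have "(NB x. ennreal (w x * \<bar>?u x\<bar> powr r))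
   <= (NB x. ennreal k * ennreal (w2 n x powr a) + ennreal (\<eta> powr p + N * \<theta>) * ennreal (\<bar>?u x\<bar> powr p)
      + ennreal (N * \<theta>) * indicator (cball 0 N) x + ennreal (N * M) * ennreal (ib N x * (?u x)^2))"
  proof (rule nn_integral_mono)
   fix x
   have "ennreal (w x * \<bar>?u x\<bar> powr r) <= ennreal (k * w2 n x powr a + (\<eta> powr p + N * \<theta>) * \<bar>?u x\<bar> powr p + N * \<theta> * ib N x + N * M * (ib N x * (?u x)^2))"
    by (rule ennreal_leI[OF pw])
   also have "... = ennreal (k * w2 n x powr a) + ennreal ((\<eta> powr p + N * \<theta>) * \<bar>?u x\<bar> powr p) + ennreal (N * \<theta> * ib N x) + ennreal (N * M * (ib N x * (?u x)^2))"
    using k0 N0 \<theta>0 M0 ib_01[of N x] by (simp add: ennreal_plus)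
   also have "... = ennreal k * ennreal (w2 n x powr a) + ennreal (\<eta> powr p + N * \<theta>) * ennreal (\<bar>?u x\<bar> powr p)
      + ennreal (N * \<theta>) * indicator (cball 0 N) x + ennreal (N * M) * ennreal (ib N x * (?u x)^2)"
   proof -
    have "ennreal (ib N x) = indicator (cball 0 N) x" by (simp add: ib_def indicator_def)
    moreover have "ennreal (k * w2 n x powr a) = ennreal k * ennreal (w2 n x powr a)" by (rule ennreal_mult) (use k0 in auto)
    moreover have "ennreal ((\<eta> powr p + N * \<theta>) * \<bar>?u x\<bar> powr p) = ennreal (\<eta> powr p + N * \<theta>) * ennreal (\<bar>?u x\<bar> powr p)"
     by (rule ennreal_mult) (use N0 \<theta>0 in auto)
    moreover have "ennreal (N * \<theta> * ib N x) = ennreal (N * \<theta>) * ennreal (ib N x)" by (rule ennreal_mult) (use N0 \<theta>0 ib_01 in auto)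
    moreover have "ennreal (N * M * (ib N x * (?u x)^2)) = ennreal (N * M) * ennreal (ib N x * (?u x)^2)"
     by (rule ennreal_mult) (use N0 M0 ib_01 in auto)
    ultimately show ?thesis by (simp only:)
   qed
   finally show "ennreal (w x * \<bar>?u x\<bar> powr r) <= ennreal k * ennreal (w2 n x powr a) + ennreal (\<eta> powr p + N * \<theta>) * ennreal (\<bar>?u x\<bar> powr p)
      + ennreal (N * \<theta>) * indicator (cball 0 N) x + ennreal (N * M) * ennreal (ib N x * (?u x)^2)" .
  qed
  also have "... = ennreal k * (NB x. ennreal (w2 n x powr a)) + ennreal (\<eta> powr p + N * \<theta>) * (NB x. ennreal (\<bar>?u x\<bar> powr p))
    + ennreal (N * \<theta>) * emeasure lborel (cball (0::r3) N) + ennreal (N * M) * (NB x. ennreal (ib N x * (?u x)^2))"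
   by (simp add: nn_integral_add nn_integral_cmult nn_integral_cmult_indicator)
  also have "... <= ennreal k * ennreal (e / (5 * k)) + ennreal (\<eta> powr p + N * \<theta>) * ennreal C
    + ennreal (N * \<theta>) * ennreal v + ennreal (N * M) * ennreal \<delta>"
   using n(1) C(2)[OF f(1)] E(2)[OF f] N0
   by (intro add_mono mult_left_mono) (auto simp: emeasure_cball3 v_def simp del: powr_numeral)
  also have "... = ennreal (k * (e / (5 * k)) + (\<eta> powr p + N * \<theta>) * C + N * \<theta> * v + N * M * \<delta>)"
  proof -
   have "0 <= k * (e / (5 * k))" "0 <= (\<eta> powr p + N * \<theta>) * C" "0 <= N * \<theta> * v" "0 <= N * M * \<delta>"
    using k0 e C N0 \<theta>0 v0 M0 \<delta>0 by auto
   moreover have "ennreal (k * (e / (5 * k))) = ennreal k * ennreal (e / (5 * k))"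
    "ennreal ((\<eta> powr p + N * \<theta>) * C) = ennreal (\<eta> powr p + N * \<theta>) * ennreal C"
    "ennreal (N * \<theta> * v) = ennreal (N * \<theta>) * ennreal v" "ennreal (N * M * \<delta>) = ennreal (N * M) * ennreal \<delta>"
    by (rule ennreal_mult; use k0 e C N0 \<theta>0 v0 M0 \<delta>0 in auto)+
   ultimately show ?thesis by (simp only: ennreal_plus add_nonneg_nonneg)
  qed
  also have "... <= ennreal e"
  proof (rule ennreal_leI)
   have 1: "k * (e / (5 * k)) = e / 5" using k0 by simp
   have "\<eta> powr p * C <= \<eta> powr p * (C + 1)" by (rule mult_left_mono) auto
   also have "... = e / 5" unfolding \<eta>p using C by (simp add: field_simps)
   finally have 2: "\<eta> powr p * C <= e / 5" .
   have "N * \<theta> * (C + v) <= N * \<theta> * (C + v + 1)" by (rule mult_left_mono) (use N0 \<theta>0 in auto)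
   also have "... = e / 5" 
   proof -
    have "N ~= 0" "C + v + 1 ~= 0" using N0 C v0 by linarith+
    moreover have "N * (e / (5 * N * X)) * X = e / 5" if "N ~= 0" "X ~= 0" for X using that by simp
    ultimately show ?thesis unfolding \<theta>_def by blast
   qed
   finally have 3: "N * \<theta> * C + N * \<theta> * v <= e / 5" by (simp add: distrib_left)
   have 4: "N * M * \<delta> = e / 5" unfolding \<delta>_def using N0 M0 by simp
   show "k * (e / (5 * k)) + (\<eta> powr p + N * \<theta>) * C + N * \<theta> * v + N * M * \<delta> <= e"
    unfolding 1 4 distrib_right using 2 3 e by linarith
  qed
  finally show "(NB x. ennreal (w x * \<bar>?u x\<bar> powr r)) <= ennreal e" .
 qed
qed

abbreviation uf :: "real => l2 => r3 => real" where "uf s f \<equiv> fn (Us s f)"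

lemma uf_add: "0 <= s ==> AE x in lborel. uf s (f + h) x = uf s f x + uf s h x"
 using fn_plus[of "Us s f" "Us s h"] by (simp add: linear_add[OF bounded_linear.linear[OF bounded_linear_Us]])

lemma uf_diff: "0 <= s ==> AE x in lborel. uf s (f - h) x = uf s f x - uf s h x"
 using fn_minus[of "Us s f" "Us s h"] by (simp add: linear_diff[OF bounded_linear.linear[OF bounded_linear_Us]])

lemma uf_scale: "0 <= s ==> AE x in lborel. uf s (c *\<^sub>R f) x = c * uf s f x"
 using fn_scaleR[of c "Us s f"] by (simp add: linear_scale[OF bounded_linear.linear[OF bounded_linear_Us]])

definition WN :: "real => (r3 => real) => real => l2 => real" where
 "WN s w r f = (LB x. w x * \<bar>uf s f x\<bar> powr r)"

lemma WN_hom_step: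
 assumes s: "0 <= s" and r: "0 < r" and C: "0 <= C" and [measurable]: "w : borel_measurable (borel :: r3 measure)" and w0: "!!x. 0 <= w x"
  and b: "f ~= 0 ==> (NB x. ennreal (w x * \<bar>uf s ((1 / norm f) *\<^sub>R f) x\<bar> powr r)) <= ennreal C"
 shows "integrable lborel (%x. w x * \<bar>uf s f x\<bar> powr r)" "WN s w r f <= C * norm f powr r"
proof -
 have n: "(NB x. ennreal (w x * \<bar>uf s f x\<bar> powr r)) <= ennreal (C * norm f powr r)"
 proof (cases "f = 0")
  case True
  have "AE x in lborel. ennreal (w x * \<bar>uf s f x\<bar> powr r) = 0"
   using uf_scale[OF s, of 0 f] by eventually_elim (simp add: True)
  then have "(NB x. ennreal (w x * \<bar>uf s f x\<bar> powr r)) = 0" by (subst nn_integral_0_iff_AE) auto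
  then show ?thesis by simp
 next
  case False
  let ?g = "(1 / norm f) *\<^sub>R f"
  have "f = norm f *\<^sub>R ?g" using False by simp
  then have ae: "AE x in lborel. uf s f x = norm f * uf s ?g x" using uf_scale[OF s, of "norm f" ?g] by metis
  have "(NB x. ennreal (w x * \<bar>uf s f x\<bar> powr r))
   = (NB x. ennreal (norm f powr r) * ennreal (w x * \<bar>uf s ?g x\<bar> powr r))"
  proof (rule nn_integral_cong_AE, use ae in eventually_elim)
   fix x assume e: "uf s f x = norm f * uf s ?g x"
   have "w x * \<bar>uf s f x\<bar> powr r = norm f powr r * (w x * \<bar>uf s ?g x\<bar> powr r)"
    unfolding e abs_mult by (simp add: powr_mult)
   then show "ennreal (w x * \<bar>uf s f x\<bar> powr r) = ennreal (norm f powr r) * ennreal (w x * \<bar>uf s ?g x\<bar> powr r)"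
    using w0[of x] by (simp only:) (rule ennreal_mult, auto)
  qed
  also have "... = ennreal (norm f powr r) * (NB x. ennreal (w x * \<bar>uf s ?g x\<bar> powr r))"
   by (rule nn_integral_cmult) measurable
  also have "... <= ennreal (norm f powr r) * ennreal C" by (rule mult_left_mono[OF b[OF False]]) simp
  also have "... = ennreal (C * norm f powr r)" using C by (simp add: ennreal_mult[symmetric] mult.commute)
  finally show ?thesis .
 qed
 show i: "integrable lborel (%x. w x * \<bar>uf s f x\<bar> powr r)"
 proof (rule integrableI_bounded)
  have "(NB x. ennreal (norm (w x * \<bar>uf s f x\<bar> powr r))) = (NB x. ennreal (w x * \<bar>uf s f x\<bar> powr r))"
   using w0 by (intro nn_integral_cong) simp
  also have "... < \<infinity>" using n by (rule order_le_less_trans) simp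
  finally show "(NB x. ennreal (norm (w x * \<bar>uf s f x\<bar> powr r))) < \<infinity>" .
 qed measurable
 have "ennreal (WN s w r f) <= ennreal (C * norm f powr r)"
  unfolding WN_def using n nn_integral_eq_integral[OF i] w0 by simp
 then show "WN s w r f <= C * norm f powr r" using C by (subst (asm) ennreal_le_iff) auto
qed

lemma weighted_hom:
 assumes s: "3/4 < s" "s < 1" and r: "0 < r" "r < pc s"
  and w: "w : borel_measurable (borel :: r3 measure)" "!!x. 0 <= w x"
  and wa: "(NB x. ennreal (w x powr (pc s / (pc s - r)))) < \<infinity>"
 shows "!!f. integrable lborel (%x. w x * \<bar>uf s f x\<bar> powr r)"
  and "EX C>=0. ALL f. WN s w r f <= C * norm f powr r"
  and "0 < e ==> EX E. finite E & (ALL f. (ALL x:E. inner f x = 0) --> WN s w r f <= e * norm f powr r)"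
proof -
 have s0: "0 <= s" using s by simp
 obtain C where C: "0 <= C" "!!f. norm f <= 1 ==> (NB x. ennreal (w x * \<bar>uf s f x\<bar> powr r)) <= ennreal C"
  using weighted_bound(1)[OF s r w wa] by blast
 have un: "norm ((1 / norm f) *\<^sub>R f) <= 1" for f :: l2 by simp
 note st = WN_hom_step[OF s0 r(1) C(1) w C(2)[OF un]]
 show "!!f. integrable lborel (%x. w x * \<bar>uf s f x\<bar> powr r)" by (rule st(1))
 show "EX C>=0. ALL f. WN s w r f <= C * norm f powr r" using st(2) C(1) by blast
 assume e: "0 < e"
 then obtain E where E: "finite E" "!!f. norm f <= 1 ==> (ALL x:E. inner f x = 0) ==>
   (NB x. ennreal (w x * \<bar>uf s f x\<bar> powr r)) <= ennreal e"
  using weighted_bound(2)[OF s r w wa] by blast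
 show "EX E. finite E & (ALL f. (ALL x:E. inner f x = 0) --> WN s w r f <= e * norm f powr r)"
 proof (intro exI[of _ E] conjI allI impI)
  show "finite E" by (rule E)
  fix f assume o: "ALL x:E. inner f x = 0"
  show "WN s w r f <= e * norm f powr r"
   by (rule WN_hom_step(2)[OF s0 r(1) _ w E(2)[OF un]]) (use e o in auto)
 qed
qed

definition sg :: "real => real => real" where "sg q x = \<bar>x\<bar> powr (q - 2) * x"

lemma sg_meas [measurable]: "sg q : borel_measurable borel" unfolding sg_def[abs_def] by measurable

lemma sg_minus: "sg q (- x) = - sg q x" by (simp add: sg_def)
lemma sg_nonneg: "0 <= x ==> sg q x = x powr (q - 1)"
 by (cases "x = 0") (auto simp: sg_def powr_diff power2_eq_square powr_numeral)
lemma abs_sg: "\<bar>sg q x\<bar> = \<bar>x\<bar> powr (q - 1)"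
 using sg_nonneg[of "\<bar>x\<bar>" q] by (simp add: sg_def abs_mult)
lemma sg_times_self: "sg q x * x = \<bar>x\<bar> powr q"
proof (cases "x = 0")
 case False
 have "sg q x * x = \<bar>x\<bar> powr (q - 2) * \<bar>x\<bar> powr 2" using False by (simp add: sg_def power2_eq_square powr_numeral)
 also have "... = \<bar>x\<bar> powr q" by (subst powr_add[symmetric]) simp
 finally show ?thesis .
qed (simp add: sg_def)

lemma powr_subadd:
 assumes "0 <= a" "a <= 1" "0 <= x" "0 <= (y::real)" shows "(x + y) powr a <= x powr a + y powr a"
proof (cases "x + y = 0")
 case False
 then have p: "0 < x + y" using assms by linarith
 have le: "z / (x + y) <= (z / (x + y)) powr a" if "0 <= z" "z <= x + y" for z
 proof (cases "z = 0")
  case False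
  have "(z / (x + y)) powr 1 <= (z / (x + y)) powr a"
   by (rule powr_mono') (use assms that p False in auto)
  then show ?thesis using that p by simp
 qed simp
 have "1 = x / (x + y) + y / (x + y)" using p by (simp add: add_divide_distrib[symmetric])
 also have "... <= (x / (x + y)) powr a + (y / (x + y)) powr a" using assms by (intro add_mono le) auto
 also have "... = (x powr a + y powr a) / (x + y) powr a" using assms p by (simp add: powr_divide add_divide_distrib)
 finally show ?thesis using p by (simp add: le_divide_eq)
qed (use assms in auto)

text \<open>For equal signs this is subadditivity of the power q - 1; for opposite signs both
  arguments are at most their distance in absolute value.\<close>

lemma sg_holder:
 assumes q: "1 < q" "q < 2" shows "\<bar>sg q a - sg q b\<bar> <= 2 * \<bar>a - b\<bar> powr (q - 1)"
proof -
 have same: "\<bar>sg q x - sg q y\<bar> <= 2 * \<bar>x - y\<bar> powr (q - 1)" if "0 <= y" "y <= x" for x y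
 proof -
  have "x powr (q - 1) <= (x - y) powr (q - 1) + y powr (q - 1)"
   using powr_subadd[of "q - 1" "x - y" y] q that by simp
  moreover have "y powr (q - 1) <= x powr (q - 1)" using that q by (intro powr_mono2) auto
  moreover have "0 <= (x - y) powr (q - 1)" by simp
  ultimately show ?thesis using that by (simp add: sg_nonneg)
 qed
 have opp: "\<bar>sg q x - sg q y\<bar> <= 2 * \<bar>x - y\<bar> powr (q - 1)" if "y <= 0" "0 <= x" for x y
 proof -
  have "sg q y = - ((- y) powr (q - 1))" using sg_minus[of q "- y"] sg_nonneg[of "- y" q] that by simp
  moreover have "x powr (q - 1) <= (x - y) powr (q - 1)" "(- y) powr (q - 1) <= (x - y) powr (q - 1)"
   using that q by (auto intro!: powr_mono2)
  moreover have "0 <= x powr (q - 1)" "0 <= (- y) powr (q - 1)" by auto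
  ultimately show ?thesis using that by (simp add: sg_nonneg)
 qed
 have sym: "\<bar>sg q x - sg q y\<bar> = \<bar>sg q (- x) - sg q (- y)\<bar>" for x y by (simp add: sg_minus)
 consider "0 <= b" "b <= a" | "0 <= a" "a <= b" | "b <= 0" "0 <= a" | "a <= 0" "0 <= b" | "a <= 0" "b <= a" | "b <= 0" "a <= b" by linarith
 then show ?thesis
 proof cases
  case 1 then show ?thesis by (rule same)
 next
  case 2 then show ?thesis using same[of a b] by (simp add: abs_minus_commute)
 next
  case 3 then show ?thesis by (rule opp)
 next
  case 4 then show ?thesis using opp[of a b] by (simp add: abs_minus_commute)
 next
  case 5 then show ?thesis using same[of "- a" "- b"] by (simp add: sg_minus abs_minus_commute)
 next
  case 6 then show ?thesis using same[of "- b" "- a"] by (simp add: sg_minus abs_minus_commute)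
 qed
qed

lemma abs_powr_deriv:
 assumes q: "1 < q" shows "((%x. \<bar>x\<bar> powr q) has_real_derivative q * sg q x) (at x)"
proof -
 consider "0 < x" | "x < 0" | "x = 0" by linarith
 then show ?thesis
 proof cases
  case 1
  have "((%x. x powr q) has_real_derivative q * sg q x) (at x)"
   using has_real_derivative_powr[OF 1, of q] sg_nonneg[of x q] 1 by simp
  moreover have "\<forall>\<^sub>F y in nhds x. y powr q = \<bar>y\<bar> powr q"
   using eventually_nhds_in_open[of "{0<..}" x] 1 by (auto elim!: eventually_mono)
  ultimately show ?thesis by (subst DERIV_cong_ev[OF refl _ refl, symmetric])
 next
  case 2
  have "((%x. (- x) powr q) has_real_derivative q * sg q x) (at x)"
  proof -
   have i: "((%x. - x) has_real_derivative - 1) (at x)" by (auto intro!: derivative_eq_intros)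
   have "sg q x = - ((- x) powr (q - 1))" using 2 sg_nonneg[of "- x" q] sg_minus[of q x] by simp
   then have e: "q * sg q x = q * (- x) powr (q - 1) * - 1" by simp
   show ?thesis unfolding e by (rule DERIV_chain2[OF has_real_derivative_powr i]) (use 2 in simp)
  qed
  moreover have "\<forall>\<^sub>F y in nhds x. (- y) powr q = \<bar>y\<bar> powr q"
   using eventually_nhds_in_open[of "{..<0}" x] 2 by (auto elim!: eventually_mono)
  ultimately show ?thesis by (subst DERIV_cong_ev[OF refl _ refl, symmetric])
 next
  case 3
  have "((%h. sg q h) \<longlongrightarrow> 0) (at 0)"
  proof (rule Lim_null_comparison)
   show "\<forall>\<^sub>F h in at 0. norm (sg q h) <= \<bar>h\<bar> powr (q - 1)" by (simp add: abs_sg)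
   have "((%h::real. \<bar>h\<bar> powr (q - 1)) \<longlongrightarrow> \<bar>0\<bar> powr (q - 1)) (at 0)"
    by (rule tendsto_powr'[OF tendsto_rabs[OF tendsto_ident_at] tendsto_const]) (use q in auto)
   then show "((%h::real. \<bar>h\<bar> powr (q - 1)) \<longlongrightarrow> 0) (at 0)" by simp
  qed
  moreover have "\<forall>\<^sub>F h in at 0. sg q h = (\<bar>0 + h\<bar> powr q - \<bar>0\<bar> powr q) / h"
   unfolding eventually_at_filter by (rule always_eventually) (auto simp flip: sg_times_self)
  ultimately show ?thesis unfolding 3 DERIV_def by (simp add: sg_def tendsto_cong)
 qed
qed

text \<open>The mean value theorem with the Hoelder bound for the derivative. A second order
  expansion is impossible at 0, so the remainder has order q only.\<close>

lemma abs_powr_taylor: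
 assumes q: "1 < q" "q < 2"
 shows "\<bar>\<bar>a + h\<bar> powr q - \<bar>a\<bar> powr q - q * sg q a * h\<bar> <= 2 * q * \<bar>h\<bar> powr q"
proof -
 have "((%t. \<bar>a + t * h\<bar> powr q) has_real_derivative q * sg q (a + t * h) * h) (at t)" for t
 proof -
  have "((%t. a + t * h) has_real_derivative h) (at t)" by (auto intro!: derivative_eq_intros)
  from DERIV_chain2[OF abs_powr_deriv[OF q(1)] this] show ?thesis .
 qed
 then obtain t where t: "0 < t" "t < 1" "\<bar>a + 1 * h\<bar> powr q - \<bar>a + 0 * h\<bar> powr q = (1 - 0) * (q * sg q (a + t * h) * h)"
  using MVT2[of 0 1 "%t. \<bar>a + t * h\<bar> powr q" "%t. q * sg q (a + t * h) * h"] by auto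
 have "\<bar>a + h\<bar> powr q - \<bar>a\<bar> powr q - q * sg q a * h = q * (sg q (a + t * h) - sg q a) * h"
  using t(3) by (simp add: algebra_simps)
 then have "\<bar>\<bar>a + h\<bar> powr q - \<bar>a\<bar> powr q - q * sg q a * h\<bar> = q * \<bar>sg q (a + t * h) - sg q a\<bar> * \<bar>h\<bar>"
  using q by (simp add: abs_mult)
 also have "... <= q * (2 * \<bar>(a + t * h) - a\<bar> powr (q - 1)) * \<bar>h\<bar>"
  using q by (intro mult_right_mono mult_left_mono sg_holder) auto
 also have "... <= q * (2 * \<bar>h\<bar> powr (q - 1)) * \<bar>h\<bar>"
  using q t by (intro mult_right_mono mult_left_mono powr_mono2) (auto simp: abs_mult mult_left_le_one_le)
 also have "\<bar>h\<bar> powr (q - 1) * \<bar>h\<bar> = \<bar>h\<bar> powr q"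
  using sg_times_self[of q "\<bar>h\<bar>"] sg_nonneg[of "\<bar>h\<bar>" q] by simp
 then have "q * (2 * \<bar>h\<bar> powr (q - 1)) * \<bar>h\<bar> = 2 * q * \<bar>h\<bar> powr q" by (simp add: mult_ac)
 finally show ?thesis .
qed

section \<open>The variational problem\<close>

locale local_term =
 fixes s q :: real and g :: "r3 => real"
 assumes s: "3/4 < s" "s < 1" and q: "1 < q" "q < 4/3" and g_meas [measurable]: "g : borel_measurable borel"
  and g_int: "(NB x. ennreal (\<bar>g x\<bar> powr (6 / (6 - q * (3 - 2 * s))))) < \<infinity>"
begin

lemma s0: "0 <= s" "0 < s" using s by auto

abbreviation u :: "l2 => r3 => real" where "u \<equiv> uf s"
abbreviation N :: "l2 => real" where "N \<equiv> WN s (%x. \<bar>g x\<bar>) q"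

lemma q_lt_pc: "q < pc s" using pc_gt[OF s] q by simp

text \<open>The exponent given for \<open>g\<close> is the one conjugate to
  \<open>pc s / q\<close>.\<close>

lemma g_int': "(NB x. ennreal (\<bar>g x\<bar> powr (pc s / (pc s - q)))) < \<infinity>"
proof -
 have e: "pc s - q = (6 - q * (3 - 2 * s)) / (3 - 2 * s)" using s by (simp add: pc_def field_simps)
 have m: "6 / c / (d / c) = 6 / d" if "c ~= 0" for c d :: real using that by simp
 have "3 - 2 * s ~= 0" using s by simp
 then have "pc s / (pc s - q) = 6 / (6 - q * (3 - 2 * s))" unfolding e unfolding pc_def by (rule m)
 then show ?thesis using g_int by simp
qed

lemma N_facts:
 shows N_int: "!!f. integrable lborel (%x. \<bar>g x\<bar> * \<bar>u f x\<bar> powr q)"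
  and N_bound: "EX C>=0. ALL f. N f <= C * norm f powr q"
  and N_compact: "0 < e ==> EX E. finite E & (ALL f. (ALL x:E. inner f x = 0) --> N f <= e * norm f powr q)"
proof -
 have q0: "0 < q" using q by simp
 have m: "(%x. \<bar>g x\<bar>) : borel_measurable borel" by measurable
 note W = weighted_hom[OF s q0 q_lt_pc m abs_ge_zero g_int']
 show "!!f. integrable lborel (%x. \<bar>g x\<bar> * \<bar>u f x\<bar> powr q)" by (rule W(1))
 show "EX C>=0. ALL f. N f <= C * norm f powr q" by (rule W(2))
 show "0 < e ==> EX E. finite E & (ALL f. (ALL x:E. inner f x = 0) --> N f <= e * norm f powr q)" by (rule W(3))
qed

lemma N_nonneg: "0 <= N f" unfolding WN_def by (rule integral_nonneg_AE) simp

lemma N_scale: "N (c *\<^sub>R f) = \<bar>c\<bar> powr q * N f"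
proof -
 have "N (c *\<^sub>R f) = (LB x. \<bar>c\<bar> powr q * (\<bar>g x\<bar> * \<bar>u f x\<bar> powr q))"
  unfolding WN_def
  by (rule integral_cong_AE) (measurable, use uf_scale[OF s0(1), of c f] in "eventually_elim, simp add: abs_mult powr_mult")
 then show ?thesis by (simp add: WN_def)
qed

definition Mg :: "l2 => l2 => real" where "Mg f h = (LB x. \<bar>g x\<bar> * (\<bar>u f x\<bar> powr (q - 1) * \<bar>u h x\<bar>))"

lemma young_q: assumes "0 <= a" "0 <= (b::real)" shows "a powr (q - 1) * b <= a powr q + b powr q"
proof -
 have e: "x powr (q - 1) * x = x powr q" if "0 <= x" for x using sg_times_self[of q x] sg_nonneg[of x q] that by simp
 show ?thesis
 proof (cases "b <= a")
  case True
  have "a powr (q - 1) * b <= a powr (q - 1) * a" by (rule mult_left_mono[OF True]) simp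
  then show ?thesis using e assms by (simp add: add_increasing2)
 next
  case False
  have "a powr (q - 1) * b <= b powr (q - 1) * b" by (intro mult_right_mono powr_mono2) (use False assms q in auto)
  then show ?thesis using e assms by (simp add: add_increasing)
 qed
qed

lemma Mg_int: "integrable lborel (%x. \<bar>g x\<bar> * (\<bar>u f x\<bar> powr (q - 1) * \<bar>u h x\<bar>))"
proof (rule bint_bound[OF bint_add[OF N_int[of f] N_int[of h]]])
 show "AE x in lborel. norm (\<bar>g x\<bar> * (\<bar>u f x\<bar> powr (q - 1) * \<bar>u h x\<bar>)) <= norm (\<bar>g x\<bar> * \<bar>u f x\<bar> powr q + \<bar>g x\<bar> * \<bar>u h x\<bar> powr q)"
 proof (rule AE_I2)
  fix x
  have "\<bar>g x\<bar> * (\<bar>u f x\<bar> powr (q - 1) * \<bar>u h x\<bar>) <= \<bar>g x\<bar> * (\<bar>u f x\<bar> powr q + \<bar>u h x\<bar> powr q)"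
   by (intro mult_left_mono young_q) auto
  then show "norm (\<bar>g x\<bar> * (\<bar>u f x\<bar> powr (q - 1) * \<bar>u h x\<bar>)) <= norm (\<bar>g x\<bar> * \<bar>u f x\<bar> powr q + \<bar>g x\<bar> * \<bar>u h x\<bar> powr q)"
   by (simp add: abs_mult distrib_left)
 qed
qed measurable

lemma Mg_le_N: "Mg f h <= N f + N h"
proof -
 have "Mg f h <= (LB x. \<bar>g x\<bar> * \<bar>u f x\<bar> powr q + \<bar>g x\<bar> * \<bar>u h x\<bar> powr q)"
  unfolding Mg_def
 proof (rule integral_mono[OF Mg_int bint_add[OF N_int N_int]])
  fix x
  have "\<bar>g x\<bar> * (\<bar>u f x\<bar> powr (q - 1) * \<bar>u h x\<bar>) <= \<bar>g x\<bar> * (\<bar>u f x\<bar> powr q + \<bar>u h x\<bar> powr q)"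
   by (intro mult_left_mono young_q) auto
  then show "\<bar>g x\<bar> * (\<bar>u f x\<bar> powr (q - 1) * \<bar>u h x\<bar>) <= \<bar>g x\<bar> * \<bar>u f x\<bar> powr q + \<bar>g x\<bar> * \<bar>u h x\<bar> powr q"
   by (simp add: distrib_left)
 qed
 also have "... = N f + N h" unfolding WN_def by (rule bintegral_add[OF N_int N_int])
 finally show ?thesis .
qed

lemma Mg_scale: assumes "0 <= c" "0 <= d" shows "Mg (c *\<^sub>R f) (d *\<^sub>R h) = c powr (q - 1) * d * Mg f h"
proof -
 have "Mg (c *\<^sub>R f) (d *\<^sub>R h) = (LB x. (c powr (q - 1) * d) * (\<bar>g x\<bar> * (\<bar>u f x\<bar> powr (q - 1) * \<bar>u h x\<bar>)))"
  unfolding Mg_def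
  by (rule integral_cong_AE) (measurable, use uf_scale[OF s0(1), of c f] uf_scale[OF s0(1), of d h] in "eventually_elim, simp add: abs_mult powr_mult assms")
 then show ?thesis by (simp add: Mg_def)
qed

text \<open>Hoelder's inequality by homogeneity: the cruder bound \<open>Mg_le_N\<close> is applied
  to suitable multiples of \<open>f\<close> and \<open>h\<close>. The free parameter
  \<open>d\<close> lets a small constant for \<open>h\<close> outweigh a large one for
  \<open>f\<close>.\<close>

lemma Mg_le:
 assumes d: "0 < d" and f: "N f <= C * norm f powr q" and h: "N h <= e * norm h powr q"
 shows "Mg f h <= (C * d powr q + e * d powr (- (q - 1) * q)) * (norm f powr (q - 1) * norm h)"
proof (cases "f = 0 \<or> h = 0")
 case True
 have "Mg f h = 0"
 proof (cases "h = 0")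
  case True then show ?thesis using Mg_scale[of 1 0 f h] by simp
 next
  case False
  then have "f = 0" using \<open>f = 0 \<or> h = 0\<close> by simp
  then show ?thesis using Mg_scale[of 0 1 f h] by simp
 qed
 then show ?thesis using True by auto
next
 case False
 \<comment> \<open>The factors satisfy c1^(q-1) c2 |f|^(q-1) |h| = 1, so rescaling reproduces the
   claimed right-hand side.\<close>
 define c1 where "c1 = d / norm f"
 define c2 where "c2 = d powr (- (q - 1)) / norm h"
 have p: "0 < c1" "0 < c2" "0 < norm f" "0 < norm h" using False d by (auto simp: c1_def c2_def)
 have 1: "N (c1 *\<^sub>R f) <= C * d powr q"
 proof -
  have "N (c1 *\<^sub>R f) <= c1 powr q * (C * norm f powr q)" unfolding N_scale by (rule mult_mono) (use p f N_nonneg in auto)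
  also have "... = C * (c1 * norm f) powr q" using p by (simp add: powr_mult)
  finally show ?thesis using p by (simp add: c1_def)
 qed
 have 2: "N (c2 *\<^sub>R h) <= e * d powr (- (q - 1) * q)"
 proof -
  have "N (c2 *\<^sub>R h) <= c2 powr q * (e * norm h powr q)" unfolding N_scale using p by (intro mult_left_mono[OF h, THEN order_trans]) auto
  also have "... = e * (c2 * norm h) powr q" using p by (simp add: powr_mult)
  finally show ?thesis using p by (simp add: c2_def powr_powr)
 qed
 have k: "c1 powr (q - 1) * c2 * (norm f powr (q - 1) * norm h) = 1"
 proof -
  have "c1 powr (q - 1) * c2 * (norm f powr (q - 1) * norm h) = (c1 * norm f) powr (q - 1) * (c2 * norm h)" using p by (simp add: powr_mult)
  also have "... = d powr (q - 1) * d powr (- (q - 1))" using p by (simp add: c1_def c2_def)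
  also have "... = 1" using d by (subst powr_add[symmetric]) simp
  finally show ?thesis .
 qed
 have "Mg f h = (c1 powr (q - 1) * c2 * (norm f powr (q - 1) * norm h)) * Mg f h" by (simp only: k)
 also have "... = Mg (c1 *\<^sub>R f) (c2 *\<^sub>R h) * (norm f powr (q - 1) * norm h)" using p by (simp add: Mg_scale)
 also have "... <= (C * d powr q + e * d powr (- (q - 1) * q)) * (norm f powr (q - 1) * norm h)"
  by (rule mult_right_mono) (use Mg_le_N[of "c1 *\<^sub>R f" "c2 *\<^sub>R h"] 1 2 in auto)
 finally show ?thesis .
qed

lemma Mg_bound: "EX C>=0. ALL f h. Mg f h <= C * (norm f powr (q - 1) * norm h)"
proof -
 obtain C where "0 <= C" "!!f. N f <= C * norm f powr q" using N_bound by blast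
 then show ?thesis using Mg_le[of 1 _ C _ C] by (intro exI[of _ "C + C"]) auto
qed

lemma Mg_compact:
 assumes e: "0 < e" shows "EX E. finite E & (ALL f h. (ALL x:E. inner h x = 0) --> Mg f h <= e * (norm f powr (q - 1) * norm h))"
proof -
 obtain C where C: "0 <= C" "!!f. N f <= C * norm f powr q" using N_bound by blast
 \<comment> \<open>The order of choices matters: first \<open>d\<close> makes the share of
   \<open>f\<close> at most e/2, then e' is taken so small that the share of \<open>h\<close> is e/2
   for this \<open>d\<close>.\<close>
 define d where "d = (e / (2 * (C + 1))) powr (1 / q)"
 have d0: "0 < d" using e C by (simp add: d_def)
 have "C * d powr q <= (C + 1) * d powr q" by (rule mult_right_mono) auto
 also have "... = e / 2" using e C q by (simp add: d_def powr_powr field_simps)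
 finally have 1: "C * d powr q <= e / 2" .
 define e' where "e' = e / 2 * d powr ((q - 1) * q)"
 have e'0: "0 < e'" using e d0 by (simp add: e'_def)
 have 2: "e' * d powr (- (q - 1) * q) = e / 2"
 proof -
  have "d powr ((q - 1) * q) * d powr (- (q - 1) * q) = 1" using d0 by (subst powr_add[symmetric]) (simp add: algebra_simps)
  then show ?thesis by (simp add: e'_def)
 qed
 obtain E where E: "finite E" "!!h. (ALL x:E. inner h x = 0) ==> N h <= e' * norm h powr q" using N_compact[OF e'0] by blast
 show ?thesis
 proof (intro exI[of _ E] conjI allI impI)
  fix f h assume o: "ALL x:E. inner h x = 0"
  have "Mg f h <= (C * d powr q + e' * d powr (- (q - 1) * q)) * (norm f powr (q - 1) * norm h)"
   by (rule Mg_le[OF d0 C(2) E(2)[OF o]])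
  also have "... <= e * (norm f powr (q - 1) * norm h)" by (rule mult_right_mono) (use 1 2 in auto)
  finally show "Mg f h <= e * (norm f powr (q - 1) * norm h)" .
 qed (rule E)
qed

definition ell :: "l2 => l2 => real" where "ell f h = (LB x. g x * sg q (u f x) * u h x)"

lemma ell_int: "integrable lborel (%x. g x * sg q (u f x) * u h x)"
 by (rule bint_bound[OF Mg_int[of f h]]) (measurable, simp add: abs_mult abs_sg)

lemma abs_ell_le: "\<bar>ell f h\<bar> <= Mg f h"
proof -
 have "\<bar>ell f h\<bar> <= (LB x. \<bar>g x * sg q (u f x) * u h x\<bar>)"
  unfolding ell_def using integral_norm_bound[of lborel "%x. g x * sg q (u f x) * u h x"] by simp
 also have "... = Mg f h" unfolding Mg_def by (rule bintegral_cong) (auto simp: abs_mult abs_sg)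
 finally show ?thesis .
qed

lemma ell_linear: "linear (ell f)"
proof
 fix x y c
 have "ell f (x + y) = (LB z. g z * sg q (u f z) * u x z + g z * sg q (u f z) * u y z)" unfolding ell_def
  by (rule integral_cong_AE) (measurable, use uf_add[OF s0(1), of x y] in "eventually_elim, simp add: distrib_left")
 also have "... = ell f x + ell f y" unfolding ell_def by (rule bintegral_add[OF ell_int ell_int])
 finally show "ell f (x + y) = ell f x + ell f y" .
 have "ell f (c *\<^sub>R x) = (LB z. c * (g z * sg q (u f z) * u x z))" unfolding ell_def
  by (rule integral_cong_AE) (measurable, use uf_scale[OF s0(1), of c x] in "eventually_elim, simp")
 then show "ell f (c *\<^sub>R x) = c *\<^sub>R ell f x" by (simp add: ell_def)
qed

lemma ell_minus: "ell (- f) h = - ell f h"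
proof -
 have "ell (- f) h = (LB x. - (g x * sg q (u f x) * u h x))" unfolding ell_def
  by (rule integral_cong_AE) (measurable, use uf_scale[OF s0(1), of "-1" f] in "eventually_elim, simp add: sg_minus")
 then show ?thesis by (simp add: ell_def)
qed

lemma ell_diff: "\<bar>ell f h - ell f' h\<bar> <= 2 * Mg (f - f') h"
proof -
 have "ell f h - ell f' h = (LB x. g x * sg q (u f x) * u h x - g x * sg q (u f' x) * u h x)"
  unfolding ell_def by (rule bintegral_diff[OF ell_int ell_int, symmetric])
 then have "\<bar>ell f h - ell f' h\<bar> <= (LB x. \<bar>g x * sg q (u f x) * u h x - g x * sg q (u f' x) * u h x\<bar>)"
  using integral_norm_bound[of lborel "%x. g x * sg q (u f x) * u h x - g x * sg q (u f' x) * u h x"] by simp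
 also have "... <= (LB x. 2 * (\<bar>g x\<bar> * (\<bar>u (f - f') x\<bar> powr (q - 1) * \<bar>u h x\<bar>)))"
 proof (rule integral_mono_AE)
  show "integrable lborel (%x. \<bar>g x * sg q (u f x) * u h x - g x * sg q (u f' x) * u h x\<bar>)"
   by (intro integrable_abs bint_diff ell_int)
  show "integrable lborel (%x. 2 * (\<bar>g x\<bar> * (\<bar>u (f - f') x\<bar> powr (q - 1) * \<bar>u h x\<bar>)))"
   by (intro integrable_mult_right Mg_int)
  show "AE x in lborel. \<bar>g x * sg q (u f x) * u h x - g x * sg q (u f' x) * u h x\<bar> <= 2 * (\<bar>g x\<bar> * (\<bar>u (f - f') x\<bar> powr (q - 1) * \<bar>u h x\<bar>))"
   using uf_diff[OF s0(1), of f f']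
  proof eventually_elim
   fix x assume e: "u (f - f') x = u f x - u f' x"
   have "\<bar>g x * sg q (u f x) * u h x - g x * sg q (u f' x) * u h x\<bar> = \<bar>g x\<bar> * \<bar>sg q (u f x) - sg q (u f' x)\<bar> * \<bar>u h x\<bar>"
    by (simp add: abs_mult[symmetric] algebra_simps)
   also have "... <= \<bar>g x\<bar> * (2 * \<bar>u f x - u f' x\<bar> powr (q - 1)) * \<bar>u h x\<bar>"
    using q by (intro mult_right_mono mult_left_mono sg_holder) auto
   finally show "\<bar>g x * sg q (u f x) * u h x - g x * sg q (u f' x) * u h x\<bar> <= 2 * (\<bar>g x\<bar> * (\<bar>u (f - f') x\<bar> powr (q - 1) * \<bar>u h x\<bar>))"
    by (simp add: e mult_ac)
  qed
 qed
 also have "... = 2 * Mg (f - f') h" by (simp add: Mg_def)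
 finally show ?thesis .
qed

definition Phi :: "l2 => real" where "Phi f = (1/q) * (LB x. g x * \<bar>u f x\<bar> powr q)"

lemma Phi_int: "integrable lborel (%x. g x * \<bar>u f x\<bar> powr q)"
 by (rule bint_bound[OF N_int[of f]]) (measurable, simp add: abs_mult)

lemma ell_self: "ell f f = q * Phi f"
 using q unfolding ell_def Phi_def by (simp add: mult.assoc sg_times_self)

lemma Phi_minus: "Phi (- f) = Phi f"
proof -
 have "(LB x. g x * \<bar>u (- f) x\<bar> powr q) = (LB x. g x * \<bar>u f x\<bar> powr q)"
  by (rule integral_cong_AE) (measurable, use uf_scale[OF s0(1), of "-1" f] in "eventually_elim, simp")
 then show ?thesis by (simp add: Phi_def)
qed

lemma abs_Phi_le: "\<bar>Phi f\<bar> <= N f"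
proof -
 have "\<bar>(LB x. g x * \<bar>u f x\<bar> powr q)\<bar> <= (LB x. \<bar>g x * \<bar>u f x\<bar> powr q\<bar>)"
  using integral_norm_bound[of lborel "%x. g x * \<bar>u f x\<bar> powr q"] by simp
 also have "... = N f" by (simp add: WN_def abs_mult)
 finally have "\<bar>Phi f\<bar> <= (1/q) * N f" using q by (simp add: Phi_def abs_mult divide_right_mono)
 also have "... <= 1 * N f" using q N_nonneg by (intro mult_right_mono) auto
 finally show ?thesis by simp
qed

lemma Phi_taylor: "\<bar>Phi (f + t *\<^sub>R h) - Phi f - t * ell f h\<bar> <= 2 * \<bar>t\<bar> powr q * N h"
proof -
 let ?i = "%x. g x * (\<bar>u (f + t *\<^sub>R h) x\<bar> powr q - \<bar>u f x\<bar> powr q - q * sg q (u f x) * (t * u h x))"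
 have ieq: "?i = (%x. g x * \<bar>u (f + t *\<^sub>R h) x\<bar> powr q - g x * \<bar>u f x\<bar> powr q - (q * t) * (g x * sg q (u f x) * u h x))"
  by (auto simp: algebra_simps)
 have ii: "integrable lborel ?i" unfolding ieq
  by (intro bint_diff Phi_int integrable_mult_right ell_int)
 have "(LB x. ?i x) = (LB x. g x * \<bar>u (f + t *\<^sub>R h) x\<bar> powr q) - (LB x. g x * \<bar>u f x\<bar> powr q) - (q * t) * ell f h"
  unfolding ieq ell_def
  by (simp add: bintegral_diff[OF bint_diff[OF Phi_int Phi_int] integrable_mult_right[OF ell_int]]
   bintegral_diff[OF Phi_int Phi_int])
 then have e: "Phi (f + t *\<^sub>R h) - Phi f - t * ell f h = (1/q) * (LB x. ?i x)"
  unfolding Phi_def using q by (simp add: field_simps)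
 have "\<bar>(LB x. ?i x)\<bar> <= (LB x. \<bar>?i x\<bar>)" using integral_norm_bound[of lborel ?i] by simp
 also have "... <= (LB x. (2 * q * \<bar>t\<bar> powr q) * (\<bar>g x\<bar> * \<bar>u h x\<bar> powr q))"
 proof (rule integral_mono_AE)
  show "integrable lborel (%x. \<bar>?i x\<bar>)" by (rule integrable_abs[OF ii])
  show "integrable lborel (%x. (2 * q * \<bar>t\<bar> powr q) * (\<bar>g x\<bar> * \<bar>u h x\<bar> powr q))" by (intro integrable_mult_right N_int)
  show "AE x in lborel. \<bar>?i x\<bar> <= (2 * q * \<bar>t\<bar> powr q) * (\<bar>g x\<bar> * \<bar>u h x\<bar> powr q)"
   using uf_add[OF s0(1), of f "t *\<^sub>R h"] uf_scale[OF s0(1), of t h]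
  proof eventually_elim
   fix x assume e: "u (f + t *\<^sub>R h) x = u f x + u (t *\<^sub>R h) x" "u (t *\<^sub>R h) x = t * u h x"
   have "\<bar>?i x\<bar> = \<bar>g x\<bar> * \<bar>\<bar>u f x + t * u h x\<bar> powr q - \<bar>u f x\<bar> powr q - q * sg q (u f x) * (t * u h x)\<bar>"
    unfolding e abs_mult ..
   also have "... <= \<bar>g x\<bar> * (2 * q * \<bar>t * u h x\<bar> powr q)"
    using q by (intro mult_left_mono abs_powr_taylor) auto
   also have "... = (2 * q * \<bar>t\<bar> powr q) * (\<bar>g x\<bar> * \<bar>u h x\<bar> powr q)" by (simp add: abs_mult powr_mult)
   finally show "\<bar>?i x\<bar> <= (2 * q * \<bar>t\<bar> powr q) * (\<bar>g x\<bar> * \<bar>u h x\<bar> powr q)" .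
  qed
 qed
 also have "... = (2 * q * \<bar>t\<bar> powr q) * N h" by (simp add: WN_def)
 finally have "\<bar>(LB x. ?i x)\<bar> <= (2 * q * \<bar>t\<bar> powr q) * N h" .
 then show ?thesis unfolding e using q by (simp add: abs_mult field_simps)
qed

lemma Phi_deriv: "((%t. Phi (f + t *\<^sub>R h)) has_real_derivative ell f h) (at 0)"
 unfolding DERIV_def
proof (rule LIM_zero_cancel, rule Lim_null_comparison)
 show "\<forall>\<^sub>F t in at 0. norm ((Phi (f + (0 + t) *\<^sub>R h) - Phi (f + 0 *\<^sub>R h)) / t - ell f h) <= 2 * \<bar>t\<bar> powr (q - 1) * N h"
  unfolding eventually_at_filter
 proof (rule always_eventually, intro allI impI)
  fix t :: real assume t: "t ~= 0"
  have "norm ((Phi (f + (0 + t) *\<^sub>R h) - Phi (f + 0 *\<^sub>R h)) / t - ell f h) = \<bar>Phi (f + t *\<^sub>R h) - Phi f - t * ell f h\<bar> / \<bar>t\<bar>"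
   using t by (simp add: abs_divide[symmetric] diff_divide_distrib)
  also have "... <= 2 * \<bar>t\<bar> powr q * N h / \<bar>t\<bar>" by (rule divide_right_mono[OF Phi_taylor]) simp
  also have "... = 2 * \<bar>t\<bar> powr (q - 1) * N h" using t by (simp add: powr_diff)
  finally show "norm ((Phi (f + (0 + t) *\<^sub>R h) - Phi (f + 0 *\<^sub>R h)) / t - ell f h) <= 2 * \<bar>t\<bar> powr (q - 1) * N h" .
 qed
 have "((%t::real. \<bar>t\<bar> powr (q - 1)) \<longlongrightarrow> \<bar>0\<bar> powr (q - 1)) (at 0)"
  by (rule tendsto_powr'[OF tendsto_rabs[OF tendsto_ident_at] tendsto_const]) (use q in auto)
 then have "((%t::real. 2 * \<bar>t\<bar> powr (q - 1) * N h) \<longlongrightarrow> 2 * (\<bar>0\<bar> powr (q - 1)) * N h) (at 0)"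
  by (intro tendsto_mult tendsto_const)
 then show "((%t. 2 * \<bar>t\<bar> powr (q - 1) * N h) \<longlongrightarrow> 0) (at 0)" by simp
qed

end

lemma mult_half_divide: "(x::real) ~= 0 ==> x * (e / (2 * x)) = e / 2" by simp

lemma inner_quadratic:
 fixes a b c :: "'a::real_inner"
 shows "inner (a + (2 * r) *\<^sub>R b + r^2 *\<^sub>R c) (a + (2 * r) *\<^sub>R b + r^2 *\<^sub>R c)
  = inner a a + r * (4 * inner a b) + r^2 * (4 * inner b b + 2 * inner a c) + r^3 * (4 * inner b c) + r^4 * inner c c"
proof -
 have "inner b a = inner a b" "inner c a = inner a c" "inner c b = inner b c" by (rule inner_commute)+
 then show ?thesis
  by (simp add: inner_add_left inner_add_right power2_eq_square power3_eq_cube power4_eq_xxxx algebra_simps)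
qed

locale choquard = local_term +
 fixes t M :: real and K :: "r3 => real"
 assumes t: "0 < t" and K_meas [measurable]: "K : borel_measurable borel" and K0: "!!x. 0 <= K x" and KM: "!!x. K x <= M"
  and K_pos: "AE x in lborel. 0 < K x" and K_int: "(NB x. ennreal (K x powr (3 / (4 * s - 3)))) < \<infinity>"
begin

text \<open>The exponent \<open>pc s / (pc s - 4)\<close> equals 3/(4s-3), and one factor of
  \<open>K^2\<close> is absorbed by the bound \<open>M\<close>. This is what puts K u^2 into L^2 for
  u in H^s.\<close>

lemma K2_int: "(NB x. ennreal ((K x)\<^sup>2 powr (pc s / (pc s - 4)))) < \<infinity>"
proof -
 define a where "a = 3 / (4 * s - 3)"
 have a0: "0 < a" using s by (simp add: a_def)
 have e: "pc s - 4 = (2 * (4 * s - 3)) / (3 - 2 * s)" using s by (simp add: pc_def field_simps)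
 have m: "6 / c / (2 * d / c) = 3 / d" if "c ~= 0" for c d :: real using that by simp
 have "3 - 2 * s ~= 0" using s by simp
 then have pa: "pc s / (pc s - 4) = a" unfolding e a_def unfolding pc_def by (rule m)
 have M0: "0 <= M" using K0[of 0] KM[of 0] by linarith
 have "(NB x. ennreal ((K x)\<^sup>2 powr a)) <= (NB x. ennreal (M powr a) * ennreal (K x powr a))"
 proof (rule nn_integral_mono)
  fix x
  have "(K x)\<^sup>2 powr a = K x powr a * K x powr a" using K0[of x] by (simp add: power2_eq_square powr_mult)
  also have "... <= M powr a * K x powr a" by (intro mult_right_mono powr_mono2) (use a0 K0 KM in auto)
  finally show "ennreal ((K x)\<^sup>2 powr a) <= ennreal (M powr a) * ennreal (K x powr a)" by (simp add: ennreal_mult[symmetric] ennreal_leI)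
 qed
 also have "... = ennreal (M powr a) * (NB x. ennreal (K x powr a))" by (rule nn_integral_cmult) measurable
 also have "... < \<infinity>" using K_int by (simp add: a_def ennreal_mult_less_top)
 finally show ?thesis unfolding pa .
qed

abbreviation N4 :: "l2 => real" where "N4 \<equiv> WN s (%x. (K x)^2) 4"

lemma N4_facts:
 shows N4_int: "!!f. integrable lborel (%x. (K x)^2 * \<bar>u f x\<bar> powr 4)"
  and N4_bound: "EX C>=0. ALL f. N4 f <= C * norm f powr 4"
  and N4_compact: "0 < e ==> EX E. finite E & (ALL f. (ALL x:E. inner f x = 0) --> N4 f <= e * norm f powr 4)"
proof -
 have 4: "(0::real) < 4" "4 < pc s" using pc_gt[OF s] by auto
 have m: "(%x. (K x)^2) : borel_measurable borel" by measurable
 note W = weighted_hom[OF s 4 m zero_le_power2 K2_int]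
 show "!!f. integrable lborel (%x. (K x)^2 * \<bar>u f x\<bar> powr 4)" by (rule W(1))
 show "EX C>=0. ALL f. N4 f <= C * norm f powr 4" by (rule W(2))
 show "0 < e ==> EX E. finite E & (ALL f. (ALL x:E. inner f x = 0) --> N4 f <= e * norm f powr 4)" by (rule W(3))
qed

definition kf :: "l2 => l2 => r3 => real" where "kf f h x = K x * (u f x * u h x)"
definition c :: "l2 => l2 => l2" where "c f h = cl (kf f h)"

lemma kf_meas [measurable]: "kf f h : borel_measurable borel" unfolding kf_def[abs_def] by measurable

lemma abs_powr4: "\<bar>x::real\<bar> powr 4 = x ^ 4" by (cases "x = 0") (simp_all add: powr_numeral)

lemma l2fun_kf: "l2fun (kf f h)"
 unfolding l2fun_def
proof
 show "integrable lborel (%x. (kf f h x)^2)"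
 proof (rule bint_bound[OF bint_add[OF N4_int[of f] N4_int[of h]]])
  show "AE x in lborel. norm ((kf f h x)^2) <= norm ((K x)^2 * \<bar>u f x\<bar> powr 4 + (K x)^2 * \<bar>u h x\<bar> powr 4)"
  proof (rule AE_I2)
   fix x
   let ?a = "(u f x)^2" and ?b = "(u h x)^2"
   have "2 * (?a * ?b) <= ?a^2 + ?b^2" using sum_squares_bound[of ?a ?b] by simp
   moreover have "0 <= ?a * ?b" by simp
   ultimately have "?a * ?b <= ?a^2 + ?b^2" by linarith
   then have "(K x)^2 * (?a * ?b) <= (K x)^2 * (?a^2 + ?b^2)" by (rule mult_left_mono) simp
   then show "norm ((kf f h x)^2) <= norm ((K x)^2 * \<bar>u f x\<bar> powr 4 + (K x)^2 * \<bar>u h x\<bar> powr 4)"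
    by (simp add: abs_powr4 kf_def power_mult_distrib distrib_left)
  qed
 qed measurable
qed measurable

lemma c_commute: "c f h = c h f" unfolding c_def kf_def[abs_def] by (simp add: mult.commute)

lemma c_add_left: "c (f + f') h = c f h + c f' h"
 unfolding c_def cl_add[OF l2fun_kf l2fun_kf, symmetric]
 by (rule cl_eq[OF l2fun_kf l2fun_add[OF l2fun_kf l2fun_kf]])
  (use uf_add[OF s0(1), of f f'] in "eventually_elim, simp add: kf_def algebra_simps")

lemma c_scale_left: "c (r *\<^sub>R f) h = r *\<^sub>R c f h"
 unfolding c_def cl_scale[OF l2fun_kf, symmetric]
 by (rule cl_eq[OF l2fun_kf l2fun_scale[OF l2fun_kf]])
  (use uf_scale[OF s0(1), of r f] in "eventually_elim, simp add: kf_def")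

lemma norm_c_sq: "(norm (c f h))^2 <= norm (c f f) * norm (c h h)"
proof -
 have "(norm (c f h))^2 = inner (c f f) (c h h)"
  unfolding c_def norm_cl[OF l2fun_kf] inner_cl[OF l2fun_kf l2fun_kf]
  by (rule bintegral_cong) (auto simp: kf_def power2_eq_square)
 also have "... <= norm (c f f) * norm (c h h)" by (rule norm_cauchy_schwarz)
 finally show ?thesis .
qed

lemma norm_c_self: "(norm (c f f))^2 = N4 f"
 unfolding c_def norm_cl[OF l2fun_kf] WN_def
 by (rule bintegral_cong) (auto simp: kf_def abs_powr4 power_mult_distrib power2_eq_square power4_eq_xxxx)

lemma norm_c_self_le: assumes C: "0 <= C" "N4 f <= C^2 * norm f powr 4" shows "norm (c f f) <= C * (norm f)^2"
proof (rule power2_le_imp_le)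
 have "norm f powr 4 = ((norm f)^2)^2" using abs_powr4[of "norm f"] by simp
 then show "(norm (c f f))^2 <= (C * (norm f)^2)^2" using C(2) unfolding norm_c_self power_mult_distrib by simp
qed (use C in simp)

lemma norm_c_le:
 assumes C: "0 <= C" "norm (c f f) <= C * (norm f)^2" and e: "0 <= e" "norm (c h h) <= e * (norm h)^2"
 shows "norm (c f h) <= sqrt (C * e) * (norm f * norm h)"
proof (rule power2_le_imp_le)
 have "(norm (c f h))^2 <= (C * (norm f)^2) * (e * (norm h)^2)"
  by (rule order_trans[OF norm_c_sq mult_mono[OF C(2) e(2)]]) (use C in auto)
 also have "... = (sqrt (C * e))^2 * (norm f * norm h)^2" using C(1) e(1) by (simp add: power_mult_distrib)
 finally show "(norm (c f h))^2 <= (sqrt (C * e) * (norm f * norm h))^2" by (simp add: power_mult_distrib)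
qed (use C e in simp)

lemma c_self_bound: "EX C>=0. ALL f. norm (c f f) <= C * (norm f)^2"
proof -
 obtain C where C: "0 <= C" "!!f. N4 f <= C * norm f powr 4" using N4_bound by blast
 have "norm (c f f) <= sqrt C * (norm f)^2" for f by (rule norm_c_self_le) (use C in auto)
 then show ?thesis using C(1) by (intro exI[of _ "sqrt C"]) simp
qed

lemma c_bound: "EX C>=0. ALL f h. norm (c f h) <= C * (norm f * norm h)"
proof -
 obtain C where C: "0 <= C" "!!f. norm (c f f) <= C * (norm f)^2" using c_self_bound by blast
 have "norm (c f h) <= sqrt (C * C) * (norm f * norm h)" for f h by (rule norm_c_le) (use C in auto)
 then show ?thesis using C(1) by (intro exI[of _ C]) simp
qed

lemma c_compact: assumes e: "0 < e" shows "EX E. finite E & (ALL f h. (ALL x:E. inner h x = 0) --> norm (c f h) <= e * (norm f * norm h))"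
proof -
 obtain C where C: "0 <= C" "!!f. norm (c f f) <= C * (norm f)^2" using c_self_bound by blast
 define d where "d = e^2 / (C + 1)"
 have d0: "0 < d" using e C by (simp add: d_def)
 have Cd: "C * d <= e^2" unfolding d_def using C(1) by (simp add: field_simps)
 obtain E where E: "finite E" "!!f. (ALL x:E. inner f x = 0) ==> N4 f <= d^2 * norm f powr 4" using N4_compact[of "d^2"] d0 by auto
 show ?thesis
 proof (intro exI[of _ E] conjI allI impI)
  fix f h assume o: "ALL x:E. inner h x = 0"
  have "norm (c h h) <= d * (norm h)^2" by (rule norm_c_self_le) (use d0 E(2)[OF o] in auto)
  then have "norm (c f h) <= sqrt (C * d) * (norm f * norm h)" using C d0 by (intro norm_c_le) auto
  also have "... <= e * (norm f * norm h)" by (rule mult_right_mono) (use Cd e in "auto intro: real_le_lsqrt")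
  finally show "norm (c f h) <= e * (norm f * norm h)" .
 qed (rule E)
qed

text \<open>The square root of the Bessel multiplier of order 2t, left on the frequency side. The
  nonlocal energy of a density is the squared norm of its image under \<open>P\<close>.\<close>

definition P :: "l2 => l2" where "P a = mul (kap (t/2)) (Hh a)"

lemma bm_k: "bm (kap (t/2))" using t by (intro bm_kap) simp

lemma bounded_linear_P: "bounded_linear P"
 unfolding P_def[abs_def] by (rule bounded_linear_compose[OF bounded_linear_mul[OF bm_k] bounded_linear_Hh])

sublocale P: bounded_linear P by (rule bounded_linear_P)

lemma norm_P_le: "norm (P a) <= norm a"
proof -
 have "\<bar>kap (t/2) x\<bar> <= 1" for x using kap_bounds(2)[of "t/2" x] kap_pos[of "t/2" x] t by simp
 then show ?thesis unfolding P_def using norm_mul_le[OF bm_k, of 1 "Hh a"] by (simp add: norm_Hh)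
qed

lemma Hh_P: "Hh (P a) = Us t (Hh a)" by (simp add: P_def Us_def)

lemma P_inj: "P a = 0 ==> a = 0"
proof -
 assume "P a = 0"
 then have "Us t (Hh a) = Us t (Hh 0)" using Hh_P[of a] Hh_P[of 0] P.zero by simp
 then have "Hh a = Hh 0" by (rule Us_inj[rotated]) (use t in simp)
 then show "a = 0" by (metis Hh_involution)
qed

lemma Qf_P: "Qf (kap t) a b = inner (P a) (P b)"
proof -
 have "mul (kap t) x = mul (kap (t/2)) (mul (kap (t/2)) x)" for x unfolding mul_mul[OF bm_k bm_k] by (simp add: kap_mult)
 then show ?thesis unfolding Qf_def P_def by (simp add: inner_mul_commute[OF bm_k])
qed

definition p :: "l2 => l2 => l2" where "p f h = P (c f h)"

lemma p_commute: "p f h = p h f" by (simp add: p_def c_commute)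
lemma p_add_left: "p (f + f') h = p f h + p f' h" by (simp add: p_def c_add_left P.add)
lemma p_scale_left: "p (r *\<^sub>R f) h = r *\<^sub>R p f h" by (simp add: p_def c_scale_left P.scale)
lemma p_add_right: "p h (f + f') = p h f + p h f'" using p_add_left[of f f' h] by (simp add: p_commute)
lemma p_scale_right: "p h (r *\<^sub>R f) = r *\<^sub>R p h f" using p_scale_left[of r f h] by (simp add: p_commute)
lemma p_diff_left: "p (f - f') h = p f h - p f' h" using p_add_left[of f "(-1) *\<^sub>R f'" h] unfolding p_scale_left by simp
lemma p_diff_right: "p h (f - f') = p h f - p h f'" using p_diff_left[of f f' h] by (simp add: p_commute)

lemma p_bound: "EX C>=0. ALL f h. norm (p f h) <= C * (norm f * norm h)"
proof -
 obtain C where C: "0 <= C" "!!f h. norm (c f h) <= C * (norm f * norm h)" using c_bound by blast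
 have "norm (p f h) <= C * (norm f * norm h)" for f h unfolding p_def by (rule order_trans[OF norm_P_le C(2)])
 then show ?thesis using C(1) by blast
qed

lemma p_compact: assumes "0 < e" shows "EX E. finite E & (ALL f h. (ALL x:E. inner h x = 0) --> norm (p f h) <= e * (norm f * norm h))"
proof -
 obtain E where E: "finite E" "!!f h. (ALL x:E. inner h x = 0) ==> norm (c f h) <= e * (norm f * norm h)" using c_compact[OF assms] by blast
 have "norm (p f h) <= e * (norm f * norm h)" if "ALL x:E. inner h x = 0" for f h
  unfolding p_def by (rule order_trans[OF norm_P_le E(2)[OF that]])
 then show ?thesis using E(1) by blast
qed

lemma c_nonneg_inner: "0 <= inner (p f f) (p h h)"
proof -
 have "ALL p q. l2fun p --> l2fun q --> (ALL x. 0 <= p x) --> (ALL x. 0 <= q x) --> 0 <= Qf (kap t) (cl p) (cl q)"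
  using pform_kap[OF t] by (simp add: pform_def)
 then have "0 <= Qf (kap t) (cl (kf f f)) (cl (kf h h))"
  using l2fun_kf[of f f] l2fun_kf[of h h] K0 by (simp add: kf_def)
 then show ?thesis by (simp add: Qf_P p_def c_def)
qed

text \<open>Positivity of the kernel is applied to the square roots of the densities.\<close>
lemma norm_p_sq: "(norm (p f h))^2 <= norm (p f f) * norm (p h h)"
proof -
 define a where "a f x = sqrt (K x) * u f x" for f x
 have [measurable]: "a f : borel_measurable borel" for f unfolding a_def[abs_def] by measurable
 have aa: "(%x. a f x * a h x) = kf f h" for f h using K0 by (auto simp: a_def kf_def)
 then have a2: "(%x. (a f x)^2) = kf f f" for f by (simp add: power2_eq_square)
 have q: "ALL f g. f : borel_measurable borel --> g : borel_measurable borel --> l2fun (%x. (f x)^2) --> l2fun (%x. (g x)^2) -->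
   l2fun (%x. f x * g x) -->
   Qf (kap t) (cl (%x. f x * g x)) (cl (%x. f x * g x)) <= Qf (kap t) (cl (%x. (f x)^2)) (cl (%x. (g x)^2))"
  using pform_kap[OF t] by (simp add: pform_def)
 have "Qf (kap t) (cl (%x. a f x * a h x)) (cl (%x. a f x * a h x)) <= Qf (kap t) (cl (%x. (a f x)^2)) (cl (%x. (a h x)^2))"
  by (rule q[rule_format]) (auto simp: aa a2 l2fun_kf)
 then have "inner (p f h) (p f h) <= inner (p f f) (p h h)" unfolding aa a2 by (simp add: Qf_P p_def c_def)
 also have "... <= norm (p f f) * norm (p h h)" by (rule norm_cauchy_schwarz)
 finally show ?thesis by (simp add: power2_norm_eq_inner)
qed

text \<open>The square root of the quartic energy. It is homogeneous of degree 2 and midpoint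
  convex, so its sublevel sets can enter \<open>nested_midconvex_nonempty\<close>.\<close>

definition nD :: "l2 => real" where "nD f = norm (p f f)"

lemma nD_nonneg: "0 <= nD f" by (simp add: nD_def)

lemma nD_scale: "nD (r *\<^sub>R f) = r^2 * nD f"
 by (simp add: nD_def p_scale_left p_scale_right power2_eq_square abs_mult mult.assoc[symmetric])

text \<open>For the midpoint m and half difference d, p m m + p d d is the mean of p f f and p h h.
  The inner product of p m m and p d d is nonnegative by positivity of the kernel, so dropping p d d
  does not raise the norm.\<close>

lemma nD_midconvex: "nD ((1/2) *\<^sub>R (f + h)) <= (nD f + nD h) / 2"
proof -
 let ?m = "(1/2) *\<^sub>R (f + h)" and ?d = "(1/2) *\<^sub>R (f - h)"
 have e: "p ?m ?m + p ?d ?d = (1/2) *\<^sub>R (p f f + p h h)"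
 proof -
  have "p ?m ?m = (1/4) *\<^sub>R (p f f + p h h + (2 *\<^sub>R p f h))" "p ?d ?d = (1/4) *\<^sub>R (p f f + p h h - (2 *\<^sub>R p f h))"
   unfolding p_scale_left p_scale_right p_add_left p_add_right p_diff_left p_diff_right
   using p_commute[of h f] by (simp_all add: scaleR_2 algebra_simps)
  then have "p ?m ?m + p ?d ?d = (1/4) *\<^sub>R ((p f f + p h h) + (p f f + p h h))" by (simp add: algebra_simps)
  then show ?thesis by (simp add: scaleR_2[symmetric])
 qed
 have "(norm (p ?m ?m))^2 <= (norm (p ?m ?m + p ?d ?d))^2"
  using c_nonneg_inner[of ?m ?d] unfolding power2_norm_eq_inner
  by (simp add: inner_add_left inner_add_right inner_commute)
 then have "norm (p ?m ?m) <= norm (p ?m ?m + p ?d ?d)" by (rule power2_le_imp_le) simp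
 also have "... <= (norm (p f f) + norm (p h h)) / 2" unfolding e using norm_triangle_ineq[of "p f f" "p h h"] by simp
 finally show ?thesis by (simp add: nD_def)
qed

text \<open>Injectivity of the Bessel potential gives K u^2 = 0, and K > 0 almost everywhere then
  gives u = 0.\<close>

lemma nD_eq_0: assumes "nD f = 0" shows "f = 0"
proof -
 have "c f f = 0" using assms P_inj by (simp add: nD_def p_def)
 then have "AE x in lborel. fn (c f f) x = 0" using fn_zero by simp
 then have "AE x in lborel. fn (Us s f) x = fn (Us s 0) x"
  using fn_cl[OF l2fun_kf[of f f]] K_pos uf_scale[OF s0(1), of 0 0] unfolding c_def
  by eventually_elim (simp add: kf_def)
 then have "Us s f = Us s 0" by (rule l2_eqI)
 then show ?thesis by (rule Us_inj[OF s0(1)])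
qed

definition B :: "l2 => l2 => real" where "B f h = inner (p f f) (p f h)"

lemma B_linear: "linear (B f)"
 by (rule linearI) (simp_all add: B_def p_add_right p_scale_right inner_add_right)

lemma B_minus: "B (- f) h = - B f h"
 using p_scale_left[of "-1" f] p_scale_right[of _ "-1" f] by (simp add: B_def)

text \<open>The bound is kept in terms of \<open>nD\<close> because the a priori estimate controls
  \<open>nD f\<close> by the power q/2 of the norm, much less than its natural growth of order
  2.\<close>

lemma abs_B_le: "\<bar>B f h\<bar> <= nD f * sqrt (nD f * nD h)"
proof -
 have "norm (p f h) <= sqrt (nD f * nD h)" unfolding nD_def by (rule real_le_rsqrt[OF norm_p_sq])
 then have "norm (p f f) * norm (p f h) <= nD f * sqrt (nD f * nD h)" unfolding nD_def by (rule mult_left_mono) simp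
 then show ?thesis unfolding B_def using Cauchy_Schwarz_ineq2[of "p f f" "p f h"] by linarith
qed

definition Psi0 :: "l2 => real" where "Psi0 f = (nD f)^2 / 4 + Phi f"
definition dPsi :: "l2 => l2 => real" where "dPsi f h = B f h + ell f h"

lemma nD_sq_deriv: "((%r. (nD (f + r *\<^sub>R h))^2 / 4) has_real_derivative B f h) (at 0)"
proof -
 have e: "(nD (f + r *\<^sub>R h))^2 / 4 = (inner (p f f) (p f f) + r * (4 * inner (p f f) (p f h))
   + r^2 * (4 * inner (p f h) (p f h) + 2 * inner (p f f) (p h h)) + r^3 * (4 * inner (p f h) (p h h)) + r^4 * inner (p h h) (p h h)) / 4" for r
 proof -
  have "p (f + r *\<^sub>R h) (f + r *\<^sub>R h) = p f f + (2 * r) *\<^sub>R p f h + r^2 *\<^sub>R p h h"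
   unfolding p_add_left p_add_right p_scale_left p_scale_right using p_commute[of h f]
   by (simp add: algebra_simps power2_eq_square scaleR_2[symmetric])
  then show ?thesis unfolding nD_def power2_norm_eq_inner by (simp only: inner_quadratic)
 qed
 show ?thesis unfolding e by (auto intro!: derivative_eq_intros simp: B_def)
qed

lemma Psi0_deriv: "((%r. Psi0 (f + r *\<^sub>R h)) has_real_derivative dPsi f h) (at 0)"
 unfolding Psi0_def dPsi_def by (rule DERIV_add[OF nD_sq_deriv Phi_deriv])

lemma Psi0_minus: "Psi0 (- f) = Psi0 f"
 using nD_scale[of "-1" f] by (simp add: Psi0_def Phi_minus)

lemma nD_0: "nD 0 = 0" using nD_scale[of 0 0] by simp

lemma Psi0_0: "Psi0 0 = 0"
proof -
 have "N 0 = 0" using N_scale[of 0 0] q by simp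
 then show ?thesis using abs_Phi_le[of 0] by (simp add: Psi0_def nD_0)
qed

lemma nD_bound: "EX C>=0. ALL f. nD f <= C * (norm f)^2"
 using p_bound unfolding nD_def power2_eq_square by blast

lemma Phi_bound: "EX C>=0. ALL f. \<bar>Phi f\<bar> <= C * norm f powr q"
proof -
 obtain C where C: "0 <= C" "!!f. N f <= C * norm f powr q" using N_bound by blast
 have "\<bar>Phi f\<bar> <= C * norm f powr q" for f by (rule order_trans[OF abs_Phi_le C(2)])
 then show ?thesis using C(1) by blast
qed

lemma dPsi_bound: "EX C>=0. ALL f h. \<bar>dPsi f h\<bar> <= C * (norm f ^ 3 + norm f powr (q - 1)) * norm h"
proof -
 obtain C where C: "0 <= C" "!!f h. norm (p f h) <= C * (norm f * norm h)" using p_bound by blast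
 obtain C' where C': "0 <= C'" "!!f h. Mg f h <= C' * (norm f powr (q - 1) * norm h)" using Mg_bound by blast
 have "\<bar>dPsi f h\<bar> <= (C^2 + C') * (norm f ^ 3 + norm f powr (q - 1)) * norm h" for f h
 proof -
  have "\<bar>B f h\<bar> <= norm (p f f) * norm (p f h)" unfolding B_def by (rule Cauchy_Schwarz_ineq2)
  also have "... <= (C * (norm f * norm f)) * (C * (norm f * norm h))" by (rule mult_mono[OF C(2) C(2)]) (use C in auto)
  finally have 1: "\<bar>B f h\<bar> <= C^2 * norm f ^ 3 * norm h" by (simp add: power2_eq_square power3_eq_cube mult_ac)
  have 2: "\<bar>ell f h\<bar> <= C' * norm f powr (q - 1) * norm h" using abs_ell_le[of f h] C'(2)[of f h] by (simp add: mult_ac)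
  have "0 <= C^2 * norm f powr (q - 1) * norm h" "0 <= C' * norm f ^ 3 * norm h" using C' by auto
  moreover have "\<bar>B f h + ell f h\<bar> <= \<bar>B f h\<bar> + \<bar>ell f h\<bar>" by (rule abs_triangle_ineq)
  ultimately have "\<bar>B f h + ell f h\<bar> <= C^2 * norm f ^ 3 * norm h + C' * norm f powr (q - 1) * norm h
   + C^2 * norm f powr (q - 1) * norm h + C' * norm f ^ 3 * norm h" using 1 2 by linarith
  then show ?thesis unfolding dPsi_def by (simp add: algebra_simps)
 qed
 then show ?thesis using C' by (intro exI[of _ "C^2 + C'"]) auto
qed

lemma dPsi_linear: "linear (dPsi f)"
 by (rule linearI) (simp_all add: dPsi_def linear_add[OF B_linear] linear_add[OF ell_linear] linear_scale[OF B_linear] linear_scale[OF ell_linear] algebra_simps)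

lemma dPsi_bounded_linear: "bounded_linear (dPsi f)"
proof -
 obtain C where C: "!!f h. \<bar>dPsi f h\<bar> <= C * (norm f ^ 3 + norm f powr (q - 1)) * norm h" using dPsi_bound by blast
 show ?thesis
  by (rule bounded_linear_intro[where K="C * (norm f ^ 3 + norm f powr (q - 1))"])
   (use C[of f] in "simp_all add: linear_add[OF dPsi_linear] linear_scale[OF dPsi_linear] mult.commute")
qed

definition G0 :: "l2 => l2" where "G0 f = (SOME y. ALL h. dPsi f h = inner y h)"

lemma inner_G0: "inner (G0 f) h = dPsi f h"
proof -
 have "ALL h. dPsi f h = inner (G0 f) h"
  unfolding G0_def by (rule someI_ex) (rule riesz_representation[OF dPsi_bounded_linear])
 then show ?thesis by simp
qed

lemma norm_le_inner: assumes "0 <= b" "!!h. \<bar>inner (y::l2) h\<bar> <= b * norm h" shows "norm y <= b"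
proof (cases "y = 0")
 case False
 have "norm y * norm y <= b * norm y" using assms(2)[of y] by (simp add: power2_norm_eq_inner[symmetric] power2_eq_square)
 then show ?thesis using False by simp
qed (use assms in simp)

lemma G0_minus: "G0 (- f) = - G0 f"
proof -
 have "inner (G0 (- f) + G0 f) h = 0" for h
  unfolding inner_add_left inner_G0 dPsi_def B_minus ell_minus by simp
 then have "G0 (- f) + G0 f = 0" by (metis inner_eq_zero_iff)
 then show ?thesis by (simp add: eq_neg_iff_add_eq_0)
qed

lemma G0_bdd: "EX b. ALL f. norm f <= R --> norm (G0 f) <= b"
proof -
 obtain C where C: "0 <= C" "!!f h. \<bar>dPsi f h\<bar> <= C * (norm f ^ 3 + norm f powr (q - 1)) * norm h" using dPsi_bound by blast
 have "norm (G0 f) <= C * (R ^ 3 + R powr (q - 1))" if f: "norm f <= R" for f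
 proof -
  have R: "0 <= R" using f norm_ge_zero order_trans by blast
  have "norm (G0 f) <= C * (norm f ^ 3 + norm f powr (q - 1))"
   by (rule norm_le_inner) (use C in "auto simp: inner_G0")
  also have "... <= C * (R ^ 3 + R powr (q - 1))" using f q C(1) by (intro mult_left_mono add_mono power_mono powr_mono2) auto
  finally show ?thesis .
 qed
 then show ?thesis by blast
qed

lemma B_lipschitz: "EX C>=0. ALL R f f' h. norm f <= R --> norm f' <= R --> \<bar>B f h - B f' h\<bar> <= C * R^2 * norm (f - f') * norm h"
proof -
 obtain C where C: "0 <= C" "!!f h. norm (p f h) <= C * (norm f * norm h)" using p_bound by blast
 have "\<bar>B f h - B f' h\<bar> <= (3 * C^2) * R^2 * norm (f - f') * norm h" if f: "norm f <= R" "norm f' <= R" for R f f' h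
 proof -
  have R: "0 <= R" using f norm_ge_zero order_trans by blast
  let ?d = "norm (f - f')"
  have de: "p f f - p f' f' = p (f - f') f + p f' (f - f')" by (simp add: p_diff_left p_diff_right)
  have "norm (p f f - p f' f') <= C * (?d * norm f) + C * (norm f' * ?d)"
   unfolding de using C(2)[of "f - f'" f] C(2)[of f' "f - f'"] norm_triangle_ineq[of "p (f - f') f" "p f' (f - f')"] by linarith
  also have "... <= C * (?d * R) + C * (R * ?d)" using f C(1) by (intro add_mono mult_left_mono mult_right_mono) auto
  finally have 1: "norm (p f f - p f' f') <= C * (2 * R * ?d)" by (simp add: algebra_simps)
  have "norm (p f h) <= C * (norm f * norm h)" by (rule C)
  also have "... <= C * (R * norm h)" using f C(1) by (intro mult_left_mono mult_right_mono) auto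
  finally have 2: "norm (p f h) <= C * (R * norm h)" .
  have "norm (p f' f') <= C * (norm f' * norm f')" by (rule C)
  also have "... <= C * (R * R)" using f C(1) R by (intro mult_left_mono mult_mono) auto
  finally have 3: "norm (p f' f') <= C * (R * R)" .
  have "B f h - B f' h = inner (p f f - p f' f') (p f h) + inner (p f' f') (p (f - f') h)"
   by (simp add: B_def p_diff_left inner_diff_left inner_diff_right)
  then have "\<bar>B f h - B f' h\<bar> <= norm (p f f - p f' f') * norm (p f h) + norm (p f' f') * norm (p (f - f') h)"
   using Cauchy_Schwarz_ineq2[of "p f f - p f' f'" "p f h"] Cauchy_Schwarz_ineq2[of "p f' f'" "p (f - f') h"] by linarith
  also have "... <= (C * (2 * R * ?d)) * (C * (R * norm h)) + (C * (R * R)) * (C * (?d * norm h))"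
   by (rule add_mono[OF mult_mono[OF 1 2] mult_mono[OF 3 C(2)]]) (use C R in auto)
  also have "... = (3 * C^2) * R^2 * ?d * norm h" by (simp add: power2_eq_square algebra_simps)
  finally show ?thesis .
 qed
 then show ?thesis by (intro exI[of _ "3 * C^2"]) auto
qed

lemma G0_ucont: assumes e: "0 < e" shows "EX d>0. ALL x y. norm x <= R --> norm y <= R --> norm (x - y) <= d --> norm (G0 x - G0 y) <= e"
proof -
 obtain C where C: "0 <= C" "!!R f f' h. norm f <= R ==> norm f' <= R ==> \<bar>B f h - B f' h\<bar> <= C * R^2 * norm (f - f') * norm h"
  using B_lipschitz by blast
 obtain C' where C': "0 <= C'" "!!f h. Mg f h <= C' * (norm f powr (q - 1) * norm h)" using Mg_bound by blast
 define d1 where "d1 = e / (2 * (C * R^2 + 1))"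
 \<comment> \<open>The exponent 1/(q-1) inverts the Hoelder modulus of the local term.\<close>
 define d2 where "d2 = (e / (4 * (C' + 1))) powr (1 / (q - 1))"
 have CR: "0 < C * R^2 + 1" using C(1) by (simp add: add_nonneg_pos)
 have d: "0 < d1" "0 < d2" using e C'(1) CR by (auto simp: d1_def d2_def)
 have k1: "C * R^2 * d1 <= e / 2"
 proof -
  have "C * R^2 * d1 <= (C * R^2 + 1) * d1" by (rule mult_right_mono) (use d in auto)
  also have "... = e / 2" unfolding d1_def by (rule mult_half_divide) (use CR in simp)
  finally show ?thesis .
 qed
 have k2: "2 * C' * d2 powr (q - 1) <= e / 2"
 proof -
  have "2 * C' * d2 powr (q - 1) <= 2 * (C' + 1) * d2 powr (q - 1)" by (intro mult_right_mono) auto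
  also have "... = e / 2"
  proof -
   have D: "d2 powr (q - 1) = e / (4 * (C' + 1))" using q e C'(1) by (simp add: d2_def powr_powr)
   show ?thesis unfolding D using C'(1) by (simp add: field_simps)
  qed
  finally show ?thesis .
 qed
 show ?thesis
 proof (intro exI[of _ "min d1 d2"] conjI allI impI)
  show "0 < min d1 d2" using d by simp
  fix x y :: l2 assume b: "norm x <= R" "norm y <= R" and xy: "norm (x - y) <= min d1 d2"
  show "norm (G0 x - G0 y) <= e"
  proof (rule norm_le_inner)
   fix h
   have "\<bar>inner (G0 x - G0 y) h\<bar> <= \<bar>B x h - B y h\<bar> + \<bar>ell x h - ell y h\<bar>"
    unfolding inner_diff_left inner_G0 dPsi_def by linarith
   also have "... <= C * R^2 * norm (x - y) * norm h + 2 * (C' * (norm (x - y) powr (q - 1) * norm h))"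
    using C(2)[OF b, of h] ell_diff[of x h y] C'(2)[of "x - y" h] by linarith
   also have "... <= C * R^2 * d1 * norm h + 2 * (C' * (d2 powr (q - 1) * norm h))"
    using xy q C(1) C'(1) by (intro add_mono mult_left_mono mult_right_mono powr_mono2) auto
   also have "... = (C * R^2 * d1 + 2 * C' * d2 powr (q - 1)) * norm h" by (simp add: algebra_simps)
   also have "... <= e * norm h" by (rule mult_right_mono) (use k1 k2 in auto)
   finally show "\<bar>inner (G0 x - G0 y) h\<bar> <= e * norm h" .
  qed (use e in simp)
 qed
qed

lemma G0_compact:
 assumes e: "0 < e"
 shows "EX E. finite E & (ALL f h. norm f <= R --> (ALL x:E. inner h x = 0) --> \<bar>inner (G0 f) h\<bar> <= e * norm h)"
proof -
 obtain C where C: "0 <= C" "!!f h. norm (p f h) <= C * (norm f * norm h)" using p_bound by blast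
 define e1 where "e1 = e / (2 * (C * \<bar>R\<bar> ^ 3 + 1))"
 define e2 where "e2 = e / (2 * (\<bar>R\<bar> powr (q - 1) + 1))"
 have CR: "0 < C * \<bar>R\<bar> ^ 3 + 1" "0 < \<bar>R\<bar> powr (q - 1) + 1" using C(1) by (simp_all add: add_nonneg_pos)
 have e12: "0 < e1" "0 < e2" using e CR by (auto simp: e1_def e2_def)
 obtain E1 where E1: "finite E1" "!!f h. (ALL x:E1. inner h x = 0) ==> norm (p f h) <= e1 * (norm f * norm h)"
  using p_compact[OF e12(1)] by blast
 obtain E2 where E2: "finite E2" "!!f h. (ALL x:E2. inner h x = 0) ==> Mg f h <= e2 * (norm f powr (q - 1) * norm h)"
  using Mg_compact[OF e12(2)] by blast
 show ?thesis
 proof (intro exI[of _ "E1 \<union> E2"] conjI allI impI)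
  show "finite (E1 \<union> E2)" using E1 E2 by simp
  fix f h :: l2 assume f: "norm f <= R" and o: "ALL x:E1 \<union> E2. inner h x = 0"
  have fR: "norm f <= \<bar>R\<bar>" using f by linarith
  have "\<bar>B f h\<bar> <= norm (p f f) * norm (p f h)" unfolding B_def by (rule Cauchy_Schwarz_ineq2)
  also have "... <= (C * (norm f * norm f)) * (e1 * (norm f * norm h))"
   by (rule mult_mono[OF C(2) E1(2)]) (use C o in auto)
  also have "... = (C * norm f ^ 3 * e1) * norm h" by (simp add: power3_eq_cube)
  also have "... <= ((C * \<bar>R\<bar> ^ 3 + 1) * e1) * norm h"
  proof (intro mult_right_mono)
   have "C * norm f ^ 3 <= C * \<bar>R\<bar> ^ 3" using fR C(1) by (intro mult_left_mono power_mono) auto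
   then show "C * norm f ^ 3 <= C * \<bar>R\<bar> ^ 3 + 1" by simp
  qed (use e12 in auto)
  also have "(C * \<bar>R\<bar> ^ 3 + 1) * e1 = e / 2" unfolding e1_def by (rule mult_half_divide) (use CR in simp)
  finally have 1: "\<bar>B f h\<bar> <= e / 2 * norm h" .
  have "\<bar>ell f h\<bar> <= e2 * (norm f powr (q - 1) * norm h)" using abs_ell_le[of f h] E2(2)[of h f] o by simp
  also have "... = (norm f powr (q - 1) * e2) * norm h" by simp
  also have "... <= ((\<bar>R\<bar> powr (q - 1) + 1) * e2) * norm h"
  proof (intro mult_right_mono)
   have "norm f powr (q - 1) <= \<bar>R\<bar> powr (q - 1)" using fR q by (intro powr_mono2) auto
   then show "norm f powr (q - 1) <= \<bar>R\<bar> powr (q - 1) + 1" by simp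
  qed (use e12 in auto)
  also have "(\<bar>R\<bar> powr (q - 1) + 1) * e2 = e / 2" unfolding e2_def by (rule mult_half_divide) (use CR in simp)
  finally have 2: "\<bar>ell f h\<bar> <= e / 2 * norm h" .
  have "\<bar>B f h + ell f h\<bar> <= \<bar>B f h\<bar> + \<bar>ell f h\<bar>" by (rule abs_triangle_ineq)
  also have "... <= e / 2 * norm h + e / 2 * norm h" by (rule add_mono[OF 1 2])
  finally show "\<bar>inner (G0 f) h\<bar> <= e * norm h" unfolding inner_G0 dPsi_def by (simp add: algebra_simps)
 qed
qed

end

section \<open>The quadratic form of (-\<Delta>)^s + V and the geometry of the functional\<close>

lemma powr_absorb:
 assumes "0 < (q::real)" "q < r" "0 < e" "0 <= c"
 shows "EX b. ALL z>=0. c * z powr q <= e * z powr r + b"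
proof -
 define z0 where "z0 = (c / e) powr (1 / (r - q))"
 have "c * z powr q <= e * z powr r + c * z0 powr q" if z: "0 <= z" for z
 proof (cases "z <= z0")
  case True
  have "c * z powr q <= c * z0 powr q" using True z assms by (intro mult_left_mono powr_mono2) auto
  then show ?thesis using assms by (simp add: add_increasing)
 next
  case False
  have "c / e = z0 powr (r - q)" using assms by (simp add: z0_def powr_powr)
  also have "... <= z powr (r - q)" using False assms by (intro powr_mono2) (auto simp: z0_def)
  finally have "c <= e * z powr (r - q)" using assms by (simp add: field_simps)
  then have "c * z powr q <= e * z powr (r - q) * z powr q" by (rule mult_right_mono) simp
  also have "... = e * z powr r" by (simp add: mult.assoc powr_add[symmetric])
  finally show ?thesis using assms by (simp add: add_increasing2)
 qed
 then show ?thesis by blast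
qed

text \<open>With y = |Z|^2/(1+|Z|^2) the two terms are y^s and (1-y)^s, and x <= x^s on the unit
  interval.\<close>

lemma fm_sq_kap: assumes s: "0 < s" "s <= 1" shows "1 <= (fm s Z)^2 + kap s Z"
proof (cases "Z = 0")
 case True then show ?thesis by (simp add: kap_def)
next
 case False
 define k where "k = 1 + (norm Z)^2"
 define y where "y = (norm Z)^2 / k"
 have "1 <= k" using one_plus_ge[of Z] by (simp add: k_def)
 then have k1: "1 <= k" "0 < k" by linarith+
 have y: "0 <= y" "y <= 1" "1 - y = 1 / k" using k1 by (auto simp: y_def k_def field_simps)
 have up: "x <= x powr s" if "0 <= x" "x <= 1" for x
 proof (cases "x = 0")
  case False
  have "x powr 1 <= x powr s" by (rule powr_mono') (use s that False in auto)
  then show ?thesis using that by simp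
 qed simp
 have "(norm Z powr s)^2 = ((norm Z)^2) powr s" by (simp add: power2_eq_square powr_mult)
 moreover have "(kap (s/2) Z)^2 = kap s Z" unfolding power2_eq_square kap_mult by simp
 moreover have kp: "kap s Z = (1 / k) powr s" using k1 by (simp add: kap_def k_def powr_minus_divide powr_divide)
 ultimately have "(fm s Z)^2 = y powr s" using k1 by (simp add: fm_def power_mult_distrib y_def powr_divide)
 moreover have "y <= y powr s" "1 / k <= (1 / k) powr s" using up y k1 by auto
 ultimately show ?thesis unfolding kp using y by linarith
qed

locale schrodinger = choquard +
 fixes V :: "r3 => real"
 assumes bmV: "bm V"
begin

text \<open>The operator of the form of (-\<Delta>)^s + V on H^s, carried over to L^2 by
  \<open>Us s\<close>. It is bounded although the original operator is not.\<close>

definition Lop :: "l2 => l2" where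
 "Lop f = mul (%Z. (fm s Z)^2) f + mul (kap (s/2)) (Hh (mul V (Us s f)))"

lemma bm_ks: "bm (kap (s/2))" using s by (intro bm_kap) simp
lemma bm_f: "bm (fm s)" by (rule bm_fm[OF s0(1)])
lemma bm_f2: "bm (%Z. (fm s Z)^2)" unfolding power2_eq_square by (rule bm_mult[OF bm_f bm_f])

lemma inner_Lop: "inner (Lop f) h = inner (mul (fm s) f) (mul (fm s) h) + inner (mul V (Us s f)) (Us s h)"
proof -
 have "mul (%Z. (fm s Z)^2) f = mul (fm s) (mul (fm s) f)" unfolding mul_mul[OF bm_f bm_f] by (simp add: power2_eq_square)
 then have "inner (mul (%Z. (fm s Z)^2) f) h = inner (mul (fm s) f) (mul (fm s) h)" by (simp add: inner_mul_commute[OF bm_f])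
 moreover have "inner (mul (kap (s/2)) (Hh (mul V (Us s f)))) h = inner (mul V (Us s f)) (Us s h)"
  using inner_Us[OF s0(1), of h "mul V (Us s f)"] by (simp add: inner_commute)
 ultimately show ?thesis by (simp add: Lop_def inner_add_left)
qed

lemma bounded_linear_Lop: "bounded_linear Lop"
 unfolding Lop_def[abs_def]
 by (rule bounded_linear_add[OF bounded_linear_mul[OF bm_f2] bounded_linear_compose[OF bounded_linear_mul[OF bm_ks]
   bounded_linear_compose[OF bounded_linear_Hh bounded_linear_compose[OF bounded_linear_mul[OF bmV] bounded_linear_Us[OF s0(1)]]]]])

lemma Lop_sym: "inner (Lop f) h = inner f (Lop h)"
proof -
 have "inner (mul V (Us s f)) (Us s h) = inner (mul V (Us s h)) (Us s f)"
  unfolding inner_mul_commute[OF bmV, of "Us s f"] by (rule inner_commute)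
 moreover have "inner (mul (fm s) f) (mul (fm s) h) = inner (mul (fm s) h) (mul (fm s) f)" by (rule inner_commute)
 moreover have "inner f (Lop h) = inner (Lop h) f" by (rule inner_commute)
 ultimately show ?thesis by (simp only: inner_Lop)
qed

lemma bm_split: "bm (%Z. (fm s Z)^2 + kap s Z - 1)"
proof (rule bmI[where C=1])
 fix x
 have "(fm s x)^2 <= 1" "0 <= (fm s x)^2" using fm_bounds[OF s0(1), of x] by (auto simp: power_le_one)
 then show "\<bar>(fm s x)^2 + kap s x - 1\<bar> <= 1"
  using kap_pos[of s x] kap_bounds(2)[OF s0(1), of x] by (simp only: abs_le_iff) linarith
next
 have [measurable]: "fm s : borel_measurable borel" using bm_f by (simp add: bm_def)
 show "(%Z. (fm s Z)^2 + kap s Z - 1) : borel_measurable borel" by measurable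
qed

lemma norm_split: "(norm f)^2 <= (norm (mul (fm s) f))^2 + (norm (Us s f))^2"
proof -
 have e: "(norm (mul (fm s) f))^2 + (norm (Us s f))^2 - (norm f)^2 = inner (mul (%Z. (fm s Z)^2 + kap s Z - 1) f) f"
 proof -
  have bs: "bm (kap s)" by (rule bm_kap[OF s0(1)])
  have a: "(norm (mul (fm s) f))^2 = (LB x. (fm s x)^2 * (fn f x * fn f x))"
  proof -
   have "(norm (mul (fm s) f))^2 = inner (mul (fm s) (mul (fm s) f)) f"
    by (simp add: power2_norm_eq_inner inner_mul_commute[OF bm_f])
   then show ?thesis unfolding mul_mul[OF bm_f bm_f] power2_eq_square[of "fm s _", symmetric] by (simp only: inner_mul[OF bm_f2])
  qed
  have b: "(norm (Us s f))^2 = (LB x. kap s x * (fn f x * fn f x))"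
  proof -
   have "(norm (Us s f))^2 = inner (mul (kap (s/2)) (mul (kap (s/2)) f)) f"
    unfolding Us_def norm_Hh by (simp add: power2_norm_eq_inner inner_mul_commute[OF bm_ks])
   also have "mul (kap (s/2)) (mul (kap (s/2)) f) = mul (kap s) f" unfolding mul_mul[OF bm_ks bm_ks] by (simp add: kap_mult)
   finally show ?thesis by (simp only: inner_mul[OF bs])
  qed
  have c: "(norm f)^2 = (LB x. fn f x * fn f x)" by (simp only: power2_norm_eq_inner inner_l2)
  have i: "integrable lborel (%x. fn f x * fn f x)" by (rule l2fun_mult_integrable) (rule l2fun_fn)+
  show ?thesis unfolding a b c inner_mul[OF bm_split]
   using inner_mul_integrable[OF bm_f2, of f f] inner_mul_integrable[OF bs, of f f] i
   by (simp add: algebra_simps)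
 qed
 have "0 <= inner (mul (%Z. (fm s Z)^2 + kap s Z - 1) f) f"
 proof -
  have "0 <= (LB x. ((fm s x)^2 + kap s x - 1) * (fn f x * fn f x))"
   by (rule integral_nonneg_AE) (use fm_sq_kap[OF s0(2)] s in "simp add: less_imp_le")
  then show ?thesis by (simp only: inner_mul[OF bm_split])
 qed
 then show ?thesis using e by linarith
qed

lemma V_form: "EX C>=0. ALL f. \<bar>inner (mul V f) f\<bar> <= C * (norm f)^2"
proof -
 obtain C where C: "!!x. \<bar>V x\<bar> <= C" using bmV by (auto simp: bm_def)
 have "\<bar>inner (mul V f) f\<bar> <= C * (norm f)^2" for f
 proof -
  have "\<bar>inner (mul V f) f\<bar> <= norm (mul V f) * norm f" by (rule Cauchy_Schwarz_ineq2)
  also have "... <= C * norm f * norm f" by (rule mult_right_mono[OF norm_mul_le[OF bmV C]]) simp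
  finally show ?thesis by (simp add: power2_eq_square)
 qed
 moreover have "0 <= C" using C[of 0] by linarith
 ultimately show ?thesis by blast
qed

text \<open>Garding's inequality: a bounded potential costs only a multiple of the L^2 norm of u,
  which is \<open>norm (Us s f)\<close>.\<close>

lemma coercive: "EX C>=0. ALL f. (norm f)^2 <= inner (Lop f) f + C * (norm (Us s f))^2"
proof -
 obtain C where C: "0 <= C" "!!f. \<bar>inner (mul V f) f\<bar> <= C * (norm f)^2" using V_form by blast
 have "(norm f)^2 <= inner (Lop f) f + (1 + C) * (norm (Us s f))^2" for f
  using norm_split[of f] C(2)[of "Us s f"] unfolding inner_Lop power2_norm_eq_inner[of "mul (fm s) f"] distrib_right by linarith
 then show ?thesis using C(1) by (intro exI[of _ "1 + C"]) auto
qed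

text \<open>Beyond a large frequency A the L^2 norm is tiny compared with the H^s norm, so Garding's
  inequality makes the form positive there. Infinitely many disjoint shells leave room for a vector
  orthogonal to any finite set.\<close>

lemma high_frequency:
 assumes F: "finite F" shows "EX f. f ~= 0 & (ALL x:F. inner f x = 0) & 0 < inner (Lop f) f"
proof -
 obtain C where C: "0 <= C" "!!f. (norm f)^2 <= inner (Lop f) f + C * (norm (Us s f))^2" using coercive by blast
 have "((%A::real. A powr (- s)) \<longlongrightarrow> 0) at_top"
  by (intro tendsto_neg_powr filterlim_ident) (use s in simp)
 then have "\<forall>\<^sub>F A in at_top. A powr (- s) < 1 / (C + 1)" by (rule order_tendstoD(2)) (use C in simp)
 then have "\<forall>\<^sub>F A in at_top. A powr (- s) < 1 / (C + 1) & 0 < A" using eventually_gt_at_top[of 0] by (rule eventually_conj)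
 then obtain A :: real where A: "A powr (- s) < 1 / (C + 1)" "0 < A" using eventually_happens'[OF trivial_limit_at_top_linorder] by blast
 define hi where "hi = mul (%Z. 1 - ib A Z)"
 have bh: "bm (%Z. 1 - ib A Z)" by (rule bmI[where C=1]) (use ib_01[of A] in auto)
 have hi_idem: "hi (hi f) = hi f" for f
 proof -
  have "(%x. (1 - ib A x) * (1 - ib A x)) = (%x. 1 - ib A x)" by (auto simp: ib_def indicator_def)
  then show ?thesis unfolding hi_def mul_mul[OF bh bh] by simp
 qed
 have hi_lin: "bounded_linear hi" unfolding hi_def by (rule bounded_linear_mul[OF bh])
 \<comment> \<open>Indicators of the disjoint shells A + k < |Z| <= A + k + 1, an orthogonal
   sequence in the range of \<open>hi\<close>.\<close>
 define ch where "ch k = (%Z. ib (A + real (Suc k)) Z - ib (A + real k) Z)" for k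
 have lch: "l2fun (ch k)" for k
 proof -
  have "l2fun (%x. ib (A + real (Suc k)) x + (-1) * ib (A + real k) x)" by (rule l2fun_add[OF l2fun_ib l2fun_scale[OF l2fun_ib]])
  then show ?thesis by (simp add: ch_def)
 qed
 define X where "X k = cl (ch k)" for k
 have chv: "ch k Z = (if A + real k < norm Z & norm Z <= A + real (Suc k) then 1 else 0)" for k Z
  by (auto simp: ch_def ib_def indicator_def)
 have orth: "inner (X j) (X k) = 0" if "j ~= k" for j k
 proof -
  have z: "ch j Z * ch k Z = 0" for Z
  proof (rule ccontr)
   assume "ch j Z * ch k Z ~= 0"
   then have "A + real j < norm Z" "norm Z <= A + real (Suc j)" "A + real k < norm Z" "norm Z <= A + real (Suc k)"
    by (auto simp: chv split: if_splits)
   then have "real j < real (Suc k)" "real k < real (Suc j)" by linarith+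
   then show False using that by simp
  qed
  show ?thesis unfolding X_def inner_cl[OF lch lch] z by simp
 qed
 have hiX: "hi (X k) = X k" for k
 proof -
  have "(%x. (1 - ib A x) * ch k x) = ch k" by (auto simp: chv ib_def indicator_def)
  then show ?thesis unfolding hi_def X_def mul_cl[OF bh lch] by simp
 qed
 have nz: "X k ~= 0" for k
 proof
  assume "X k = 0"
  then have "AE x in lborel. ch k x = 0" using fn_cl[OF lch[of k]] fn_zero unfolding X_def[symmetric] by auto
  then have "AE x in lborel. ~ (A + real k < norm x & norm (x::r3) <= A + real (Suc k))"
   by eventually_elim (simp add: chv split: if_splits)
  moreover have "{x::r3. A + real k < norm x & norm x < A + real (Suc k)} ~= {}"
  proof -
   have "norm ((A + real k + 1/2) *\<^sub>R (axis 1 1 :: r3)) = A + real k + 1/2" using A by (simp add: norm_axis_1)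
   then have "(A + real k + 1/2) *\<^sub>R (axis 1 1 :: r3) : {x::r3. A + real k < norm x & norm x < A + real (Suc k)}"
    by (simp only: mem_Collect_eq) simp
   then show ?thesis by blast
  qed
  moreover have op: "open {x::r3. A + real k < norm x & norm x < A + real (Suc k)}"
   by (intro open_Collect_conj open_Collect_less continuous_intros)
  ultimately obtain z e where z: "0 < e" "ball z e \<subseteq> {x::r3. A + real k < norm x & norm x < A + real (Suc k)}"
   by (meson ex_in_conv open_contains_ball)
  have "AE x in lborel. x ~: ball z e"
   using \<open>AE x in lborel. ~ (A + real k < norm x & norm (x::r3) <= A + real (Suc k))\<close>
   by eventually_elim (use z in force)
  then have "emeasure lborel (ball z e) = 0" by (subst (asm) AE_iff_measurable[of "ball z e"]) auto
  moreover have "vb ~= 0" using vb_pos by linarith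
  ultimately show False using z emeasure_ball[of e z] by simp
 qed
 have ind: "independent (range X)"
 proof (rule pairwise_orthogonal_independent)
  show "pairwise orthogonal (range X)" by (auto simp: pairwise_def orthogonal_def intro!: orth)
  show "0 ~: range X" using nz by auto
 qed
 have inX: "inj X"
 proof (rule injI, rule ccontr)
  fix j k assume "X j = X k" "j ~= k"
  then show False using orth[of j k] nz[of k] by simp
 qed
 obtain Q where Q: "orthon Q" "span Q = span (hi ` F)"
  using gram_schmidt[of "{}" "hi ` F"] F by (auto simp: orthon_def)
 have Qhi: "hi x = x" if "x : span Q" for x
 proof -
  have "x : span (hi ` F)" using that Q by simp
  then show ?thesis
   by (induction rule: span_induct_alt)
    (auto simp: linear_0[OF bounded_linear.linear[OF hi_lin]] linear_add[OF bounded_linear.linear[OF hi_lin]]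
     linear_scale[OF bounded_linear.linear[OF hi_lin]] hi_idem)
 qed
 have "~ range X \<subseteq> span Q"
 proof
  assume "range X \<subseteq> span Q"
  then have "finite (range X)" using independent_span_bound[of Q "range X"] ind Q(1) by (auto simp: orthon_def)
  then show False using inX by (simp add: finite_image_iff)
 qed
 then obtain k where k: "X k ~: span Q" by blast
 define f where "f = X k - prj Q (X k)"
 have pin: "prj Q (X k) : span Q" by (rule prj_in_span)
 have f0: "f ~= 0" using k pin by (auto simp: f_def)
 have hf: "hi f = f" unfolding f_def linear_diff[OF bounded_linear.linear[OF hi_lin]] hiX Qhi[OF pin] ..
 have fQ: "inner f x = 0" if "x : span Q" for x unfolding f_def by (rule inner_sub_prj[OF Q(1) that])
 have fF: "inner f x = 0" if "x : F" for x
 proof -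
  have "inner f x = inner (hi f) x" by (simp add: hf)
  also have "... = inner f (hi x)" unfolding hi_def by (rule inner_mul_commute[OF bh])
  also have "... = 0" by (rule fQ) (use that Q in "simp add: span_base")
  finally show ?thesis .
 qed
 have mb: "\<bar>kap (s/2) Z * (1 - ib A Z)\<bar> <= A powr (- s)" for Z
 proof (cases "norm Z <= A")
  case True then show ?thesis by (simp add: ib_def)
 next
  case False
  have n: "Z ~= 0" using False A by auto
  have "kap (s/2) Z <= norm Z powr (- 2 * (s/2))" by (rule kap_le_norm[OF _ n]) (use s in simp)
  also have "... <= A powr (- 2 * (s/2))" by (rule powr_mono2') (use s A False in auto)
  finally show ?thesis using False kap_pos[of "s/2" Z] by (simp add: ib_def)
 qed
 have "Us s f = Hh (mul (%Z. kap (s/2) Z * (1 - ib A Z)) f)"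
  unfolding mul_mul[OF bm_ks bh, symmetric] hi_def[symmetric] hf Us_def ..
 then have "norm (Us s f) <= A powr (- s) * norm f"
  using norm_mul_le[OF bm_mult[OF bm_ks bh] mb, of f] by (simp add: norm_Hh)
 also have "... <= 1 / (C + 1) * norm f" by (rule mult_right_mono) (use A in auto)
 finally have "(norm (Us s f))^2 <= (1 / (C + 1) * norm f)^2" by (rule power_mono) simp
 then have "C * (norm (Us s f))^2 <= C * ((1 / (C + 1))^2 * (norm f)^2)" unfolding power_mult_distrib by (rule mult_left_mono[OF _ C(1)])
 also have "... = (C / (C + 1)^2) * (norm f)^2" by (simp add: power_divide)
 also have "... < 1 * (norm f)^2"
 proof (rule mult_strict_right_mono)
  have "0 <= C * C" using C(1) by simp
  moreover have "(C + 1)^2 = C + (1 + C + C * C)" by (simp add: power2_eq_square algebra_simps)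
  ultimately have "C < (C + 1)^2" using C(1) by linarith
  then show "C / (C + 1)^2 < 1" using C(1) by simp
  show "0 < (norm f)^2" using f0 by simp
 qed
 finally have "0 < inner (Lop f) f" using C(2)[of f] by linarith
 then show ?thesis using f0 fF by blast
qed

lemma nD_lipschitz: "EX C>=0. ALL f f'. \<bar>nD f - nD f'\<bar> <= C * (norm f + norm f') * norm (f - f')"
proof -
 obtain C where C: "0 <= C" "!!f h. norm (p f h) <= C * (norm f * norm h)" using p_bound by blast
 have "\<bar>nD f - nD f'\<bar> <= C * (norm f + norm f') * norm (f - f')" for f f'
 proof -
  have "\<bar>nD f - nD f'\<bar> <= norm (p f f - p f' f')" unfolding nD_def by (rule norm_triangle_ineq3)
  also have "p f f - p f' f' = p (f - f') f + p f' (f - f')" by (simp add: p_diff_left p_diff_right)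
  also have "norm ... <= C * (norm (f - f') * norm f) + C * (norm f' * norm (f - f'))"
   by (rule order_trans[OF norm_triangle_ineq add_mono[OF C(2) C(2)]])
  also have "... = C * (norm f + norm f') * norm (f - f')" by (simp add: algebra_simps)
  finally show ?thesis .
 qed
 then show ?thesis using C(1) by blast
qed

text \<open>By homogeneity it suffices to treat |y| = 1. The vectors y converge along a subsequence
  in the finite dimensional span, while for v the nested midpoint convex sets supply a limit. A zero
  limit value would give v = -y, placing y in both eigenspaces of \<open>J\<close>.\<close>

lemma nD_coercive:
 fixes S J :: "l2 => l2"
 assumes S: "bounded_linear S" "!!x. S x = 0 ==> x = 0" and J: "bounded_linear J" and Y: "finite Y" "!!y. y : Y ==> J y = y"
 shows "EX d>0. ALL y:span Y. ALL v. J v = - v --> norm v <= 2 * norm y --> d * (norm y)^2 <= nD (S (v + y))"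
proof -
 interpret S: bounded_linear S by (rule S)
 interpret J: bounded_linear J by (rule J)
 obtain \<sigma> where \<sigma>: "0 <= \<sigma>" "!!x. norm (S x) <= norm x * \<sigma>" using S.nonneg_bounded by blast
 obtain C where C: "0 <= C" "!!f f'. \<bar>nD f - nD f'\<bar> <= C * (norm f + norm f') * norm (f - f')" using nD_lipschitz by blast
 have Jfix: "J x = x" if "x : span Y" for x
  by (rule linear_eq_on_span[of J "%x. x" Y]) (use that Y in "auto simp: J.linear linear_ident")
 have "EX d>0. ALL y:span Y. ALL v. J v = - v --> norm y = 1 --> norm v <= 2 --> d <= nD (S (v + y))"
 proof (rule ccontr)
  assume neg: "~ ?thesis"
  have ex: "EX y v. y : span Y & J v = - v & norm y = 1 & norm v <= 2 & nD (S (v + y)) < 1 / (real n + 1)" for n :: nat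
  proof -
   have "0 < 1 / (real n + 1)" by simp
   then show ?thesis using neg by (meson not_le)
  qed
  obtain ys vs where yv: "!!n::nat. ys n : span Y" "!!n. J (vs n) = - vs n" "!!n. norm (ys n) = 1" "!!n. norm (vs n) <= 2"
   "!!n. nD (S (vs n + ys n)) < 1 / (real n + 1)" using ex by metis
  obtain Q where Q: "orthon Q" "span Q = span Y" using gram_schmidt[of "{}" Y] Y by (auto simp: orthon_def)
  obtain Kc where Kc: "compact Kc" "Kc \<subseteq> span Q" "ALL x:span Q. norm x <= 1 --> x : Kc"
   using span_ball_in_compact[OF Q(1), of 1] by blast
  have "ALL n. ys n : Kc" using yv Kc Q by simp
  then obtain y r where y: "y : Kc" "strict_mono r" "(ys \<circ> r) \<longlonglongrightarrow> y"
   using Kc(1) unfolding compact_eq_seq_compact_metric seq_compact_def by metis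
  have ysp: "y : span Y" using y Kc Q by auto
  have "(%n. norm ((ys \<circ> r) n)) \<longlonglongrightarrow> norm y" by (rule tendsto_norm[OF y(3)])
  then have ny: "norm y = 1" using yv(3) by (simp add: LIMSEQ_const_iff)
  have nyn: "(%n. norm ((ys \<circ> r) n - y)) \<longlonglongrightarrow> 0" by (intro tendsto_norm_zero LIM_zero y(3))
  \<comment> \<open>With the limit y fixed, these sets collect every admissible v; convexity of
    \<open>nD\<close> makes them suitable for the nested set lemma.\<close>
  define Cs where "Cs n = {v. J v = - v & norm v <= 2 & nD (S (v + y)) <= 1 / (real n + 1)}" for n
  have contD: "continuous_on UNIV nD"
  proof (rule continuous_at_imp_continuous_on, rule ballI)
   fix f :: l2
   have "((%f'. C * (norm f' + norm f) * norm (f' - f)) \<longlongrightarrow> C * (norm f + norm f) * norm (f - f)) (at f)"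
    by (intro tendsto_intros)
   then have "((%f'. C * (norm f' + norm f) * norm (f' - f)) \<longlongrightarrow> 0) (at f)" by simp
   then have "((%f'. nD f' - nD f) \<longlongrightarrow> 0) (at f)"
    by (rule Lim_null_comparison[rotated]) (use C(2) in "simp add: always_eventually")
   then show "isCont nD f" unfolding isCont_def by (rule LIM_zero_cancel)
  qed
  have "EX x. ALL n. x : Cs n"
  proof (rule nested_midconvex_nonempty)
   fix n
   have c1: "continuous_on UNIV (%v. J v)" by (rule linear_continuous_on[OF J])
   have "continuous_on UNIV (%v. S (v + y))"
    by (rule continuous_on_compose2[OF linear_continuous_on[OF S(1)], of UNIV]) (auto intro!: continuous_intros)
   then have c2: "continuous_on UNIV (%v. nD (S (v + y)))" by (rule continuous_on_compose2[OF contD]) auto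
   show "closed (Cs n)" unfolding Cs_def
    by (intro closed_Collect_conj closed_Collect_eq closed_Collect_le c1 c2 continuous_on_const continuous_on_minus continuous_on_id continuous_on_norm)
   show "Cs m \<subseteq> Cs n" if "n <= m" for m
   proof -
    have "1 / (real m + 1) <= 1 / (real n + 1)" using that by (simp add: frac_le)
    then show ?thesis unfolding Cs_def by auto
   qed
   show "norm x <= 2" if "x : Cs n" for x using that by (simp add: Cs_def)
   show "(1/2) *\<^sub>R (x + x') : Cs n" if a: "x : Cs n" "x' : Cs n" for x x'
   proof -
    have "S ((1/2) *\<^sub>R (x + x') + y) = (1/2) *\<^sub>R (S (x + y) + S (x' + y))"
    proof -
     have "(1/2) *\<^sub>R (x + x') + y = (1/2) *\<^sub>R ((x + y) + (x' + y))"
     proof -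
      have "y = (1/2) *\<^sub>R (y + y)" by (simp flip: scaleR_2)
      then have "(1/2) *\<^sub>R (x + x') + y = (1/2) *\<^sub>R (x + x') + (1/2) *\<^sub>R (y + y)" by simp
      also have "... = (1/2) *\<^sub>R ((x + y) + (x' + y))" unfolding scaleR_add_right[symmetric] by (simp add: add_ac)
      finally show ?thesis .
     qed
     then show ?thesis by (simp only: S.scaleR S.add)
    qed
    then have "nD (S ((1/2) *\<^sub>R (x + x') + y)) <= (nD (S (x + y)) + nD (S (x' + y))) / 2" by (simp only: nD_midconvex)
    also have "... <= 1 / (real n + 1)" using a unfolding Cs_def by simp
    finally have 1: "nD (S ((1/2) *\<^sub>R (x + x') + y)) <= 1 / (real n + 1)" .
    have 2: "J ((1/2) *\<^sub>R (x + x')) = - ((1/2) *\<^sub>R (x + x'))" using a by (simp add: Cs_def J.scaleR J.add algebra_simps)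
    have 3: "norm ((1/2) *\<^sub>R (x + x')) <= 2" using a norm_triangle_ineq[of x x'] by (simp add: Cs_def)
    show ?thesis unfolding Cs_def using 1 2 3 by simp
   qed
   show "Cs n ~= {}"
   proof -
    \<comment> \<open>Half of 1/(n+1) is for the value at the approximating pair, the other half for
      replacing its y by the limit. The condition 2n + 1 <= m below secures the first half.\<close>
    let ?e = "1 / (2 * (real n + 1))"
    have e0: "0 < ?e" by simp
    have "(%m. C * (6 * \<sigma>) * (norm ((ys \<circ> r) m - y) * \<sigma>)) \<longlonglongrightarrow> C * (6 * \<sigma>) * (0 * \<sigma>)"
     by (intro tendsto_intros nyn)
    then have "\<forall>\<^sub>F m in sequentially. C * (6 * \<sigma>) * (norm ((ys \<circ> r) m - y) * \<sigma>) < ?e"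
     by (rule order_tendstoD(2)) simp
    then have "\<forall>\<^sub>F m in sequentially. C * (6 * \<sigma>) * (norm ((ys \<circ> r) m - y) * \<sigma>) < ?e & 2 * n + 1 <= m"
     using eventually_ge_at_top by (rule eventually_conj)
    then obtain m where m: "C * (6 * \<sigma>) * (norm ((ys \<circ> r) m - y) * \<sigma>) < ?e" "2 * n + 1 <= m"
     using eventually_happens'[OF trivial_limit_sequentially] by blast
    let ?v = "vs (r m)" and ?y = "ys (r m)"
    have "nD (S (?v + ?y)) < 1 / (real (r m) + 1)" by (rule yv)
    also have "... <= ?e" using m(2) seq_suble[OF y(2), of m] by (intro divide_left_mono) auto
    finally have 1: "nD (S (?v + ?y)) < ?e" .
    have n1: "norm (?v + ?y) <= 3" using norm_triangle_ineq[of ?v ?y] yv(3,4)[of "r m"] by linarith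
    have n2: "norm (?v + y) <= 3" using norm_triangle_ineq[of ?v y] yv(4)[of "r m"] ny by linarith
    have "\<bar>nD (S (?v + y)) - nD (S (?v + ?y))\<bar> <= C * (norm (S (?v + y)) + norm (S (?v + ?y))) * norm (S (?v + y) - S (?v + ?y))" by (rule C)
    also have "... <= C * (6 * \<sigma>) * (norm (?y - y) * \<sigma>)"
    proof (rule mult_mono)
     have "norm (S (?v + y)) <= 3 * \<sigma>" "norm (S (?v + ?y)) <= 3 * \<sigma>"
      using \<sigma>(2)[of "?v + y"] \<sigma>(2)[of "?v + ?y"] mult_right_mono[OF n1 \<sigma>(1)] mult_right_mono[OF n2 \<sigma>(1)] by linarith+
     then show "C * (norm (S (?v + y)) + norm (S (?v + ?y))) <= C * (6 * \<sigma>)" using C(1) by (intro mult_left_mono) auto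
     have "S (?v + y) - S (?v + ?y) = S (y - ?y)" by (simp add: S.diff S.add)
     then show "norm (S (?v + y) - S (?v + ?y)) <= norm (?y - y) * \<sigma>" using \<sigma>(2)[of "y - ?y"] by (simp add: norm_minus_commute)
    qed (use C \<sigma> in auto)
    also have "... < ?e" using m(1) by simp
    finally have "nD (S (?v + y)) <= ?e + ?e" using 1 by linarith
    also have "?e + ?e = 1 / (real n + 1)" by (simp add: field_simps)
    finally have "?v : Cs n" using yv(2,4)[of "r m"] by (simp add: Cs_def)
    then show ?thesis by blast
   qed
  qed
  then obtain v where v: "!!n. v : Cs n" by blast
  have "nD (S (v + y)) <= 0"
  proof (rule LIMSEQ_le_const)
   show "(%n. 1 / (real n + 1)) \<longlonglongrightarrow> 0" using LIMSEQ_inverse_real_of_nat by (simp add: inverse_eq_divide add.commute)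
   show "EX N. ALL n>=N. nD (S (v + y)) <= 1 / (real n + 1)" using v by (auto simp: Cs_def)
  qed
  then have "nD (S (v + y)) = 0" using nD_nonneg[of "S (v + y)"] by linarith
  then have "v + y = 0" by (rule S(2)[OF nD_eq_0])
  then have vy: "v = - y" by (simp add: eq_neg_iff_add_eq_0)
  have "J v = - v" using v[of 0] by (simp add: Cs_def)
  then have "- y = y" using Jfix[OF ysp] vy by (simp add: J.neg)
  from arg_cong[OF this, of "%z. y + z"] have "2 *\<^sub>R y = 0" unfolding scaleR_2 right_minus by (rule sym)
  then show False using ny by simp
 qed
 then obtain d where d: "0 < d" "!!y v. y : span Y ==> J v = - v ==> norm y = 1 ==> norm v <= 2 ==> d <= nD (S (v + y))" by blast
 have "d * (norm y)^2 <= nD (S (v + y))" if a: "y : span Y" "J v = - v" "norm v <= 2 * norm y" for y v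
 proof (cases "y = 0")
  case True then show ?thesis by (simp add: nD_nonneg)
 next
  case False
  let ?c = "1 / norm y"
  have "d <= nD (S (?c *\<^sub>R v + ?c *\<^sub>R y))"
  proof (rule d(2))
   show "?c *\<^sub>R y : span Y" by (rule span_scale[OF a(1)])
   show "J (?c *\<^sub>R v) = - (?c *\<^sub>R v)" by (simp add: J.scaleR a(2))
   show "norm (?c *\<^sub>R y) = 1" using False by simp
   show "norm (?c *\<^sub>R v) <= 2" using False a(3) by (simp add: divide_le_eq)
  qed
  also have "S (?c *\<^sub>R v + ?c *\<^sub>R y) = ?c *\<^sub>R S (v + y)" by (simp only: S.scaleR S.add scaleR_add_right)
  finally show ?thesis using False by (simp add: nD_scale power_divide field_simps)
 qed
 then show ?thesis using d(1) by blast
qed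

text \<open>The change of variables f = S z turns the form of \<open>Lop\<close> into that of the
  involution, so the fountain theorem applies to z. Critical points pull back to f because S is
  invertible, and a high level forces a large norm.\<close>

theorem critical_points:
 fixes n c0 :: real
 assumes c0: "0 < c0" "!!f. c0 * norm f <= norm (Lop f)" and n0: "0 <= n"
 shows "EX f. (ALL h. inner (Lop f) h = dPsi f h) & n <= norm f"
proof -
 define LL where "LL = Blinfun Lop"
 have LL: "blinfun_apply LL = Lop" unfolding LL_def by (rule bounded_linear_Blinfun_apply[OF bounded_linear_Lop])
 have "sadj LL" unfolding sadj_def LL using Lop_sym by blast
 then obtain SS WW JJ :: "l2 \<Rightarrow>\<^sub>L l2" where SWJ: "SS o\<^sub>L WW = id_blinfun" "WW o\<^sub>L SS = id_blinfun" "sadj SS" "sadj JJ"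
  "JJ o\<^sub>L JJ = id_blinfun" "ALL x y. inner (LL (SS x)) (SS y) = inner (JJ x) y"
  using symmetric_congruent_involution[of LL c0] c0 unfolding LL by blast
 define S W J where "S = blinfun_apply SS" and "W = blinfun_apply WW" and "J = blinfun_apply JJ"
 have SW: "S (W x) = x" for x using arg_cong[OF SWJ(1), of "%T. blinfun_apply T x"] by (simp add: S_def W_def)
 have WS: "W (S x) = x" for x using arg_cong[OF SWJ(2), of "%T. blinfun_apply T x"] by (simp add: S_def W_def)
 have JJx: "J (J x) = x" for x using arg_cong[OF SWJ(5), of "%T. blinfun_apply T x"] by (simp add: J_def)
 have selfS: "inner (S x) y = inner x (S y)" for x y using SWJ(3) by (simp add: sadj_def S_def)
 have selfJ: "inner (J x) y = inner x (J y)" for x y using SWJ(4) by (simp add: sadj_def J_def)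
 have LSJ: "inner (Lop (S x)) (S y) = inner (J x) y" for x y using SWJ(6) by (simp add: S_def J_def LL)
 have selfW: "inner (W x) y = inner x (W y)" for x y
  using selfS[of "W x" "W y"] by (simp add: SW)
 have linS: "bounded_linear S" and linW: "bounded_linear W" and linJ: "bounded_linear J"
  unfolding S_def W_def J_def by (rule blinfun.bounded_linear_right)+
 interpret S: bounded_linear S by (rule linS)
 interpret W: bounded_linear W by (rule linW)
 interpret J: bounded_linear J by (rule linJ)
 have S0: "x = 0" if "S x = 0" for x using WS[of x] that W.zero by simp
 define \<sigma> where "\<sigma> = norm SS + 1"
 have \<sigma>0: "0 < \<sigma>" by (simp add: \<sigma>_def add_nonneg_pos)
 have nS: "norm (S x) <= \<sigma> * norm x" for x
  using norm_blinfun[of SS x] norm_ge_zero[of x] unfolding S_def \<sigma>_def distrib_right by linarith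
 have nW: "norm (W x) <= norm WW * norm x" for x unfolding W_def by (rule norm_blinfun)
 define Psi where "Psi z = Psi0 (S z)" for z
 define G where "G z = S (G0 (S z))" for z
 have inner_G: "inner (G z) v = dPsi (S z) (S v)" for z v by (simp add: G_def selfS inner_G0)
 interpret F: indefinite_functional J Psi G
 proof
  show "inner (J x) y = inner x (J y)" for x y by (rule selfJ)
  show "J (J x) = x" for x by (rule JJx)
  show "Psi (- u) = Psi u" for u by (simp add: Psi_def S.neg Psi0_minus)
  show "Psi 0 = 0" by (simp add: Psi_def S.zero Psi0_0)
  show "G (- u) = - G u" for u by (simp add: G_def S.neg G0_minus)
  show "((%t. Psi (u + t *\<^sub>R v)) has_real_derivative inner (G u) v) (at 0)" for u v
   using Psi0_deriv[of "S u" "S v"] by (simp add: Psi_def S.add S.scaleR inner_G)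
  show "EX B. ALL u. norm u <= R --> norm (G u) <= B" for R
  proof -
   obtain b where b: "!!f. norm f <= \<sigma> * R ==> norm (G0 f) <= b" using G0_bdd by blast
   have "norm (G u) <= \<sigma> * b" if u: "norm u <= R" for u
   proof -
    have "norm (S u) <= \<sigma> * R" using nS[of u] mult_left_mono[OF u, of \<sigma>] \<sigma>0 by linarith
    then have "norm (G0 (S u)) <= b" by (rule b)
    then show ?thesis unfolding G_def using nS[of "G0 (S u)"] mult_left_mono[of _ b \<sigma>] \<sigma>0 order_trans by (meson less_imp_le)
   qed
   then show ?thesis by blast
  qed
  show "EX h>0. ALL x y. norm x <= R --> norm y <= R --> norm (x - y) <= h --> norm (G x - G y) <= e" if e: "0 < e" for R e
  proof -
   obtain d where d: "0 < d" "!!x y. norm x <= \<sigma> * R ==> norm y <= \<sigma> * R ==> norm (x - y) <= d ==> norm (G0 x - G0 y) <= e / \<sigma>"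
    using G0_ucont[of "e / \<sigma>" "\<sigma> * R"] e \<sigma>0 by auto
   have "norm (G x - G y) <= e" if a: "norm x <= R" "norm y <= R" "norm (x - y) <= d / \<sigma>" for x y
   proof -
    have "norm (S x) <= \<sigma> * R" using nS[of x] mult_left_mono[OF a(1), of \<sigma>] \<sigma>0 by linarith
    moreover have "norm (S y) <= \<sigma> * R" using nS[of y] mult_left_mono[OF a(2), of \<sigma>] \<sigma>0 by linarith
    moreover have "norm (S x - S y) <= d"
     using nS[of "x - y"] mult_left_mono[OF a(3), of \<sigma>] \<sigma>0 by (simp add: S.diff)
    ultimately have "norm (G0 (S x) - G0 (S y)) <= e / \<sigma>" by (rule d(2))
    then show ?thesis using nS[of "G0 (S x) - G0 (S y)"] mult_left_mono[of "norm (G0 (S x) - G0 (S y))" "e / \<sigma>" \<sigma>] \<sigma>0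
     by (simp add: G_def S.diff)
   qed
   then show ?thesis using d(1) \<sigma>0 by (intro exI[of _ "d / \<sigma>"]) simp
  qed
  show "EX E. finite E & (ALL u v. norm u <= R --> (ALL x:E. inner v x = 0) --> \<bar>inner (G u) v\<bar> <= e * norm v)" if e: "0 < e" for R e
  proof -
   obtain E where E: "finite E" "!!f h. norm f <= \<sigma> * R ==> (ALL x:E. inner h x = 0) ==> \<bar>inner (G0 f) h\<bar> <= e / \<sigma> * norm h"
    using G0_compact[of "e / \<sigma>" "\<sigma> * R"] e \<sigma>0 by auto
   have "\<bar>inner (G u) v\<bar> <= e * norm v" if a: "norm u <= R" "ALL x:S ` E. inner v x = 0" for u v
   proof -
    have 1: "norm (S u) <= \<sigma> * R" using nS[of u] mult_left_mono[OF a(1), of \<sigma>] \<sigma>0 by linarith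
    have 2: "ALL x:E. inner (S v) x = 0" using a(2) by (simp add: selfS)
    have "\<bar>inner (G u) v\<bar> <= e / \<sigma> * norm (S v)" using E(2)[OF 1 2] by (simp add: G_def selfS)
    also have "... <= e / \<sigma> * (\<sigma> * norm v)" by (rule mult_left_mono[OF nS]) (use e \<sigma>0 in simp)
    finally show ?thesis using \<sigma>0 by simp
   qed
   then show ?thesis using E(1) by (intro exI[of _ "S ` E"]) auto
  qed
 qed
 obtain C1 where C1: "0 <= C1" "!!f. \<bar>Phi f\<bar> <= C1 * norm f powr q" using Phi_bound by blast
 obtain C2 where C2: "0 <= C2" "!!f. nD f <= C2 * (norm f)^2" using nD_bound by blast
 obtain C3 where C3: "0 <= C3" "!!f h. Mg f h <= C3 * (norm f powr (q - 1) * norm h)" using Mg_bound by blast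
 have PhiS: "\<bar>Phi (S z)\<bar> <= C1 * \<sigma> powr q * x powr q" if "norm z <= x" for z x
 proof -
  have "norm (S z) <= \<sigma> * x" using nS[of z] mult_left_mono[OF that, of \<sigma>] \<sigma>0 by linarith
  then have "norm (S z) powr q <= (\<sigma> * x) powr q" using q by (intro powr_mono2) auto
  also have "... = \<sigma> powr q * x powr q" by (rule powr_mult)
  finally have "C1 * norm (S z) powr q <= C1 * (\<sigma> powr q * x powr q)" by (rule mult_left_mono[OF _ C1(1)])
  then show ?thesis using C1(2)[of "S z"] by (simp add: mult.assoc)
 qed
 interpret FF: fountain J Psi G
 proof
  fix Y assume Y: "finite Y" "ALL y:Y. J y = y"
  obtain d where d: "0 < d" "!!y v. y : span Y ==> J v = - v ==> norm v <= 2 * norm y ==> d * (norm y)^2 <= nD (S (v + y))"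
   using nD_coercive[OF linS S0 linJ Y(1)] Y(2) by blast
  define k where "k = C1 * \<sigma> powr q"
  have k0: "0 <= k" using C1 by (simp add: k_def)
  \<comment> \<open>The constant 3/10: if |v| > 2|y|, then |y|^2 is at most a fifth of |v + y|^2,
    and the quadratic part is at most (1/5 - 4/5)/2 times |v + y|^2.\<close>
  obtain b1 where b1: "!!z. 0 <= z ==> k * z powr q <= (3/10) * z powr 2 + b1"
   using powr_absorb[of q 2 "3/10" k] q k0 by auto
  \<comment> \<open>If |v| <= 2|y|, the quartic term is at least (d x^2/5)^2/4 = 2 e1 x^4, one share
    each for the quadratic part and the local term.\<close>
  define e1 where "e1 = d^2 / 200"
  have e1: "0 < e1" using d by (simp add: e1_def)
  obtain b2 where b2: "!!z. 0 <= z ==> (1/2) * z powr 2 <= e1 * z powr 4 + b2"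
   using powr_absorb[of 2 4 e1 "1/2"] e1 by auto
  obtain b3 where b3: "!!z. 0 <= z ==> k * z powr q <= e1 * z powr 4 + b3"
   using powr_absorb[of q 4 e1 k] q k0 e1 by auto
  show "EX a. ALL v. ALL y:span Y. J v = - v --> F.I (v + y) <= a"
  proof (intro exI allI ballI impI)
   fix v y assume y: "y : span Y" and v: "J v = - v"
   have Jy: "J y = y" by (rule linear_eq_on_span[of J "%x. x" Y]) (use y Y in "auto simp: J.linear linear_ident")
   have vy: "inner v y = 0" using selfJ[of v y] v Jy by simp
   let ?z = "v + y"
   define x where "x = norm ?z"
   have x2: "x^2 = (norm v)^2 + (norm y)^2"
    using vy by (simp add: x_def power2_norm_eq_inner inner_add_left inner_add_right inner_commute)
   have x0: "0 <= x" by (simp add: x_def)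
   have xp: "x powr 2 = x^2" "x powr 4 = (x^2)^2" using abs_powr4[of x] x0 by (cases "x = 0"; simp add: powr_numeral)+
   have Jz: "inner (J ?z) ?z = (norm y)^2 - (norm v)^2"
    using vy by (simp add: J.add v Jy power2_norm_eq_inner inner_add_left inner_add_right inner_diff_left inner_diff_right inner_commute)
   have ph: "\<bar>Phi (S ?z)\<bar> <= k * x powr q" unfolding k_def by (rule PhiS) (simp add: x_def)
   have I: "F.I ?z <= ((norm y)^2 - (norm v)^2) / 2 - (nD (S ?z))^2 / 4 + k * x powr q"
    using ph unfolding F.I_def Jz Psi_def Psi0_def by linarith
   show "F.I ?z <= \<bar>b1\<bar> + \<bar>b2\<bar> + \<bar>b3\<bar>"
   proof (cases "norm v <= 2 * norm y")
    case False
    then have "(2 * norm y)^2 <= (norm v)^2" by (intro power_mono) auto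
    then have "4 * (norm y)^2 <= (norm v)^2" by (simp add: power_mult_distrib)
    then have "((norm y)^2 - (norm v)^2) / 2 <= - (3/10) * x^2" unfolding x2 by (simp add: field_simps)
    moreover have "0 <= (nD (S ?z))^2" by simp
    ultimately show ?thesis using I b1[OF x0] unfolding xp by linarith
   next
    case True
    then have "(norm v)^2 <= (2 * norm y)^2" by (intro power_mono) auto
    then have vy2: "(norm v)^2 <= 4 * (norm y)^2" by (simp add: power_mult_distrib)
    have "d * (x^2 / 5) <= d * (norm y)^2" using vy2 d(1) unfolding x2 by (intro mult_left_mono) auto
    also have "... <= nD (S ?z)" by (rule d(2)[OF y v True])
    finally have "(d * (x^2 / 5))^2 <= (nD (S ?z))^2" using d(1) by (intro power_mono) auto
    moreover have "(d * (x^2 / 5))^2 = 8 * (e1 * (x^2)^2)" by (simp add: e1_def power_mult_distrib power_divide)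
    moreover have "((norm y)^2 - (norm v)^2) / 2 <= (1/2) * x^2" unfolding x2 by simp
    ultimately show ?thesis using I b2[OF x0] b3[OF x0] unfolding xp by linarith
   qed
  qed
 next
  fix a :: real
  \<comment> \<open>The growth of B(f, S(J z)) found below: q/2 comes from \<open>nD f\<close>, and
    q/4 + 1 from the root of \<open>nD f\<close> times a quadratic bound. The sum 3q/4 + 1 is below
    2 because q < 4/3.\<close>
  define \<gamma> where "\<gamma> = q / 2 + (q / 4 + 1)"
  define c2 where "c2 = 4 * (\<bar>a\<bar> + 1 + C1 * \<sigma> powr q)"
  define c4 where "c4 = sqrt c2 * sqrt (sqrt c2 * (C2 * \<sigma>^2))"
  define c5 where "c5 = C3 * \<sigma> powr q"
  define c6 where "c6 = 2 + c4 + c5"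
  have \<gamma>2: "\<gamma> < 2" "q <= \<gamma>" "1 <= \<gamma>" using q by (auto simp: \<gamma>_def)
  have c20: "0 <= c2" using C1 by (simp add: c2_def)
  show "EX R. ALL u. F.I u <= a --> \<bar>inner (F.dI u) u\<bar> <= norm u --> \<bar>inner (F.dI u) (J u)\<bar> <= norm u --> norm u <= R"
  proof (intro exI allI impI)
   fix z assume Ia: "F.I z <= a" and d1: "\<bar>inner (F.dI z) z\<bar> <= norm z" and d2: "\<bar>inner (F.dI z) (J z)\<bar> <= norm z"
   define X where "X = max 1 (norm z)"
   have X: "1 <= X" "norm z <= X" by (auto simp: X_def)
   let ?f = "S z" and ?h = "S (J z)"
   have Xq: "X <= X powr q" "1 <= X powr q" using X powr_mono[of 1 q X] powr_mono[of 0 q X] q by auto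
   have X\<gamma>: "X <= X powr \<gamma>" "1 <= X powr \<gamma>" "X powr q <= X powr \<gamma>"
    using X \<gamma>2 powr_mono[of 1 \<gamma> X] powr_mono[of 0 \<gamma> X] powr_mono[of q \<gamma> X] by auto
   have nf: "norm ?f <= \<sigma> * X" using nS[of z] mult_left_mono[OF X(2), of \<sigma>] \<sigma>0 by linarith
   have nh: "norm ?h <= \<sigma> * X" using nS[of "J z"] mult_left_mono[OF X(2), of \<sigma>] \<sigma>0 unfolding F.norm_J by linarith
   have ph: "\<bar>Phi ?f\<bar> <= C1 * \<sigma> powr q * X powr q" by (rule PhiS[OF X(2)])
   have dff: "dPsi ?f ?f = (nD ?f)^2 + q * Phi ?f" by (simp add: dPsi_def B_def nD_def power2_norm_eq_inner ell_self)
   \<comment> \<open>This combination cancels the indefinite quadratic form and leaves a quarter of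
     the quartic term, hence a bound on \<open>nD\<close>.\<close>
   have "F.I z - inner (F.dI z) z / 2 = (nD ?f)^2 / 4 + (q / 2 - 1) * Phi ?f"
    unfolding F.I_def F.dI_def inner_diff_left inner_G dff Psi_def Psi0_def by (simp add: field_simps)
   moreover have "\<bar>(q / 2 - 1) * Phi ?f\<bar> <= 1 * \<bar>Phi ?f\<bar>" unfolding abs_mult by (rule mult_right_mono) (use q in auto)
   moreover have "a + X <= (\<bar>a\<bar> + 1) * X powr q"
   proof -
    have "\<bar>a\<bar> * 1 <= \<bar>a\<bar> * X powr q" by (rule mult_left_mono[OF Xq(2)]) simp
    then show ?thesis using Xq(1) unfolding distrib_right by linarith
   qed
   ultimately have "(nD ?f)^2 / 4 <= (\<bar>a\<bar> + 1) * X powr q + C1 * \<sigma> powr q * X powr q" using Ia d1 X ph by linarith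
   then have D2: "(nD ?f)^2 <= c2 * X powr q" by (simp add: c2_def algebra_simps)
   have D: "nD ?f <= sqrt c2 * X powr (q / 2)"
   proof (rule power2_le_imp_le)
    have "(X powr (q / 2))^2 = X powr q" by (simp add: power2_eq_square powr_add[symmetric])
    then show "(nD ?f)^2 <= (sqrt c2 * X powr (q / 2))^2" using D2 c20 by (simp add: power_mult_distrib)
   qed (use c20 in simp)
   have Dh: "nD ?h <= C2 * \<sigma>^2 * X powr 2"
   proof -
    have "(norm ?h)^2 <= (\<sigma> * X)^2" by (rule power_mono[OF nh]) simp
    then have "C2 * (norm ?h)^2 <= C2 * (\<sigma> * X)^2" by (rule mult_left_mono[OF _ C2(1)])
    then show ?thesis using C2(2)[of ?h] X by (simp add: power_mult_distrib powr_numeral mult.assoc)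
   qed
   have "\<bar>B ?f ?h\<bar> <= nD ?f * sqrt (nD ?f * nD ?h)" by (rule abs_B_le)
   also have "... <= (sqrt c2 * X powr (q / 2)) * sqrt ((sqrt c2 * X powr (q / 2)) * (C2 * \<sigma>^2 * X powr 2))"
    by (intro mult_mono real_sqrt_le_mono D Dh) (use nD_nonneg c20 C2 in auto)
   also have "(sqrt c2 * X powr (q / 2)) * (C2 * \<sigma>^2 * X powr 2) = (sqrt c2 * (C2 * \<sigma>^2)) * (X powr (q / 4 + 1))^2"
   proof -
    have "(X powr (q / 4 + 1))^2 = X powr (q / 2) * X powr 2"
     unfolding power2_eq_square powr_add[symmetric] by (simp add: algebra_simps)
    then show ?thesis by (simp only: mult_ac)
   qed
   also have "sqrt ... = sqrt (sqrt c2 * (C2 * \<sigma>^2)) * X powr (q / 4 + 1)" by (simp add: real_sqrt_mult)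
   also have "(sqrt c2 * X powr (q / 2)) * ... = c4 * (X powr (q / 2) * X powr (q / 4 + 1))" by (simp add: c4_def)
   also have "X powr (q / 2) * X powr (q / 4 + 1) = X powr \<gamma>" unfolding \<gamma>_def by (rule powr_add[symmetric])
   finally have Bb: "\<bar>B ?f ?h\<bar> <= c4 * X powr \<gamma>" .
   have "\<bar>ell ?f ?h\<bar> <= C3 * (norm ?f powr (q - 1) * norm ?h)" using abs_ell_le[of ?f ?h] C3(2)[of ?f ?h] by linarith
   also have "... <= C3 * ((\<sigma> * X) powr (q - 1) * (\<sigma> * X))"
    using nf nh q C3(1) by (intro mult_left_mono mult_mono powr_mono2) auto
   also have "(\<sigma> * X) powr (q - 1) * (\<sigma> * X) = (\<sigma> * X) powr q"
    using sg_times_self[of q "\<sigma> * X"] sg_nonneg[of "\<sigma> * X" q] \<sigma>0 X by simp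
   also have "C3 * (\<sigma> * X) powr q = c5 * X powr q" using \<sigma>0 X by (simp add: c5_def powr_mult)
   also have "... <= c5 * X powr \<gamma>" by (rule mult_left_mono[OF X\<gamma>(3)]) (use C3 in "simp add: c5_def")
   finally have Eb: "\<bar>ell ?f ?h\<bar> <= c5 * X powr \<gamma>" .
   \<comment> \<open>Testing with J z makes the indefinite form definite: since J is an isometry,
     the quadratic part becomes |z|^2.\<close>
   have "inner (F.dI z) (J z) = (norm z)^2 - (B ?f ?h + ell ?f ?h)"
    unfolding F.dI_def inner_diff_left inner_G dPsi_def using F.norm_J[of z] by (simp add: power2_norm_eq_inner[symmetric])
   then have z2: "(norm z)^2 <= X powr \<gamma> + c4 * X powr \<gamma> + c5 * X powr \<gamma>"
    using d2 Bb Eb X(2) X\<gamma>(1) by linarith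
   have "X^2 <= 1 + (norm z)^2" unfolding X_def max_def by auto
   then have "X^2 <= c6 * X powr \<gamma>" using z2 X\<gamma>(2) by (simp add: c6_def distrib_right)
   moreover have "X^2 = X powr (2 - \<gamma>) * X powr \<gamma>" using X by (subst powr_add[symmetric]) (simp add: powr_numeral)
   ultimately have le: "X powr (2 - \<gamma>) <= c6" using X by simp
   have "norm z <= X" by (rule X)
   also have "X = (X powr (2 - \<gamma>)) powr (1 / (2 - \<gamma>))" using X \<gamma>2 by (simp add: powr_powr)
   also have "... <= c6 powr (1 / (2 - \<gamma>))" using le \<gamma>2 by (intro powr_mono2) auto
   finally show "norm z <= c6 powr (1 / (2 - \<gamma>))" .
  qed
 next
  fix Fs :: "l2 set" assume "finite Fs"
  \<comment> \<open>The required z is the positive part of W f. Its orthogonality to e is that of f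
    to W applied to the positive part of e, so these vectors are what f has to avoid.\<close>
  then have "finite ((%e. W ((1/2) *\<^sub>R (e + J e))) ` Fs)" by simp
  from high_frequency[OF this] obtain f where f0: "f ~= 0"
   and fo: "ALL x:(%e. W ((1/2) *\<^sub>R (e + J e))) ` Fs. inner f x = 0" and f3: "0 < inner (Lop f) f"
   by (elim exE conjE)
  have f2: "inner f (W ((1/2) *\<^sub>R (e + J e))) = 0" if "e : Fs" for e
   by (rule bspec[OF fo imageI[OF that]])
  let ?z = "(1/2) *\<^sub>R (W f + J (W f))"
  have "?z ~= 0"
  proof
   assume "?z = 0"
   then have "J (W f) = - W f" by (simp add: eq_neg_iff_add_eq_0 add.commute)
   then have "inner (Lop f) f = - inner (W f) (W f)" using LSJ[of "W f" "W f"] by (simp add: SW)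
   then show False using f3 inner_ge_zero[of "W f"] by linarith
  qed
  moreover have "J ?z = ?z" by (simp add: J.scaleR J.add JJx add.commute)
  moreover have "inner ?z e = 0" if "e : Fs" for e
  proof -
   have "inner ?z e = inner (W f) ((1/2) *\<^sub>R (e + J e))" by (simp add: inner_add_left inner_add_right selfJ)
   also have "... = 0" using f2[OF that] by (simp only: selfW)
   finally show ?thesis .
  qed
  ultimately show "EX z. z ~= 0 & J z = z & (ALL x:Fs. inner z x = 0)" by blast
 qed
 \<comment> \<open>Exceeds by 1 an upper bound of I over all z with |S z| <= n, for which |z| is at
   most the norm of W times n.\<close>
 define b where "b = (norm WW * n)^2 / 2 + C1 * n powr q + 1"
 obtain z where z: "J z = G z" "b <= F.I z" using FF.critical_point_above[of b] by blast
 have cr: "inner (Lop (S z)) h = dPsi (S z) h" for h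
  using LSJ[of z "W h"] inner_G[of z "W h"] z(1) by (simp add: SW)
 have "n <= norm (S z)"
 proof (rule ccontr)
  assume "~ n <= norm (S z)"
  then have l: "norm (S z) <= n" by simp
  have "norm z <= norm WW * n" using nW[of "S z"] mult_left_mono[OF l, of "norm WW"] by (simp add: WS)
  then have 1: "(norm z)^2 <= (norm WW * n)^2" by (rule power_mono) simp
  have 2: "inner (J z) z <= (norm z)^2" using norm_cauchy_schwarz[of "J z" z] by (simp add: power2_eq_square)
  have "norm (S z) powr q <= n powr q" using l q by (intro powr_mono2) auto
  then have "C1 * norm (S z) powr q <= C1 * n powr q" by (rule mult_left_mono[OF _ C1(1)])
  then have 3: "\<bar>Phi (S z)\<bar> <= C1 * n powr q" using C1(2)[of "S z"] by linarith
  have 4: "0 <= (nD (S z))^2" by simp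
  show False using z(2) 1 2 3 4 unfolding F.I_def Psi_def Psi0_def b_def by linarith
 qed
 then show ?thesis using cr by blast
qed

end

section \<open>From the transported problem back to the functions of the statement\<close>

lemma l2norm_rep: "is_rep u a ==> l2norm u = norm a"
 using is_rep_mult(1)[of u a u a] by (simp add: l2norm_def power2_eq_square norm_eq_sqrt_inner)

lemma lebesgue_borel_version:
 assumes "f : borel_measurable lebesgue"
 shows "EX f'::r3 => real. f' : borel_measurable borel & (AE x in lebesgue. f x = f' x)"
proof -
 obtain f' where "f' : borel_measurable lborel" "AE x in lborel. f x = f' x"
  using completion_ex_borel_measurable_real[of f lborel] assms by auto
 then show ?thesis by (auto intro!: AE_lebesgue)
qed

lemma is_rep_meas: "is_rep u a ==> u : borel_measurable lebesgue" by (simp add: is_rep_def)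
lemma is_rep_AE: "is_rep u a ==> AE x in lebesgue. u x = fn a x" by (simp add: is_rep_def)

context schrodinger begin

lemma form_Lop:
 assumes V': "V' : borel_measurable lebesgue" "AE x in lebesgue. V' x = V x"
  and u: "is_rep w (Us s f)" and v: "is_rep v (Us s h)"
 shows "(\<integral>x. frac_half s w x * frac_half s v x + V' x * w x * v x \<partial>lebesgue) = inner (Lop f) h"
  "integrable lebesgue (%x. frac_half s w x * frac_half s v x + V' x * w x * v x)"
proof -
 note fu = frac_half_rep[OF s0(1) u] and fv = frac_half_rep[OF s0(1) v]
 have "AE x in lebesgue. V' x * w x = fn (mul V (Us s f)) x"
  using V'(2) is_rep_AE[OF u] AE_lebesgue[OF fn_mul[OF bmV, of "Us s f"]] by eventually_elim simp
 then have Vu: "is_rep (%x. V' x * w x) (mul V (Us s f))"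
  unfolding is_rep_def using borel_measurable_times[OF V'(1) is_rep_meas[OF u]] by blast
 show "integrable lebesgue (%x. frac_half s w x * frac_half s v x + V' x * w x * v x)"
  by (rule bint_add[OF is_rep_mult(2)[OF fu fv] is_rep_mult(2)[OF Vu v]])
 show "(\<integral>x. frac_half s w x * frac_half s v x + V' x * w x * v x \<partial>lebesgue) = inner (Lop f) h"
  unfolding bintegral_add[OF is_rep_mult(2)[OF fu fv] is_rep_mult(2)[OF Vu v]]
   is_rep_mult(1)[OF fu fv] is_rep_mult(1)[OF Vu v] inner_Lop inner_Hh ..
qed

text \<open>Duality: the norm of the function represented by f is tested against the solution of the equation with that function as right-hand side.\<close>
lemma bounded_below_of_resolvent:
 assumes V': "V' : borel_measurable lebesgue" "AE x in lebesgue. V' x = V x" and res: "in_resolvent s V' 0"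
 shows "EX c0>0. ALL f. c0 * norm f <= norm (Lop f)"
proof -
 have sol: "EX w. form_op s V' w (fn b)" for b
 proof -
  have "lp 2 (fn b)" using lp2_iff is_rep_fn by blast
  then show ?thesis using res by (simp add: in_resolvent_def)
 qed
 obtain Cr where Cr: "!!w b. form_op s V' w b ==> l2norm w <= Cr * l2norm b" using res by (auto simp: in_resolvent_def)
 obtain C where C: "0 <= C" "!!f. (norm f)^2 <= inner (Lop f) f + C * (norm (Us s f))^2" using coercive by blast
 define A where "A = \<bar>Cr\<bar> + 1"
 have A0: "0 < A" by (simp add: A_def)
 \<comment> \<open>\<open>k\<close> represents the weak solution with right-hand side
   \<open>b\<close>. The resolvent estimate controls only its L^2 norm; coercivity upgrades this to
   the H^s norm afterwards.\<close>
 have dual: "EX k. (ALL h. inner (Lop k) h = inner b (Us s h)) & norm (Us s k) <= A * norm b" for b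
 proof -
  obtain w where w: "form_op s V' w (fn b)" using sol by blast
  then obtain k where k: "is_rep w (Us s k)" using hs_iff[OF s0(1)] by (auto simp: form_op_def)
  have "inner (Lop k) h = inner b (Us s h)" for h
  proof -
   have v: "is_rep (fn (Us s h)) (Us s h)" by (rule is_rep_fn)
   then have "hs s (fn (Us s h))" using hs_iff[OF s0(1)] by blast
   then have "(\<integral>x. frac_half s w x * frac_half s (fn (Us s h)) x + V' x * w x * fn (Us s h) x \<partial>lebesgue)
    = (\<integral>x. fn b x * fn (Us s h) x \<partial>lebesgue)" using w unfolding form_op_def by blast
   then show ?thesis unfolding form_Lop(1)[OF V' k v] is_rep_mult(1)[OF is_rep_fn is_rep_fn] .
  qed
  moreover have "norm (Us s k) <= Cr * norm b" using Cr[OF w] by (simp only: l2norm_rep[OF k] l2norm_rep[OF is_rep_fn])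
  moreover have "Cr * norm b <= A * norm b" by (rule mult_right_mono) (auto simp: A_def)
  ultimately show ?thesis by (meson order_trans)
 qed
 \<comment> \<open>Coercivity at \<open>k\<close> bounds |k|^2 by A |b|^2 from the form plus C A^2
   |b|^2 from the L^2 norm.\<close>
 define D where "D = sqrt (A + C * A^2)"
 have D2: "0 <= A + C * A^2" using A0 C(1) by simp
 have D0: "0 <= D" using D2 by (simp add: D_def)
 have low: "norm (Us s f) <= D * norm (Lop f)" for f
 proof -
  let ?b = "Us s f"
  obtain k where k: "!!h. inner (Lop k) h = inner ?b (Us s h)" "norm (Us s k) <= A * norm ?b" using dual by blast
  have "(norm k)^2 <= inner ?b (Us s k) + C * (norm (Us s k))^2" using C(2)[of k] by (simp only: k(1))
  also have "inner ?b (Us s k) <= norm ?b * (A * norm ?b)"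
   by (rule order_trans[OF norm_cauchy_schwarz mult_left_mono[OF k(2)]]) simp
  also have "C * (norm (Us s k))^2 <= C * (A * norm ?b)^2" by (intro mult_left_mono power_mono k(2) C(1)) simp
  finally have "(norm k)^2 <= (A + C * A^2) * (norm ?b)^2" by (simp add: power2_eq_square algebra_simps)
  also have "... = (D * norm ?b)^2" unfolding D_def power_mult_distrib real_sqrt_pow2[OF D2] ..
  finally have nk: "norm k <= D * norm ?b" by (rule power2_le_imp_le) (use D0 in simp)
  have "norm ?b * norm ?b = inner (Lop k) f" by (simp add: k(1) power2_norm_eq_inner[symmetric] power2_eq_square)
  also have "... = inner k (Lop f)" by (rule Lop_sym)
  also have "... <= norm k * norm (Lop f)" by (rule norm_cauchy_schwarz)
  also have "... <= (D * norm ?b) * norm (Lop f)" by (rule mult_right_mono[OF nk]) simp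
  finally have "norm ?b * norm ?b <= norm ?b * (D * norm (Lop f))" by (simp add: mult_ac)
  then show ?thesis using D0 by (cases "norm ?b = 0") auto
 qed
 \<comment> \<open>At least 1, so that a violation gives |Lop f| <= |f|, and at least the constant 1
   + C D^2 that coercivity then yields, which is contradictory.\<close>
 define m where "m = 2 + 2 * C * D^2"
 have m0: "0 < m" using C(1) by (simp add: m_def add_pos_nonneg)
 have "norm f <= m * norm (Lop f)" for f
 proof (rule ccontr)
  let ?y = "norm (Lop f)"
  assume "~ norm f <= m * ?y"
  then have l: "m * ?y < norm f" by simp
  have f0: "0 < norm f" using l m0 norm_ge_zero[of "Lop f"] mult_nonneg_nonneg[of m ?y] by linarith
  have "(norm f)^2 <= ?y * norm f + C * (D * ?y)^2"
   using C(2)[of f] norm_cauchy_schwarz[of "Lop f" f] mult_left_mono[OF power_mono[OF low[of f] norm_ge_zero, of 2] C(1)] by linarith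
  also have "C * (D * ?y)^2 <= C * D^2 * (?y * norm f)"
  proof -
   have "1 * ?y <= m * ?y" by (rule mult_right_mono) (use C(1) in "auto simp: m_def")
   then have "?y <= norm f" using l by linarith
   then have "?y * ?y <= ?y * norm f" by (rule mult_left_mono) simp
   then have "(C * D^2) * (?y * ?y) <= (C * D^2) * (?y * norm f)" by (rule mult_left_mono) (use C(1) in simp)
   then show ?thesis by (simp add: power_mult_distrib power2_eq_square mult_ac)
  qed
  finally have "norm f * norm f <= ((1 + C * D^2) * ?y) * norm f" by (simp add: power2_eq_square algebra_simps)
  then have "norm f <= (1 + C * D^2) * ?y" using f0 by simp
  moreover have "(1 + C * D^2) * ?y <= m * ?y" by (rule mult_right_mono) (use C(1) in "auto simp: m_def")
  ultimately show False using l by linarith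
 qed
 then have "ALL f. 1 / m * norm f <= norm (Lop f)" using m0 by (simp add: field_simps)
 then show ?thesis using m0 by (intro exI[of _ "1 / m"]) simp
qed

text \<open>Every chosen object of the statement has a known representative, so each term of the
  weak equation becomes an inner product or a value of \<open>ell\<close>. Integrability is checked
  term by term before the integral is split.\<close>

lemma weak_solution_of_critical_point:
 assumes V': "V' : borel_measurable lebesgue" "AE x in lebesgue. V' x = V x"
  and K': "K' : borel_measurable lebesgue" "AE x in lebesgue. K' x = K x"
  and g': "g' : borel_measurable lebesgue" "AE x in lebesgue. g' x = g x"
  and cr: "!!h. inner (Lop f) h = dPsi f h"
 shows "weak_solution s t V' K' g' q (u f) (phi_of t K' (u f))"
proof -
 have rf: "is_rep (u f) (Us s f)" by (rule is_rep_fn)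
 have Kc: "is_rep (%x. K' x * u f x * v x) (c f h)" if v: "is_rep v (Us s h)" for v h
 proof -
  have "AE x in lebesgue. K' x * u f x * v x = fn (c f h) x"
   using K'(2) is_rep_AE[OF v] AE_lebesgue[OF fn_cl[OF l2fun_kf[of f h]]] unfolding c_def
   by eventually_elim (simp add: kf_def)
  then show ?thesis unfolding is_rep_def
   using borel_measurable_times[OF borel_measurable_times[OF K'(1) is_rep_meas[OF rf]] is_rep_meas[OF v]] by blast
 qed
 have Kff: "is_rep (%x. K' x * (u f x)^2) (c f f)" using Kc[OF rf] by (simp add: power2_eq_square mult.assoc)
 note ph = phi_of_rep[OF t Kff]
 have "(\<integral>x. frac_half s (u f) x * frac_half s v x + V' x * u f x * v x
       - K' x * phi_of t K' (u f) x * u f x * v x - g' x * \<bar>u f x\<bar> powr (q - 2) * u f x * v x \<partial>lebesgue) = 0"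
  if hv: "hs s v" for v
 proof -
  obtain h where v: "is_rep v (Us s h)" using hv hs_iff[OF s0(1)] by blast
  let ?\<phi> = "phi_of t K' (u f)"
  let ?n = "%x. g' x * \<bar>u f x\<bar> powr (q - 2) * u f x * v x"
  have nm: "?n : borel_measurable lebesgue"
  proof -
   have "(%x. \<bar>u f x\<bar> powr (q - 2) * u f x) : borel_measurable lebesgue" by (rule lebesgue_meas) measurable
   from borel_measurable_times[OF borel_measurable_times[OF g'(1) this] is_rep_meas[OF v]] show ?thesis by (simp add: mult.assoc)
  qed
  have nb: "(%x. g x * sg q (u f x) * u h x) : borel_measurable borel" by measurable
  have nae: "AE x in lebesgue. ?n x = g x * sg q (u f x) * u h x"
   using g'(2) is_rep_AE[OF v] by eventually_elim (simp add: sg_def)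
  have ni: "integrable lebesgue ?n" unfolding leb_integrable[OF nm nb nae] by (rule ell_int)
  have nI: "(\<integral>x. ?n x \<partial>lebesgue) = ell f h" unfolding leb_integral[OF nm nb nae] ell_def ..
  note Kv = is_rep_mult[OF ph(1) Kc[OF v]]
  have KI: "(\<integral>x. ?\<phi> x * (K' x * u f x * v x) \<partial>lebesgue) = B f h"
  proof -
   have "inner (Hh (mul (kap t) (Hh (c f f)))) (c f h) = Qf (kap t) (c f f) (c f h)" unfolding Qf_def by (rule Hh_self_adjoint)
   then show ?thesis unfolding Kv(1) by (simp add: Qf_P B_def p_def)
  qed
  note fL = form_Lop[OF V' rf v]
  have "(\<integral>x. frac_half s (u f) x * frac_half s v x + V' x * u f x * v x
       - K' x * ?\<phi> x * u f x * v x - ?n x \<partial>lebesgue)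
    = (\<integral>x. ((frac_half s (u f) x * frac_half s v x + V' x * u f x * v x) - ?\<phi> x * (K' x * u f x * v x)) - ?n x \<partial>lebesgue)"
   by (rule bintegral_cong) (auto simp: mult_ac)
  also have "... = inner (Lop f) h - B f h - ell f h"
   unfolding bintegral_diff[OF bint_diff[OF fL(2) Kv(2)] ni]
    bintegral_diff[OF fL(2) Kv(2)] fL(1) KI nI ..
  finally show ?thesis by (simp add: cr dPsi_def)
 qed
 moreover have "hs s (u f)" using hs_iff[OF s0(1)] rf by blast
 ultimately show ?thesis unfolding weak_solution_def using ph(2) by blast
qed

end

theorem theorem1p1:
  fixes s t q :: real and V K g :: "r3 \<Rightarrow> real"
  assumes "3/4 < s" "s < 1" "0 < t" "t < 1"
    and "continuous_on UNIV V" "linf V" "zero_in_spectral_gap s V"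
    and "lp (3 / (4 * s - 3)) K" "linf K" "AE x in lebesgue. K x > 0"
    and "1 < q" "q < 4/3" "lp (6 / (6 - q * (3 - 2 * s))) g"
  shows "\<exists>u :: nat \<Rightarrow> r3 \<Rightarrow> real.
           (\<forall>n. weak_solution s t V K g q (u n) (phi_of t K (u n))) \<and>
           filterlim (\<lambda>n. hs_norm s (u n)) at_top sequentially"
proof -
 have Vm: "V : borel_measurable lebesgue" and Km: "K : borel_measurable lebesgue" and gm: "g : borel_measurable lebesgue"
  using assms by (auto simp: linf_def lp_def)
 obtain CV where CV: "AE x in lebesgue. \<bar>V x\<bar> <= CV" using assms(6) by (auto simp: linf_def)
 obtain CK where CK: "AE x in lebesgue. \<bar>K x\<bar> <= CK" using assms(9) by (auto simp: linf_def)
 obtain V1 where V1: "V1 : borel_measurable borel" "AE x in lebesgue. V x = V1 x" using lebesgue_borel_version[OF Vm] by blast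
 obtain K1 where K1: "K1 : borel_measurable borel" "AE x in lebesgue. K x = K1 x" using lebesgue_borel_version[OF Km] by blast
 obtain g1 where g1: "g1 : borel_measurable borel" "AE x in lebesgue. g x = g1 x" using lebesgue_borel_version[OF gm] by blast
 note [measurable] = V1(1) K1(1) g1(1)
 \<comment> \<open>Truncation turns almost everywhere bounds and signs into bounds at every point,
   as the locale demands, and changes the functions only on a null set.\<close>
 define Vb where "Vb x = max (- \<bar>CV\<bar>) (min \<bar>CV\<bar> (V1 x))" for x
 define Kb where "Kb x = max 0 (min \<bar>CK\<bar> (K1 x))" for x
 have Vb: "AE x in lebesgue. V x = Vb x"
  using CV V1(2) by eventually_elim (simp add: Vb_def max_def min_def abs_if split: if_splits)
 have Kb: "AE x in lebesgue. K x = Kb x"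
  using CK K1(2) assms(10) by eventually_elim (simp add: Kb_def max_def min_def abs_if split: if_splits)
 have Kbm [measurable]: "Kb : borel_measurable borel" unfolding Kb_def[abs_def] by measurable
 have bmVb: "bm Vb"
 proof (rule bmI[where C="\<bar>CV\<bar>"])
  show "Vb : borel_measurable borel" unfolding Vb_def[abs_def] by measurable
  show "\<bar>Vb x\<bar> <= \<bar>CV\<bar>" for x unfolding Vb_def by (simp add: max_def min_def abs_if)
 qed
 have transfer: "(NB x. ennreal (\<bar>f' x\<bar> powr p)) < \<infinity>"
  if "lp p f" "f' : borel_measurable borel" "AE x in lebesgue. f x = f' x" for p and f f' :: "r3 => real"
 proof -
  have "(\<integral>\<^sup>+x. ennreal (\<bar>f x\<bar> powr p) \<partial>lebesgue) = (\<integral>\<^sup>+x. ennreal (\<bar>f' x\<bar> powr p) \<partial>lebesgue)"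
   by (rule nn_integral_cong_AE) (use that(3) in "eventually_elim, simp")
  then show ?thesis using that by (simp add: lp_def nn_integral_completion)
 qed
 have Kpos: "AE x in lborel. 0 < Kb x"
 proof -
  have "AE x in lebesgue. 0 < Kb x" using Kb assms(10) by eventually_elim simp
  then show ?thesis by (subst (asm) AE_lebesgue_iff) measurable
 qed
 interpret schrodinger s q g1 t "\<bar>CK\<bar>" Kb Vb
 proof
  show "(NB x. ennreal (\<bar>g1 x\<bar> powr (6 / (6 - q * (3 - 2 * s))))) < \<infinity>" by (rule transfer[OF assms(13) g1])
  show "(NB x. ennreal (Kb x powr (3 / (4 * s - 3)))) < \<infinity>"
   using transfer[OF assms(8) Kbm Kb] by (simp add: Kb_def)
  show "0 <= Kb x" "Kb x <= \<bar>CK\<bar>" for x by (simp_all add: Kb_def)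
 qed (fact assms g1 Kbm Kpos bmVb)+
 \<comment> \<open>Since 0 lies in the resolvent set, the transported operator is bounded below,
   which is the input of the involution theorem.\<close>
 obtain c0 where c0: "0 < c0" "!!f. c0 * norm f <= norm (Lop f)"
  using bounded_below_of_resolvent[OF Vm Vb] assms(7) by (auto simp: zero_in_spectral_gap_def)
 have "EX f. (ALL h. inner (Lop f) h = dPsi f h) & real n <= norm f" for n
  by (rule critical_points[OF c0]) simp_all
 then obtain F where F: "!!n h. inner (Lop (F n)) h = dPsi (F n) h" "!!n. real n <= norm (F n)" by metis
 show ?thesis
 proof (intro exI[of _ "%n. uf s (F n)"] conjI allI)
  show "weak_solution s t V K g q (uf s (F n)) (phi_of t K (uf s (F n)))" for n
   by (rule weak_solution_of_critical_point[OF Vm Vb Km Kb gm g1(2) F(1)])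
  have "hs_norm s (uf s (F n)) = norm (F n)" for n by (rule hs_norm_rep[OF s0(1) is_rep_fn])
  then show "filterlim (%n. hs_norm s (uf s (F n))) at_top sequentially"
   by (intro filterlim_at_top_mono[OF filterlim_real_sequentially] always_eventually) (simp add: F(2))
 qed
qed

end
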